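(* Let $\mathcal{A}(t)$, $t\in I$, satisfy the standing assumptions given in the context, and let $\{\mu_t:t\in I\}$ be the measures described there. Assume the following. (a) The first order spatial derivatives of $q_{ij}$ and $b_i$ ($i,j=1,\dots,d$) belong to $C^{\alpha/2,\alpha}_{\rm loc}(I\times\mathbb{R}^d)$; there exists a continuous $k:I\to[0,+\infty)$ with $|\nabla_xq_{ij}(t,x)|\le k(t)\eta(t,x)$ for all $(t,x)\in I\times\mathbb{R}^d$, $i,j=1,\dots,d$; there exists a continuous $m:I\to\mathbb{R}$ with $\langle\nabla_xb(t,x)\xi,\xi\rangle\le m(t)|\xi|^2$ for all $\xi\in\mathbb{R}^d$, $(t,x)\in I\times\mathbb{R}^d$. (b) $\psi:I\times\mathbb{R}\to\mathbb{R}$ is a given function such that $t\mapsto\psi(t,0)$ is in $L^1_{\rm loc}(I)$, and for any $s\in I$, $\tau>s$ there exists $L>0$ with $|\psi(t,\xi)-\psi(t,\eta)|\le L|\xi-\eta|$ for all $t\in[s,\tau]$, $\xi,\eta\in\mathbb{R}$. (c) For any $s\in I$ and $\tau>s$ there exist positive constants $C_i=C_i(s,\tau)$, $i=0,1,2$, such that for any $t\in[s,\tau]$, $x\in\mathbb{R}^d$ $$|Q(t,x)x|\le C_0|x|\varphi(x),\qquad \mathrm{Tr}(Q(t,x))\le C_1(1+|x|)\varphi(x),\qquad\langle b(t,x),x\rangle\le C_2|x|\varphi(x),$$ where $\varphi$ is the Lyapunov function of the standing assumption (iii). (d) There exists $\psi_0\in\mathbb{R}$ such that $\xi\,\psi(t,\xi)\le\psi_0\,\xi^2$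 for all $t\in I$, $\xi\in\mathbb{R}$. (e) There exists a constant $K>0$ such that $$\int_{\mathbb{R}^d}|g|^\gamma\log|g|\,d\mu_r\le\|g\|_{L^\gamma(\mathbb{R}^d,\mu_r)}^\gamma\log\|g\|_{L^\gamma(\mathbb{R}^d,\mu_r)}+\gamma K\int_{\{g\ne0\}}|g|^{\gamma-2}|\nabla g|^2\,d\mu_r$$ for any $r\in I$, $g\in C_b^1(\mathbb{R}^d)$ and $\gamma\in(1,+\infty)$. For any $s\in I$ and $p>1$ set $$p(t):=e^{\eta_0K^{-1}(t-s)}(p-1)+1,\qquad t\ge s,$$ where $\eta_0$ is the ellipticity constant of the standing assumption (ii). Then for every $f\in L^p(\mathbb{R}^d,\mu_s)$, the mild solution $u_f$ of $$D_tu(t,x)=(\mathcal{A}(t)u)(t,x)+\psi(t,u(t,x)),\ t>s,\ x\in\mathbb{R}^d,\qquad u(s,x)=f(x),\ x\in\mathbb{R}^d,$$ satisfies $u_f(t,\cdot)\in L^{p(t)}(\mathbb{R}^d,\mu_t)$ for every $t>s$ and $$\|u_f(t,\cdot)\|_{L^{p(t)}(\mathbb{R}^d,\mu_t)}\le e^{\psi_0(t-s)}\|f\|_{L^p(\mathbb{R}^d,\mu_s)},\qquad t>s.$$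
   Context: Let $d\ge1$ and let $I$ be either an open right half-line or $I=\mathbb{R}$. For $t\in I$ let $(\mathcal{A}(t)\zeta)(x)=\sum_{i,j=1}^d q_{ij}(t,x)D_{ij}\zeta(x)+\sum_{i=1}^d b_i(t,x)D_i\zeta(x)$, $x\in\mathbb{R}^d$, with real, possibly unbounded coefficients; $Q=[q_{ij}]$, $b=(b_1,\dots,b_d)$. Standing assumptions on $\mathcal{A}(t)$: (i) $q_{ij},b_i\in C^{\alpha/2,\alpha}_{\rm loc}(I\times\mathbb{R}^d)$ for some $\alpha\in(0,1)$ (parabolic Hölder continuity on compact sets: exponent $\alpha/2$ in $t$, $\alpha$ in $x$); (ii) $Q(t,x)$ is symmetric and $\langle Q(t,x)\xi,\xi\rangle\ge\eta(t,x)|\xi|^2$ for all $(t,x)\in I\times\mathbb{R}^d$, $\xi\in\mathbb{R}^d$, for some $\eta:I\times\mathbb{R}^d\to\mathbb{R}$ with $\inf\eta=\eta_0>0$; (iii) there exist a nonnegative $\varphi\in C^2(\mathbb{R}^d)$ and constants $a,c>0$ with $\lim_{|x|\to+\infty}\varphi(x)=+\infty$ and $(\mathcal{A}(t)\varphi)(x)\le a-c\,\varphi(x)$ for all $(t,x)\in I\times\mathbb{R}^d$. $C_b(\mathbb{R}^d)$ denotes bounded continuous real functions; $C_b^1(\mathbb{R}^d)$ denotes $C^1$ functions bounded together with their first order derivatives. Evolution operator (known to be well defined under these assumptions): for $s\in I$ and $f\in C_b(\mathbb{R}^d)$, $(t,x)\mapsto(G(t,s)f)(x)$ is the unique function in $C_b([s,+\infty)\times\mathbb{R}^d)\cap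 C^{1,2}((s,+\infty)\times\mathbb{R}^d)$ with $D_tu=\mathcal{A}(t)u$ in $(s,+\infty)\times\mathbb{R}^d$, $u(s,\cdot)=f$. Measures: $\{\mu_t:t\in I\}$ is a fixed tight evolution system of measures (known to exist), i.e. a tight family of Borel probability measures on $\mathbb{R}^d$ with $\int_{\mathbb{R}^d}G(t,s)f\,d\mu_t=\int_{\mathbb{R}^d}f\,d\mu_s$ for $t>s\in I$, $f\in C_b(\mathbb{R}^d)$, and with $\sup_{t\in I}\int_{\mathbb{R}^d}\varphi\,d\mu_t<+\infty$. For $1\le p<\infty$ and $t>s$, $G(t,s)$ extends uniquely to a contraction (same notation) from $L^p(\mathbb{R}^d,\mu_s)$ to $L^p(\mathbb{R}^d,\mu_t)$. $\nu$ is the Borel measure on $I\times\mathbb{R}^d$ determined by $\nu(J\times\mathcal{O})=\int_J\mu_t(\mathcal{O})\,dt$ for Borel $J\subset I$, $\mathcal{O}\subset\mathbb{R}^d$. Mild solution in $[s,\tau]$: a function $u:[s,\tau]\times\mathbb{R}^d\to\mathbb{R}$ such that for a.e. $x\in\mathbb{R}^d$ and any $t\in(s,\tau]$ the function $r\mapsto(G(t,r)\psi(r,u(r,\cdot)))(x)$ is integrable in $(s,t)$, and $u(t,x)=(G(t,s)f)(x)+\int_s^t(G(t,r)\psi(r,u(r,\cdot)))(x)\,dr$ for any $t\in[s,\tau]$ and a.e. $x\in\mathbb{R}^d$. Under the standing assumptions and (b), the paper proves that for every $s\in I$ and $f\in L^p(\mathbb{R}^d,\mu_s)$, $p>1$,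 there is, for every $\tau>s$, a unique mild solution in $[s,\tau]$ belonging to $L^p([s,\tau]\times\mathbb{R}^d,\nu)$; $u_f$ denotes this solution, defined on $[s,+\infty)\times\mathbb{R}^d$. The standing assumption, made in this part of the paper, that $\psi(t,0)=0$ for all $t\in I$ is implied by (b) and (d). *)

theory Defs
  imports "HOL-Probability.Probability"
begin

section \<open>Function spaces\<close>

definition partial :: "'n \<Rightarrow> (real ^ 'n::finite \<Rightarrow> real) \<Rightarrow> real ^ 'n \<Rightarrow> real" where
  "partial i f x = frechet_derivative f (at x) (axis i 1)"

definition gradient :: "(real ^ 'n::finite \<Rightarrow> real) \<Rightarrow> real ^ 'n \<Rightarrow> real ^ 'n" where
  "gradient f x = (\<chi> i. partial i f x)"

definition jacobian_matrix :: "(real ^ 'n::finite \<Rightarrow> real ^ 'n) \<Rightarrow> real ^ 'n \<Rightarrow> real ^ 'n ^ 'n" where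
  "jacobian_matrix v x = (\<chi> i j. partial j (\<lambda>y. v y $ i) x)"

definition Cb :: "(real ^ 'n::finite \<Rightarrow> real) set" where
  "Cb = {f. continuous_on UNIV f \<and> bounded (range f)}"

definition C1 :: "(real ^ 'n::finite \<Rightarrow> real) set" where
  "C1 = {f. f differentiable_on UNIV \<and> (\<forall>i. continuous_on UNIV (partial i f))}"

definition C2 :: "(real ^ 'n::finite \<Rightarrow> real) set" where
  "C2 = {f \<in> C1. \<forall>i. partial i f \<in> C1}"

definition Cb1 :: "(real ^ 'n::finite \<Rightarrow> real) set" where
  "Cb1 = {f \<in> C1. bounded (range f) \<and> (\<forall>i. bounded (range (partial i f)))}"

text \<open>The class $C^{1,2}(J \times \mathbb{R}^d)$ for an open set $J$ of times.\<close>

definition C12 :: "real set \<Rightarrow> (real \<Rightarrow> real ^ 'n::finite \<Rightarrow> real) set" where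
  "C12 J = {u.
     continuous_on (J \<times> UNIV) (\<lambda>(t, x). u t x) \<and>
     (\<forall>x. \<forall>t\<in>J. (\<lambda>r. u r x) differentiable (at t)) \<and>
     continuous_on (J \<times> UNIV) (\<lambda>(t, x). deriv (\<lambda>r. u r x) t) \<and>
     (\<forall>t\<in>J. u t \<in> C2) \<and>
     (\<forall>i. continuous_on (J \<times> UNIV) (\<lambda>(t, x). partial i (u t) x)) \<and>
     (\<forall>i j. continuous_on (J \<times> UNIV) (\<lambda>(t, x). partial i (partial j (u t)) x))}"

text \<open>
  The class $C^{\alpha/2,\alpha}_{\rm loc}(I \times \mathbb{R}^d)$. Boundedness on compact sets
  need not be required, as it follows from the continuity entailed by the Hoelder estimate.
\<close>

definition parabolic_Hoelder_loc ::
    "real \<Rightarrow> real set \<Rightarrow> (real \<Rightarrow> real ^ 'n::finite \<Rightarrow> real) \<Rightarrow> bool" where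
  "parabolic_Hoelder_loc \<alpha> I g \<longleftrightarrow>
     (\<forall>C. compact C \<and> C \<subseteq> I \<times> UNIV \<longrightarrow>
       (\<exists>M. \<forall>(t, x)\<in>C. \<forall>(r, y)\<in>C.
          \<bar>g t x - g r y\<bar> \<le> M * (\<bar>t - r\<bar> powr (\<alpha> / 2) + norm (x - y) powr \<alpha>)))"

definition L1_loc :: "real set \<Rightarrow> (real \<Rightarrow> real) \<Rightarrow> bool" where
  "L1_loc I g \<longleftrightarrow> (\<forall>C. compact C \<and> C \<subseteq> I \<longrightarrow> set_integrable lebesgue C g)"

text \<open>Elements of $L^p$ are represented by measurable functions.\<close>

definition Lp_on :: "'a measure \<Rightarrow> 'a set \<Rightarrow> real \<Rightarrow> ('a \<Rightarrow> real) set" where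
  "Lp_on M A p = {f. set_borel_measurable M A f \<and> set_integrable M A (\<lambda>x. \<bar>f x\<bar> powr p)}"

abbreviation Lp :: "'a measure \<Rightarrow> real \<Rightarrow> ('a \<Rightarrow> real) set" where
  "Lp M p \<equiv> Lp_on M (space M) p"

definition Lp_norm :: "'a measure \<Rightarrow> real \<Rightarrow> ('a \<Rightarrow> real) \<Rightarrow> real" where
  "Lp_norm M p f = (\<integral>x. \<bar>f x\<bar> powr p \<partial>M) powr (1 / p)"


section \<open>The evolution operator and the evolution system of measures\<close>

definition elliptic_op ::
    "(real \<Rightarrow> real ^ 'n \<Rightarrow> real ^ 'n ^ 'n) \<Rightarrow> (real \<Rightarrow> real ^ 'n \<Rightarrow> real ^ 'n) \<Rightarrow>
     real \<Rightarrow> (real ^ 'n::finite \<Rightarrow> real) \<Rightarrow> real ^ 'n \<Rightarrow> real" where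
  "elliptic_op Q b t \<zeta> x =
     (\<Sum>i\<in>UNIV. \<Sum>j\<in>UNIV. Q t x $ i $ j * partial i (partial j \<zeta>) x) +
     (\<Sum>i\<in>UNIV. b t x $ i * partial i \<zeta> x)"

definition bounded_classical_solution ::
    "(real \<Rightarrow> real ^ 'n \<Rightarrow> real ^ 'n ^ 'n) \<Rightarrow> (real \<Rightarrow> real ^ 'n \<Rightarrow> real ^ 'n) \<Rightarrow>
     real \<Rightarrow> (real ^ 'n::finite \<Rightarrow> real) \<Rightarrow> (real \<Rightarrow> real ^ 'n \<Rightarrow> real) \<Rightarrow> bool" where
  "bounded_classical_solution Q b s f u \<longleftrightarrow>
     continuous_on ({s..} \<times> UNIV) (\<lambda>(t, x). u t x) \<and>
     bounded ((\<lambda>(t, x). u t x) ` ({s..} \<times> UNIV)) \<and>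
     u \<in> C12 {s<..} \<and>
     (\<forall>t>s. \<forall>x. deriv (\<lambda>r. u r x) t = elliptic_op Q b t (u t) x) \<and>
     (\<forall>x. u s x = f x)"

definition evolution_operator ::
    "real set \<Rightarrow> (real \<Rightarrow> real ^ 'n \<Rightarrow> real ^ 'n ^ 'n) \<Rightarrow> (real \<Rightarrow> real ^ 'n \<Rightarrow> real ^ 'n) \<Rightarrow>
     (real \<Rightarrow> real \<Rightarrow> (real ^ 'n::finite \<Rightarrow> real) \<Rightarrow> real ^ 'n \<Rightarrow> real) \<Rightarrow> bool" where
  "evolution_operator I Q b G \<longleftrightarrow>
     (\<forall>s\<in>I. \<forall>f\<in>Cb. bounded_classical_solution Q b s f (\<lambda>t. G t s f))"

definition tight_evolution_system ::
    "real set \<Rightarrow> (real \<Rightarrow> real \<Rightarrow> (real ^ 'n::finite \<Rightarrow> real) \<Rightarrow> real ^ 'n \<Rightarrow> real) \<Rightarrow>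
     (real \<Rightarrow> (real ^ 'n) measure) \<Rightarrow> bool" where
  "tight_evolution_system I G \<mu> \<longleftrightarrow>
     (\<forall>t\<in>I. prob_space (\<mu> t) \<and> sets (\<mu> t) = sets borel) \<and>
     (\<forall>\<epsilon>>0. \<exists>C. compact C \<and> (\<forall>t\<in>I. measure (\<mu> t) C \<ge> 1 - \<epsilon>)) \<and>
     (\<forall>s\<in>I. \<forall>t>s. \<forall>f\<in>Cb. (\<integral>x. G t s f x \<partial>\<mu> t) = (\<integral>x. f x \<partial>\<mu> s))"

text \<open>
  \<open>G t s\<close> is the contractive linear extension to the $L^p$ spaces of its restriction to
  $C_b(\mathbb{R}^d)$. These properties determine \<open>G t s f\<close> only up to $\mu_t$-null sets, which is
  not enough to give a meaning to $r \mapsto (G(t,r)g(r,\cdot))(x)$ for fixed $x$, as required in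
  the definition of mild solutions. The last clause therefore fixes the canonical representative
  $(G(t,s)f)(x) = \int f \, dP_{t,s}(x,\cdot)$, where $P_{t,s}(x,\cdot)$ are the transition
  probabilities of the evolution operator (for $t = s$ they are the Dirac measures). The integral
  has the default value 0 at those $x$, forming a $\mu_t$-null set, where $f$ is not
  $P_{t,s}(x,\cdot)$-integrable.
\<close>

definition Lp_extended ::
    "real set \<Rightarrow> (real \<Rightarrow> (real ^ 'n) measure) \<Rightarrow>
     (real \<Rightarrow> real \<Rightarrow> (real ^ 'n::finite \<Rightarrow> real) \<Rightarrow> real ^ 'n \<Rightarrow> real) \<Rightarrow> bool" where
  "Lp_extended I \<mu> G \<longleftrightarrow>
     (\<forall>s\<in>I. \<forall>t>s. \<forall>p\<ge>1.
        (\<forall>f\<in>Lp (\<mu> s) p. G t s f \<in> Lp (\<mu> t) p \<and>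
           Lp_norm (\<mu> t) p (G t s f) \<le> Lp_norm (\<mu> s) p f) \<and>
        (\<forall>f\<in>Lp (\<mu> s) p. \<forall>g\<in>Lp (\<mu> s) p. \<forall>c d. AE x in \<mu> t.
           G t s (\<lambda>y. c * f y + d * g y) x = c * G t s f x + d * G t s g x)) \<and>
     (\<exists>P. \<forall>s\<in>I. \<forall>t\<ge>s. \<forall>x.
        prob_space (P t s x) \<and> sets (P t s x) = sets borel \<and>
        (\<forall>f\<in>Lp (\<mu> s) 1. G t s f x = (\<integral>y. f y \<partial>P t s x)))"

definition space_time_measure ::
    "real set \<Rightarrow> (real \<Rightarrow> (real ^ 'n::finite) measure) \<Rightarrow> (real \<times> (real ^ 'n)) measure \<Rightarrow> bool" where
  "space_time_measure I \<mu> \<nu> \<longleftrightarrow>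
     sets \<nu> = sets (restrict_space borel (I \<times> UNIV)) \<and>
     (\<forall>J\<in>sets borel. \<forall>S\<in>sets borel. J \<subseteq> I \<longrightarrow>
        emeasure \<nu> (J \<times> S) = (\<integral>\<^sup>+t\<in>J. emeasure (\<mu> t) S \<partial>lborel))"


section \<open>Mild solutions\<close>

definition mild_solution ::
    "(real \<Rightarrow> real \<Rightarrow> (real ^ 'n::finite \<Rightarrow> real) \<Rightarrow> real ^ 'n \<Rightarrow> real) \<Rightarrow> (real \<Rightarrow> real \<Rightarrow> real) \<Rightarrow>
     real \<Rightarrow> real \<Rightarrow> (real ^ 'n \<Rightarrow> real) \<Rightarrow> (real \<Rightarrow> real ^ 'n \<Rightarrow> real) \<Rightarrow> bool" where
  "mild_solution G \<psi> s \<tau> f u \<longleftrightarrow>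
     (AE x in lborel. \<forall>t\<in>{s<..\<tau>}.
        set_integrable lebesgue {s<..<t} (\<lambda>r. G t r (\<lambda>y. \<psi> r (u r y)) x)) \<and>
     (\<forall>t\<in>{s..\<tau>}. AE x in lborel.
        u t x = G t s f x +
          set_lebesgue_integral lebesgue {s<..<t} (\<lambda>r. G t r (\<lambda>y. \<psi> r (u r y)) x))"

text \<open>The characteristic property of $u_f$, which determines it up to null sets.\<close>

definition global_mild_solution ::
    "(real \<Rightarrow> real \<Rightarrow> (real ^ 'n::finite \<Rightarrow> real) \<Rightarrow> real ^ 'n \<Rightarrow> real) \<Rightarrow> (real \<times> (real ^ 'n)) measure \<Rightarrow>
     (real \<Rightarrow> real \<Rightarrow> real) \<Rightarrow> real \<Rightarrow> real \<Rightarrow> (real ^ 'n \<Rightarrow> real) \<Rightarrow>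
     (real \<Rightarrow> real ^ 'n \<Rightarrow> real) \<Rightarrow> bool" where
  "global_mild_solution G \<nu> \<psi> p s f u \<longleftrightarrow>
     (\<forall>\<tau>>s. mild_solution G \<psi> s \<tau> f u \<and> (\<lambda>(t, x). u t x) \<in> Lp_on \<nu> ({s..\<tau>} \<times> UNIV) p)"

text \<open>
  For $1 < \gamma < 2$ the integral on the right-hand side may be infinite, in which case the
  inequality is void; since the Bochner integral would be 0 then, integrability is made
  an explicit premise. The convention $0 \log 0 = 0$ agrees with that of the library.
\<close>

definition log_Sobolev :: "real set \<Rightarrow> (real \<Rightarrow> (real ^ 'n::finite) measure) \<Rightarrow> real \<Rightarrow> bool" where
  "log_Sobolev I \<mu> K \<longleftrightarrow>
     (\<forall>r\<in>I. \<forall>g\<in>Cb1. \<forall>\<gamma>>1.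
        set_integrable (\<mu> r) {x. g x \<noteq> 0} (\<lambda>x. \<bar>g x\<bar> powr (\<gamma> - 2) * (norm (gradient g x))\<^sup>2) \<longrightarrow>
        (\<integral>x. \<bar>g x\<bar> powr \<gamma> * ln \<bar>g x\<bar> \<partial>\<mu> r) \<le>
          Lp_norm (\<mu> r) \<gamma> g powr \<gamma> * ln (Lp_norm (\<mu> r) \<gamma> g) +
          \<gamma> * K * set_lebesgue_integral (\<mu> r) {x. g x \<noteq> 0}
            (\<lambda>x. \<bar>g x\<bar> powr (\<gamma> - 2) * (norm (gradient g x))\<^sup>2))"

end

theory Submission
  imports Defs
begin

text \<open>
  Write $P_{t,s}$ for the transition probabilities. The theorem combines hypercontractivity of the
  linear evolution with the pointwise domination $|u_f(t,\cdot)| \le e^{\psi_0(t-s)} P_{t,s}|f|$,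
  which holds $\mu_t$-almost everywhere.

  Hypercontractivity: for a positive bounded solution $v$ of the linear equation, the logarithmic
  Sobolev inequality makes $t \mapsto \|v(t,\cdot)\|_{L^{p(t)}(\mu_t)}$ nonincreasing. The
  derivative is computed for functions multiplied by cutoffs; (c) and the uniform bound on
  $\int \varphi\,d\mu_t$ make the resulting errors vanish.

  Domination: for large $l$, (b) and (d) give $|\psi(t,\xi) + l\xi| \le (\psi_0 + l)|\xi|$. The
  function $e^{l(t-s)}u$ solves a mild equation with this nonlinearity, and Gronwall's lemma for
  kernels applies. Shifting by $l$ needs Fubini's theorem and the Chapman-Kolmogorov equation for
  $(r,x) \mapsto \int \psi(r,u(r,y))\,P_{t,r}(x,dy)$, although $\psi$ need not be measurable in
  time. Joint measurability is a Caratheodory argument: being a mild solution gives measurability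
  in $r$ for almost every $x$, the strong Feller property gives continuity in $x$. The latter
  follows from absolute continuity of $P_{t,r}(x,\cdot)$ with a locally bounded density, obtained
  from a parametrix; this also turns Lebesgue-null sets into $\mu_t$-null sets.
\<close>

text \<open>The solution \<open>u\<close> is only a measurable function whose mild equation holds
  for each time at almost every point. No derivatives of it are available, so the entropy
  computation cannot be made on \<open>u\<close>; this is why the nonlinearity enters only through a
  linear comparison. The rate \<eta>0/K of the exponent q is where two terms balance. The changing
  exponent produces q' times the integral of v^q ln v, ellipticity removes q(q-1)\<eta>0 times the
  integral of v^(q-2)|grad v|^2, and the logarithmic Sobolev inequality trades one for the other
  exactly if q' = (\<eta>0/K)(q-1). That inequality asks for functions in \<open>Cb1\<close>, while
  the gradient of v is controlled only on compact sets. It is therefore applied to an interpolation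
  between v and a constant, chosen so that its powers compare with those of v in the right
  direction. The measures \<mu> and, for fixed (t,x), the transition probabilities r -> P(t,r,x)
  satisfy the same backward invariance. Differentiation in time and density bounds are proved once
  for this common notion, \<open>flow\<close>, with constants independent of the particular flow.
  That uniformity in x is what the strong Feller property rests on.\<close>

abbreviation (input) nint :: "'a measure => ('a => ennreal) => ennreal" where "nint \<equiv> nn_integral"

abbreviation (input) lint :: "'a measure => ('a => 'b::{banach, second_countable_topology}) => 'b" where "lint \<equiv> lebesgue_integral"

abbreviation (input) Bmeas :: "('a::topological_space => 'b::topological_space) set" where "Bmeas \<equiv> borel_measurable borel"

section \<open>Second-order calculus and the maximum principle\<close>

definition outer :: "real ^ 'n => real ^ 'n => real ^ 'n ^ 'n::finite" where
 "outer u v = (\<chi> i j. u $ i * v $ j)"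

text \<open>Second-order differentiability with the gradient \<open>D\<close> and the Hessian
  \<open>H\<close> as explicit witnesses, so that the derivatives of composite functions are terms
  and not Frechet derivatives to be computed. \<open>H x $ i $ j\<close> is the derivative in
  direction i of the j-th component of \<open>D\<close>. Continuity of \<open>H\<close> is stated
  separately where it matters.\<close>

definition C2w :: "(real ^ 'n::finite => real) => (real ^ 'n => real ^ 'n) => (real ^ 'n => real ^ 'n ^ 'n) => bool" where
 "C2w f D H \<longleftrightarrow> (ALL x. (f has_derivative (%v. D x \<bullet> v)) (at x)) &
  (ALL x j. ((%x. D x $ j) has_derivative (%v. \<Sum>i\<in>UNIV. H x $ i $ j * v $ i)) (at x))"

lemma C2wI:
 assumes "!!x. (f has_derivative (%v. D x \<bullet> v)) (at x)"
  "!!x j. ((%x. D x $ j) has_derivative (%v. \<Sum>i\<in>UNIV. H x $ i $ j * v $ i)) (at x)"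
 shows "C2w f D H"
 using assms by (auto simp: C2w_def)

lemma C2wD1: "C2w f D H ==> (f has_derivative (%v. D x \<bullet> v)) (at x)"
 and C2wD2: "C2w f D H ==> ((%x. D x $ j) has_derivative (%v. \<Sum>i\<in>UNIV. H x $ i $ j * v $ i)) (at x)"
 by (auto simp: C2w_def)

lemma partial_eq: "(f has_derivative f') (at x) ==> partial i f x = f' (axis i 1)"
 by (simp add: partial_def frechet_derivative_at[symmetric])

lemma C2w_partial: "C2w f D H ==> partial i f = (%x. D x $ i)"
 using partial_eq[OF C2wD1] by (fastforce simp: inner_axis)

lemma sum_mult_axis: "(\<Sum>i\<in>UNIV. g i * axis k (1::real) $ i) = g (k::'n::finite)"
proof -
 have "(\<Sum>i\<in>UNIV. g i * axis k (1::real) $ i) = (\<Sum>i\<in>UNIV. if i = k then g i else 0)"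
  by (intro sum.cong) (auto simp: axis_def)
 then show ?thesis by simp
qed

lemma C2w_partial2: "C2w f D H ==> partial i (partial j f) x = H x $ i $ j"
 unfolding C2w_partial[of f D H j] using partial_eq[OF C2wD2] by (simp add: sum_mult_axis)

lemma inner_matrix: "(A :: real ^ 'n ^ 'm) \<bullet> B = (\<Sum>i\<in>UNIV. \<Sum>j\<in>UNIV. A $ i $ j * B $ i $ j)"
 by (simp add: inner_vec_def)

lemma elliptic_op_C2w: "C2w f D H ==> elliptic_op Q b t f x = Q t x \<bullet> H x + b t x \<bullet> D x"
 by (simp add: elliptic_op_def C2w_partial2 inner_matrix inner_vec_def) (simp add: C2w_partial inner_vec_def)

lemma has_derivative_sum_form:
 assumes "(f has_derivative f') (at (x::real^'n::finite))"
 shows "f' = (%v. \<Sum>i\<in>UNIV. partial i f x *\<^sub>R v $ i)"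
proof
 fix v :: "real^'n"
 have lin: "linear f'" using assms has_derivative_linear by blast
 have "f' v = f' (\<Sum>i\<in>UNIV. v $ i *\<^sub>R axis i 1)" by (simp add: basis_expansion scalar_mult_eq_scaleR[symmetric])
 also have "... = (\<Sum>i\<in>UNIV. v $ i *\<^sub>R f' (axis i 1))"
  by (simp add: linear_sum[OF lin] linear_scale[OF lin])
 also have "... = (\<Sum>i\<in>UNIV. partial i f x *\<^sub>R v $ i)"
  using partial_eq[OF assms] by (simp add: mult.commute)
 finally show "f' v = (\<Sum>i\<in>UNIV. partial i f x *\<^sub>R v $ i)" .
qed

lemma C1_has_derivative:
 assumes "f : C1" shows "(f has_derivative (%v. \<Sum>i\<in>UNIV. partial i f x * v $ i)) (at x)"
proof -
 from assms have "f differentiable at x" by (simp add: C1_def differentiable_on_def)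
 then obtain f' where f': "(f has_derivative f') (at x)" by (auto simp: differentiable_def)
 show ?thesis using f' has_derivative_sum_form[OF f'] by simp
qed

lemma C2_C2w:
 assumes "f : C2" shows "C2w f (gradient f) (%x. \<chi> i j. partial i (partial j f) x)"
 using assms C1_has_derivative[of f] C1_has_derivative[of "partial _ f"]
 by (auto simp: C2w_def C2_def gradient_def inner_vec_def)

lemma C2w_const: "C2w (%x. c) (%x. 0) (%x. 0)"
 by (auto simp: C2w_def)

lemma C2w_add: "C2w f Df Hf ==> C2w g Dg Hg ==> C2w (%x. f x + g x) (%x. Df x + Dg x) (%x. Hf x + Hg x)"
 unfolding C2w_def inner_add_left vector_add_component ring_distribs sum.distrib
 by (auto intro!: has_derivative_add)

lemma C2w_linear:
 assumes "bounded_linear f" shows "C2w f (%x. \<chi> i. f (axis i 1)) (%x. 0)"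
proof -
 have "f v = (\<chi> i. f (axis i 1)) \<bullet> v" for v
 proof -
  have lin: "linear f" using assms bounded_linear.linear by blast
  have "f v = f (\<Sum>i\<in>UNIV. v $ i *\<^sub>R axis i 1)" by (simp add: basis_expansion scalar_mult_eq_scaleR[symmetric])
  also have "... = (\<Sum>i\<in>UNIV. v $ i *\<^sub>R f (axis i 1))"
   by (simp add: linear_sum[OF lin] linear_scale[OF lin])
  finally show ?thesis by (simp add: inner_vec_def mult.commute)
 qed
 then have eq: "(%v. (\<chi> i. f (axis i 1)) \<bullet> v) = f" by (intro ext) (rule sym)
 show ?thesis unfolding C2w_def eq using bounded_linear_imp_has_derivative[OF assms] by simp
qed

lemma C2w_mult:
 assumes f: "C2w f Df Hf" and g: "C2w g Dg Hg"
 shows "C2w (%x. f x * g x) (%x. f x *\<^sub>R Dg x + g x *\<^sub>R Df x)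
  (%x. f x *\<^sub>R Hg x + g x *\<^sub>R Hf x + outer (Df x) (Dg x) + outer (Dg x) (Df x))"
proof (rule C2wI)
 fix x
 show "((%x. f x * g x) has_derivative (%v. (f x *\<^sub>R Dg x + g x *\<^sub>R Df x) \<bullet> v)) (at x)"
  by (rule has_derivative_eq_rhs[OF has_derivative_mult[OF C2wD1[OF f] C2wD1[OF g]]])
   (auto simp: inner_add_left algebra_simps)
 fix j
 show "((%x. (f x *\<^sub>R Dg x + g x *\<^sub>R Df x) $ j) has_derivative
   (%v. \<Sum>i\<in>UNIV. (f x *\<^sub>R Hg x + g x *\<^sub>R Hf x + outer (Df x) (Dg x) + outer (Dg x) (Df x)) $ i $ j * v $ i)) (at x)"
  unfolding vector_add_component vector_scaleR_component real_scaleR_def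
  by (rule has_derivative_eq_rhs[OF has_derivative_add[OF has_derivative_mult[OF C2wD1[OF f] C2wD2[OF g]]
     has_derivative_mult[OF C2wD1[OF g] C2wD2[OF f]]]])
   (auto simp: outer_def inner_vec_def sum_distrib_left sum_distrib_right sum.distrib[symmetric] algebra_simps
    intro!: sum.cong)
qed

lemma C2w_compose:
 assumes f: "C2w f Df Hf"
  and F: "!!x. (F has_real_derivative F1 (f x)) (at (f x))" "!!x. (F1 has_real_derivative F2 (f x)) (at (f x))"
 shows "C2w (%x. F (f x)) (%x. F1 (f x) *\<^sub>R Df x) (%x. F1 (f x) *\<^sub>R Hf x + F2 (f x) *\<^sub>R outer (Df x) (Df x))"
proof (rule C2wI)
 fix x
 have 1: "((%x. F (f x)) has_derivative (%v. F1 (f x) * (Df x \<bullet> v))) (at x)"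
  using has_derivative_compose[OF C2wD1[OF f] F(1)[unfolded has_field_derivative_def]] by simp
 then show "((%x. F (f x)) has_derivative (%v. (F1 (f x) *\<^sub>R Df x) \<bullet> v)) (at x)" by simp
 have 2: "((%x. F1 (f x)) has_derivative (%v. F2 (f x) * (Df x \<bullet> v))) (at x)"
  using has_derivative_compose[OF C2wD1[OF f] F(2)[unfolded has_field_derivative_def]] by simp
 fix j
 show "((%x. (F1 (f x) *\<^sub>R Df x) $ j) has_derivative
   (%v. \<Sum>i\<in>UNIV. (F1 (f x) *\<^sub>R Hf x + F2 (f x) *\<^sub>R outer (Df x) (Df x)) $ i $ j * v $ i)) (at x)"
  unfolding vector_scaleR_component real_scaleR_def
  by (rule has_derivative_eq_rhs[OF has_derivative_mult[OF 2 C2wD2[OF f]]])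
   (auto simp: outer_def inner_vec_def sum_distrib_left sum_distrib_right sum.distrib[symmetric] algebra_simps
    intro!: sum.cong)
qed

lemma C2w_cmult: "C2w f D H ==> C2w (%x. c * f x) (%x. c *\<^sub>R D x) (%x. c *\<^sub>R H x)"
 using C2w_mult[OF C2w_const[of c], of f D H] by (simp add: outer_def zero_vec_def[symmetric])

lemma C2w_cont: "C2w f D H ==> continuous_on UNIV f"
 by (meson C2wD1 differentiableI differentiable_imp_continuous_on differentiable_on_def differentiable_at_imp_differentiable_on)

lemma C2w_contD: "C2w f D H ==> continuous_on UNIV D"
proof -
 assume a: "C2w f D H"
 have "continuous_on UNIV (%x. D x $ j)" for j
  using C2wD2[OF a] by (meson has_derivative_continuous continuous_at_imp_continuous_on)
 then have "continuous_on UNIV (%x. \<chi> j. D x $ j)" by (intro continuous_on_vec_lambda)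
 then show ?thesis by simp
qed

lemma C2w_diff: "C2w f Df Hf ==> C2w g Dg Hg ==> C2w (%x. f x - g x) (%x. Df x - Dg x) (%x. Hf x - Hg x)"
 using C2w_add[of f Df Hf, OF _ C2w_cmult[of g Dg Hg "-1"]] by simp

lemma inner_outer: "A \<bullet> outer u v = u \<bullet> (A *v v)"
 by (simp add: inner_matrix outer_def inner_vec_def matrix_vector_mult_def sum_distrib_left mult_ac)

lemma C2w_quadratic: "C2w (%x::real^'n::finite. (norm x)^2) (%x. 2 *\<^sub>R x) (%x. 2 *\<^sub>R mat 1)"
proof (rule C2wI)
 fix x :: "real^'n"
 show "((%x. (norm x)^2) has_derivative (%v. (2 *\<^sub>R x) \<bullet> v)) (at x)"
  unfolding power2_norm_eq_inner
  by (auto intro!: derivative_eq_intros simp: inner_commute)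
 fix j
 have *: "(\<Sum>i\<in>UNIV. (2 *\<^sub>R mat 1 :: real^'n^'n) $ i $ j * v $ i) = 2 * v $ j" for v :: "real^'n"
 proof -
  have "(\<Sum>i\<in>UNIV. (2 *\<^sub>R mat 1 :: real^'n^'n) $ i $ j * v $ i) = (\<Sum>i\<in>UNIV. if i = j then 2 * v $ i else 0)"
   by (intro sum.cong) (auto simp: mat_def)
  then show ?thesis by simp
 qed
 show "((%x. (2 *\<^sub>R x) $ j) has_derivative (%v. \<Sum>i\<in>UNIV. (2 *\<^sub>R mat 1 :: real^'n^'n) $ i $ j * v $ i)) (at x)"
  unfolding * by (auto intro!: derivative_eq_intros bounded_linear_imp_has_derivative bounded_linear_intros)
qed

section \<open>Semidefinite matrices and the maximum principle\<close>

definition psd :: "real ^ 'n ^ 'n::finite => bool" where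
 "psd A \<longleftrightarrow> transpose A = A & (ALL xi. 0 <= xi \<bullet> (A *v xi))"

lemma sym_inner: "transpose A = A ==> x \<bullet> (A *v y) = y \<bullet> (A *v (x::real^'n::finite))"
 by (metis dot_lmul_matrix inner_commute transpose_matrix_vector)

text \<open>The quadratic polynomial t -> <A(x+ty), x+ty> is nonnegative. Its leading coefficient
  may vanish, since A may be degenerate; then the polynomial is affine and its linear coefficient
  must be 0.\<close>

lemma psd_cauchy:
 assumes "psd A" shows "(x \<bullet> (A *v y))^2 <= (x \<bullet> (A *v x)) * (y \<bullet> (A *v y))"
proof -
 define a c d where "a = x \<bullet> (A *v x)" and "c = x \<bullet> (A *v y)" and "d = y \<bullet> (A *v y)"
 have sy: "y \<bullet> (A *v x) = c" using assms sym_inner by (auto simp: psd_def c_def)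
 have q: "0 <= a + 2 * t * c + t^2 * d" for t
 proof -
  have "0 <= (x + t *\<^sub>R y) \<bullet> (A *v (x + t *\<^sub>R y))" using assms by (simp add: psd_def)
  also have "... = a + 2 * t * c + t^2 * d"
   by (simp add: matrix_vector_right_distrib scaleR_matrix_vector_assoc[symmetric] matrix_vector_mult_scaleR inner_add_left inner_add_right
    a_def[symmetric] c_def[symmetric] d_def[symmetric] sy power2_eq_square algebra_simps)
  finally show ?thesis .
 qed
 have a0: "a >= 0" and d0: "d >= 0" using assms by (auto simp: psd_def a_def d_def)
 have "c^2 <= a * d"
 proof (cases "d = 0")
  case True
  have "c = 0"
  proof (rule ccontr)
   assume "c ~= 0"
   have "0 <= a + 2 * (- (a+1)/(2*c)) * c" using q[of "- (a+1)/(2*c)"] True by simp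
   then show False using \<open>c ~= 0\<close> by (simp add: field_simps)
  qed
  then show ?thesis using a0 d0 by simp
 next
  case False
  then have "d > 0" using d0 by simp
  have "0 <= a + 2 * (-c/d) * c + (-c/d)^2 * d" by (rule q)
  also have "... = a - c^2 / d" using \<open>d > 0\<close> by (simp add: power2_eq_square field_simps)
  finally show ?thesis using \<open>d > 0\<close> by (simp add: field_simps)
 qed
 then show ?thesis by (simp add: a_def c_def d_def)
qed

lemma axis_quad: "axis i 1 \<bullet> (A *v axis j 1) = (A :: real^'n^'n::finite) $ i $ j"
 by (simp add: inner_axis' matrix_vector_mult_def sum_mult_axis)

text \<open>Elimination replaces diagonalisation: if A has a nonzero diagonal entry k, then A minus
  the rank-one matrix built from its k-th column is again semidefinite (\<open>psd_cauchy\<close>)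
  and has fewer nonzero diagonal entries. Each rank-one piece contributes a value <v,Hv> <= 0. A
  semidefinite matrix with zero diagonal is 0, which ends the induction.\<close>

lemma psd_inner_nonpos:
 fixes A H :: "real ^ 'n ^ 'n::finite"
 assumes "psd A" and H: "!!v. v \<bullet> (H *v v) <= 0"
 shows "A \<bullet> H <= 0"
 using assms(1)
proof (induction "card {i. A $ i $ i ~= 0}" arbitrary: A rule: less_induct)
 case less
 show ?case
 proof (cases "EX i. A $ i $ i ~= 0")
  case False
  have "A $ i $ j = 0" for i j
   using psd_cauchy[OF less.prems, of "axis i 1" "axis j 1"] False by (simp add: axis_quad)
  then show ?thesis by (simp add: inner_matrix)
 next
  case True
  then obtain k where k: "A $ k $ k ~= 0" by auto
  have sym: "transpose A = A" using less.prems by (simp add: psd_def)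
  have symc: "A $ i $ j = A $ j $ i" for i j
   using arg_cong[OF sym, of "%M. M $ j $ i"] by (simp add: transpose_def)
  have pos: "A $ k $ k > 0"
   using k less.prems[unfolded psd_def] axis_quad[of k A k] by (metis order_le_less)
  define v where "v = A *v axis k 1"
  have vi: "v $ i = A $ i $ k" for i unfolding v_def by (simp add: matrix_vector_mult_def sum_mult_axis)
  define B where "B = A - (1 / A $ k $ k) *\<^sub>R outer v v"
  have Bq: "x \<bullet> (B *v y) = x \<bullet> (A *v y) - (x \<bullet> v) * (v \<bullet> y) / A $ k $ k" for x y
  proof -
   have "outer v v *v y = (v \<bullet> y) *\<^sub>R v"
    by (simp add: vec_eq_iff matrix_vector_mult_def outer_def inner_vec_def sum_distrib_left sum_distrib_right mult_ac)
   then show ?thesis unfolding B_def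
    by (simp add: matrix_vector_mult_diff_rdistrib scaleR_matrix_vector_assoc[symmetric] inner_diff_right)
  qed
  have psdB: "psd B"
   unfolding psd_def
  proof (intro conjI allI)
   show "transpose B = B"
    by (auto simp: vec_eq_iff transpose_def B_def outer_def symc)
   fix xi
   have "(xi \<bullet> v)^2 <= (xi \<bullet> (A *v xi)) * A $ k $ k"
    using psd_cauchy[OF less.prems, of xi "axis k 1"] by (simp add: axis_quad v_def)
   then show "0 <= xi \<bullet> (B *v xi)" unfolding Bq using pos
    by (simp add: inner_commute power2_eq_square field_simps)
  qed
  have Bd: "B $ i $ i = A $ i $ i - (A $ i $ k)^2 / A $ k $ k" for i
   by (simp add: B_def outer_def vi power2_eq_square)
  have "{i. B $ i $ i ~= 0} \<subset> {i. A $ i $ i ~= 0}"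
  proof
   show "{i. B $ i $ i ~= 0} \<subseteq> {i. A $ i $ i ~= 0}"
   proof clarify
    fix i assume "B $ i $ i ~= 0" "A $ i $ i = 0"
    moreover have "A $ i $ k = 0" using psd_cauchy[OF less.prems, of "axis i 1" "axis k 1"] \<open>A $ i $ i = 0\<close> by (simp add: axis_quad)
    ultimately show False by (simp add: Bd)
   qed
   have "B $ k $ k = 0" using pos by (simp add: Bd power2_eq_square)
   then show "{i. B $ i $ i ~= 0} ~= {i. A $ i $ i ~= 0}" using k by auto
  qed
  then have "card {i. B $ i $ i ~= 0} < card {i. A $ i $ i ~= 0}" by (intro psubset_card_mono) auto
  from less.hyps[OF this psdB] have "B \<bullet> H <= 0" .
  moreover have "outer v v \<bullet> H <= 0" using H[of v] by (metis inner_commute inner_outer)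
  ultimately show ?thesis unfolding B_def using pos
   by (simp add: inner_diff_left inner_diff_right inner_commute[of H]) (smt (verit, best) divide_nonpos_pos)
 qed
qed

text \<open>Along the line through x in direction v the first derivative vanishes at x. If the
  derivative of that derivative were positive there, the first derivative would be positive
  immediately afterwards and f would rise above its maximum.\<close>

lemma C2w_max_second:
 assumes C: "C2w f D H" and max: "!!y. f y <= f x"
 shows "D x = 0" "v \<bullet> (H x *v v) <= 0"
proof -
 have D: "((%t. f (x + t *\<^sub>R v)) has_real_derivative D (x + t *\<^sub>R v) \<bullet> v) (at t)" for t v
 proof -
  have "((%t. x + t *\<^sub>R v) has_derivative (%s. s *\<^sub>R v)) (at t)" by (auto intro!: derivative_eq_intros)
  from has_derivative_compose[OF this C2wD1[OF C]] show ?thesis by (simp add: has_field_derivative_def mult_commute_abs)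
 qed
 have z: "D x \<bullet> v = 0" for v
 proof -
  have "((%t. f (x + t *\<^sub>R v)) has_real_derivative D x \<bullet> v) (at 0)" using D[of v 0] by simp
  from DERIV_local_max[OF this, of 1] show ?thesis using max by simp
 qed
 then show "D x = 0" using inner_eq_zero_iff by blast
 define g where "g t = D (x + t *\<^sub>R v) \<bullet> v" for t
 have gd: "(g has_real_derivative v \<bullet> (H x *v v)) (at 0)"
 proof -
  have lin: "((%t. x + t *\<^sub>R v) has_derivative (%s. s *\<^sub>R v)) (at 0)" by (auto intro!: derivative_eq_intros)
  have "((%t. D (x + t *\<^sub>R v) $ j) has_derivative (%s. \<Sum>i\<in>UNIV. H x $ i $ j * (s *\<^sub>R v) $ i)) (at 0)" for j
   using has_derivative_compose[OF lin, of "%x. D x $ j" "%v. \<Sum>i\<in>UNIV. H x $ i $ j * v $ i"] C2wD2[OF C, of j x] by simp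
  then have "((%t. \<Sum>j\<in>UNIV. D (x + t *\<^sub>R v) $ j * v $ j) has_derivative (%s. \<Sum>j\<in>UNIV. (\<Sum>i\<in>UNIV. H x $ i $ j * (s *\<^sub>R v) $ i) * v $ j)) (at 0)"
   by (intro has_derivative_sum has_derivative_mult_left)
  moreover have "(%s::real. \<Sum>j\<in>UNIV. (\<Sum>i\<in>UNIV. H x $ i $ j * (s *\<^sub>R v) $ i) * v $ j) = (*) (v \<bullet> (H x *v v))"
  proof
   fix s :: real
   have "(\<Sum>j\<in>UNIV. (\<Sum>i\<in>UNIV. H x $ i $ j * (s *\<^sub>R v) $ i) * v $ j) = (\<Sum>j\<in>UNIV. \<Sum>i\<in>UNIV. s * (v $ i * (H x $ i $ j * v $ j)))"
    by (simp add: sum_distrib_right sum_distrib_left mult_ac)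
   also have "... = (\<Sum>i\<in>UNIV. \<Sum>j\<in>UNIV. s * (v $ i * (H x $ i $ j * v $ j)))" by (rule sum.swap)
   also have "... = v \<bullet> (H x *v v) * s"
    by (simp add: inner_vec_def matrix_vector_mult_def sum_distrib_left sum_distrib_right mult_ac)
   finally show "(\<Sum>j\<in>UNIV. (\<Sum>i\<in>UNIV. H x $ i $ j * (s *\<^sub>R v) $ i) * v $ j) = v \<bullet> (H x *v v) * s" .
  qed
  ultimately show ?thesis by (simp add: has_field_derivative_def g_def[abs_def] inner_vec_def)
 qed
 show "v \<bullet> (H x *v v) <= 0"
 proof (rule ccontr)
  assume "\<not> ?thesis"
  then have "v \<bullet> (H x *v v) > 0" by simp
  from DERIV_pos_inc_right[OF gd this] obtain d where d: "d > 0" "!!h. 0 < h ==> h < d ==> g 0 < g (0 + h)" by auto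
  have g0: "g 0 = 0" using z by (simp add: g_def)
  have "f (x + 0 *\<^sub>R v) < f (x + (d/2) *\<^sub>R v)"
  proof (rule DERIV_pos_imp_increasing_open[of 0 "d/2" "%t. f (x + t *\<^sub>R v)"])
   show "0 < d/2" using d by simp
   show "EX y. ((%t. f (x + t *\<^sub>R v)) has_real_derivative y) (at t) & 0 < y" if "0 < t" "t < d/2" for t
    using D[of v t] d(2)[of t] that g0 by (auto simp: g_def)
   show "continuous_on {0..d/2} (%t. f (x + t *\<^sub>R v))"
    using D by (meson DERIV_continuous_on DERIV_subset UNIV_I subset_UNIV has_field_derivative_at_within)
  qed
  then show False using max[of "x + (d/2) *\<^sub>R v"] by simp
 qed
qed

text \<open>The domain is unbounded, so a small multiple of the Lyapunov function is subtracted: it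
  tends to infinity and confines a positive maximum to a compact set. At such a point the first and
  second order conditions contradict the differential inequality, and the multiple is then sent to
  0.\<close>

lemma max_principle:
 fixes z :: "real => real ^ 'n::finite => real"
 assumes sT: "s <= T"
  and psd: "!!t x. s < t ==> t <= T ==> psd (Q t x)"
  and phi: "C2w \<phi> D\<phi> H\<phi>" "!!x. \<phi> x >= 0" "filterlim \<phi> at_top at_infinity"
   "!!t x. s < t ==> t <= T ==> Q t x \<bullet> H\<phi> x + b t x \<bullet> D\<phi> x <= a"
  and cont: "continuous_on ({s..T} \<times> UNIV) (%(t, x). z t x)"
  and bd: "!!t x. s <= t ==> t <= T ==> z t x <= B"
  and zt: "!!t x. s < t ==> t <= T ==> ((%r. z r x) has_real_derivative zt t x) (at t)"
  and zx: "!!t. s < t ==> t <= T ==> C2w (z t) (Dz t) (Hz t)"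
  and ineq: "!!t x. s < t ==> t <= T ==> zt t x - (Q t x \<bullet> Hz t x + b t x \<bullet> Dz t x) <= N"
  and init: "!!x. z s x <= 0"
  and t: "s <= t" "t <= T"
 shows "z t x <= N * (t - s)"
proof -
 \<comment> \<open>The correction \<open>(abs a + 1) * (t - s)\<close> overcompensates the bound
   \<open>a\<close> on the operator applied to \<phi>, which makes the final contradiction
   strict.\<close>
 define y where "y ep t x = z t x - N * (t - s) - ep * (\<phi> x + (abs a + 1) * (t - s))" for ep t x
 have key: "y ep t x <= 0" if e: "ep > 0" and t: "s <= t" "t <= T" for ep t x
 proof (rule ccontr)
  assume "\<not> ?thesis"
  then have pos: "y ep t x > 0" by simp
  define B' where "B' = abs B + abs N * (T - s)"
  have "eventually (%x. \<phi> x >= (B' + 1) / ep) at_infinity" using phi(3) by (simp add: filterlim_at_top)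
  then obtain R where R: "!!x. norm x >= R ==> \<phi> x >= (B' + 1) / ep" by (auto simp: eventually_at_infinity)
  have yneg: "y ep t x < 0" if "norm x >= R" "s <= t" "t <= T" for t x
  proof -
   have "z t x <= abs B" using bd[OF that(2,3), of x] by simp
   moreover have "- N * (t - s) <= abs N * (T - s)"
    using that by (intro mult_mono) auto
   moreover have "ep * ((abs a + 1) * (t - s)) >= 0" using e that by simp
   moreover have "ep * \<phi> x >= B' + 1" using R[OF that(1)] e by (simp add: field_simps)
   ultimately show ?thesis unfolding y_def B'_def by (simp add: distrib_left)
  qed
  define S where "S = {s..T} \<times> cball (0::real^'n) (max R (norm x))"
  have S: "compact S" "S ~= {}" "(t, x) : S"
   unfolding S_def using t by (auto intro!: compact_Times)
  have cy: "continuous_on S (%(t, x). y ep t x)"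
  proof -
   have "continuous_on S (%(t, x). z t x)" by (rule continuous_on_subset[OF cont]) (auto simp: S_def)
   then have 1: "continuous_on S (%p. z (fst p) (snd p))" by (simp add: case_prod_beta')
   have 2: "continuous_on S (%p. \<phi> (snd p))"
    using continuous_on_compose2[OF C2w_cont[OF phi(1)] continuous_on_snd[OF continuous_on_id]] by auto
   show ?thesis unfolding y_def case_prod_beta'
    by (intro continuous_intros 1 2)
  qed
  from continuous_attains_sup[OF S(1,2) cy] obtain p where p: "p : S" "!!q. q : S ==> (%(t, x). y ep t x) q <= (%(t, x). y ep t x) p"
   by metis
  obtain t0 x0 where p0: "p = (t0, x0)" by force
  have t0: "s <= t0" "t0 <= T" using p p0 by (auto simp: S_def)
  have y0: "y ep t0 x0 > 0" using p(2)[OF S(3)] pos p0 by simp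
  have mx: "y ep r q <= y ep t0 x0" if "s <= r" "r <= T" for r q
  proof (cases "norm q <= max R (norm x)")
   case True then show ?thesis using p(2)[of "(r,q)"] that p0 by (auto simp: S_def)
  next
   case False
   then have "R <= norm q" by linarith
   then show ?thesis using yneg[of q r] that y0 by simp
  qed
  have "t0 ~= s"
  proof
   assume "t0 = s"
   then have "y ep t0 x0 <= 0" unfolding y_def
    using init[of x0] mult_nonneg_nonneg[OF less_imp_le[OF e] phi(2)[of x0]] by simp
   then show False using y0 by simp
  qed
  then have st0: "s < t0" using t0 by simp
  have dy: "((%r. y ep r x0) has_real_derivative zt t0 x0 - N - ep * (abs a + 1)) (at t0)"
   unfolding y_def using zt[OF st0 t0(2), of x0] by (auto intro!: derivative_eq_intros simp: algebra_simps)
  \<comment> \<open>The maximum may sit at the final time \<open>T\<close>, so it is compared with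
    earlier times only.\<close>
  have d0: "0 <= zt t0 x0 - N - ep * (abs a + 1)"
  proof (rule ccontr)
   assume "\<not> ?thesis"
   then have "zt t0 x0 - N - ep * (abs a + 1) < 0" by simp
   from DERIV_neg_dec_left[OF dy this] obtain d where d: "d > 0" "!!h. 0 < h ==> h < d ==> y ep t0 x0 < y ep (t0 - h) x0" by auto
   define h where "h = min (d/2) (t0 - s)"
   have h: "0 < h" "h < d" "h <= t0 - s" using d st0 by (auto simp: h_def min_def)
   show False using d(2)[OF h(1,2)] mx[of "t0 - h" x0] h t0 by simp
  qed
  have Cy: "C2w (y ep t0) (%x. Dz t0 x - ep *\<^sub>R D\<phi> x) (%x. Hz t0 x - ep *\<^sub>R H\<phi> x)"
  proof -
   have "C2w (%x. (z t0 x - ep * \<phi> x) + (- N * (t0 - s) - ep * ((abs a + 1) * (t0 - s)))) (%x. (Dz t0 x - ep *\<^sub>R D\<phi> x) + 0) (%x. (Hz t0 x - ep *\<^sub>R H\<phi> x) + 0)"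
    by (intro C2w_add C2w_diff zx st0 t0 C2w_cmult phi C2w_const)
   then show ?thesis by (simp add: y_def[abs_def] algebra_simps)
  qed
  have "!!q. y ep t0 q <= y ep t0 x0" using mx t0 by simp
  note m = C2w_max_second[OF Cy this]
  have "Q t0 x0 \<bullet> (Hz t0 x0 - ep *\<^sub>R H\<phi> x0) <= 0" by (rule psd_inner_nonpos[OF psd[OF st0 t0(2)] m(2)])
  then have "Q t0 x0 \<bullet> Hz t0 x0 <= ep * (Q t0 x0 \<bullet> H\<phi> x0)" by (simp add: inner_diff_right)
  moreover have "Dz t0 x0 = ep *\<^sub>R D\<phi> x0" using m(1) by simp
  ultimately have "Q t0 x0 \<bullet> Hz t0 x0 + b t0 x0 \<bullet> Dz t0 x0 <= ep * (Q t0 x0 \<bullet> H\<phi> x0 + b t0 x0 \<bullet> D\<phi> x0)"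
   by (simp add: distrib_left)
  also have "... <= ep * a" using phi(4)[OF st0 t0(2), of x0] e by (intro mult_left_mono) auto
  finally have "zt t0 x0 <= N + ep * a" using ineq[OF st0 t0(2), of x0] by simp
  moreover have "ep * a < ep * (abs a + 1)" using e by (intro mult_strict_left_mono) auto
  ultimately show False using d0 by simp
 qed
 define c where "c = \<phi> x + (abs a + 1) * (t - s)"
 have c0: "c >= 0" unfolding c_def using phi(2)[of x] t by simp
 show ?thesis
 proof (rule field_le_epsilon)
  fix e :: real assume "e > 0"
  then have "y (e / (c + 1)) t x <= 0" using c0 t by (intro key) auto
  then have "z t x <= N * (t - s) + e / (c + 1) * c" by (simp add: y_def c_def)
  also have "e / (c + 1) * c <= e" using \<open>e > 0\<close> c0 by (simp add: field_simps)
  finally show "z t x <= N * (t - s) + e" by simp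
 qed
qed

section \<open>Functions of class C^{1,2} with explicit derivatives\<close>

definition cl12 :: "real set => (real => real ^ 'n::finite => real) => (real => real ^ 'n => real) =>
  (real => real ^ 'n => real ^ 'n) => (real => real ^ 'n => real ^ 'n ^ 'n) => bool" where
 "cl12 J h T D H \<longleftrightarrow>
  (ALL t:J. C2w (h t) (D t) (H t)) &
  (ALL t:J. ALL x. ((%r. h r x) has_real_derivative T t x) (at t)) &
  continuous_on (J \<times> UNIV) (%p. h (fst p) (snd p)) &
  continuous_on (J \<times> UNIV) (%p. T (fst p) (snd p)) &
  continuous_on (J \<times> UNIV) (%p. D (fst p) (snd p)) &
  continuous_on (J \<times> UNIV) (%p. H (fst p) (snd p))"

lemma cl12_subset: "cl12 J h T D H ==> J' \<subseteq> J ==> cl12 J' h T D H"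
 unfolding cl12_def by (auto intro: continuous_on_subset[of "J \<times> UNIV"])

lemma continuous_on_snd_UNIV: "continuous_on UNIV f ==> continuous_on A (%p. f (snd p))"
 using continuous_on_compose2[OF _ continuous_on_snd[OF continuous_on_id], of UNIV f A] by auto

lemma continuous_on_fst_Times: "continuous_on J f ==> continuous_on (J \<times> B) (%p. f (fst p))"
 using continuous_on_compose2[OF _ continuous_on_fst[OF continuous_on_id], of J f "J \<times> B"] by auto

lemma continuous_on_outer:
 assumes "continuous_on S f" "continuous_on S g"
 shows "continuous_on S (%p. outer (f p) (g p))"
 unfolding outer_def by (intro continuous_intros assms)

lemma cl12_time:
 assumes "!!t. t : J ==> (q has_real_derivative q' t) (at t)" "continuous_on J q'"
 shows "cl12 J (%t x. q t) (%t x. q' t) (%t x. 0) (%t x. 0)"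
proof -
 have "continuous_on J q" using assms(1) by (meson DERIV_isCont continuous_at_imp_continuous_on)
 then show ?thesis using assms by (auto simp: cl12_def C2w_const intro!: continuous_on_fst_Times)
qed

lemma cl12_space:
 assumes "C2w f D H" "continuous_on UNIV H"
 shows "cl12 J (%t. f) (%t x. 0) (%t. D) (%t. H)"
 using assms C2w_cont[OF assms(1)] C2w_contD[OF assms(1)]
 by (auto simp: cl12_def intro!: continuous_on_snd_UNIV)

lemma cl12_add:
 assumes "cl12 J f Tf Df Hf" "cl12 J g Tg Dg Hg"
 shows "cl12 J (%t x. f t x + g t x) (%t x. Tf t x + Tg t x) (%t x. Df t x + Dg t x) (%t x. Hf t x + Hg t x)"
 using assms unfolding cl12_def
 by (auto intro!: C2w_add DERIV_add continuous_intros)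

lemma cl12_mult:
 assumes "cl12 J f Tf Df Hf" "cl12 J g Tg Dg Hg"
 shows "cl12 J (%t x. f t x * g t x) (%t x. f t x * Tg t x + g t x * Tf t x)
  (%t x. f t x *\<^sub>R Dg t x + g t x *\<^sub>R Df t x)
  (%t x. f t x *\<^sub>R Hg t x + g t x *\<^sub>R Hf t x + outer (Df t x) (Dg t x) + outer (Dg t x) (Df t x))"
 using assms unfolding cl12_def
 by (auto intro!: C2w_mult continuous_intros continuous_on_outer derivative_eq_intros)

lemma cl12_compose:
 assumes h: "cl12 J h T D H"
  and S: "!!t x. t : J ==> h t x : S"
  and F: "!!y. y : S ==> (F has_real_derivative F1 y) (at y)"
   "!!y. y : S ==> (F1 has_real_derivative F2 y) (at y)" "continuous_on S F2"
 shows "cl12 J (%t x. F (h t x)) (%t x. F1 (h t x) * T t x)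
  (%t x. F1 (h t x) *\<^sub>R D t x) (%t x. F1 (h t x) *\<^sub>R H t x + F2 (h t x) *\<^sub>R outer (D t x) (D t x))"
proof -
 have c: "continuous_on S F" "continuous_on S F1"
  using F by (meson DERIV_isCont continuous_at_imp_continuous_on)+
 have hc: "continuous_on (J \<times> UNIV) (%p. h (fst p) (snd p))" using h by (simp add: cl12_def)
 have cc: "continuous_on (J \<times> UNIV) (%p. K (h (fst p) (snd p)))" if "continuous_on S K" for K :: "real => real"
  by (rule continuous_on_compose2[OF that hc]) (auto simp: S)
 show ?thesis using h unfolding cl12_def
  by (auto intro!: C2w_compose F S continuous_intros continuous_on_outer cc c DERIV_chain2[where f = F])
qed

lemma C12_cl12:
 assumes "u : C12 J"
 shows "cl12 J u (%t x. deriv (%r. u r x) t) (%t. gradient (u t)) (%t x. \<chi> i j. partial i (partial j (u t)) x)"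
 using assms unfolding C12_def cl12_def
 by (auto simp: C2_C2w case_prod_beta' gradient_def DERIV_deriv_iff_real_differentiable intro!: continuous_intros)

section \<open>Cutoff functions of class C^2\<close>

lemma DERIV_pospow:
 assumes "n >= 1"
 shows "((%y::real. (max 0 y) ^ Suc n) has_real_derivative real (Suc n) * (max 0 y) ^ n) (at y)"
proof -
 consider "y > 0" | "y < 0" | "y = 0" by linarith
 then show ?thesis
 proof cases
  case 1
  have "((%y::real. y ^ Suc n) has_real_derivative real (Suc n) * y ^ n) (at y)"
   using DERIV_pow[of "Suc n" y UNIV] by simp
  from has_field_derivative_transform_within_open[OF this, of "{0<..}" "%y. (max 0 y) ^ Suc n"] 1 show ?thesis by simp
 next
  case 2
  have "((%y::real. 0) has_real_derivative 0) (at y)" by simp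
  from has_field_derivative_transform_within_open[OF this, of "{..<0}" "%y. (max 0 y) ^ Suc n"] 2 assms show ?thesis
   by (simp add: max_absorb1 zero_power)
 next
  case 3
  have "((%h. (max 0 h) ^ Suc n / h) \<longlongrightarrow> 0) (at (0::real))"
  proof (rule Lim_null_comparison)
   show "\<forall>\<^sub>F h in at (0::real). norm ((max 0 h) ^ Suc n / h) <= abs h ^ n"
    using assms by (intro always_eventually allI) (auto simp: max_def)
   show "((%h. abs h ^ n) \<longlongrightarrow> 0) (at (0::real))" using assms by (auto intro!: tendsto_eq_intros)
  qed
  then show ?thesis using 3 assms by (simp add: DERIV_def zero_power)
 qed
qed

text \<open>A C^2 transition from 1 (up to y = 1) to 0 (from y = 2 on). The cube of a positive part
  is C^2, so nesting two such cubes gives the required smoothness with elementary derivatives;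
  \<open>bump1\<close> and \<open>bump2\<close> are its first and second derivative.\<close>

definition bump :: "real => real" where "bump y = (max 0 (1 - (max 0 (y - 1)) ^ 3)) ^ 3"
definition bump1 :: "real => real" where
 "bump1 y = - 9 * (max 0 (1 - (max 0 (y - 1)) ^ 3)) ^ 2 * (max 0 (y - 1)) ^ 2"
definition bump2 :: "real => real" where
 "bump2 y = 54 * max 0 (1 - (max 0 (y - 1)) ^ 3) * (max 0 (y - 1)) ^ 4
  - 18 * (max 0 (1 - (max 0 (y - 1)) ^ 3)) ^ 2 * max 0 (y - 1)"

lemma DERIV_pos3: "((%y::real. (max 0 y) ^ 3) has_real_derivative 3 * (max 0 y)^2) (at y)"
 and DERIV_pos2: "((%y::real. (max 0 y)^2) has_real_derivative 2 * max 0 y) (at y)"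
 using DERIV_pospow[of 2 y] DERIV_pospow[of 1 y] by (simp_all add: numeral_3_eq_3 numeral_2_eq_2)

lemma DERIV_bump: "(bump has_real_derivative bump1 y) (at y)" "(bump1 has_real_derivative bump2 y) (at y)"
proof -
 have s: "((%y. y - 1) has_real_derivative 1) (at y)" for y :: real
  by (auto intro!: derivative_eq_intros)
 have a: "((%y. (max 0 (y - 1)) ^ 3) has_real_derivative 3 * (max 0 (y - 1)) ^ 2) (at y)" for y :: real
  using DERIV_chain2[OF DERIV_pos3 s] by simp
 have a2: "((%y. (max 0 (y - 1)) ^ 2) has_real_derivative 2 * max 0 (y - 1)) (at y)" for y :: real
  using DERIV_chain2[OF DERIV_pos2 s] by simp
 have b: "((%y. 1 - (max 0 (y - 1)) ^ 3) has_real_derivative - (3 * (max 0 (y - 1)) ^ 2)) (at y)" for y :: real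
  by (rule derivative_eq_intros a refl | simp)+
 have c: "(bump has_real_derivative (3 * (max 0 (1 - (max 0 (y - 1)) ^ 3)) ^ 2) * - (3 * (max 0 (y - 1)) ^ 2)) (at y)"
  unfolding bump_def[abs_def] by (rule DERIV_chain2[OF DERIV_pos3 b])
 then show "(bump has_real_derivative bump1 y) (at y)" by (simp add: bump1_def mult_ac)
 have d: "((%y. (max 0 (1 - (max 0 (y - 1)) ^ 3)) ^ 2) has_real_derivative (2 * max 0 (1 - (max 0 (y - 1)) ^ 3)) * - (3 * (max 0 (y - 1)) ^ 2)) (at y)"
  by (rule DERIV_chain2[OF DERIV_pos2 b])
 show "(bump1 has_real_derivative bump2 y) (at y)"
  unfolding bump1_def[abs_def] mult.assoc
  by (rule DERIV_cong[OF DERIV_cmult[OF DERIV_mult[OF d a2]]])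
   (simp add: bump2_def algebra_simps power2_eq_square power4_eq_xxxx)
qed

lemma compact_bound:
 fixes f :: "'a::topological_space => real"
 assumes "compact S" "continuous_on S f"
 obtains B where "B > 0" "!!x. x : S ==> abs (f x) <= B"
proof -
 obtain B where B: "ALL y:f ` S. norm y <= B"
  using compact_imp_bounded[OF compact_continuous_image[OF assms(2,1)]] unfolding bounded_iff by blast
 show ?thesis
 proof (rule that[of "abs B + 1"])
  fix x assume "x : S"
  then have "abs (f x) <= B" using B by auto
  then show "abs (f x) <= abs B + 1" by simp
 qed simp
qed

lemma continuous_bump2: "continuous_on A bump2"
 unfolding bump2_def[abs_def] by (intro continuous_intros)

lemma bump_low: "y <= 1 ==> bump y = 1" "y <= 1 ==> bump1 y = 0" "y <= 1 ==> bump2 y = 0"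
 by (auto simp: bump_def bump1_def bump2_def max_def)

lemma bump_high: assumes "y >= 2" shows "bump y = 0" "bump1 y = 0" "bump2 y = 0"
proof -
 have "1 <= (y - 1) ^ 3" using assms by (intro one_le_power) simp
 then have "max 0 (1 - (max 0 (y - 1)) ^ 3) = 0" using assms by (simp add: max_absorb2 max_absorb1)
 then show "bump y = 0" "bump1 y = 0" "bump2 y = 0" by (simp_all add: bump_def bump1_def bump2_def)
qed

lemma bump_range: "0 <= bump y" "bump y <= 1" "bump1 y <= 0"
 by (auto simp: bump_def bump1_def intro!: power_le_one)

lemma bump_bounds: "EX B>0. ALL y. abs (bump1 y) <= B & abs (bump2 y) <= B"
proof -
 have "continuous_on {1..2::real} bump1" unfolding bump1_def[abs_def] by (intro continuous_intros)
 from compact_bound[OF compact_Icc this] obtain B1 where B1: "!!y. y : {1..2} ==> abs (bump1 y) <= B1"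
  by metis
 from compact_bound[OF compact_Icc continuous_bump2, of 1 2] obtain B2 where B2: "!!y. y : {1..2} ==> abs (bump2 y) <= B2"
  by metis
 show ?thesis
 proof (intro exI[of _ "abs B1 + abs B2 + 1"] conjI allI)
  fix y :: real
  consider "y <= 1" | "y >= 2" | "y : {1..2}" by force
  then show "abs (bump1 y) <= abs B1 + abs B2 + 1" "abs (bump2 y) <= abs B1 + abs B2 + 1"
   using B1[of y] B2[of y] by (cases; auto simp: bump_low bump_high)+
 qed auto
qed

text \<open>The squared norm keeps the function smooth at the origin. It equals 1 for norm at most n
  and vanishes already from sqrt 2 * n on; the rounder radius 2n is used throughout.\<close>

definition cut :: "real => real ^ 'n::finite => real" where "cut n x = bump ((norm x)^2 / n^2)"
definition Dcut :: "real => real ^ 'n::finite => real ^ 'n" where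
 "Dcut n x = (2 * bump1 ((norm x)^2 / n^2) / n^2) *\<^sub>R x"
definition Hcut :: "real => real ^ 'n::finite => real ^ 'n ^ 'n" where
 "Hcut n x = (2 * bump1 ((norm x)^2 / n^2) / n^2) *\<^sub>R mat 1 + (4 * bump2 ((norm x)^2 / n^2) / n^4) *\<^sub>R outer x x"

lemma outer_scaleR: "outer (c *\<^sub>R u) (d *\<^sub>R v) = (c * d) *\<^sub>R outer u v"
 by (simp add: outer_def vec_eq_iff)

lemma C2w_cut: "C2w (cut n) (Dcut n) (Hcut n :: real ^ 'n::finite => _)"
proof -
 have 1: "((%y. bump (y / n^2)) has_real_derivative bump1 (y / n^2) / n^2) (at y)" for y
  using DERIV_chain2[OF DERIV_bump(1) DERIV_cdivide[OF DERIV_ident]] by simp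
 have 2: "((%y. bump1 (y / n^2) / n^2) has_real_derivative bump2 (y / n^2) / n^2 / n^2) (at y)" for y
 proof -
  have "((%y. y / n^2) has_real_derivative 1 / n^2) (at y)" by (rule DERIV_cdivide[OF DERIV_ident])
  from DERIV_cdivide[OF DERIV_chain2[OF DERIV_bump(2) this], of "n^2"] show ?thesis by simp
 qed
 have 3: "n^4 = n^2 * n^2" by (simp add: power2_eq_square power4_eq_xxxx)
 have "cut n = (%x::real^'n. bump ((norm x)^2 / n^2))" "Dcut n = (%x::real^'n. (bump1 ((norm x)^2 / n^2) / n^2) *\<^sub>R 2 *\<^sub>R x)"
  "Hcut n = (%x::real^'n. (bump1 ((norm x)^2 / n^2) / n^2) *\<^sub>R 2 *\<^sub>R mat 1 + (bump2 ((norm x)^2 / n^2) / n^2 / n^2) *\<^sub>R outer (2 *\<^sub>R x) (2 *\<^sub>R x))"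
  unfolding cut_def Dcut_def Hcut_def outer_scaleR 3 fun_eq_iff scaleR_scaleR by (simp_all add: mult.commute)
 then show ?thesis using C2w_compose[OF C2w_quadratic 1 2] by (simp only:)
qed

lemma continuous_Hcut: "continuous_on A (Hcut n :: real ^ 'n::finite => _)"
proof -
 have 1: "continuous_on A (%x::real^'n. bump1 ((norm x)^2 / n^2))"
  unfolding bump1_def divide_inverse by (intro continuous_intros)
 have 2: "continuous_on A (%x::real^'n. bump2 ((norm x)^2 / n^2))"
  unfolding bump2_def divide_inverse by (intro continuous_intros)
 show ?thesis unfolding Hcut_def[abs_def] divide_inverse
  by (intro continuous_intros continuous_on_outer 1[unfolded divide_inverse] 2[unfolded divide_inverse])
qed

lemma cut_range: "0 <= cut n x" "cut n x <= 1"
 by (simp_all add: cut_def bump_range)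

lemma cut_one: "n > 0 ==> norm x <= n ==> cut n x = 1"
 by (auto simp: cut_def bump_low field_simps)

lemma cut_zero: "n > 0 ==> norm x >= 2 * n ==> cut n x = 0"
proof -
 assume a: "n > 0" "norm x >= 2 * n"
 then have "(2 * n)^2 <= (norm x)^2" by (intro power_mono) auto
 then have "4 * n^2 <= (norm x)^2" unfolding power_mult_distrib by simp
 then have "2 * n^2 <= (norm x)^2" using zero_le_power2[of n] by linarith
 then have "2 <= (norm x)^2 / n^2" using a by (simp add: field_simps)
 then show ?thesis by (simp add: cut_def bump_high)
qed

section \<open>Compactly supported test functions\<close>

lemma real_polynomial_C2w:
 "real_polynomial_function f ==> EX D H. C2w f D H & continuous_on UNIV (H :: real ^ 'n::finite => _)"
proof (induction rule: real_polynomial_function.induct)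
 case (linear f)
 then show ?case using C2w_linear[OF linear] continuous_on_const by blast
next
 case (const c)
 then show ?case using C2w_const[of c] continuous_on_const by blast
next
 case (add f g)
 then obtain Df Hf Dg Hg where "C2w f Df Hf" "continuous_on UNIV Hf" "C2w g Dg Hg" "continuous_on UNIV Hg" by auto
 then show ?case using C2w_add[of f Df Hf g Dg Hg] by (blast intro: continuous_on_add)
next
 case (mult f g)
 then obtain Df Hf Dg Hg where a: "C2w f Df Hf" "continuous_on UNIV Hf" "C2w g Dg Hg" "continuous_on UNIV Hg" by auto
 have "continuous_on UNIV (%x. f x *\<^sub>R Hg x + g x *\<^sub>R Hf x + outer (Df x) (Dg x) + outer (Dg x) (Df x))"
  by (intro continuous_intros continuous_on_outer a C2w_cont[OF a(1)] C2w_cont[OF a(3)] C2w_contD[OF a(1)] C2w_contD[OF a(3)])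
 then show ?case using C2w_mult[OF a(1,3)] by blast
qed

definition test :: "(real ^ 'n::finite => real) => (real ^ 'n => real ^ 'n) => (real ^ 'n => real ^ 'n ^ 'n) => bool" where
 "test p D H \<longleftrightarrow> C2w p D H & continuous_on UNIV H & (EX R. ALL x. norm x >= R --> p x = 0)"

text \<open>A Stone-Weierstrass polynomial q on the ball of radius 2n, multiplied by
  \<open>cut n\<close>. Since \<open>g\<close> vanishes beyond n, it equals \<open>cut n\<close>
  times itself, and the error is \<open>cut n\<close> times the error of q on that ball.\<close>

lemma Cc_approx:
 fixes g :: "real ^ 'n::finite => real"
 assumes g: "continuous_on UNIV g" "!!x. norm x >= R ==> g x = 0" and e: "ep > 0"
 shows "EX p D H. test p D H & (ALL x. abs (g x - p x) <= ep)"
proof -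
 define n where "n = max 1 R"
 have n: "n > 0" "R <= n" by (auto simp: n_def)
 obtain q where q: "real_polynomial_function q" "!!x. x : cball 0 (2 * n) ==> abs (g x - q x) < ep"
  using Stone_Weierstrass_real_polynomial_function[OF compact_cball continuous_on_subset[OF g(1) subset_UNIV] e] by metis
 obtain D H where D: "C2w q D H" "continuous_on UNIV H" using real_polynomial_C2w[OF q(1)] by auto
 have t: "test (%x. cut n x * q x) (%x. cut n x *\<^sub>R D x + q x *\<^sub>R Dcut n x)
  (%x. cut n x *\<^sub>R H x + q x *\<^sub>R Hcut n x + outer (Dcut n x) (D x) + outer (D x) (Dcut n x))"
  unfolding test_def
  by (intro conjI C2w_mult C2w_cut D exI[of _ "2 * n"] continuous_intros continuous_on_outer C2w_contD[OF D(1)] C2w_contD[OF C2w_cut]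
   C2w_cont[OF D(1)] C2w_cont[OF C2w_cut] continuous_Hcut) (simp add: cut_zero n)
 have "abs (g x - cut n x * q x) <= ep" for x
 proof -
  have "g x = cut n x * g x" using g(2)[of x] cut_one[OF n(1), of x] n(2) by (cases "norm x <= n") auto
  then have "abs (g x - cut n x * q x) = cut n x * abs (g x - q x)"
   by (metis abs_mult abs_of_nonneg cut_range(1) right_diff_distrib)
  also have "... <= ep"
  proof (cases "norm x <= 2 * n")
   case True
   then have "abs (g x - q x) < ep" using q(2)[of x] by simp
   then show ?thesis using cut_range[of n x] mult_mono[of "cut n x" 1 "abs (g x - q x)" ep] by simp
  next
   case False
   then have "cut n x = 0" using cut_zero[OF n(1), of x] by simp
   then show ?thesis using e by simp
  qed
  finally show ?thesis .
 qed
 then show ?thesis using t by blast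
qed

lemma C2w_zero_out:
 assumes C: "C2w f D H" and z: "!!x. norm x >= R ==> f x = 0" and x: "norm x > R"
 shows "D x = 0" "H x = 0"
proof -
 have op: "open {x::real^'n::finite. norm x > R}" by (intro open_Collect_less continuous_intros)
 have D0: "D y = 0" if "norm y > R" for y
 proof -
  have "(f has_derivative (%v. 0)) (at y)"
   by (rule has_derivative_transform_within_open[OF has_derivative_const[of 0] op]) (use that z in auto)
  from has_derivative_unique[OF this C2wD1[OF C]] have "D y \<bullet> D y = 0" by metis
  then show ?thesis by simp
 qed
 then show "D x = 0" using x by simp
 have "H x $ i $ j = 0" for i j
 proof -
  have "((%x. D x $ j) has_derivative (%v. 0)) (at x)"
   by (rule has_derivative_transform_within_open[OF has_derivative_const[of 0] op]) (use x D0 in auto)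
  from has_derivative_unique[OF this C2wD2[OF C, of j x]] have "(\<Sum>i'\<in>UNIV. H x $ i' $ j * axis i 1 $ i') = 0" by metis
  then show ?thesis by (simp add: sum_mult_axis)
 qed
 then show "H x = 0" by (simp add: vec_eq_iff)
qed

lemma Cc_Cb:
 fixes g :: "real ^ 'n::finite => real"
 assumes g: "continuous_on UNIV g" "!!x. norm x >= R ==> g x = 0"
 shows "g : Cb"
proof -
 obtain B where B: "!!x. x : cball 0 R ==> abs (g x) <= B"
  using compact_bound[OF compact_cball continuous_on_subset[OF g(1) subset_UNIV]] by metis
 have "abs (g x) <= abs B" for x using B[of x] g(2)[of x] by (cases "norm x <= R") auto
 then have "bounded (range g)" unfolding bounded_iff by auto
 then show ?thesis using g by (simp add: Cb_def)
qed

lemma test_Cb: "test p D H ==> p : Cb"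
 unfolding test_def using Cc_Cb C2w_cont by blast

lemma Cb_integrable:
 fixes f :: "real ^ 'n::finite => real"
 assumes "f : Cb" "finite_measure m" "sets m = sets borel"
 shows "integrable m f"
proof -
 interpret finite_measure m by fact
 obtain B where "!!x. abs (f x) <= B" using assms(1) by (auto simp: Cb_def bounded_iff)
 moreover have "f : borel_measurable m"
  using assms(1) borel_measurable_continuous_onI[of f] measurable_cong_sets[OF assms(3) refl] by (auto simp: Cb_def)
 ultimately show ?thesis by (intro integrable_const_bound[of _ B]) auto
qed

lemma CbI: "continuous_on UNIV f ==> (!!x. abs (f x) <= B) ==> f : Cb"
 unfolding Cb_def bounded_iff by auto

lemma CbE: assumes "f : Cb" obtains B where "continuous_on UNIV f" "B > 0" "!!x. abs (f x) <= B"
proof -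
 obtain B where "!!x. abs (f x) <= B" using assms by (auto simp: Cb_def bounded_iff)
 then have "!!x. abs (f x) <= abs B + 1" by (meson abs_ge_self add_increasing2 order_trans zero_le_one)
 then show ?thesis using assms by (intro that[of "abs B + 1"]) (auto simp: Cb_def)
qed

section \<open>The evolution operator and its transition probabilities\<close>

lemma Cb_measurable: "f : Cb ==> f : Bmeas"
 by (auto simp: Cb_def borel_measurable_continuous_onI)

lemma cl12_compact_bound:
 assumes "compact C" "continuous_on (C \<times> UNIV) (%p. g (fst p) (snd p))"
  "!!r x. r : C ==> norm x >= R ==> g r x = (0::real)"
 obtains B where "B > 0" "!!r x. r : C ==> abs (g r (x::real^'n::finite)) <= B"
proof -
 obtain B where B: "B > 0" "!!p. p : C \<times> cball 0 R ==> abs (g (fst p) (snd p)) <= B"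
  using compact_bound[OF compact_Times[OF assms(1) compact_cball] continuous_on_subset[OF assms(2)]]
  by (metis Sigma_mono subset_UNIV subset_refl)
 have "abs (g r x) <= B" if "r : C" for r x
  using B(2)[of "(r, x)"] assms(3)[OF that, of x] B(1) that by (cases "norm x <= R") auto
 then show ?thesis using B(1) that by blast
qed

lemma cl12_zero_out:
 assumes h: "cl12 U h T D H" and "open U" and z: "!!r x. r : U ==> norm x >= R ==> h r x = 0"
  and "r : U" "norm x > R"
 shows "T r x = 0" "D r x = 0" "H r x = 0"
proof -
 have "((%r. h r x) has_real_derivative T r x) (at r)" using h assms by (auto simp: cl12_def)
 moreover have "((%r. h r x) has_real_derivative 0) (at r)"
  by (rule has_field_derivative_transform_within_open[OF DERIV_const[of 0] \<open>open U\<close> \<open>r : U\<close>]) (use assms z in auto)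
 ultimately show "T r x = 0" by (rule DERIV_unique)
 show "D r x = 0" "H r x = 0" using C2w_zero_out[of "h r" "D r" "H r" R x] assms by (auto simp: cl12_def)
qed

text \<open>The kernels \<open>P\<close> represent \<open>G\<close> on bounded continuous functions,
  including t = s, where they are Dirac measures by the initial condition. Positivity and
  contraction of \<open>G\<close> are read off from them.\<close>

locale kolm =
 fixes I :: "real set"
  and Q :: "real => real ^ 'n::finite => real ^ 'n ^ 'n"
  and b :: "real => real ^ 'n => real ^ 'n"
  and \<phi> :: "real ^ 'n => real" and D\<phi> H\<phi>
  and a :: real
  and G :: "real => real => (real ^ 'n => real) => real ^ 'n => real"
  and P :: "real => real => real ^ 'n => (real ^ 'n) measure"
 assumes I_open: "open I" and I_up: "!!s t. s : I ==> s <= t ==> t : I"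
  and Qc: "continuous_on (I \<times> UNIV) (%p. Q (fst p) (snd p))"
  and bc: "continuous_on (I \<times> UNIV) (%p. b (fst p) (snd p))"
  and Qpsd: "!!t x. t : I ==> psd (Q t x)"
  and phi: "C2w \<phi> D\<phi> H\<phi>" "!!x. \<phi> x >= 0" "filterlim \<phi> at_top at_infinity"
  and Lyap: "!!t x. t : I ==> Q t x \<bullet> H\<phi> x + b t x \<bullet> D\<phi> x <= a"
  and G: "evolution_operator I Q b G"
  and P: "!!s t x. s : I ==> s <= t ==> prob_space (P t s x)"
   "!!s t x. s : I ==> s <= t ==> sets (P t s x) = sets borel"
   "!!s t x f. s : I ==> s <= t ==> f : Cb ==> G t s f x = lint (P t s x) f"
begin

abbreviation (input) bst :: "(real \<times> (real^'n)) measure" where "bst \<equiv> borel"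

definition AA :: "real => (real ^ 'n => real ^ 'n) => (real ^ 'n => real ^ 'n ^ 'n) => real ^ 'n => real" where
 "AA t D H x = Q t x \<bullet> H x + b t x \<bullet> D x"

lemma AA_add: "AA t (%x. D x + D' x) (%x. H x + H' x) x = AA t D H x + AA t D' H' x"
 and AA_cmult: "AA t (%x. c *\<^sub>R D x) (%x. c *\<^sub>R H x) x = c * AA t D H x"
 by (simp_all add: AA_def inner_add_right inner_diff_right algebra_simps)

lemma AA_cont:
 assumes "U \<subseteq> I" "continuous_on (U \<times> UNIV) (%p. D (fst p) (snd p))" "continuous_on (U \<times> UNIV) (%p. H (fst p) (snd p))"
 shows "continuous_on (U \<times> UNIV) (%p. AA (fst p) (D (fst p)) (H (fst p)) (snd p))"
proof -
 have "U \<times> UNIV \<subseteq> I \<times> UNIV" using assms(1) by auto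
 then show ?thesis unfolding AA_def
  by (intro continuous_intros assms continuous_on_subset[OF Qc] continuous_on_subset[OF bc])
qed

lemma G_bcs: "s : I ==> f : Cb ==> bounded_classical_solution Q b s f (%t. G t s f)"
 using G by (auto simp: evolution_operator_def)

lemma G_cont: "s : I ==> f : Cb ==> continuous_on ({s..} \<times> UNIV) (%p. G (fst p) s f (snd p))"
 using G_bcs[of s f] by (simp add: bounded_classical_solution_def case_prod_beta')

lemma G_init: "s : I ==> f : Cb ==> G s s f = f"
 using G_bcs[of s f] by (auto simp: bounded_classical_solution_def)

lemma G_cont1: "s : I ==> s <= t ==> f : Cb ==> continuous_on UNIV (G t s f)"
 using continuous_on_compose2[OF G_cont[of s f] continuous_on_Pair[OF continuous_on_const[of UNIV t] continuous_on_id]] by force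

lemma G_bound: "s : I ==> s <= t ==> f : Cb ==> (!!x. c <= f x & f x <= B) ==> c <= G t s f x & G t s f x <= B"
proof -
 assume a: "s : I" "s <= t" "f : Cb" "!!x. c <= f x & f x <= B"
 interpret prob_space "P t s x" by (rule P(1)[OF a(1,2)])
 have i: "integrable (P t s x) f" using Cb_integrable[OF a(3) finite_measure_axioms P(2)[OF a(1,2)]] .
 show ?thesis unfolding P(3)[OF a(1-3)] using integral_ge_const[OF i, of c] integral_le_const[OF i, of B] a(4) by auto
qed

lemma G_Cb: assumes "s : I" "s <= t" "f : Cb" shows "G t s f : Cb"
proof -
 obtain B where B: "!!x. abs (f x) <= B" using assms(3) by (rule CbE) blast
 have "- B <= f x & f x <= B" for x using B[of x] by (auto simp: abs_le_iff)
 from G_bound[OF assms this] have "abs (G t s f x) <= B" for x by (smt (verit))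
 then show ?thesis by (rule CbI[OF G_cont1[OF assms]])
qed

lemma G_cl12: "s : I ==> f : Cb ==> EX T D H. cl12 {s<..} (%t. G t s f) T D H & (ALL t>s. ALL x. T t x = AA t (D t) (H t) x)
 & D = (%t. gradient (G t s f))"
proof -
 assume a: "s : I" "f : Cb"
 let ?u = "%t. G t s f"
 let ?H = "%t x. \<chi> i j. partial i (partial j (?u t)) x"
 have "?u : C12 {s<..}" using G_bcs[OF a] by (simp add: bounded_classical_solution_def)
 note c = C12_cl12[OF this]
 have "deriv (%r. ?u r x) t = AA t (gradient (?u t)) (?H t) x" if "t > s" for t x
 proof -
  have "deriv (%r. ?u r x) t = elliptic_op Q b t (?u t) x"
   using G_bcs[OF a] that by (simp add: bounded_classical_solution_def)
  also have "... = AA t (gradient (?u t)) (?H t) x"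
   using elliptic_op_C2w[of "?u t" "gradient (?u t)" "?H t" Q b t x] c that by (simp add: cl12_def AA_def)
  finally show ?thesis .
 qed
 then show ?thesis using c by blast
qed

text \<open>The difference between \<open>h\<close> and the solution started from \<open>h r\<close>
  has zero initial value and a source bounded by N, and the maximum principle applies to it. This
  replaces the variation of constants formula, which would require differentiating \<open>G\<close>
  in its initial time.\<close>

lemma duhamel_le:
 assumes r: "r : I" and hc: "continuous_on ({r..T} \<times> UNIV) (%p. h (fst p) (snd p))"
  and hB: "!!t x. r <= t ==> t <= T ==> abs (h t x) <= B"
  and h: "cl12 {r<..T} h Th Dh Hh"
  and N: "!!t x. r < t ==> t <= T ==> abs (Th t x - AA t (Dh t) (Hh t) x) <= N"
  and t: "r <= t" "t <= T"
 shows "abs (h t x - G t r (h r) x) <= N * (t - r)"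
proof -
 have rT: "r <= T" using t by simp
 have hr: "h r : Cb"
 proof (rule CbI)
  show "continuous_on UNIV (h r)"
   using continuous_on_compose2[OF hc continuous_on_Pair[OF continuous_on_const[of UNIV r] continuous_on_id]] rT by force
  show "abs (h r x) <= B" for x using hB rT by simp
 qed
 obtain Tu Du Hu where u: "cl12 {r<..} (%t. G t r (h r)) Tu Du Hu" "!!t x. t > r ==> Tu t x = AA t (Du t) (Hu t) x"
  using G_cl12[OF r hr] by blast
 have uc: "continuous_on ({r..T} \<times> UNIV) (%p. G (fst p) r (h r) (snd p))"
  by (rule continuous_on_subset[OF G_cont[OF r hr]]) auto
 have uB: "abs (G t r (h r) x) <= B" if "r <= t" "t <= T" for t x
 proof -
  have "- B <= h r y & h r y <= B" for y using hB[of r y] rT by (simp add: abs_le_iff)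
  from G_bound[OF r that(1) hr this] show ?thesis by (smt (verit))
 qed
 have tI: "t : I" if "r < t" for t using I_up[OF r, of t] that by simp
 \<comment> \<open>The factor c is 1 or -1 and gives the upper and the lower bound together.\<close>
 have main: "c * (h t x - G t r (h r) x) <= N * (t - r)" if c: "abs c = 1" for c
 proof (rule max_principle[where z = "%t x. c * (h t x - G t r (h r) x)" and zt = "%t x. c * (Th t x - Tu t x)"
   and Dz = "%t x. c *\<^sub>R (Dh t x - Du t x)" and Hz = "%t x. c *\<^sub>R (Hh t x - Hu t x)" and Q = Q and b = b and B = "2 * B",
   OF rT _ phi])
  fix t' x' assume t': "r < t'" "t' <= T"
  show "psd (Q t' x')" using Qpsd tI t' by simp
  show "Q t' x' \<bullet> H\<phi> x' + b t' x' \<bullet> D\<phi> x' <= a" using Lyap tI t' by simp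
  show "((%r'. c * (h r' x' - G r' r (h r) x')) has_real_derivative c * (Th t' x' - Tu t' x')) (at t')"
   using h u(1) t' by (intro DERIV_cmult DERIV_diff) (auto simp: cl12_def)
  have "c * (Th t' x' - Tu t' x') - (Q t' x' \<bullet> c *\<^sub>R (Hh t' x' - Hu t' x') + b t' x' \<bullet> c *\<^sub>R (Dh t' x' - Du t' x'))
   = c * (Th t' x' - AA t' (Dh t') (Hh t') x')"
   unfolding u(2)[OF t'(1)] AA_def by (simp add: inner_diff_right algebra_simps)
  also have "... <= abs (c * (Th t' x' - AA t' (Dh t') (Hh t') x'))" by (rule abs_ge_self)
  also have "... <= N" using N[OF t'] c by (simp add: abs_mult)
  finally show "c * (Th t' x' - Tu t' x') - (Q t' x' \<bullet> c *\<^sub>R (Hh t' x' - Hu t' x') + b t' x' \<bullet> c *\<^sub>R (Dh t' x' - Du t' x')) <= N" .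
 next
  fix t' assume t': "r < t'" "t' <= T"
  show "C2w (%x. c * (h t' x - G t' r (h r) x)) (%x. c *\<^sub>R (Dh t' x - Du t' x)) (%x. c *\<^sub>R (Hh t' x - Hu t' x))"
   using h u(1) t' by (intro C2w_cmult C2w_diff) (auto simp: cl12_def)
 next
  show "continuous_on ({r..T} \<times> UNIV) (%(t, x). c * (h t x - G t r (h r) x))"
   unfolding case_prod_beta' by (intro continuous_intros hc uc)
  fix t' x' assume t': "r <= t'" "t' <= T"
  have "c * (h t' x' - G t' r (h r) x') <= abs (c * (h t' x' - G t' r (h r) x'))" by (rule abs_ge_self)
  also have "... <= 2 * B" using hB[OF t', of x'] uB[OF t', of x'] c by (simp add: abs_mult)
  finally show "c * (h t' x' - G t' r (h r) x') <= 2 * B" .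
 qed (use G_init[OF r hr] t in auto)
 from main[of 1] main[of "-1"] show ?thesis by simp
qed

text \<open>Seen from time r on, the solution started at s is a bounded solution with initial value
  \<open>G r s f\<close>, so \<open>duhamel_le\<close> with vanishing source identifies it.\<close>

lemma evolution_law:
 assumes "s : I" "s <= r" "r <= t" "f : Cb"
 shows "G t r (G r s f) = G t s f"
proof
 fix x
 have rI: "r : I" using I_up assms by blast
 obtain Tu Du Hu where u: "cl12 {s<..} (%t. G t s f) Tu Du Hu" "!!t x. t > s ==> Tu t x = AA t (Du t) (Hu t) x"
  using G_cl12[OF assms(1,4)] by blast
 obtain B where B: "!!x. abs (f x) <= B" using assms(4) by (rule CbE) blast
 have B2: "- B <= f x & f x <= B" for x using B[of x] by (auto simp: abs_le_iff)
 have "abs (G t s f x - G t r (G r s f) x) <= 0 * (t - r)"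
 proof (rule duhamel_le[where h = "%t. G t s f" and T = t and B = B and Th = Tu and Dh = Du and Hh = Hu, OF rI])
  show "continuous_on ({r..t} \<times> UNIV) (%p. G (fst p) s f (snd p))"
   by (rule continuous_on_subset[OF G_cont[OF assms(1,4)]]) (use assms in auto)
  show "abs (G t' s f x') <= B" if "r <= t'" for t' x'
   using G_bound[OF assms(1) _ assms(4) B2, of t' x'] that assms by (auto simp: abs_le_iff)
  show "cl12 {r<..t} (%t. G t s f) Tu Du Hu" by (rule cl12_subset[OF u(1)]) (use assms in auto)
  show "abs (Tu t' x' - AA t' (Du t') (Hu t') x') <= 0" if "r < t'" for t' x' using u(2)[of t' x'] that assms by simp
 qed (use assms in auto)
 then show "G t r (G r s f) x = G t s f x" by simp
qed

text \<open>Families of measures transported backwards by the adjoint of \<open>G\<close>. The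
  evolution system \<mu> is one example; for fixed t and x the transition probabilities r ->
  \<open>P t r x\<close> on r <= t are another (\<open>flow_P\<close>). Whatever is proved for flows
  with uniform constants holds for both.\<close>

definition flow :: "real set => (real => (real ^ 'n) measure) => bool" where
 "flow J m \<longleftrightarrow> J \<subseteq> I & (ALL r:J. prob_space (m r) & sets (m r) = sets borel) &
  (ALL r:J. ALL t:J. r < t --> (ALL f:Cb. lint (m t) (G t r f) = lint (m r) f))"

lemma flow_subset: "flow J m ==> J' \<subseteq> J ==> flow J' m"
 unfolding flow_def by blast

lemma flow_P: "flow {r:I. r <= t} (%r. P t r x)"
 unfolding flow_def
proof (intro conjI ballI impI)
 fix r r' and f :: "real^'n => real" assume r: "r : {r : I. r <= t}" "r' : {r : I. r <= t}" "r < r'" "f : Cb"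
 then show "lint (P t r' x) (G r' r f) = lint (P t r x) f"
  using P(3)[of r' t "G r' r f" x] P(3)[of r t f x] G_Cb[of r r' f] evolution_law[of r r' t f] by auto
qed (use P in auto)

lemma flow_int:
 assumes "flow J m" "r : J" "f : Cb"
 shows "integrable (m r) f" "prob_space (m r)" "sets (m r) = sets borel"
 using assms Cb_integrable[of f "m r"] by (auto simp: flow_def prob_space.axioms)

lemma flow_eq: "flow J m ==> r : J ==> t : J ==> r <= t ==> f : Cb ==> (lint (m t) (G t r f)) = lint (m r) f"
 using G_init[of r f] by (cases "r = t") (auto simp: flow_def)

lemma flow_bound:
 assumes "flow J m" "r : J" "f : Cb" "!!x. abs (f x) <= B"
 shows "abs (lint (m r) f) <= B"
proof -
 interpret prob_space "m r" using flow_int[OF assms(1-3)] by simp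
 note i = flow_int(1)[OF assms(1-3)]
 have "- B <= f x & f x <= B" for x using assms(4)[of x] by (auto simp: abs_le_iff)
 then show ?thesis using integral_ge_const[OF i, of "-B"] integral_le_const[OF i, of B] by (auto simp: abs_le_iff)
qed

text \<open>Near a time r0, a time-dependent compactly supported function is replaced by one test
  function p, to which the operator can be applied with a bounded result. Uniform continuity of
  \<open>g\<close> on a compact block controls the change in time.\<close>

lemma unif_approx:
 fixes g :: "real => real ^ 'n => real"
 assumes U: "open U" "U \<subseteq> I" and g: "continuous_on (U \<times> UNIV) (%p. g (fst p) (snd p))"
  and z: "!!r x. r : U ==> norm x >= R ==> g r x = 0" and r0: "r0 : U" and e: "ep > 0"
 obtains p D H de M where "test p D H" "de > 0" "cball r0 de \<subseteq> U" "M > 0"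
  "!!r x. r : cball r0 de ==> abs (g r x - p x) <= ep" "!!r x. r : cball r0 de ==> abs (AA r D H x) <= M"
proof -
 obtain de1 where d1: "de1 > 0" "cball r0 de1 \<subseteq> U" using U r0 by (meson open_contains_cball)
 have gr0: "continuous_on UNIV (g r0)"
  using continuous_on_compose2[OF g continuous_on_Pair[OF continuous_on_const[of UNIV r0] continuous_on_id]] r0 by force
 obtain p D H where p: "test p D H" "!!x. abs (g r0 x - p x) <= ep / 2"
  using Cc_approx[of "g r0" R "ep/2"] gr0 z[OF r0] e by auto
 define C where "C = cball r0 de1 \<times> cball (0::real^'n) R"
 have "compact C" by (simp add: C_def compact_Times)
 have "C \<subseteq> U \<times> UNIV" using d1 by (auto simp: C_def)
 have "uniformly_continuous_on C (%p. g (fst p) (snd p))"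
  by (rule compact_uniformly_continuous[OF continuous_on_subset[OF g \<open>C \<subseteq> _\<close>] \<open>compact C\<close>])
 then obtain d where d: "d > 0" "!!q q'. q : C ==> q' : C ==> dist q' q < d ==> dist (g (fst q') (snd q')) (g (fst q) (snd q)) < ep / 2"
  unfolding uniformly_continuous_on_def using e by (metis half_gt_zero)
 define de where "de = min de1 (d/2)"
 have dd: "de > 0" "de <= de1" "de < d" using d1 d by (auto simp: de_def)
 have sub: "cball r0 de \<subseteq> cball r0 de1" using dd by auto
 have close: "abs (g r x - p x) <= ep" if "r : cball r0 de" for r x
 proof -
  have "abs (g r x - g r0 x) <= ep / 2"
  proof (cases "norm x <= R")
   case True
   then have "(r, x) : C" "(r0, x) : C" using that sub d1 by (auto simp: C_def)
   moreover have "dist (r, x) (r0, x) < d" using that dd by (simp add: dist_Pair_Pair dist_commute)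
   ultimately show ?thesis using d(2)[of "(r0, x)" "(r, x)"] by (simp add: dist_real_def)
  next
   case False
   moreover have "r : U" using that sub d1 by auto
   ultimately show ?thesis using z[of r x] z[OF r0, of x] e by simp
  qed
  then show ?thesis using p(2)[of x] by linarith
 qed
 obtain R' where R': "!!x. norm x >= R' ==> p x = 0" "C2w p D H" "continuous_on UNIV H" using p(1) by (auto simp: test_def)
 have c: "continuous_on (cball r0 de \<times> UNIV) (%p. AA (fst p) D H (snd p))"
  by (rule AA_cont) (use sub d1 U R' in "auto intro!: continuous_on_snd_UNIV C2w_contD")
 have "AA r D H x = 0" if "norm x >= R' + 1" for r x
  using C2w_zero_out[OF R'(2,1), of R' x] that by (simp add: AA_def)
 from cl12_compact_bound[OF compact_cball c this] obtain M where "M > 0" "!!r x. r : cball r0 de ==> abs (AA r D H x) <= M" by metis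
 with that[OF p(1) dd(1) _ this(1) close this(2)] sub d1 show ?thesis by blast
qed

lemma test_step:
 assumes p: "test p D H" and r: "r : I" "r <= t" and M: "!!r' x. r <= r' ==> r' <= t ==> abs (AA r' D H x) <= M"
 shows "abs (p x - G t r p x) <= M * (t - r)"
proof -
 obtain B where B: "continuous_on UNIV p" "!!x. abs (p x) <= B" using test_Cb[OF p] by (rule CbE) blast
 show ?thesis
 proof (rule duhamel_le[where h = "%t. p" and Th = "%t x. 0" and Dh = "%t. D" and Hh = "%t. H" and T = t and B = B])
  show "continuous_on ({r..t} \<times> UNIV) (%q. p (snd q))" by (rule continuous_on_snd_UNIV[OF B(1)])
  show "cl12 {r<..t} (%t. p) (%t x. 0) (%t. D) (%t. H)" using p by (intro cl12_space) (auto simp: test_def)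
 qed (use B M r in auto)
qed

text \<open>Both estimates move the earlier measure to the later one through \<open>flow_eq\<close>,
  so only values at time t are compared. A test function p changes by at most M(t-r) under
  \<open>G t r\<close>; this gives the modulus of continuity. The second estimate is the first-order
  expansion of the integral of \<open>h\<close>, where \<open>g\<close> is the image of
  \<open>h\<close> under the parabolic operator; the derivative appears at the right endpoint
  t.\<close>

lemma flow_cont_est:
 fixes g :: "real => real ^ 'n => real"
 assumes fl: "flow J m" and J: "is_interval J" and U: "open U" "U \<subseteq> I" "J \<subseteq> U"
  and g: "continuous_on (U \<times> UNIV) (%p. g (fst p) (snd p))"
  and z: "!!r x. r : U ==> norm x >= R ==> g r x = 0" and r0: "r0 : J" and e: "ep > 0"
 obtains de M where "de > 0" "M > 0" "cball r0 de \<subseteq> U"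
  "!!r t. r : J \<inter> cball r0 de ==> t : J \<inter> cball r0 de ==> r <= t ==>
   abs (lint (m t) (g t) - lint (m r) (g r)) <= 2 * ep + (t - r) * M"
  "!!r t h T D H. r : J \<inter> cball r0 de ==> t : J \<inter> cball r0 de ==> r <= t ==> cl12 U h T D H ==>
   (!!r x. r : U ==> norm x >= R ==> h r x = 0) ==>
   (!!r x. r : U ==> g r x = T r x - AA r (D r) (H r) x) ==>
   abs (lint (m t) (h t) - lint (m r) (h r) - (t - r) * lint (m t) (g t)) <= (t - r) * (2 * ep + (t - r) * M)"
proof -
 obtain p D H de M where p: "test p D H" "de > 0" "cball r0 de \<subseteq> U" "M > 0"
  "!!r x. r : cball r0 de ==> abs (g r x - p x) <= ep" "!!r x. r : cball r0 de ==> abs (AA r D H x) <= M"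
 proof (rule unif_approx[OF U(1,2) g _ _ e])
  show "r0 : U" using r0 U(3) by auto
  show "!!r x. r : U ==> norm x >= R ==> g r x = 0" by (rule z)
 qed blast
 have pCb: "p : Cb" using test_Cb[OF p(1)] .
 have gCb: "g r : Cb" if "r : U" for r
 proof (rule Cc_Cb)
  show "continuous_on UNIV (g r)"
   using continuous_on_compose2[OF g continuous_on_Pair[OF continuous_on_const[of UNIV r] continuous_on_id]] that by force
 qed (use z that in auto)
 have gp: "abs (lint (m r) (g r) - lint (m r) p) <= ep" if "r : J \<inter> cball r0 de" for r
 proof -
  have rU: "r : U" "r : J" using that U by auto
  have cb: "(%x. g r x - p x) : Cb" using gCb[OF rU(1)] pCb p(5) that
   by (intro CbI[of _ ep]) (auto simp: Cb_def intro!: continuous_intros)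
  have "lint (m r) (g r) - lint (m r) p = lint (m r) (%x. g r x - p x)"
   using flow_int(1)[OF fl rU(2)] gCb[OF rU(1)] pCb by simp
  then show ?thesis using flow_bound[OF fl rU(2) cb, of ep] p(5) that by auto
 qed
 have btw: "r' : cball r0 de" if "r : cball r0 de" "t : cball r0 de" "r <= r'" "r' <= t" for r r' t
  using that by (auto simp: dist_real_def)
 show ?thesis
 proof (rule that[OF p(2,4,3)])
  fix r t assume r: "r : J \<inter> cball r0 de" "t : J \<inter> cball r0 de" "r <= t"
  have rI: "r : I" "r : J" "t : J" using r U by auto
  have st: "abs (p x - G t r p x) <= M * (t - r)" for x
  proof (rule test_step[OF p(1) rI(1) r(3)])
   fix r' x assume "r <= r'" "r' <= t"
   then show "abs (AA r' D H x) <= M" using p(6)[OF btw[of r t r']] r by blast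
  qed
  have cb: "(%x. p x - G t r p x) : Cb"
   using pCb G_Cb[OF rI(1) r(3) pCb] st by (intro CbI[of _ "M * (t - r)"]) (auto simp: Cb_def intro!: continuous_intros)
  have "lint (m t) p - lint (m r) p = lint (m t) (%x. p x - G t r p x)"
   using flow_eq[OF fl rI(2,3) r(3) pCb] flow_int(1)[OF fl rI(3)] pCb G_Cb[OF rI(1) r(3) pCb] by simp
  then have "abs (lint (m t) p - lint (m r) p) <= M * (t - r)" using flow_bound[OF fl rI(3) cb st] by simp
  then show "abs (lint (m t) (g t) - lint (m r) (g r)) <= 2 * ep + (t - r) * M"
   using gp[OF r(1)] gp[OF r(2)] by (simp add: mult.commute)
 next
  fix r t h Th Dh Hh assume r: "r : J \<inter> cball r0 de" "t : J \<inter> cball r0 de" "r <= t" and h: "cl12 U h Th Dh Hh"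
   and hz: "!!r x. r : U ==> norm x >= R ==> h r x = 0"
   and gh: "!!r x. r : U ==> g r x = Th r x - AA r (Dh r) (Hh r) x"
  have rI: "r : I" "r : J" "t : J" "r : U" "t : U" using r U by auto
  have sub: "{r..t} \<subseteq> U"
  proof
   fix r' assume "r' : {r..t}"
   then have "r' : cball r0 de" by (intro btw[of r t r']) (use r in auto)
   then show "r' : U" using p(3) by blast
  qed
  have hCb: "h r : Cb" if "r : U" for r
   using that h hz by (intro Cc_Cb[of _ R] C2w_cont) (auto simp: cl12_def)
  \<comment> \<open>The image of h' under the parabolic operator is g - p + (ta - r) A p, hence at
    most ep + (t - r) M in modulus, and h' agrees with h at time r. So \<open>duhamel_le\<close>
    applies with a small source.\<close>
  define h' where "h' ta x = h ta x - (ta - r) * p x" for ta x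
  have C2p: "C2w p D H" and Hc: "continuous_on UNIV H" using p(1) by (auto simp: test_def)
  have t1: "cl12 U (%ta x. r - ta) (%ta x. -1) (%ta x. 0) (%ta x. 0)"
   by (rule cl12_time) (auto intro!: derivative_eq_intros)
  have cl: "cl12 U h' (%ta x. Th ta x + ((r - ta) * 0 + p x * - 1))
    (%ta x. Dh ta x + ((r - ta) *\<^sub>R D x + p x *\<^sub>R 0))
    (%ta x. Hh ta x + ((r - ta) *\<^sub>R H x + p x *\<^sub>R 0 + outer 0 (D x) + outer (D x) 0))"
  proof -
   have "h' = (%ta x. h ta x + (r - ta) * p x)" by (auto simp: h'_def fun_eq_iff algebra_simps)
   then show ?thesis using cl12_add[OF h cl12_mult[OF t1 cl12_space[OF C2p Hc]]] by simp
  qed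
  have o0: "outer 0 v = 0" "outer v 0 = 0" for v :: "real^'n" by (simp_all add: outer_def vec_eq_iff)
  obtain B where B: "!!ta x. ta : {r..t} ==> abs (h ta x) <= B"
  proof (rule cl12_compact_bound[OF compact_Icc])
   have "continuous_on (U \<times> UNIV) (%p. h (fst p) (snd p))" using h by (simp add: cl12_def)
   then show "continuous_on ({r..t} \<times> UNIV) (%p. h (fst p) (snd p))"
    by (rule continuous_on_subset) (use sub in auto)
   show "!!r' x. r' : {r..t} ==> norm x >= R ==> h r' x = 0" using hz sub by blast
  qed blast
  obtain B' where B': "!!x. abs (p x) <= B'" using pCb by (rule CbE) blast
  have "abs (h' t x - G t r (h' r) x) <= (ep + (t - r) * M) * (t - r)" for x
  proof (rule duhamel_le[OF rI(1), where h = h' and T = t and B = "B + (t - r) * B'", OF _ _ cl12_subset[OF cl]])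
   show "{r<..t} \<subseteq> U" using sub by auto
   show "continuous_on ({r..t} \<times> UNIV) (%p. h' (fst p) (snd p))"
    using cl sub by (auto simp: cl12_def intro: continuous_on_subset[of "U \<times> UNIV"])
   show "abs (h' ta x) <= B + (t - r) * B'" if "r <= ta" "ta <= t" for ta x
   proof -
    have "abs ((ta - r) * p x) <= (t - r) * B'" unfolding abs_mult using that B'[of x] by (intro mult_mono) auto
    then show ?thesis using B[of ta x] that by (auto simp: h'_def)
   qed
   fix ta x assume ta: "r < ta" "ta <= t"
   have taU: "ta : U" "ta : cball r0 de" using sub ta btw[of r t ta] r by auto
   have "AA ta (%x. Dh ta x + ((r - ta) *\<^sub>R D x + p x *\<^sub>R 0)) (%x. Hh ta x + ((r - ta) *\<^sub>R H x + p x *\<^sub>R 0 + outer 0 (D x) + outer (D x) 0)) x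
    = AA ta (Dh ta) (Hh ta) x + (r - ta) * AA ta D H x"
    by (simp add: o0 AA_add AA_cmult)
   then have "Th ta x + ((r - ta) * 0 + p x * - 1) - AA ta (%x. Dh ta x + ((r - ta) *\<^sub>R D x + p x *\<^sub>R 0)) (%x. Hh ta x + ((r - ta) *\<^sub>R H x + p x *\<^sub>R 0 + outer 0 (D x) + outer (D x) 0)) x
    = (g ta x - p x) + (ta - r) * AA ta D H x" using gh[OF taU(1), of x] by (simp add: algebra_simps)
   moreover have "abs ((ta - r) * AA ta D H x) <= (t - r) * M" unfolding abs_mult using ta p(6)[OF taU(2), of x] by (intro mult_mono) auto
   ultimately show "abs (Th ta x + ((r - ta) * 0 + p x * - 1) - AA ta (%x. Dh ta x + ((r - ta) *\<^sub>R D x + p x *\<^sub>R 0)) (%x. Hh ta x + ((r - ta) *\<^sub>R H x + p x *\<^sub>R 0 + outer 0 (D x) + outer (D x) 0)) x) <= ep + (t - r) * M"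
    using p(5)[OF taU(2), of x] by linarith
  qed (use r in auto)
  then have est: "abs (h t x - (t - r) * p x - G t r (h r) x) <= (ep + (t - r) * M) * (t - r)" for x
  proof -
   have "h' r = h r" by (simp add: h'_def fun_eq_iff)
   then show ?thesis using \<open>!!x. \<bar>h' t x - G t r (h' r) x\<bar> <= _\<close>[of x] by (simp add: h'_def)
  qed
  note hrCb = hCb[OF rI(4)] and htCb = hCb[OF rI(5)]
  have cb: "(%x. h t x - (t - r) * p x - G t r (h r) x) : Cb"
   using htCb pCb G_Cb[OF rI(1) r(3) hrCb] est by (intro CbI[OF _ est]) (auto simp: Cb_def intro!: continuous_intros)
  have "lint (m t) (h t) - (t - r) * lint (m t) p - lint (m r) (h r) = lint (m t) (%x. h t x - (t - r) * p x - G t r (h r) x)"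
   using flow_eq[OF fl rI(2,3) r(3) hrCb] flow_int(1)[OF fl rI(3)] pCb htCb G_Cb[OF rI(1) r(3) hrCb] by simp
  then have 1: "abs (lint (m t) (h t) - (t - r) * lint (m t) p - lint (m r) (h r)) <= (ep + (t - r) * M) * (t - r)"
   using flow_bound[OF fl rI(3) cb est] by simp
  have 2: "abs ((t - r) * lint (m t) (g t) - (t - r) * lint (m t) p) <= (t - r) * ep"
   unfolding right_diff_distrib[symmetric] abs_mult using gp[OF r(2)] r(3) by (intro mult_mono) auto
  have "(ep + (t - r) * M) * (t - r) + (t - r) * ep = (t - r) * (2 * ep + (t - r) * M)" by (simp add: algebra_simps)
  then show "abs (lint (m t) (h t) - lint (m r) (h r) - (t - r) * lint (m t) (g t)) <= (t - r) * (2 * ep + (t - r) * M)"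
   using 1 2 by linarith
 qed
qed

lemma flow_cont:
 fixes g :: "real => real ^ 'n => real"
 assumes fl: "flow J m" and J: "is_interval J" and U: "open U" "U \<subseteq> I" "J \<subseteq> U"
  and g: "continuous_on (U \<times> UNIV) (%p. g (fst p) (snd p))"
  and z: "!!r x. r : U ==> norm x >= R ==> g r x = 0"
 shows "continuous_on J (%r. lint (m r) (g r))"
 unfolding continuous_on_iff
proof (intro ballI allI impI)
 fix r0 and e :: real assume r0: "r0 : J" and e: "0 < e"
 then have "e / 4 > 0" by simp
 show "EX d>0. ALL x':J. dist x' r0 < d --> dist (lint (m x') (g x')) (lint (m r0) (g r0)) < e"
 proof (rule flow_cont_est[OF fl J U g z r0 \<open>e / 4 > 0\<close>])
 show "!!r x. r : U ==> R <= norm x ==> r : U" "!!r x. r : U ==> R <= norm x ==> R <= norm x" by auto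
 fix de M :: real
 assume d: "de > 0" "M > 0"
  "!!r t. r : J \<inter> cball r0 de ==> t : J \<inter> cball r0 de ==> r <= t ==>
   abs (lint (m t) (g t) - lint (m r) (g r)) <= 2 * (e/4) + (t - r) * M"
 show ?thesis
 proof (intro exI[of _ "min de (e / (4 * M))"] conjI ballI impI)
  show "0 < min de (e / (4 * M))" using d e by simp
  fix r assume r: "r : J" "dist r r0 < min de (e / (4 * M))"
  then have rc: "r : J \<inter> cball r0 de" "r0 : J \<inter> cball r0 de" using r0 d by (auto simp: dist_commute)
  have "abs (r - r0) * M < e / 4" using r d by (simp add: dist_real_def field_simps)
  then show "dist (lint (m r) (g r)) (lint (m r0) (g r0)) < e"
   using d(3)[OF rc] d(3)[OF rc(2,1)] e by (cases "r <= r0") (auto simp: dist_real_def abs_if split: if_splits)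
 qed
 qed
qed

text \<open>A flow solves the adjoint equation: the time derivative of the integral of h is the
  integral of (d/dt - A)h. The derivative is taken within J, because J may be a closed
  interval.\<close>

lemma flow_deriv:
 fixes h :: "real => real ^ 'n => real"
 assumes fl: "flow J m" and J: "is_interval J" and U: "open U" "U \<subseteq> I" "J \<subseteq> U"
  and h: "cl12 U h T D H" and z: "!!r x. r : U ==> norm x >= R ==> h r x = 0" and r0: "r0 : J"
 shows "((%r. lint (m r) (h r)) has_real_derivative (lint (m r0) (%x. T r0 x - AA r0 (D r0) (H r0) x))) (at r0 within J)"
proof -
 define g where "g r x = T r x - AA r (D r) (H r) x" for r x
 have gc: "continuous_on (U \<times> UNIV) (%p. g (fst p) (snd p))"
  unfolding g_def using h by (intro continuous_intros AA_cont U) (auto simp: cl12_def)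
 have gz: "g r x = 0" if "r : U" "norm x >= R + 1" for r x
  using cl12_zero_out[OF h U(1) z, of R r x] that by (simp add: g_def AA_def)
 have hz: "!!r x. r : U ==> norm x >= R + 1 ==> h r x = 0" using z by simp
 have "((%r. lint (m r) (h r)) has_derivative (%v. lint (m r0) (g r0) * v)) (at r0 within J)"
  unfolding has_derivative_within_alt
 proof (intro conjI allI impI)
  show "bounded_linear ((*) (lint (m r0) (g r0)))" by (rule bounded_linear_mult_right)
  fix e :: real assume e: "0 < e"
  then have "e / 8 > 0" by simp
  show "EX d>0. ALL y:J. norm (y - r0) < d --> norm (lint (m y) (h y) - lint (m r0) (h r0) - lint (m r0) (g r0) * (y - r0)) <= e * norm (y - r0)"
  proof (rule flow_cont_est[OF fl J U gc gz r0 \<open>e / 8 > 0\<close>])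
  fix de M :: real
  assume d: "de > 0" "M > 0"
   "!!r t. r : J \<inter> cball r0 de ==> t : J \<inter> cball r0 de ==> r <= t ==>
    abs (lint (m t) (g t) - lint (m r) (g r)) <= 2 * (e/8) + (t - r) * M"
   and d4': "!!r t h T D H. r : J \<inter> cball r0 de ==> t : J \<inter> cball r0 de ==> r <= t ==> cl12 U h T D H ==>
   (!!r x. r : U ==> norm x >= R + 1 ==> h r x = 0) ==>
   (!!r x. r : U ==> g r x = T r x - AA r (D r) (H r) x) ==>
   abs (lint (m t) (h t) - lint (m r) (h r) - (t - r) * lint (m t) (g t)) <= (t - r) * (2 * (e/8) + (t - r) * M)"
  note d4 = d4'[OF _ _ _ h hz g_def]
  show ?thesis
  proof (intro exI[of _ "min de (e / (8 * M))"] conjI ballI impI)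
   show "0 < min de (e / (8 * M))" using d e by simp
   fix y assume y: "y : J" "norm (y - r0) < min de (e / (8 * M))"
   then have rc: "y : J \<inter> cball r0 de" "r0 : J \<inter> cball r0 de" using r0 d by (auto simp: dist_real_def)
   have sm: "abs (y - r0) * M < e / 8" using y d by (simp add: field_simps)
   \<comment> \<open>For y before r0, the expansion with right endpoint r0 is already the claim. For
     y after r0 the derivative term sits at y and still has to be moved to r0 by the modulus of
     continuity.\<close>
   show "norm (lint (m y) (h y) - lint (m r0) (h r0) - lint (m r0) (g r0) * (y - r0)) <= e * norm (y - r0)"
   proof (cases "r0 <= y")
    case True
    let ?A = "lint (m y) (h y) - lint (m r0) (h r0)"
    have 1: "abs (?A - (y - r0) * lint (m y) (g y)) <= (y - r0) * (2 * (e/8) + (y - r0) * M)" using d4[OF rc(2,1) True] .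
    have "abs ((y - r0) * lint (m y) (g y) - (y - r0) * lint (m r0) (g r0)) <= (y - r0) * (2 * (e/8) + (y - r0) * M)"
     unfolding right_diff_distrib[symmetric] abs_mult using d(3)[OF rc(2,1) True] True by (intro mult_mono) auto
    moreover have "(y - r0) * (2 * (e/8) + (y - r0) * M) <= (y - r0) * (e / 2)" using sm True e by (intro mult_left_mono) auto
    ultimately have "abs (?A - (y - r0) * lint (m r0) (g r0)) <= (y - r0) * e" using 1 by linarith
    then show ?thesis using True by (simp add: mult.commute)
   next
    case False
    then have le: "y <= r0" by simp
    have "abs (lint (m r0) (h r0) - lint (m y) (h y) - (r0 - y) * lint (m r0) (g r0)) <= (r0 - y) * (2 * (e/8) + (r0 - y) * M)"
     using d4[OF rc le] .
    also have "... <= (r0 - y) * e" using sm le e by (intro mult_left_mono) auto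
    finally have "abs (lint (m y) (h y) - lint (m r0) (h r0) - lint (m r0) (g r0) * (y - r0)) <= (r0 - y) * e"
     by (simp add: abs_le_iff algebra_simps)
    then show ?thesis using le by (simp add: mult.commute)
   qed
  qed
  qed
 qed
 then show ?thesis unfolding has_field_derivative_def g_def .
qed

end

section \<open>The parabolic operator on products and powers\<close>

lemma real_powr_bounds:
 fixes y q :: real
 assumes "0 < d" "d <= y" "y <= M" "1 <= q" "q <= qm"
 shows "(min 1 d) powr qm <= y powr q" "y powr q <= (max 1 M) powr qm" "abs (ln y) <= abs (ln d) + abs (ln M)"
proof -
 have "(min 1 d) powr qm <= (min 1 d) powr q" using assms by (intro powr_mono') auto
 also have "... <= y powr q" using assms by (intro powr_mono2) auto
 finally show "(min 1 d) powr qm <= y powr q" .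
 have "y powr q <= (max 1 M) powr q" using assms by (intro powr_mono2) auto
 also have "... <= (max 1 M) powr qm" using assms by (intro powr_mono) auto
 finally show "y powr q <= (max 1 M) powr qm" .
 have "ln d <= ln y" "ln y <= ln M" using assms by auto
 then show "abs (ln y) <= abs (ln d) + abs (ln M)" by linarith
qed

lemma inner_mat1: "(A :: real ^ 'n ^ 'n::finite) \<bullet> mat 1 = trace A"
proof -
 have "A \<bullet> mat 1 = (\<Sum>i\<in>UNIV. \<Sum>j\<in>UNIV. if j = i then A $ i $ j else 0)"
  unfolding inner_matrix by (intro sum.cong) (auto simp: mat_def)
 then show ?thesis by (simp add: trace_def)
qed

text \<open>Young's inequality for a semidefinite form: expand the form at 2n a + c and divide by n.
  The weight n will be the cutoff radius, so that only the fraction 1/n of the dissipation is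
  spent.\<close>

lemma psd_bilin:
 assumes "psd A" "n > 0"
 shows "- 4 * (a \<bullet> (A *v c)) <= 4 * n * (a \<bullet> (A *v a)) + (1 / n) * (c \<bullet> (A *v (c::real^'n::finite)))"
proof -
 have sy: "c \<bullet> (A *v a) = a \<bullet> (A *v c)" using assms sym_inner by (auto simp: psd_def)
 have "0 <= ((2 * n) *\<^sub>R a + c) \<bullet> (A *v ((2 * n) *\<^sub>R a + c))" using assms by (simp add: psd_def)
 also have "... = 4 * n^2 * (a \<bullet> (A *v a)) + 4 * n * (a \<bullet> (A *v c)) + c \<bullet> (A *v c)"
  by (simp add: matrix_vector_right_distrib matrix_vector_mult_scaleR inner_add_left inner_add_right sy power2_eq_square algebra_simps)
 finally have "0 <= (4 * n^2 * (a \<bullet> (A *v a)) + 4 * n * (a \<bullet> (A *v c)) + c \<bullet> (A *v c)) / n" using assms by simp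
 also have "... = 4 * n * (a \<bullet> (A *v a)) + 4 * (a \<bullet> (A *v c)) + (1 / n) * (c \<bullet> (A *v c))"
  using assms by (simp add: field_simps power2_eq_square)
 finally show ?thesis by linarith
qed

lemma norm_add_sq: "n > 0 ==> (norm (v + w))^2 <= (1 + 1 / n) * (norm v)^2 + (1 + n) * (norm (w :: 'a::real_inner))^2"
proof -
 assume n: "n > 0"
 have "(norm (v - n *\<^sub>R w))^2 = (norm v)^2 - 2 * n * (v \<bullet> w) + n^2 * (norm w)^2"
  unfolding power2_norm_eq_inner by (simp add: inner_diff_left inner_diff_right inner_commute[of w v] power2_eq_square algebra_simps)
 moreover have "0 <= (norm (v - n *\<^sub>R w))^2 / n" using n by simp
 ultimately have "0 <= ((norm v)^2 - 2 * n * (v \<bullet> w) + n^2 * (norm w)^2) / n" by simp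
 also have "... = (norm v)^2 / n - 2 * n * (v \<bullet> w) / n + n^2 * (norm w)^2 / n"
  by (simp only: diff_divide_distrib add_divide_distrib)
 also have "... = (1 / n) * (norm v)^2 - 2 * (v \<bullet> w) + n * (norm w)^2"
  using n by (simp add: power2_eq_square)
 finally have "2 * (v \<bullet> w) <= (1 / n) * (norm v)^2 + n * (norm w)^2" by simp
 moreover have "(norm (v + w))^2 = (norm v)^2 + 2 * (v \<bullet> w) + (norm w)^2"
  by (simp add: power2_norm_eq_inner inner_add_left inner_add_right inner_commute)
 ultimately show ?thesis by (simp add: algebra_simps)
qed

context kolm begin

text \<open>The defect of the product rule is twice the form of \<open>Q\<close> on the two
  gradients; symmetry of \<open>Q\<close> merges the two mixed terms.\<close>

lemma L_mult:
 assumes "t : I"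
 shows "(f * Tg + g * Tf) - AA t (%x. f' x *\<^sub>R Dg x + g' x *\<^sub>R Df x)
  (%x. f' x *\<^sub>R Hg x + g' x *\<^sub>R Hf x + outer (Df x) (Dg x) + outer (Dg x) (Df x)) x
 = f * Tg - f' x * AA t Dg Hg x + (g * Tf - g' x * AA t Df Hf x) - 2 * (Df x \<bullet> (Q t x *v Dg x))"
proof -
 have "Dg x \<bullet> (Q t x *v Df x) = Df x \<bullet> (Q t x *v Dg x)"
  using sym_inner Qpsd[OF assms] by (auto simp: psd_def)
 then show ?thesis unfolding AA_def by (simp add: inner_add_right inner_outer algebra_simps)
qed

lemma L_comp:
 "F1 * T - AA t (%x. f1 x *\<^sub>R D x) (%x. f1 x *\<^sub>R H x + f2 x *\<^sub>R outer (D x) (D x)) x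
 = F1 * T - f1 x * AA t D H x - f2 x * (D x \<bullet> (Q t x *v D x))"
 unfolding AA_def by (simp add: inner_add_right inner_outer algebra_simps)

text \<open>\<open>L\<close> is the image of \<open>h\<close> under d/dt - A(t) and \<open>D\<close>
  its spatial gradient. The gradient is exposed because the product and chain rules contain it; the
  time derivative and the Hessian enter only through \<open>L\<close> and stay hidden.\<close>

definition Lsol :: "real set => (real => real ^ 'n => real) => (real => real ^ 'n => real) => (real => real ^ 'n => real ^ 'n) => bool" where
 "Lsol J h L D \<longleftrightarrow> J \<subseteq> I & (EX T H. cl12 J h T D H & (ALL t:J. ALL x. T t x - AA t (D t) (H t) x = L t x))"

lemma Lsol_mult:
 assumes "Lsol J f Lf Df" "Lsol J g Lg Dg"
 shows "Lsol J (%t x. f t x * g t x) (%t x. f t x * Lg t x + g t x * Lf t x - 2 * (Df t x \<bullet> (Q t x *v Dg t x)))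
  (%t x. f t x *\<^sub>R Dg t x + g t x *\<^sub>R Df t x)"
proof -
 obtain Tf Hf Tg Hg where f: "cl12 J f Tf Df Hf" "!!t x. t : J ==> Tf t x - AA t (Df t) (Hf t) x = Lf t x"
  and g: "cl12 J g Tg Dg Hg" "!!t x. t : J ==> Tg t x - AA t (Dg t) (Hg t) x = Lg t x"
  and J: "J \<subseteq> I"
  using assms unfolding Lsol_def by metis
 have "(f t x * Tg t x + g t x * Tf t x) - AA t (%x. f t x *\<^sub>R Dg t x + g t x *\<^sub>R Df t x)
  (%x. f t x *\<^sub>R Hg t x + g t x *\<^sub>R Hf t x + outer (Df t x) (Dg t x) + outer (Dg t x) (Df t x)) x
  = f t x * Lg t x + g t x * Lf t x - 2 * (Df t x \<bullet> (Q t x *v Dg t x))" if "t : J" for t x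
  unfolding f(2)[OF that, symmetric] g(2)[OF that, symmetric] using that J
  by (subst L_mult) (auto simp: algebra_simps)
 then show ?thesis unfolding Lsol_def using cl12_mult[OF f(1) g(1)] J by blast
qed

lemma Lsol_compose:
 assumes "Lsol J h L D" and S: "!!t x. t : J ==> h t x : S"
  and F: "!!y. y : S ==> (F has_real_derivative F1 y) (at y)"
   "!!y. y : S ==> (F1 has_real_derivative F2 y) (at y)" "continuous_on S F2"
 shows "Lsol J (%t x. F (h t x)) (%t x. F1 (h t x) * L t x - F2 (h t x) * (D t x \<bullet> (Q t x *v D t x))) (%t x. F1 (h t x) *\<^sub>R D t x)"
proof -
 obtain T H where h: "cl12 J h T D H" "!!t x. t : J ==> T t x - AA t (D t) (H t) x = L t x" and J: "J \<subseteq> I"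
  using assms(1) unfolding Lsol_def by metis
 have "F1 (h t x) * T t x - AA t (%x. F1 (h t x) *\<^sub>R D t x) (%x. F1 (h t x) *\<^sub>R H t x + F2 (h t x) *\<^sub>R outer (D t x) (D t x)) x
   = F1 (h t x) * L t x - F2 (h t x) * (D t x \<bullet> (Q t x *v D t x))" if "t : J" for t x
  unfolding h(2)[OF that, symmetric] L_comp by (simp add: algebra_simps)
 then show ?thesis unfolding Lsol_def using cl12_compose[OF h(1) S F] J by blast
qed

lemma Lsol_time:
 assumes "J \<subseteq> I" "!!t. t : J ==> (q has_real_derivative q' t) (at t)" "continuous_on J q'"
 shows "Lsol J (%t x. q t) (%t x. q' t) (%t x. 0)"
 unfolding Lsol_def using cl12_time[of J q q'] assms
 by (intro conjI exI[of _ "%t x. q' t"] exI[of _ "%t x. 0"]) (auto simp: AA_def)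

lemma Lsol_space:
 assumes "J \<subseteq> I" "C2w f D H" "continuous_on UNIV H"
 shows "Lsol J (%t. f) (%t x. - AA t D H x) (%t. D)"
 unfolding Lsol_def using cl12_space[OF assms(2,3)] assms(1)
 by (intro conjI exI[of _ "%t x. 0"] exI[of _ "%t. H"]) auto

lemma Lsol_cong:
 assumes L: "Lsol J h L D" and "open J" and eq: "!!t x. t : J ==> h t x = h' t x" "!!t x. t : J ==> L t x = L' t x" "!!t x. t : J ==> D t x = D' t x"
 shows "Lsol J h' L' D'"
proof -
 obtain T H where h: "cl12 J h T D H" "!!t x. t : J ==> T t x - AA t (D t) (H t) x = L t x" and J: "J \<subseteq> I"
  using L unfolding Lsol_def by metis
 have e: "h t = h' t" "D t = D' t" if "t : J" for t using eq that by auto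
 have "((%r. h' r x) has_real_derivative T t x) (at t)" if "t : J" for t x
 proof -
  have "((%r. h r x) has_real_derivative T t x) (at t)" using h that by (simp add: cl12_def)
  then show ?thesis by (rule has_field_derivative_transform_within_open[of _ _ _ J]) (use that eq \<open>open J\<close> in auto)
 qed
 moreover have "continuous_on (J \<times> UNIV) (%p. h' (fst p) (snd p))"
  using h eq by (subst continuous_on_cong[OF refl, of _ _ "%p. h (fst p) (snd p)"]) (auto simp: cl12_def)
 moreover have "continuous_on (J \<times> UNIV) (%p. D' (fst p) (snd p))"
  using h eq by (subst continuous_on_cong[OF refl, of _ _ "%p. D (fst p) (snd p)"]) (auto simp: cl12_def)
 ultimately have "cl12 J h' T D' H" using h(1) e by (auto simp: cl12_def)
 then show ?thesis unfolding Lsol_def using J h(2) eq e by (intro conjI exI[of _ T] exI[of _ H]) (auto simp: AA_def)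
qed

lemma Lsol_G: "s : I ==> f : Cb ==> Lsol {s<..} (%t. G t s f) (%t x. 0) (%t. gradient (G t s f))"
 using G_cl12[of s f] I_up[of s] unfolding Lsol_def by (auto simp: subset_eq) blast

lemma Lsol_flow_deriv:
 assumes L: "Lsol U h L D" and fl: "flow J m" and J: "is_interval J" "open U" "J \<subseteq> U"
  and z: "!!r x. r : U ==> norm x >= R ==> h r x = 0" and r0: "r0 : J"
 shows "((%r. lint (m r) (h r)) has_real_derivative (lint (m r0) (L r0))) (at r0 within J)"
  "L r0 : Cb"
proof -
 obtain T H where h: "cl12 U h T D H" "!!t x. t : U ==> T t x - AA t (D t) (H t) x = L t x" and U: "U \<subseteq> I"
  using L unfolding Lsol_def by metis
 have r0U: "r0 : U" using r0 J by auto
 have "((%r. lint (m r) (h r)) has_real_derivative (lint (m r0) (%x. T r0 x - AA r0 (D r0) (H r0) x))) (at r0 within J)"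
  by (rule flow_deriv[OF fl J(1,2) U J(3) h(1) z r0])
 moreover have eq: "(%x. T r0 x - AA r0 (D r0) (H r0) x) = L r0"
  using h(2)[OF r0U] by auto
 ultimately show "((%r. lint (m r) (h r)) has_real_derivative (lint (m r0) (L r0))) (at r0 within J)" by simp
 have "continuous_on (U \<times> UNIV) (%p. T (fst p) (snd p) - AA (fst p) (D (fst p)) (H (fst p)) (snd p))"
  using h U by (intro continuous_intros AA_cont) (auto simp: cl12_def)
 from continuous_on_compose2[OF this continuous_on_Pair[OF continuous_on_const[of UNIV r0] continuous_on_id]]
 have "continuous_on UNIV (%x. T r0 x - AA r0 (D r0) (H r0) x)" using r0U by force
 then show "L r0 : Cb" unfolding eq
 proof (rule Cc_Cb)
  fix x :: "real^'n" assume "norm x >= R + 1"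
  then have "T r0 x = 0" "D r0 x = 0" "H r0 x = 0" using cl12_zero_out[OF h(1) J(2) z r0U, of R x] by auto
  then show "L r0 x = 0" using h(2)[OF r0U, of x] by (simp add: AA_def)
 qed
qed

text \<open>The positive lower bound d makes the logarithm of the solution smooth. The cutoff is
  squared so that the mixed term keeps one factor \<open>cut n\<close>, which Young's inequality can
  pair with the squared cutoff in front of the dissipation.\<close>

lemma entropy_Lsol:
 assumes s: "s : I" "f : Cb" and f: "0 < d" "!!x. d <= f x & f x <= M"
  and q: "!!t. t > s ==> (q has_real_derivative q' t) (at t)" "continuous_on {s<..} q'"
 shows "EX D. Lsol {s<..} (%t x. (cut n x)^2 * (G t s f x) powr q t)
  (%t x. (cut n x)^2 * (G t s f x) powr q t * (q' t * ln (G t s f x) - q t * (q t - 1) / (G t s f x)^2 * (gradient (G t s f) x \<bullet> (Q t x *v gradient (G t s f) x)))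
   + (G t s f x) powr q t * (- 2 * cut n x * AA t (Dcut n) (Hcut n) x - 2 * (Dcut n x \<bullet> (Q t x *v Dcut n x)))
   - 4 * cut n x * (G t s f x) powr q t * q t / G t s f x * (Dcut n x \<bullet> (Q t x *v gradient (G t s f) x))) D"
proof -
 have sub: "{s<..} \<subseteq> I" using I_up[OF s(1)] by auto
 have up: "0 < G t s f x" if "t : {s<..}" for t x
  using G_bound[OF s(1) _ s(2) f(2), of t x] f(1) that by simp
 have v: "Lsol {s<..} (%t x. ln (G t s f x)) (%t x. 1 / (G t s f x) * 0 - (- 1 / (G t s f x)^2) * (gradient (G t s f) x \<bullet> (Q t x *v gradient (G t s f) x)))
   (%t x. (1 / (G t s f x)) *\<^sub>R gradient (G t s f) x)"
  by (rule Lsol_compose[OF Lsol_G[OF s], of "{0<..}"]) (auto simp: up power2_eq_square intro!: derivative_eq_intros continuous_intros)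
 have qc: "Lsol {s<..} (%t x. q t) (%t x. q' t) (%t x. 0)"
  by (rule Lsol_time[OF sub]) (use q in auto)
 \<comment> \<open>The power with time-dependent exponent is written as exp (q ln v), so that
   product and chain rule suffice.\<close>
 note e = Lsol_compose[OF Lsol_mult[OF qc v] UNIV_I DERIV_exp DERIV_exp continuous_on_exp[OF continuous_on_id]]
 have c: "Lsol {s<..} (%t. cut n) (%t x. - AA t (Dcut n) (Hcut n) x) (%t. Dcut n)"
  by (rule Lsol_space[OF sub C2w_cut continuous_Hcut])
 note r = Lsol_mult[OF Lsol_mult[OF c c] e]
 show ?thesis
 proof (rule exI, rule Lsol_cong[OF r open_greaterThan _ _ refl])
  fix t x assume t: "t : {s<..}"
  define U where "U = G t s f x"
  have U: "U > 0" "U ~= 0" using up[OF t, of x] by (auto simp: U_def)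
  have W: "exp (q t * ln U) = U powr q t" using U by (simp add: powr_def)
  then show "cut n x * cut n x * exp (q t * ln (G t s f x)) = (cut n x)^2 * (G t s f x) powr q t"
   by (simp add: U_def power2_eq_square)
  define g where "g = gradient (G t s f) x"
  define A2 where "A2 = AA t (Dcut n) (Hcut n) x"
  define c where "c = Dcut n x"
  define k where "k = cut n x"
  show "cut n x * cut n x *
     (exp (q t * ln (G t s f x)) *
     (q t * (1 / G t s f x * 0 - - 1 / (G t s f x)^2 * (gradient (G t s f) x \<bullet> (Q t x *v gradient (G t s f) x))) + ln (G t s f x) * q' t -
      2 * (0 \<bullet> (Q t x *v (1 / G t s f x) *\<^sub>R gradient (G t s f) x))) -
     exp (q t * ln (G t s f x)) *
     ((q t *\<^sub>R (1 / G t s f x) *\<^sub>R gradient (G t s f) x + ln (G t s f x) *\<^sub>R 0) \<bullet>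
      (Q t x *v (q t *\<^sub>R (1 / G t s f x) *\<^sub>R gradient (G t s f) x + ln (G t s f x) *\<^sub>R 0)))) +
     exp (q t * ln (G t s f x)) *
     (cut n x * - AA t (Dcut n) (Hcut n) x + cut n x * - AA t (Dcut n) (Hcut n) x - 2 * (Dcut n x \<bullet> (Q t x *v Dcut n x))) -
     2 * ((cut n x *\<^sub>R Dcut n x + cut n x *\<^sub>R Dcut n x) \<bullet>
       (Q t x *v exp (q t * ln (G t s f x)) *\<^sub>R (q t *\<^sub>R (1 / G t s f x) *\<^sub>R gradient (G t s f) x + ln (G t s f x) *\<^sub>R 0)))
   = (cut n x)^2 * (G t s f x) powr q t * (q' t * ln (G t s f x) - q t * (q t - 1) / (G t s f x)^2 * (gradient (G t s f) x \<bullet> (Q t x *v gradient (G t s f) x)))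
   + (G t s f x) powr q t * (- 2 * cut n x * AA t (Dcut n) (Hcut n) x - 2 * (Dcut n x \<bullet> (Q t x *v Dcut n x)))
   - 4 * cut n x * (G t s f x) powr q t * q t / G t s f x * (Dcut n x \<bullet> (Q t x *v gradient (G t s f) x))"
   unfolding U_def[symmetric] g_def[symmetric] A2_def[symmetric] c_def[symmetric] k_def[symmetric] W
   using U
   by (simp only: matrix_vector_mult_scaleR inner_add_left scaleR_zero_right add_0_right inner_scaleR_left inner_scaleR_right scaleR_scaleR inner_zero_left)
    (simp add: field_simps power2_eq_square)
 qed
qed

end

section \<open>Hypercontractivity\<close>

locale kolm_mu = kolm I Q b \<phi> D\<phi> H\<phi> a G P
 for I :: "real set" and Q :: "real => real ^ 'n::finite => real ^ 'n ^ 'n" and b \<phi> D\<phi> H\<phi> a G P +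
 fixes \<mu> :: "real => (real ^ 'n) measure" and \<eta>\<^sub>0 K \<Phi> :: real
 assumes mu: "flow I \<mu>"
  and tight: "!!ep. ep > 0 ==> EX C. compact C & (ALL t:I. measure (\<mu> t) C >= 1 - ep)"
  and mu_phi: "!!t. t : I ==> integrable (\<mu> t) \<phi>" "!!t. t : I ==> (lint (\<mu> t) \<phi>) <= \<Phi>"
  and eta: "\<eta>\<^sub>0 > 0" "!!t x xi. t : I ==> \<eta>\<^sub>0 * (norm xi)^2 <= xi \<bullet> (Q t x *v xi)"
  and K: "K > 0" "log_Sobolev I \<mu> K"
  and growth: "!!sg ta. sg : I ==> ta > sg ==>
         EX C\<^sub>0>0. EX C\<^sub>1>0. EX C\<^sub>2>0. ALL t:{sg..ta}. ALL x.
          norm (Q t x *v x) <= C\<^sub>0 * norm x * \<phi> x &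
          trace (Q t x) <= C\<^sub>1 * (1 + norm x) * \<phi> x &
          inner (b t x) x <= C\<^sub>2 * norm x * \<phi> x"
begin

lemma mu_prob: "t : I ==> prob_space (\<mu> t)" and mu_sets: "t : I ==> sets (\<mu> t) = sets borel"
 using mu by (auto simp: flow_def)

lemma mu_space: "t : I ==> space (\<mu> t) = UNIV"
 using sets_eq_imp_space_eq[OF mu_sets] by simp

text \<open>The derivatives of \<open>cut n\<close> live where the norm of x is between n and 2n,
  where (c) turns into multiples of n \<phi> and n^2 \<phi>. One-sided growth of the drift is enough
  for the first bound, since \<open>bump1\<close> is nonpositive: the trace and <b,x> enter -A(cut)
  with a nonnegative factor.\<close>

lemma cut_bounds:
 assumes "sg : I" "ta > sg"
 shows "EX C>0. ALL n>=1. ALL t:{sg..ta}. ALL x. - AA t (Dcut n) (Hcut n) x <= C / n * \<phi> x &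
  Dcut n x \<bullet> (Q t x *v Dcut n x) <= C / n^2 * \<phi> x & norm (Dcut n x) <= C / n"
proof -
 obtain C0 C1 C2 where C: "C0 > 0" "C1 > 0" "C2 > 0"
  "!!t x. t : {sg..ta} ==> norm (Q t x *v x) <= C0 * norm x * \<phi> x &
          trace (Q t x) <= C1 * (1 + norm x) * \<phi> x & inner (b t x) x <= C2 * norm x * \<phi> x"
  using growth[OF assms] by metis
 obtain B where B: "B > 0" "!!y. abs (bump1 y) <= B" "!!y. abs (bump2 y) <= B" using bump_bounds by metis
 \<comment> \<open>The sum of the constants of all three estimates, so that one C serves each of
   them.\<close>
 define C where "C = 2 * B * (3 * C1 + 2 * C2) + 16 * B * C0 + 16 * B^2 * C0 + 4 * B"
 have Cpos: "C > 0" using C(1-3) B(1) by (simp add: C_def add_pos_pos)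
 have Cge: "2 * B * (3 * C1 + 2 * C2) + 16 * B * C0 <= C" "16 * B^2 * C0 <= C" "4 * B <= C"
  using C(1-3) B(1) by (auto simp: C_def)
 show ?thesis
 proof (intro exI[of _ C] conjI allI impI ballI)
  fix n t and x :: "real^'n" assume n: "(1::real) <= n" and t: "t : {sg..ta}"
  define \<beta> where "\<beta> = bump1 ((norm x)^2 / n^2)"
  define ga where "ga = bump2 ((norm x)^2 / n^2)"
  have bg: "abs \<beta> <= B" "abs ga <= B" "\<beta> <= 0" using B bump_range by (auto simp: \<beta>_def ga_def)
  define X where "X = x \<bullet> (Q t x *v x)"
  have ph: "\<phi> x >= 0" by (rule phi(2))
  have X: "abs X <= C0 * (norm x)^2 * \<phi> x"
  proof -
   have "abs X <= norm x * norm (Q t x *v x)" unfolding X_def by (rule Cauchy_Schwarz_ineq2)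
   also have "... <= norm x * (C0 * norm x * \<phi> x)" using C(4)[OF t, of x] by (intro mult_left_mono) auto
   finally show ?thesis by (simp add: power2_eq_square mult_ac)
  qed
  have A: "AA t (Dcut n) (Hcut n) x = (2 * \<beta> / n^2) * (trace (Q t x) + b t x \<bullet> x) + (4 * ga / n^4) * X"
   unfolding AA_def Dcut_def Hcut_def by (simp add: inner_add_right inner_mat1 inner_outer X_def \<beta>_def ga_def algebra_simps add_divide_distrib)
  have Gm: "Dcut n x \<bullet> (Q t x *v Dcut n x) = (4 * \<beta>^2 / n^4) * X"
   unfolding Dcut_def by (simp add: matrix_vector_mult_scaleR X_def \<beta>_def power2_eq_square power4_eq_xxxx)
  have Nm: "norm (Dcut n x) = 2 * abs \<beta> / n^2 * norm x" unfolding Dcut_def by (simp add: \<beta>_def abs_mult)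
  show "- AA t (Dcut n) (Hcut n) x <= C / n * \<phi> x" "Dcut n x \<bullet> (Q t x *v Dcut n x) <= C / n^2 * \<phi> x" "norm (Dcut n x) <= C / n"
  proof -
   consider "norm x <= n \<or> norm x >= 2 * n" | "n < norm x" "norm x < 2 * n" by linarith
   then have "- AA t (Dcut n) (Hcut n) x <= C / n * \<phi> x & Dcut n x \<bullet> (Q t x *v Dcut n x) <= C / n^2 * \<phi> x & norm (Dcut n x) <= C / n"
   proof cases
    case 1
    have "\<beta> = 0 & ga = 0"
    proof (cases "norm x <= n")
     case True
     then have "(norm x)^2 / n^2 <= 1" using n by (simp add: power_mono)
     then show ?thesis by (simp add: \<beta>_def ga_def bump_low)
    next
     case False
     then have "(2 * n)^2 <= (norm x)^2" using 1 n by (intro power_mono) auto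
     then have "4 * n^2 <= (norm x)^2" unfolding power_mult_distrib by simp
     then have "2 * n^2 <= (norm x)^2" using zero_le_power2[of n] by linarith
     then have "2 <= (norm x)^2 / n^2" using n by (simp add: field_simps)
     then show ?thesis by (simp add: \<beta>_def ga_def bump_high)
    qed
    then show ?thesis using A Gm Nm Cpos ph n by simp
   next
    case 2
    have n0: "n > 0" using n by simp
    have sq: "(norm x)^2 <= 4 * n^2" using power_mono[of "norm x" "2 * n" 2] 2 by (simp add: power_mult_distrib)
    have X4: "abs X <= 4 * n^2 * C0 * \<phi> x"
    proof -
     have "C0 * (norm x)^2 * \<phi> x <= C0 * (4 * n^2) * \<phi> x" using sq C(1) ph by (intro mult_right_mono mult_left_mono) auto
     then show ?thesis using X by (simp add: mult_ac)
    qed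
    have tb: "trace (Q t x) + b t x \<bullet> x <= (3 * C1 + 2 * C2) * n * \<phi> x"
    proof -
     have "C1 * (1 + norm x) * \<phi> x <= C1 * (3 * n) * \<phi> x" using 2 n C(2) ph by (intro mult_right_mono mult_left_mono) auto
     moreover have "C2 * norm x * \<phi> x <= C2 * (2 * n) * \<phi> x" using 2 n C(3) ph by (intro mult_right_mono mult_left_mono) auto
     ultimately show ?thesis using C(4)[OF t, of x] by (simp add: algebra_simps)
    qed
    have "(- 2 * \<beta> / n^2) * (trace (Q t x) + b t x \<bullet> x) <= (- 2 * \<beta> / n^2) * ((3 * C1 + 2 * C2) * n * \<phi> x)"
     using bg n0 by (intro mult_left_mono tb) (auto intro!: divide_nonpos_nonneg)
    also have "... <= (2 * B / n^2) * ((3 * C1 + 2 * C2) * n * \<phi> x)"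
     using bg n0 C(1-3) ph by (intro mult_right_mono divide_right_mono) auto
    also have "... = 2 * B * (3 * C1 + 2 * C2) / n * \<phi> x" using n0 by (simp add: power2_eq_square)
    finally have 3: "(- 2 * \<beta> / n^2) * (trace (Q t x) + b t x \<bullet> x) <= 2 * B * (3 * C1 + 2 * C2) / n * \<phi> x" .
    have "- ((4 * ga / n^4) * X) <= abs ((4 * ga / n^4) * X)" by (rule abs_ge_minus_self)
    also have "... = (4 * abs ga / n^4) * abs X" by (simp add: abs_mult)
    also have "... <= (4 * B / n^4) * (4 * n^2 * C0 * \<phi> x)"
     using bg n0 X4 B(1) by (intro mult_mono divide_right_mono) auto
    also have "... = 16 * B * C0 * \<phi> x * (1 / n^2)" using n0 by (simp add: power2_eq_square power4_eq_xxxx)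
    also have "... <= 16 * B * C0 * \<phi> x * (1 / n)"
     using n B(1) C(1) ph by (intro mult_left_mono) (auto simp: power2_eq_square field_simps)
    finally have 4: "- ((4 * ga / n^4) * X) <= 16 * B * C0 / n * \<phi> x" by simp
    have "- AA t (Dcut n) (Hcut n) x <= (2 * B * (3 * C1 + 2 * C2) + 16 * B * C0) / n * \<phi> x"
     using 3 4 unfolding A by (simp add: add_divide_distrib distrib_right)
    also have "... <= C / n * \<phi> x" using Cge n0 ph by (intro mult_right_mono divide_right_mono) auto
    finally have r1: "- AA t (Dcut n) (Hcut n) x <= C / n * \<phi> x" .
    have "(4 * \<beta>^2 / n^4) * X <= (4 * B^2 / n^4) * (4 * n^2 * C0 * \<phi> x)"
    proof -
     have "\<beta>^2 <= B^2" using bg by (metis abs_le_square_iff abs_of_pos B(1))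
     moreover have "X <= 4 * n^2 * C0 * \<phi> x" using X4 by simp
     moreover have "0 <= 4 * n^2 * C0 * \<phi> x" using C(1) ph by simp
     ultimately have "(4 * \<beta>^2 / n^4) * X <= (4 * \<beta>^2 / n^4) * (4 * n^2 * C0 * \<phi> x)" by (intro mult_left_mono) auto
     also have "... <= (4 * B^2 / n^4) * (4 * n^2 * C0 * \<phi> x)"
      using \<open>\<beta>\<^sup>2 <= B\<^sup>2\<close> \<open>0 <= 4 * n\<^sup>2 * C0 * \<phi> x\<close> by (intro mult_right_mono divide_right_mono) auto
     finally show ?thesis .
    qed
    also have "... = (16 * B^2 * C0) / n^2 * \<phi> x" using n0 by (simp add: power2_eq_square power4_eq_xxxx)
    also have "... <= C / n^2 * \<phi> x" using Cge ph by (intro mult_right_mono divide_right_mono) auto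
    finally have r2: "Dcut n x \<bullet> (Q t x *v Dcut n x) <= C / n^2 * \<phi> x" by (simp add: Gm)
    have "norm (Dcut n x) <= 2 * B / n^2 * (2 * n)" unfolding Nm using bg 2 B(1) by (intro mult_mono divide_right_mono) auto
    also have "... = 4 * B / n" using n0 by (simp add: power2_eq_square)
    also have "... <= C / n" using Cge n0 by (intro divide_right_mono) auto
    finally show ?thesis using r1 r2 by simp
   qed
   then show "- AA t (Dcut n) (Hcut n) x <= C / n * \<phi> x" "Dcut n x \<bullet> (Q t x *v Dcut n x) <= C / n^2 * \<phi> x" "norm (Dcut n x) <= C / n"
    by auto
  qed
 qed (rule Cpos)
qed

lemma tail:
 assumes "ep > 0" shows "EX N0>=1. ALL n>=N0. ALL t:I. measure (\<mu> t) {x. n < norm x} <= ep"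
proof -
 obtain C where C: "compact C" "!!t. t : I ==> measure (\<mu> t) C >= 1 - ep" using tight[OF assms] by auto
 obtain B where B: "!!x. x : C ==> norm x <= B" using compact_imp_bounded[OF C(1)] by (auto simp: bounded_iff)
 show ?thesis
 proof (intro exI[of _ "max 1 B"] conjI allI impI ballI)
  fix n t assume n: "max 1 B <= n" and t: "t : I"
  interpret prob_space "\<mu> t" by (rule mu_prob[OF t])
  have Cs: "C : sets (\<mu> t)" using C(1) by (simp add: mu_sets[OF t] borel_compact)
  have "measure (\<mu> t) {x. n < norm x} <= measure (\<mu> t) (space (\<mu> t) - C)"
   using B n Cs by (intro finite_measure_mono) (fastforce simp: mu_space[OF t])+
  also have "... = 1 - measure (\<mu> t) C" by (rule prob_compl[OF Cs])
  finally show "measure (\<mu> t) {x. n < norm x} <= ep" using C(2)[OF t] by simp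
 qed simp
qed

lemma diff_tail:
 fixes f g :: "real ^ 'n => real"
 assumes t: "t : I" and fg: "f : Cb" "g : Cb" "!!x. abs (f x) <= B" "!!x. abs (g x) <= B" "!!x. norm x <= n ==> f x = g x"
 shows "abs (lint (\<mu> t) f - lint (\<mu> t) (%x. g x)) <= 2 * B * measure (\<mu> t) {x. n < norm x}"
proof -
 interpret prob_space "\<mu> t" by (rule mu_prob[OF t])
 note i = flow_int(1)[OF mu t fg(1)] flow_int(1)[OF mu t fg(2)]
 have "open {x::real^'n. n < norm x}" by (intro open_Collect_less continuous_intros)
 then have ms: "{x. n < norm x} : sets (\<mu> t)" by (simp add: mu_sets[OF t])
 have "lint (\<mu> t) f - lint (\<mu> t) (%x. g x) = lint (\<mu> t) (%x. f x - g x)" using i by simp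
 also have "abs (...) <= lint (\<mu> t) (%x. abs (f x - g x))" by (rule integral_abs_bound)
 also have "... <= lint (\<mu> t) (%x. 2 * B * indicator {x. n < norm x} x)"
 proof (rule integral_mono)
  show "integrable (\<mu> t) (%x. abs (f x - g x))" using i by simp
  show "integrable (\<mu> t) (%x. 2 * B * indicator {x. n < norm x} x)"
   using ms by (intro integrable_mult_right) (simp add: emeasure_eq_measure)
  show "abs (f x - g x) <= 2 * B * indicator {x. n < norm x} x" for x
   using fg(3)[of x] fg(4)[of x] fg(5)[of x] by (cases "norm x <= n") (auto simp: indicator_def)
 qed
 also have "... = 2 * B * measure (\<mu> t) {x. n < norm x}" using ms by simp
 finally show ?thesis .
qed

text \<open>The constant in front of the error 1/n + tail mass in \<open>static_est\<close>. It
  depends on the solution only through its bounds d and M, on the exponent through its maximum qm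
  and on the cutoffs through C, hence neither on n nor on the time.\<close>

definition hypC :: "real => real => real => real => real" where
 "hypC d M qm C = (let W = (max 1 M) powr qm; Lm = abs (ln d) + abs (ln M); c0 = (min 1 d) powr qm in
  (\<eta>\<^sub>0 / K) * qm * (2 * W * Lm) + (\<eta>\<^sub>0 / K) * qm * (W * Lm + W * (abs (ln c0) + abs (ln W)))
  + qm^2 * \<eta>\<^sub>0 * (2 * (W / d^2) * (M^2 * C^2)) + (2 + 4 * qm) * W * C * \<Phi>)"

text \<open>The integral of \<open>Lf\<close> is the time derivative of the integral of cut^2 v^q.
  Its gradient term is bounded through ellipticity and then through the logarithmic Sobolev
  inequality. With the given q' the integrals of v^q ln v cancel up to an error vanishing as n
  grows, and (q'/q) N ln N is left. Here N is the integral of g^q for a function g in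
  \<open>Cb1\<close> that agrees with v on the ball of radius n; it differs from the cut-off
  integral by a tail.\<close>

lemma static_est:
 assumes t: "t : I" and v: "C2w v Dv Hv" "!!x. d <= v x & v x <= M" and d: "d > 0" and n: "n >= 1"
  and q: "1 < q" "q <= qm" "1 / n <= q - 1" and C: "C > 0"
  and cb: "!!x. - AA t (Dcut n) (Hcut n) x <= C / n * \<phi> x"
   "!!x. Dcut n x \<bullet> (Q t x *v Dcut n x) <= C / n^2 * \<phi> x" "!!x::real^'n. norm (Dcut n x) <= C / n"
  and q': "q' = \<eta>\<^sub>0 / K * (q - 1)"
  and Lf: "Lf : Cb" "!!x. Lf x = (cut n x)^2 * v x powr q * (q' * ln (v x) - q * (q - 1) / (v x)^2 * (Dv x \<bullet> (Q t x *v Dv x)))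
   + v x powr q * (- 2 * cut n x * AA t (Dcut n) (Hcut n) x - 2 * (Dcut n x \<bullet> (Q t x *v Dcut n x)))
   - 4 * cut n x * v x powr q * q / v x * (Dcut n x \<bullet> (Q t x *v Dv x))"
 shows "EX N. (min 1 d) powr qm <= N & N <= (max 1 M) powr qm &
  abs (N - lint (\<mu> t) (%x. (cut n x)^2 * v x powr q)) <= 2 * (max 1 M) powr qm * measure (\<mu> t) {x. n < norm x} &
  (lint (\<mu> t) Lf) <= q' / q * (N * ln N) + hypC d M qm C * (1 / n + measure (\<mu> t) {x. n < norm x})"
proof -
 interpret prob_space "\<mu> t" by (rule mu_prob[OF t])
 have n0: "n > 0" using n by simp
 have M: "M > 0" using v(2)[of 0] d by simp
 have vp: "v x > 0" "v x ~= 0" for x using v(2)[of x] d by auto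
 define W where "W = (max 1 M) powr qm"
 define Lm where "Lm = abs (ln d) + abs (ln M)"
 define c0 where "c0 = (min 1 d) powr qm"
 define th where "th = (cut n :: real^'n => real)"
 define m where "m = measure (\<mu> t) {x. n < norm x}"
 have m0: "m >= 0" by (simp add: m_def)
 have th: "0 <= th x" "th x <= 1" for x using cut_range by (auto simp: th_def)
 have W1: "W >= 1" unfolding W_def using q by (intro ge_one_powr_ge_zero) auto
 have pb: "c0 <= y powr q" "y powr q <= W" "abs (ln y) <= Lm" if "d <= y" "y <= M" for y
  using real_powr_bounds[of d y M q qm] d that q by (auto simp: c0_def W_def Lm_def)
 have c0: "c0 > 0" using d by (simp add: c0_def)
 have Lm0: "Lm >= 0" by (simp add: Lm_def)
 have vc: "continuous_on UNIV v" and Dvc: "continuous_on UNIV Dv" using C2w_cont[OF v(1)] C2w_contD[OF v(1)] by auto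
 have thc: "continuous_on UNIV th" and Dthc: "continuous_on UNIV (Dcut n :: real^'n => _)"
  unfolding th_def using C2w_cont[OF C2w_cut] C2w_contD[OF C2w_cut] by auto
 define w where "w x = v x powr q" for x
 have wc: "continuous_on UNIV w" unfolding w_def by (intro continuous_intros vc) (use vp in auto)
 have w: "c0 <= w x" "w x <= W" "0 <= w x" for x using pb[of "v x"] v(2)[of x] by (auto simp: w_def)
 define X where "X = lint (\<mu> t) (%x. (th x)^2 * (w x / (v x)^2) * (norm (Dv x))^2)"
 define En where "En = lint (\<mu> t) (%x. (th x)^2 * w x * ln (v x))"
 have thz: "th x = 0" if "norm x >= 2 * n" for x using cut_zero[OF n0 that] by (simp add: th_def)
 have Xi: "integrable (\<mu> t) (%x. (th x)^2 * (w x / (v x)^2) * (norm (Dv x))^2)"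
 proof (rule flow_int(1)[OF mu t], rule Cc_Cb[of _ "2 * n"])
  show "continuous_on UNIV (%x. (th x)^2 * (w x / (v x)^2) * (norm (Dv x))^2)"
   by (intro continuous_intros thc wc vc Dvc) (use vp in auto)
 qed (use thz in simp)
 have EnCb: "(%x. (th x)^2 * w x * ln (v x)) : Cb"
 proof (rule Cc_Cb[of _ "2 * n"])
  show "continuous_on UNIV (%x. (th x)^2 * w x * ln (v x))"
   by (intro continuous_intros thc wc vc) (use vp in auto)
 qed (use thz in simp)
 note Eni = flow_int(1)[OF mu t EnCb]
 have e1: "Lf x <= q' * ((th x)^2 * w x * ln (v x)) - q * (q - 1 - 1 / n) * \<eta>\<^sub>0 * ((th x)^2 * (w x / (v x)^2) * (norm (Dv x))^2) + (2 + 4 * qm) * W * C / n * \<phi> x" for x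
 proof -
  define \<Gamma> where "\<Gamma> = Dv x \<bullet> (Q t x *v Dv x)"
  define g2 where "g2 = Dcut n x \<bullet> (Q t x *v Dcut n x)"
  define g3 where "g3 = Dcut n x \<bullet> (Q t x *v Dv x)"
  have ph: "\<phi> x >= 0" by (rule phi(2))
  have psd: "psd (Q t x)" by (rule Qpsd[OF t])
  have g20: "g2 >= 0" using psd by (simp add: g2_def psd_def)
  \<comment> \<open>The mixed term is split with weight n: the part with the gradient of the cutoff
    is at most of order \<phi>/n by \<open>cb\<close>, the other part costs the fraction 1/n of the
    dissipation.\<close>
  have "- 4 * (Dcut n x \<bullet> (Q t x *v (th x / v x) *\<^sub>R Dv x)) <= 4 * n * g2 + (1 / n) * (((th x / v x) *\<^sub>R Dv x) \<bullet> (Q t x *v (th x / v x) *\<^sub>R Dv x))"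
   unfolding g2_def by (rule psd_bilin[OF psd n0])
  then have "- 4 * ((th x / v x) * g3) <= 4 * n * g2 + (1 / n) * ((th x / v x)^2 * \<Gamma>)"
   by (simp add: matrix_vector_mult_scaleR g3_def \<Gamma>_def power2_eq_square mult_ac)
  then have "w x * q * (- 4 * ((th x / v x) * g3)) <= w x * q * (4 * n * g2 + (1 / n) * ((th x / v x)^2 * \<Gamma>))"
   using w q by (intro mult_left_mono) auto
  then have a1: "- 4 * th x * w x * q / v x * g3 <= w x * q * (4 * n * g2) + q * (1 / n) * ((th x)^2 * (w x / (v x)^2) * \<Gamma>)"
   by (simp add: power_divide algebra_simps)
  have "w x * q * (4 * n * g2) <= W * qm * (4 * n * (C / n^2 * \<phi> x))"
   using w[of x] q g20 cb(2)[of x] n0 W1 by (intro mult_mono) (auto simp: g2_def)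
  also have "... = 4 * qm * W * C / n * \<phi> x" using n0 by (simp add: power2_eq_square)
  finally have a2: "w x * q * (4 * n * g2) <= 4 * qm * W * C / n * \<phi> x" .
  have "w x * (- 2 * th x * AA t (Dcut n) (Hcut n) x) = (2 * w x * th x) * (- AA t (Dcut n) (Hcut n) x)" by simp
  also have "... <= (2 * w x * th x) * (C / n * \<phi> x)" using cb(1)[of x] w[of x] th[of x] by (intro mult_left_mono) auto
  also have "... <= (2 * W * 1) * (C / n * \<phi> x)" using w[of x] th[of x] ph C n0 W1 by (intro mult_mono) auto
  finally have a3: "w x * (- 2 * th x * AA t (Dcut n) (Hcut n) x) <= 2 * W * C / n * \<phi> x" by simp
  have a4: "w x * (2 * g2) >= 0" using w[of x] g20 by simp
  have "q * (q - 1 - 1 / n) * ((th x)^2 * (w x / (v x)^2)) * (\<eta>\<^sub>0 * (norm (Dv x))^2) <= q * (q - 1 - 1 / n) * ((th x)^2 * (w x / (v x)^2)) * \<Gamma>"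
   using eta(2)[OF t, of "Dv x" x] q w[of x] by (intro mult_left_mono) (auto simp: \<Gamma>_def)
  then have a5: "q * (q - 1 - 1 / n) * \<eta>\<^sub>0 * ((th x)^2 * (w x / (v x)^2) * (norm (Dv x))^2) <= q * (q - 1 - 1 / n) * ((th x)^2 * (w x / (v x)^2) * \<Gamma>)"
   by (simp only: mult_ac)
  define Z where "Z = (th x)^2 * (w x / (v x)^2) * \<Gamma>"
  have "Lf x = q' * ((th x)^2 * w x * ln (v x)) - q * (q - 1) * Z + w x * (- 2 * th x * AA t (Dcut n) (Hcut n) x) - w x * (2 * g2) + (- 4 * th x * w x * q / v x * g3)"
   unfolding Lf(2) Z_def th_def[symmetric] w_def[symmetric] \<Gamma>_def[symmetric] g2_def[symmetric] g3_def[symmetric]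
   by (simp add: algebra_simps)
  moreover have "q * (q - 1) * Z - q * (1 / n) * Z = q * (q - 1 - 1 / n) * Z" by (simp add: algebra_simps)
  moreover have "(2 + 4 * qm) * W * C / n * \<phi> x = 2 * W * C / n * \<phi> x + 4 * qm * W * C / n * \<phi> x"
   by (simp add: algebra_simps add_divide_distrib)
  ultimately show ?thesis using a1 a2 a3 a4 a5 unfolding Z_def[symmetric] by linarith
 qed
 have e2: "lint (\<mu> t) Lf <= q' * En - q * (q - 1 - 1 / n) * \<eta>\<^sub>0 * X + (2 + 4 * qm) * W * C * \<Phi> / n"
 proof -
  have "lint (\<mu> t) Lf <= lint (\<mu> t) (%x. q' * ((th x)^2 * w x * ln (v x)) - q * (q - 1 - 1 / n) * \<eta>\<^sub>0 * ((th x)^2 * (w x / (v x)^2) * (norm (Dv x))^2) + (2 + 4 * qm) * W * C / n * \<phi> x)"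
   by (intro integral_mono flow_int(1)[OF mu t Lf(1)] e1 Bochner_Integration.integrable_add Bochner_Integration.integrable_diff integrable_mult_right Eni Xi mu_phi(1) t)
  also have "... = q' * En - q * (q - 1 - 1 / n) * \<eta>\<^sub>0 * X + (2 + 4 * qm) * W * C / n * (lint (\<mu> t) \<phi>)"
  proof -
   have lin: "lint (\<mu> t) (%x. c1 * f1 x - c2 * f2 x + c3 * f3 x) = c1 * lint (\<mu> t) f1 - c2 * lint (\<mu> t) f2 + c3 * lint (\<mu> t) f3"
    if "integrable (\<mu> t) f1" "integrable (\<mu> t) f2" "integrable (\<mu> t) f3" for f1 f2 f3 :: "real^'n => real" and c1 c2 c3
    using that by simp
   show ?thesis unfolding En_def X_def by (rule lin[OF Eni Xi mu_phi(1)[OF t]])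
  qed
  also have "... <= q' * En - q * (q - 1 - 1 / n) * \<eta>\<^sub>0 * X + (2 + 4 * qm) * W * C / n * \<Phi>"
   using mu_phi(2)[OF t] q W1 C n0 by (intro add_left_mono mult_left_mono) auto
  finally show ?thesis by simp
 qed
 \<comment> \<open>The function g below runs between v and this constant. For q < 2 the constant is
   M, so g >= v and the negative exponent q - 2 gives g^(q-2) <= v^(q-2); for q >= 2 the constant is
   d, so g <= v gives the same. Without this comparison the weight in front of the gradient of v
   could not be matched.\<close>
 define ka where "ka = (if q < 2 then M else d)"
 have kap: "d <= ka" "ka <= M" using v(2)[of 0] by (auto simp: ka_def)
 define g where "g x = ka + th x * (v x - ka)" for x
 define Dg where "Dg x = th x *\<^sub>R Dv x + (v x - ka) *\<^sub>R Dcut n x" for x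
 have gd: "d <= g x" "g x <= M" "g x > 0" for x
 proof -
  have *: "g x = (1 - th x) * ka + th x * v x" by (simp add: g_def algebra_simps)
  have "(1 - th x) * d + th x * d <= g x" unfolding * using th[of x] kap v(2)[of x] by (intro add_mono mult_left_mono) auto
  then show "d <= g x" by (simp add: algebra_simps)
  then show "g x > 0" using d by simp
  have "g x <= (1 - th x) * M + th x * M" unfolding * using th[of x] kap v(2)[of x] by (intro add_mono mult_left_mono) auto
  then show "g x <= M" by (simp add: algebra_simps)
 qed
 have gn: "g x = v x" if "norm x <= n" for x using cut_one[OF n0 that] by (simp add: g_def th_def)
 have gC: "C2w g Dg (%x. 0 + (th x *\<^sub>R (Hv x - 0) + (v x - ka) *\<^sub>R Hcut n x + outer (Dcut n x) (Dv x - 0) + outer (Dv x - 0) (Dcut n x)))"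
 proof -
  have "Dg = (%x. 0 + (th x *\<^sub>R (Dv x - 0) + (v x - ka) *\<^sub>R Dcut n x))" by (simp add: Dg_def fun_eq_iff)
  then show ?thesis unfolding g_def[abs_def] th_def
   using C2w_add[OF C2w_const C2w_mult[OF C2w_cut C2w_diff[OF v(1) C2w_const]]] by (simp only:)
 qed
 have gc: "continuous_on UNIV g" and Dgc: "continuous_on UNIV Dg" using C2w_cont[OF gC] C2w_contD[OF gC] by auto
 have gradg: "gradient g = Dg" by (simp add: gradient_def[abs_def] C2w_partial[OF gC] fun_eq_iff)
 have Dgz: "Dg x = 0" if "norm x >= 2 * n + 1" for x
 proof -
  have "Dcut n x = 0" by (rule C2w_zero_out(1)[OF C2w_cut, of "2 * n"]) (use cut_zero[OF n0] that in auto)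
  then show ?thesis using thz[of x] that by (simp add: Dg_def)
 qed
 have gCb1: "g : Cb1"
 proof -
  have pi: "partial i g : Cb" for i
   unfolding C2w_partial[OF gC] by (rule Cc_Cb[of _ "2 * n + 1"]) (auto intro!: continuous_intros Dgc simp: Dgz)
  have "g differentiable_on UNIV" using C2w_contD[OF gC] C2wD1[OF gC] by (auto simp: differentiable_on_def differentiable_def)
  moreover have "bounded (range g)"
  proof -
   have "norm (g x) <= M" for x using gd(2)[of x] gd(3)[of x] by simp
   then show ?thesis unfolding bounded_iff by blast
  qed
  ultimately show ?thesis using pi by (simp add: Cb1_def C1_def Cb_def)
 qed
 define N where "N = lint (\<mu> t) (%x. g x powr q)"
 define Eg where "Eg = lint (\<mu> t) (%x. g x powr q * ln (g x))"
 have gqCb: "(%x. g x powr q) : Cb"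
 proof (rule CbI)
  show "continuous_on UNIV (%x. g x powr q)" by (intro continuous_intros gc) (use gd(3) in "auto simp: less_le")
  show "abs (g x powr q) <= W" for x using pb[OF gd(1,2), of x] by simp
 qed
 have WL: "abs (z * l) <= W * Lm" if "0 <= z" "z <= W" "abs l <= Lm" for z l
  unfolding abs_mult using that W1 by (intro mult_mono) auto
 have gE: "abs (g x powr q * ln (g x)) <= W * Lm" for x using WL[of "g x powr q" "ln (g x)"] pb[OF gd(1,2), of x] by simp
 have gECb: "(%x. g x powr q * ln (g x)) : Cb"
 proof (rule CbI[OF _ gE])
  show "continuous_on UNIV (%x. g x powr q * ln (g x))"
   by (intro continuous_intros gc) (use gd(3) in "auto simp: less_le")
 qed
 have Nb: "c0 <= N" "N <= W"
  unfolding N_def using integral_ge_const[OF flow_int(1)[OF mu t gqCb], of c0] integral_le_const[OF flow_int(1)[OF mu t gqCb], of W]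
   pb[OF gd(1,2)] by auto
 have N0: "N > 0" using Nb c0 by simp
 have DgCb: "(%x. g x powr (q - 2) * (norm (Dg x))^2) : Cb"
 proof (rule Cc_Cb[of _ "2 * n + 1"])
  show "continuous_on UNIV (%x. g x powr (q - 2) * (norm (Dg x))^2)"
   by (intro continuous_intros gc Dgc) (use gd(3) in "auto simp: less_le")
 qed (use Dgz in simp)
 note Dgi = flow_int(1)[OF mu t DgCb]
 define DD where "DD = lint (\<mu> t) (%x. g x powr (q - 2) * (norm (Dg x))^2)"
 have LSI: "Eg <= (1 / q) * (N * ln N) + q * K * DD"
 proof -
  have nz: "{x. g x ~= 0} = UNIV" using gd(3) by (auto simp: less_le)
  have ab: "abs (g x) = g x" for x using gd(3)[of x] by simp
  have "set_integrable (\<mu> t) {x. g x ~= 0} (%x. abs (g x) powr (q - 2) * (norm (gradient g x))^2)"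
   unfolding nz ab gradg set_integrable_def using Dgi by simp
  from K(2)[unfolded log_Sobolev_def, rule_format, OF t gCb1 q(1) this]
  have "Eg <= Lp_norm (\<mu> t) q g powr q * ln (Lp_norm (\<mu> t) q g) + q * K * DD"
   unfolding nz ab gradg Eg_def DD_def set_lebesgue_integral_def by simp
  moreover have "Lp_norm (\<mu> t) q g = N powr (1 / q)" by (simp add: Lp_norm_def ab N_def)
  ultimately show ?thesis using N0 q(1) by (simp add: powr_powr ln_powr)
 qed
 define C4 where "C4 = 2 * (W / d^2) * (M^2 * C^2)"
 have DX: "DD <= (1 + 1 / n) * X + C4 / n"
 proof -
  have pw: "g x powr (q - 2) * (norm (Dg x))^2 <= (1 + 1 / n) * ((th x)^2 * (w x / (v x)^2) * (norm (Dv x))^2) + C4 / n" for x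
  proof -
   have w2: "y powr (q - 2) = y powr q / y^2" if "y > 0" for y using that by (simp add: powr_diff)
   have g1: "g x powr (q - 2) <= w x / (v x)^2"
   proof (cases "q < 2")
    case True
    then have "v x <= g x" using v(2)[of x] th[of x] mult_left_mono[of "v x" M "1 - th x"] by (simp add: g_def ka_def algebra_simps)
    then show ?thesis unfolding w_def w2[OF vp(1), symmetric] using True vp by (intro powr_mono2') auto
   next
    case False
    then have "g x <= v x" using v(2)[of x] th[of x] mult_left_mono[of d "v x" "1 - th x"] by (simp add: g_def ka_def algebra_simps)
    then show ?thesis unfolding w_def w2[OF vp(1), symmetric] using False gd(3)[of x] by (intro powr_mono2) auto
   qed
   have g2: "g x powr (q - 2) <= W / d^2"
    unfolding w2[OF gd(3)] using pb[OF gd(1,2), of x] gd(1)[of x] d W1 by (intro frac_le power_mono) auto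
   have "(norm (Dg x))^2 <= (1 + 1 / n) * (norm (th x *\<^sub>R Dv x))^2 + (1 + n) * (norm ((v x - ka) *\<^sub>R Dcut n x))^2"
    unfolding Dg_def by (rule norm_add_sq[OF n0])
   moreover have "(norm ((v x - ka) *\<^sub>R Dcut n x))^2 <= M^2 * (C / n)^2"
   proof -
    have "abs (v x - ka) <= M" using v(2)[of x] kap d by auto
    then have "abs (v x - ka) * norm (Dcut n x) <= M * (C / n)" using cb(3)[of x] M by (intro mult_mono) auto
    then have "(abs (v x - ka) * norm (Dcut n x))^2 <= (M * (C / n))^2" by (intro power_mono) auto
    then show ?thesis unfolding norm_scaleR power_mult_distrib by simp
   qed
   moreover have "(1 + n) * (norm ((v x - ka) *\<^sub>R Dcut n x))^2 <= (1 + n) * (M^2 * (C / n)^2)"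
    using calculation(2) n0 by (intro mult_left_mono) auto
   moreover have "(norm (th x *\<^sub>R Dv x))^2 = (th x)^2 * (norm (Dv x))^2" by (simp add: power_mult_distrib)
   ultimately have "(norm (Dg x))^2 <= (1 + 1 / n) * ((th x)^2 * (norm (Dv x))^2) + (1 + n) * (M^2 * (C / n)^2)"
    by (simp only:)
   also have "(1 + n) * (M^2 * (C / n)^2) <= 2 * (M^2 * C^2) / n"
   proof -
    have "(1 + n) * (M^2 * (C / n)^2) = (1 + n) / n * ((M^2 * C^2) / n)" using n0 by (simp add: power_divide power2_eq_square)
    also have "... <= 2 * ((M^2 * C^2) / n)" using n by (intro mult_right_mono) (auto simp: field_simps)
    finally show ?thesis by simp
   qed
   finally have gg: "(norm (Dg x))^2 <= (1 + 1 / n) * ((th x)^2 * (norm (Dv x))^2) + 2 * (M^2 * C^2) / n" by simp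
   have "g x powr (q - 2) * (norm (Dg x))^2 <= g x powr (q - 2) * ((1 + 1 / n) * ((th x)^2 * (norm (Dv x))^2)) + g x powr (q - 2) * (2 * (M^2 * C^2) / n)"
    unfolding distrib_left[symmetric] by (intro mult_left_mono gg) auto
   also have "... <= w x / (v x)^2 * ((1 + 1 / n) * ((th x)^2 * (norm (Dv x))^2)) + W / d^2 * (2 * (M^2 * C^2) / n)"
    using n0 by (intro add_mono mult_right_mono g1 g2) auto
   also have "... = (1 + 1 / n) * ((th x)^2 * (w x / (v x)^2) * (norm (Dv x))^2) + C4 / n"
    by (simp add: C4_def algebra_simps add_divide_distrib)
   finally show ?thesis .
  qed
  have "DD <= lint (\<mu> t) (%x. (1 + 1 / n) * ((th x)^2 * (w x / (v x)^2) * (norm (Dv x))^2) + C4 / n)"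
   unfolding DD_def by (intro integral_mono Dgi pw Bochner_Integration.integrable_add integrable_mult_right Xi) simp
  also have "... = (1 + 1 / n) * X + C4 / n"
  proof -
   have lin: "lint (\<mu> t) (%x. c1 * f1 x + c2) = c1 * lint (\<mu> t) f1 + c2"
    if "integrable (\<mu> t) f1" for f1 :: "real^'n => real" and c1 c2
    using that by (simp add: prob_space)
   show ?thesis unfolding X_def by (rule lin[OF Xi])
  qed
  finally show ?thesis .
 qed
 have thw: "abs ((th x)^2 * w x) <= W" "0 <= (th x)^2 * w x" for x
 proof -
  have "(th x)^2 <= 1" using th[of x] by (simp add: power_le_one)
  then have "(th x)^2 * w x <= 1 * W" using w[of x] by (intro mult_mono) auto
  then show "abs ((th x)^2 * w x) <= W" "0 <= (th x)^2 * w x" using w[of x] by auto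
 qed
 have th1: "th x = 1" if "norm x <= n" for x using cut_one[OF n0 that] by (simp add: th_def)
 have FnCb: "(%x. (th x)^2 * w x) : Cb" by (rule CbI[OF _ thw(1)]) (intro continuous_intros thc wc)
 have NF: "abs (N - lint (\<mu> t) (%x. (th x)^2 * w x)) <= 2 * W * m"
  unfolding N_def m_def
 proof (rule diff_tail[OF t gqCb FnCb])
  show "abs (g x powr q) <= W" for x using pb[OF gd(1,2), of x] by simp
 qed (use thw gn th1 in "auto simp: w_def")
 have EE: "abs (En - Eg) <= 2 * (W * Lm) * m"
  unfolding En_def Eg_def m_def
 proof (rule diff_tail[OF t EnCb gECb])
  show "abs ((th x)^2 * w x * ln (v x)) <= W * Lm" for x using WL[of "(th x)^2 * w x" "ln (v x)"] thw[of x] pb[of "v x"] v(2)[of x] by auto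
 qed (use gE gn th1 in "auto simp: w_def")
 have Egb: "abs Eg <= W * Lm" unfolding Eg_def by (rule flow_bound[OF mu t gECb gE])
 have NlnN: "abs (N * ln N) <= W * (abs (ln c0) + abs (ln W))"
 proof -
  have "ln c0 <= ln N" "ln N <= ln W" using Nb c0 by auto
  then have "abs (ln N) <= abs (ln c0) + abs (ln W)" by linarith
  then show ?thesis unfolding abs_mult using Nb N0 W1 by (intro mult_mono) auto
 qed
 \<comment> \<open>The share of the dissipation left for the logarithmic Sobolev inequality: 1/n
   went to the mixed term, the factor 1 + 1/n to the gradient of g. The deficit e = q - 1 - c equals
   q/(n+1).\<close>
 define c where "c = (q - 1 - 1 / n) / (1 + 1 / n)"
 define e where "e = q - 1 - c"
 define h where "h = \<eta>\<^sub>0 / K"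
 have h0: "h > 0" using eta K by (simp add: h_def)
 have n1: "1 + 1 / n > 0" using n0 by (simp add: add_pos_pos)
 have cn: "c * (1 + 1 / n) = q - 1 - 1 / n" unfolding c_def using n1 by simp
 have nn: "n * (1 + 1 / n) = n + 1" using n0 by (simp add: distrib_left)
 have "c * (n * (1 + 1 / n)) = n * (c * (1 + 1 / n))" by (simp only: mult_ac)
 also have "... = n * (q - 1) - n * (1 / n)" unfolding cn by (simp only: right_diff_distrib)
 finally have cn': "c * (n + 1) = n * (q - 1) - 1" using n0 unfolding nn by simp
 have c: "0 <= c" "c <= q - 1"
 proof -
  show "0 <= c" unfolding c_def using q n0 by (intro divide_nonneg_pos) (auto intro: add_pos_pos)
  have "(q - 1) * 1 <= (q - 1) * (1 + 1 / n)" using q n0 by (intro mult_left_mono) auto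
  then have "q - 1 - 1 / n <= (q - 1) * (1 + 1 / n)" using n0 by (smt (verit) zero_less_divide_1_iff)
  then show "c <= q - 1" unfolding c_def using n0 by (simp add: divide_le_eq add_pos_pos)
 qed
 have e: "0 <= e" "e <= qm / n"
 proof -
  show "0 <= e" using c by (simp add: e_def)
  have "e * (n + 1) = q" unfolding e_def left_diff_distrib cn' by (simp add: algebra_simps)
  then have "e = q / (n + 1)" using n0 by (simp add: field_simps)
  also have "... <= qm / n" using q n0 by (intro frac_le) auto
  finally show "e <= qm / n" .
 qed
 have cX: "q * (q - 1 - 1 / n) * \<eta>\<^sub>0 * X >= h * c * (Eg - (1 / q) * (N * ln N)) - qm^2 * \<eta>\<^sub>0 * C4 / n"
 proof -
  have "q * (q - 1 - 1 / n) * \<eta>\<^sub>0 * X = q * c * \<eta>\<^sub>0 * ((1 + 1 / n) * X)" unfolding cn[symmetric] by simp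
  also have "... >= q * c * \<eta>\<^sub>0 * (DD - C4 / n)" using DX q c eta by (intro mult_left_mono) auto
  finally have 1: "q * (q - 1 - 1 / n) * \<eta>\<^sub>0 * X >= q * c * \<eta>\<^sub>0 * DD - q * c * \<eta>\<^sub>0 * C4 / n" by (simp add: algebra_simps)
  have "h * c * (Eg - (1 / q) * (N * ln N)) <= h * c * (q * K * DD)" using LSI h0 c by (intro mult_left_mono) auto
  also have "... = q * c * \<eta>\<^sub>0 * DD" using K by (simp add: h_def)
  finally have 2: "h * c * (Eg - (1 / q) * (N * ln N)) <= q * c * \<eta>\<^sub>0 * DD" .
  have "q * c <= qm * qm" using q c by (intro mult_mono) auto
  then have "q * c * \<eta>\<^sub>0 * C4 / n <= qm^2 * \<eta>\<^sub>0 * C4 / n"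
   using eta W1 n0 unfolding power2_eq_square by (intro divide_right_mono mult_right_mono) (auto simp: C4_def)
  then show ?thesis using 1 2 by linarith
 qed
 have q'h: "q' = h * (q - 1)" by (simp add: q' h_def)
 \<comment> \<open>The first summand on the right is a tail, the second and fourth carry the deficit
   e, and the third is the term to be kept.\<close>
 have "q' * En - h * c * (Eg - (1 / q) * (N * ln N)) = q' * (En - Eg) + h * e * Eg + q' / q * (N * ln N) - h * e * (1 / q) * (N * ln N)"
  unfolding q'h e_def by (simp add: algebra_simps diff_divide_distrib)
 moreover have "q' * (En - Eg) <= h * qm * (2 * W * Lm) * m"
 proof -
  have "q' * (En - Eg) <= q' * (2 * (W * Lm) * m)" using EE q h0 unfolding q'h by (intro mult_left_mono) auto
  also have "... <= (h * qm) * (2 * (W * Lm) * m)" unfolding q'h using h0 q W1 Lm0 m0 by (intro mult_right_mono mult_left_mono) auto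
  finally show ?thesis by (simp add: mult_ac)
 qed
 moreover have "h * e * Eg <= h * (qm / n) * (W * Lm)"
 proof -
  have "h * e * Eg <= h * e * (W * Lm)" using Egb h0 e by (intro mult_left_mono) auto
  also have "... <= h * (qm / n) * (W * Lm)" using h0 e W1 Lm0 by (intro mult_right_mono mult_left_mono) auto
  finally show ?thesis .
 qed
 moreover have "- (h * e * (1 / q) * (N * ln N)) <= h * (qm / n) * (W * (abs (ln c0) + abs (ln W)))"
 proof -
  have "- (h * e * (1 / q) * (N * ln N)) <= abs (h * e * (1 / q) * (N * ln N))" by (rule abs_ge_minus_self)
  also have "... = h * e * (1 / q) * abs (N * ln N)" using h0 e q by (simp add: abs_mult)
  also have "... <= h * (qm / n) * 1 * (W * (abs (ln c0) + abs (ln W)))"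
   using h0 e q NlnN n0 by (intro mult_mono) auto
  finally show ?thesis by simp
 qed
 ultimately have fin: "lint (\<mu> t) Lf <= q' / q * (N * ln N) + h * qm * (2 * W * Lm) * m + h * (qm / n) * (W * Lm)
  + h * (qm / n) * (W * (abs (ln c0) + abs (ln W))) + qm^2 * \<eta>\<^sub>0 * C4 / n + (2 + 4 * qm) * W * C * \<Phi> / n"
  using e2 cX by linarith
 have Ph: "\<Phi> >= 0"
 proof -
  have "0 <= (lint (\<mu> t) \<phi>)" by (rule Bochner_Integration.integral_nonneg) (rule phi(2))
  then show ?thesis using mu_phi(2)[OF t] by simp
 qed
 have hC: "hypC d M qm C = h * qm * (2 * W * Lm) + h * qm * (W * Lm + W * (abs (ln c0) + abs (ln W))) + qm^2 * \<eta>\<^sub>0 * C4 + (2 + 4 * qm) * W * C * \<Phi>"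
  by (simp add: hypC_def Let_def W_def Lm_def c0_def h_def C4_def)
 define A1 where "A1 = h * qm * (2 * W * Lm)"
 define A2 where "A2 = h * qm * (W * Lm + W * (abs (ln c0) + abs (ln W))) + qm^2 * \<eta>\<^sub>0 * C4 + (2 + 4 * qm) * W * C * \<Phi>"
 have A: "A1 >= 0" "A2 >= 0"
  unfolding A1_def A2_def C4_def using h0 q W1 Lm0 eta C Ph by (auto intro!: add_nonneg_nonneg mult_nonneg_nonneg)
 have "h * qm * (2 * W * Lm) * m + h * (qm / n) * (W * Lm)
  + h * (qm / n) * (W * (abs (ln c0) + abs (ln W))) + qm^2 * \<eta>\<^sub>0 * C4 / n + (2 + 4 * qm) * W * C * \<Phi> / n = A1 * m + A2 / n"
  unfolding A1_def A2_def by (simp add: add_divide_distrib distrib_left)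
 also have "... <= (A1 + A2) * (1 / n + m)"
 proof -
  have "(A1 + A2) * (1 / n + m) = A1 * m + A2 / n + (A1 / n + A2 * m)" by (simp add: algebra_simps add_divide_distrib)
  moreover have "A1 / n + A2 * m >= 0" using A m0 n0 by simp
  ultimately show ?thesis by linarith
 qed
 also have "A1 + A2 = hypC d M qm C" unfolding hC A1_def A2_def by simp
 finally have "lint (\<mu> t) Lf <= q' / q * (N * ln N) + hypC d M qm C * (1 / n + m)" using fin by linarith
 then show ?thesis using Nb NF unfolding W_def[symmetric] c0_def[symmetric] m_def[symmetric] th_def w_def
  by (intro exI[of _ N]) auto
qed

end

context kolm_mu begin

text \<open>The logarithm of the norm, ln F / q with F the cut-off integral of v^q, has derivative
  (F' - (q'/q) F ln F) / (F q). By \<open>static_est\<close> its numerator is at most a small error,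
  so the logarithm is nonincreasing up to an error, which is removed by n -> infinity. The bounds d
  and M keep F away from 0 and infinity.\<close>

lemma hyp_Cb:
 fixes q :: "real => real"
 assumes s: "s : I" and sT: "s < T" and p: "p > 1" and f: "f : Cb" and d: "0 < d" and fb: "!!x. d <= f x & f x <= M"
  and q_def: "q = (%t. exp (\<eta>\<^sub>0 * inverse K * (t - s)) * (p - 1) + 1)"
 shows "lint (\<mu> T) (%x. (G T s f x) powr q T) powr (1 / q T) <= lint (\<mu> s) (%x. f x powr p) powr (1 / p)"
proof -
 define h where "h = \<eta>\<^sub>0 / K"
 have h0: "h > 0" using eta K by (simp add: h_def)
 define q' where "q' t = h * (q t - 1)" for t
 have q1: "q t > 1" for t unfolding q_def using p by simp
 have qd: "(q has_real_derivative q' t) (at t)" for t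
  unfolding q_def q'_def h_def by (auto intro!: derivative_eq_intros simp: divide_inverse)
 have qcont: "continuous_on A q" for A using qd by (meson DERIV_isCont continuous_at_imp_continuous_on)
 have q'cont: "continuous_on A q'" for A unfolding q'_def by (intro continuous_intros qcont)
 define qm where "qm = q T"
 have h': "\<eta>\<^sub>0 * inverse K = h" by (simp add: h_def divide_inverse)
 have qrange: "p <= q t" "q t <= qm" if "s <= t" "t <= T" for t
 proof -
  have "1 * (p - 1) <= exp (h * (t - s)) * (p - 1)" using that h0 p by (intro mult_right_mono) auto
  then show "p <= q t" by (simp add: q_def h')
  show "q t <= qm" unfolding qm_def q_def h' using that h0 p by (intro add_right_mono mult_right_mono) auto
 qed
 have qs: "q s = p" by (simp add: q_def)
 define W where "W = (max 1 M) powr qm"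
 define c0 where "c0 = (min 1 d) powr qm"
 have c0: "c0 > 0" using d by (simp add: c0_def)
 have W1: "W >= 1" unfolding W_def qm_def using q1[of T] by (intro ge_one_powr_ge_zero) auto
 have tI: "t : I" if "s <= t" for t using I_up[OF s that] .
 have vb: "d <= G t s f x & G t s f x <= M" if "s <= t" for t x by (rule G_bound[OF s that f fb])
 have wb: "c0 <= G t s f x powr q t" "G t s f x powr q t <= W" if "s <= t" "t <= T" for t x
  using real_powr_bounds[of d "G t s f x" M "q t" qm] d vb[OF that(1), of x] q1[of t] qrange[OF that] by (auto simp: c0_def W_def)
 obtain C where C: "C > 0" "!!n t x. n >= 1 ==> t : {s..T} ==> - AA t (Dcut n) (Hcut n) x <= C / n * \<phi> x"
  "!!n t x. n >= 1 ==> t : {s..T} ==> Dcut n x \<bullet> (Q t x *v Dcut n x) <= C / n^2 * \<phi> x"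
  "!!n x. n >= 1 ==> norm (Dcut n (x::real^'n)) <= C / n"
 proof -
  obtain C where C: "C > 0" "ALL n>=1. ALL t:{s..T}. ALL x. - AA t (Dcut n) (Hcut n) x <= C / n * \<phi> x &
   Dcut n x \<bullet> (Q t x *v Dcut n x) <= C / n^2 * \<phi> x & norm (Dcut n x) <= C / n" using cut_bounds[OF s sT] by blast
  have "s : {s..T}" using sT by simp
  then show ?thesis using C by (intro that[of C]) blast+
 qed
 define E where "E = hypC d M qm C"
 \<comment> \<open>Replacing t by \<open>max t s\<close> extends the solution constantly to times
   before s, since \<open>flow_cont\<close> asks for continuity on an open set of times around
   [s,T].\<close>
 define F where "F n t = lint (\<mu> t) (%x. (cut n x)^2 * (G (max t s) s f x) powr q t)" for n t
 define tl where "tl n t = measure (\<mu> t) {x. n < norm x}" for n t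
 have tl0: "tl n t >= 0" for n t by (simp add: tl_def)
 have FCb: "(%x. (cut n x)^2 * (G t s f x) powr q t) : Cb" if t: "s <= t" "t <= T" for n t
 proof (rule CbI)
  show "continuous_on UNIV (%x. (cut n x)^2 * (G t s f x) powr q t)"
   by (intro continuous_intros C2w_cont[OF C2w_cut] G_cont1[OF s t(1) f]) (use vb[OF t(1)] d in "auto simp: less_le", metis order_trans less_le not_less)
  fix x
  have "(cut n x)^2 * (G t s f x) powr q t <= 1 * W" using cut_range[of n x] wb[OF t, of x] c0 by (intro mult_mono power_le_one) auto
  then show "abs ((cut n x)^2 * (G t s f x) powr q t) <= W" by simp
 qed
 have VCb: "(%x. (G t s f x) powr q t) : Cb" if t: "s <= t" "t <= T" for t
 proof (rule CbI)
  show "continuous_on UNIV (%x. (G t s f x) powr q t)"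
   by (intro continuous_intros G_cont1[OF s t(1) f]) (use vb[OF t(1)] d in "auto simp: less_le", metis order_trans less_le not_less)
  show "abs ((G t s f x) powr q t) <= W" for x using wb[OF t, of x] by simp
 qed
 have Fle: "F n t <= W" if t: "s <= t" "t <= T" for n t
 proof -
  have "abs (F n t) <= W" unfolding F_def
  proof (rule flow_bound[OF mu tI[OF t(1)]])
   show "(%x. (cut n x)^2 * (G (max t s) s f x) powr q t) : Cb" using FCb[OF t] t by (simp add: max_def)
   fix x
   have "(cut n x)^2 * (G t s f x) powr q t <= 1 * W" using cut_range[of n x] wb[OF t, of x] c0 by (intro mult_mono power_le_one) auto
   then show "abs ((cut n x)^2 * (G (max t s) s f x) powr q t) <= W" using t by (simp add: max_def)
  qed
  then show ?thesis by simp
 qed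
 have Flim: "abs (F n t - lint (\<mu> t) (%x. (G t s f x) powr q t)) <= 2 * W * tl n t" if t: "s <= t" "t <= T" and n: "n > 0" for n t
 proof -
  have eq: "F n t = lint (\<mu> t) (%x. (cut n x)^2 * (G t s f x) powr q t)" using t by (simp add: F_def max_def)
  show ?thesis unfolding eq tl_def
  proof (rule diff_tail[OF tI[OF t(1)] FCb[OF t] VCb[OF t]])
   fix x
   have "(cut n x)^2 * (G t s f x) powr q t <= 1 * W" using cut_range[of n x] wb[OF t, of x] c0 by (intro mult_mono power_le_one) auto
   then show "abs ((cut n x)^2 * (G t s f x) powr q t) <= W" by simp
   show "abs ((G t s f x) powr q t) <= W" using wb[OF t, of x] by simp
  qed (simp add: cut_one[OF n])
 qed
 have Fcont: "continuous_on {s..T} (F n)" if n: "n >= 1" for n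
  unfolding F_def
 proof (rule flow_cont[OF flow_subset[OF mu] is_interval_cc I_open order_refl, where R = "2 * n"])
  show sub: "{s..T} \<subseteq> I" using tI by auto
  then show "{s..T} \<subseteq> I" .
  have g: "continuous_on (I \<times> UNIV) (%p. G (max (fst p) s) s f (snd p))"
  proof -
   have "continuous_on (I \<times> UNIV) (%p::real \<times> (real^'n). (max (fst p) s, snd p))" by (intro continuous_intros)
   from continuous_on_compose2[OF G_cont[OF s f] this] show ?thesis by force
  qed
  have "continuous_on (I \<times> UNIV) (%p::real \<times> (real^'n). (cut n (snd p))^2)"
   by (intro continuous_intros continuous_on_snd_UNIV C2w_cont[OF C2w_cut])
  moreover have "continuous_on (I \<times> UNIV) (%p. (G (max (fst p) s) s f (snd p)) powr q (fst p))"
  proof (rule continuous_on_powr[OF g])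
   show "continuous_on (I \<times> UNIV) (%p::real \<times> (real^'n). q (fst p))" by (rule continuous_on_fst_Times[OF qcont])
   show "ALL p:I \<times> UNIV. G (max (fst p) s) s f (snd p) ~= 0"
   proof
    fix p :: "real \<times> (real^'n)"
    show "G (max (fst p) s) s f (snd p) ~= 0" using vb[of "max (fst p) s" "snd p"] d by auto
   qed
  qed
  ultimately show "continuous_on (I \<times> UNIV) (%p. (cut n (snd p))^2 * (G (max (fst p) s) s f (snd p)) powr q (fst p))"
   by (rule continuous_on_mult)
  show "(cut n x)^2 * (G (max r s) s f x) powr q r = 0" if "2 * n <= norm x" for r x
   using cut_zero[of n x] that n by simp
 qed
 have Fderiv: "EX F'. (F n has_real_derivative F') (at t) & (EX N. c0 <= N & N <= W & abs (N - F n t) <= 2 * W * tl n t &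
   F' <= q' t / q t * (N * ln N) + E * (1 / n + tl n t))" if n: "n >= 1" "1 / n <= p - 1" and t: "s < t" "t <= T" for n t
 proof -
  have t': "s <= t" using t by simp
  obtain Df where L: "Lsol {s<..} (%t x. (cut n x)^2 * (G t s f x) powr q t)
   (%t x. (cut n x)^2 * (G t s f x) powr q t * (q' t * ln (G t s f x) - q t * (q t - 1) / (G t s f x)^2 * (gradient (G t s f) x \<bullet> (Q t x *v gradient (G t s f) x)))
   + (G t s f x) powr q t * (- 2 * cut n x * AA t (Dcut n) (Hcut n) x - 2 * (Dcut n x \<bullet> (Q t x *v Dcut n x)))
   - 4 * cut n x * (G t s f x) powr q t * q t / G t s f x * (Dcut n x \<bullet> (Q t x *v gradient (G t s f) x))) Df"
   (is "Lsol _ _ ?L _")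
   using entropy_Lsol[OF s f d fb, of q q' n] qd q'cont by blast
  have sub: "{s<..} \<subseteq> I" using tI by auto
  have z: "!!r x. r : {s<..} ==> norm x >= 2 * n ==> (cut n x)^2 * (G r s f x) powr q r = 0"
   using n by (simp add: cut_zero)
  have tU: "t : {s<..}" using t by simp
  note D = Lsol_flow_deriv[OF L flow_subset[OF mu sub] is_interval_oi open_greaterThan order_refl _ tU, of "2 * n"]
  have "((%r. lint (\<mu> r) (%x. (cut n x)^2 * (G r s f x) powr q r)) has_real_derivative (lint (\<mu> t) (%x. ?L t x))) (at t within {s<..})"
   by (rule D(1)) (rule z)
  then have "((%r. lint (\<mu> r) (%x. (cut n x)^2 * (G r s f x) powr q r)) has_real_derivative (lint (\<mu> t) (%x. ?L t x))) (at t)"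
   using t at_within_open[of t "{s<..}"] by simp
  then have Fd: "(F n has_real_derivative (lint (\<mu> t) (%x. ?L t x))) (at t)"
   by (rule has_field_derivative_transform_within_open[of _ _ _ "{s<..}"]) (use t in "auto simp: F_def max_def")
  have LCb: "?L t : Cb" by (rule D(2)) (rule z)
  obtain Tu Hu where cl: "cl12 {s<..} (%t. G t s f) Tu (%t. gradient (G t s f)) Hu"
   using G_cl12[OF s f] by metis
  then have C2: "C2w (G t s f) (gradient (G t s f)) (Hu t)" using t by (simp add: cl12_def)
  have qq: "1 < q t" "q t <= qm" "1 / n <= q t - 1" using q1 qrange[of t] t n by auto
  have tt: "t : {s..T}" using t by simp
  from static_est[OF tI[OF t'] C2 vb[OF t'] d n(1) qq C(1) C(2)[OF n(1) tt] C(3)[OF n(1) tt] C(4)[OF n(1)] _ LCb refl]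
  obtain N where N: "min 1 d powr qm <= N" "N <= max 1 M powr qm"
   "abs (N - lint (\<mu> t) (%x. (cut n x)^2 * G t s f x powr q t)) <= 2 * max 1 M powr qm * measure (\<mu> t) {x. n < norm x}"
   "lint (\<mu> t) (%x. ?L t x) <= q' t / q t * (N * ln N) + hypC d M qm C * (1 / n + measure (\<mu> t) {x. n < norm x})"
   by (auto simp: q'_def h_def)
  then show ?thesis using Fd t by (intro exI conjI) (auto simp: c0_def W_def F_def max_def tl_def E_def)
 qed
 define y where "y n t = ln (F n t) / q t" for n t
 \<comment> \<open>(h + 2|E|) e bounds the numerator of the derivative, and c0/2 is a lower bound of
   its denominator F q.\<close>
 define B where "B = (h + 2 * abs E) * (2 / c0)"
 have B0: "B > 0" using h0 c0 by (simp add: B_def)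
 have step: "EX N1>=1. ALL n>=N1. F n s >= c0 / 2 & F n T >= c0 / 2 & y n T <= y n s + B * e * (T - s)" if e: "e > 0" for e
 proof -
  \<comment> \<open>Used to pass from N ln N, delivered by \<open>static_est\<close>, to F ln F,
    which the derivative of ln F / q requires.\<close>
  have "uniformly_continuous_on {c0/2..W} (%z. z * ln z)"
   by (intro compact_uniformly_continuous continuous_intros) (use c0 in auto)
  then obtain de where de: "de > 0" "!!a b. a : {c0/2..W} ==> b : {c0/2..W} ==> abs (a - b) < de ==> abs (a * ln a - b * ln b) < e"
   unfolding uniformly_continuous_on_def dist_real_def using e by (metis abs_minus_commute)
  \<comment> \<open>A level of tail mass that keeps F >= c0/2, brings N within \<open>de\<close> of
    F and is itself at most e.\<close>
  define ta where "ta = min (c0 / (4 * W)) (min (de / (4 * W)) e)"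
  have tau: "ta > 0" "2 * W * ta <= c0 / 2" "2 * W * ta < de" "ta <= e"
  proof -
   show "ta > 0" using c0 W1 de e by (simp add: ta_def)
   have "2 * W * ta <= 2 * W * (c0 / (4 * W))" using W1 by (intro mult_left_mono) (auto simp: ta_def)
   then show "2 * W * ta <= c0 / 2" using W1 by simp
   have "2 * W * ta <= 2 * W * (de / (4 * W))" using W1 by (intro mult_left_mono) (auto simp: ta_def)
   then show "2 * W * ta < de" using W1 de by simp
   show "ta <= e" by (simp add: ta_def)
  qed
  obtain N0 where N0: "N0 >= 1" "!!n t. n >= N0 ==> t : I ==> tl n t <= ta" using tail[OF tau(1)] unfolding tl_def by blast
  define N1 where "N1 = max N0 (max (1 / (p - 1)) (1 / e))"
  show ?thesis
  proof (intro exI[of _ N1] conjI allI impI)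
   show "1 <= N1" using N0 by (simp add: N1_def)
   fix n assume "N1 <= n"
   then have n: "n >= N0" "n >= 1" "n >= 1 / (p - 1)" "n >= 1 / e" using N0 by (auto simp: N1_def)
   have n': "1 / n <= p - 1" "1 / n <= e" using n p e by (auto simp: field_simps)
   have tle: "2 * W * tl n t <= 2 * W * ta" if "s <= t" for t using N0(2)[OF n(1) tI[OF that]] W1 by (intro mult_left_mono) auto
   have Fge: "F n t >= c0 / 2" if t: "s <= t" "t <= T" for t
   proof -
    have "c0 <= lint (\<mu> t) (%x. (G t s f x) powr q t)"
    proof -
     interpret prob_space "\<mu> t" by (rule mu_prob[OF tI[OF t(1)]])
     show ?thesis using integral_ge_const[OF flow_int(1)[OF mu tI[OF t(1)] VCb[OF t]], of c0] wb[OF t] by auto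
    qed
    then show ?thesis using Flim[OF t, of n] n tle[OF t(1)] tau by linarith
   qed
   show "c0 / 2 <= F n s" "c0 / 2 <= F n T" using Fge sT by auto
   have "y n T - B * e * T <= y n s - B * e * s"
   proof (rule DERIV_nonpos_imp_decreasing_open[where f = "%t. y n t - B * e * t" and a = s and b = T])
    show "s <= T" using sT by simp
    show "continuous_on {s..T} (%t. y n t - B * e * t)"
     unfolding y_def
     using Fge c0 q1 by (intro continuous_intros Fcont n qcont) (fastforce simp: less_le, metis less_numeral_extra(1) not_less_iff_gr_or_eq order_less_trans)
    fix t assume t: "s < t" "t < T"
    then have t': "s <= t" "t <= T" by auto
    obtain F' N where F': "(F n has_real_derivative F') (at t)" "c0 <= N" "N <= W" "abs (N - F n t) <= 2 * W * tl n t"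
      "F' <= q' t / q t * (N * ln N) + E * (1 / n + tl n t)" using Fderiv[OF n(2) n'(1) t(1) t'(2)] by auto
    have Fp: "F n t > 0" using Fge[OF t'] c0 by linarith
    define k where "k = q' t / q t"
    have k: "0 <= k" "k <= h"
    proof -
     show "0 <= k" using q1[of t] h0 by (simp add: k_def q'_def)
     have "h * (q t - 1) <= h * q t" using h0 by (intro mult_left_mono) auto
     then show "k <= h" using q1[of t] by (simp add: k_def q'_def divide_le_eq)
    qed
    have "abs (N * ln N - F n t * ln (F n t)) < e"
    proof (rule de(2))
     show "abs (N - F n t) < de" using F'(4) tle[OF t'(1)] tau by linarith
    qed (use F'(2,3) Fge[OF t'] Fle[OF t', of n] c0 in auto)
    then have "k * (N * ln N) <= k * (F n t * ln (F n t) + e)" using k by (intro mult_left_mono) auto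
    moreover have "k * e <= h * e" using k e by (intro mult_right_mono) auto
    moreover have "E * (1 / n + tl n t) <= abs E * (2 * e)"
    proof -
     have "0 <= 1 / n + tl n t" using n(2) tl0 by simp
     moreover have "1 / n + tl n t <= 2 * e" using n' N0(2)[OF n(1) tI[OF t'(1)]] tau by linarith
     ultimately show ?thesis by (intro mult_mono) auto
    qed
    ultimately have Fk: "F' - k * (F n t * ln (F n t)) <= (h + 2 * abs E) * e"
     using F'(5) unfolding k_def[symmetric] by (simp add: algebra_simps)
    have yd: "((%t. y n t - B * e * t) has_real_derivative (F' - k * (F n t * ln (F n t))) / (F n t * q t) - B * e) (at t)"
    proof -
     have "((%t. y n t - B * e * t) has_real_derivative ((1 / F n t * F') * q t - ln (F n t) * q' t) / (q t * q t) - B * e * 1) (at t)"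
      unfolding y_def using Fp q1[of t]
      by (intro DERIV_diff DERIV_divide DERIV_cmult DERIV_ident qd DERIV_chain2[OF DERIV_ln_divide F'(1)]) auto
     moreover have "((1 / F n t * F') * q t - ln (F n t) * q' t) / (q t * q t) - B * e * 1 = (F' - k * (F n t * ln (F n t))) / (F n t * q t) - B * e"
      using Fp q1[of t] by (simp add: k_def field_simps)
     ultimately show ?thesis by (simp only:)
    qed
    have Fq: "F n t * q t >= c0 / 2"
    proof -
     have "c0 / 2 * 1 <= F n t * q t" using Fge[OF t'] q1[of t] c0 by (intro mult_mono) auto
     then show ?thesis by simp
    qed
    have "(F' - k * (F n t * ln (F n t))) / (F n t * q t) <= ((h + 2 * abs E) * e) / (c0 / 2)"
    proof -
     have "(F' - k * (F n t * ln (F n t))) / (F n t * q t) <= ((h + 2 * abs E) * e) / (F n t * q t)"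
      using Fk Fq c0 by (intro divide_right_mono) auto
     also have "... <= ((h + 2 * abs E) * e) / (c0 / 2)"
      using Fq c0 h0 e Fp q1[of t] by (intro divide_left_mono mult_pos_pos) auto
     finally show ?thesis .
    qed
    also have "... = B * e" by (simp add: B_def)
    finally show "EX z. ((%t. y n t - B * e * t) has_real_derivative z) (at t) & z <= 0"
     using yd by (intro exI conjI) auto
   qed
   then show "y n T <= y n s + B * e * (T - s)" by (simp add: algebra_simps)
  qed
 qed
 define Fi where "Fi t = lint (\<mu> t) (%x. (G t s f x) powr q t)" for t
 have Fic: "Fi t >= c0" if t: "s <= t" "t <= T" for t
 proof -
  interpret prob_space "\<mu> t" by (rule mu_prob[OF tI[OF t(1)]])
  show ?thesis unfolding Fi_def using integral_ge_const[OF flow_int(1)[OF mu tI[OF t(1)] VCb[OF t]], of c0] wb[OF t] by auto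
 qed
 have Ft: "(%n. F (real n) t) \<longlonglongrightarrow> Fi t" if t: "s <= t" "t <= T" for t
 proof (rule LIMSEQ_I)
  fix r :: real assume r: "0 < r"
  then have "r / (4 * W) > 0" using W1 by simp
  from tail[OF this] obtain N0 where N0: "N0 >= 1" "!!n. n >= N0 ==> tl n t <= r / (4 * W)" using tI[OF t(1)] unfolding tl_def by blast
  show "EX no. ALL n>=no. norm (F (real n) t - Fi t) < r"
  proof (intro exI[of _ "nat \<lceil>N0\<rceil>"] allI impI)
   fix n assume "nat \<lceil>N0\<rceil> <= n"
   then have n: "real n >= N0" by linarith
   then have "real n > 0" using N0 by linarith
   have "2 * W * tl n t <= 2 * W * (r / (4 * W))" using N0(2)[OF n] W1 by (intro mult_left_mono) auto
   also have "... < r" using W1 r by simp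
   finally show "norm (F (real n) t - Fi t) < r" using Flim[OF t \<open>real n > 0\<close>] by (simp add: Fi_def)
  qed
 qed
 have yt: "(%n. y (real n) t) \<longlonglongrightarrow> ln (Fi t) / q t" if t: "s <= t" "t <= T" for t
  unfolding y_def using Fic[OF t] c0 q1[of t] by (intro tendsto_divide tendsto_ln Ft t tendsto_const) auto
 have "ln (Fi T) / q T <= ln (Fi s) / q s"
 proof (rule field_le_epsilon)
  fix e :: real assume e: "e > 0"
  define e' where "e' = e / (B * (T - s))"
  have "e' > 0" using e B0 sT by (simp add: e'_def)
  from step[OF this] obtain N1 where N1: "!!n. n >= N1 ==> y n T <= y n s + B * e' * (T - s)" by blast
  have be: "B * e' * (T - s) = e" using B0 sT by (simp add: e'_def)
  show "ln (Fi T) / q T <= ln (Fi s) / q s + e"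
  proof (rule LIMSEQ_le[OF yt tendsto_add[OF yt tendsto_const]])
   show "EX N. ALL n>=N. y (real n) T <= y (real n) s + e"
   proof (intro exI[of _ "nat \<lceil>N1\<rceil>"] allI impI)
    fix n assume "nat \<lceil>N1\<rceil> <= n"
    then have "real n >= N1" by linarith
    from N1[OF this] show "y (real n) T <= y (real n) s + e" by (simp only: be)
   qed
  qed (use sT in auto)
 qed
 moreover have Fp: "Fi T > 0" "Fi s > 0" using Fic[of T] Fic[of s] c0 sT by auto
 ultimately have "(Fi T) powr (1 / q T) <= (Fi s) powr (1 / p)" by (simp add: powr_def qs)
 moreover have "Fi s = lint (\<mu> s) (%x. f x powr p)" unfolding Fi_def qs G_init[OF s f] ..
 ultimately show ?thesis by (simp add: Fi_def)
qed

end

section \<open>Measurability of the transition kernels\<close>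

lemma open_Cb_approx:
 fixes U :: "(real ^ 'n::finite) set"
 assumes "open U"
 obtains f :: "nat => real ^ 'n => real" where "!!k. f k : Cb" "!!k x. 0 <= f k x & f k x <= 1" "!!x. (%k. f k x) \<longlonglongrightarrow> indicator U x"
proof (cases "U = UNIV")
 case True
 then show ?thesis by (intro that[of "%k x. 1"]) (auto intro: CbI[of _ 1])
next
 case False
 \<comment> \<open>\<open>infdist\<close> to the empty set is 0, which would make these functions
   vanish; hence the separate case of the whole space.\<close>
 define f where "f k x = min 1 (real k * infdist x (- U))" for k x
 have "f k : Cb" for k
 proof (rule CbI[of _ 1])
  show "continuous_on UNIV (f k)" unfolding f_def by (intro continuous_intros)
 qed (auto simp: f_def min_def infdist_nonneg)
 moreover have "0 <= f k x & f k x <= 1" for k x by (simp add: f_def infdist_nonneg)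
 moreover have "(%k. f k x) \<longlonglongrightarrow> indicator U x" for x
 proof (cases "x : U")
  case True
  have "closed (- U)" "- U ~= {}" using assms False by auto
  then have "infdist x (- U) > 0" using True in_closed_iff_infdist_zero[of "- U" x] infdist_nonneg[of x "- U"] by force
  then obtain N where N: "real N * infdist x (- U) > 1" using reals_Archimedean3 by blast
  have "f k x = 1" if "k >= N" for k
  proof -
   have "real N * infdist x (- U) <= real k * infdist x (- U)" using that by (intro mult_right_mono) (auto simp: infdist_nonneg)
   then show ?thesis using N by (simp add: f_def)
  qed
  then have "eventually (%k. f k x = 1) sequentially" unfolding eventually_sequentially by blast
  then show ?thesis using True by (simp add: tendsto_eventually)
 next
  case False
  then have "infdist x (- U) = 0" by simp
  then show ?thesis using False by (simp add: f_def)
 qed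
 ultimately show ?thesis by (rule that)
qed

lemma Cb_limit_integral:
 fixes f :: "nat => real ^ 'n::finite => real"
 assumes m: "finite_measure m" "sets m = sets borel" and f: "!!k. f k : Bmeas" "!!k x. abs (f k x) <= B" "!!x. (%k. f k x) \<longlonglongrightarrow> g x"
  and g: "g : Bmeas"
 shows "(%k. lint m (f k)) \<longlonglongrightarrow> (lint m (%x. g x))"
proof -
 interpret finite_measure m by fact
 have c: "(borel_measurable m :: (real^'n => real) set) = Bmeas" by (rule measurable_cong_sets[OF m(2) refl])
 show ?thesis
  by (rule integral_dominated_convergence[where w = "%x. B"]) (use f g in "auto simp: c")
qed

lemma measure_open_limit:
 fixes f :: "nat => real ^ 'n::finite => real"
 assumes m: "finite_measure m" "sets m = sets borel" and f: "!!k. f k : Cb" "!!k x. 0 <= f k x & f k x <= 1" "!!x. (%k. f k x) \<longlonglongrightarrow> indicator U x"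
  and U: "open U"
 shows "(%k. lint m (f k)) \<longlonglongrightarrow> measure m U"
proof -
 interpret finite_measure m by fact
 have sp: "space m = UNIV" using sets_eq_imp_space_eq[OF m(2)] by simp
 have "(%k. lint m (f k)) \<longlonglongrightarrow> (lint m (indicator U))"
 proof (rule Cb_limit_integral[OF m, of _ 1])
  show "abs (f k x) <= 1" for k x using f(2)[of k x] by (simp add: abs_le_iff)
 qed (use f U in "auto simp: Cb_measurable")
 then show ?thesis using sp by simp
qed

lemma sets_borel_open: "sets (borel :: 'a::topological_space measure) = sigma_sets UNIV (Collect open)"
 by (simp add: borel_def)

lemma Cb_measure_eq:
 fixes A B :: "(real ^ 'n::finite) measure"
 assumes A: "prob_space A" "sets A = sets borel" and B: "prob_space B" "sets B = sets borel"
  and eq: "!!f. f : Cb ==> (lint A f) = lint B f"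
 shows "A = B"
proof (rule measure_eqI_generator_eq[where E = "Collect open" and \<Omega> = UNIV and A = "%i. UNIV"])
 interpret A: prob_space A by fact
 interpret B: prob_space B by fact
 show "Int_stable (Collect open :: (real^'n) set set)" by (auto simp: Int_stable_def)
 fix U :: "(real^'n) set" assume "U : Collect open"
 then have U: "open U" by simp
 obtain f :: "nat => real ^ 'n => real" where f: "!!k. f k : Cb" "!!k x. 0 <= f k x & f k x <= 1" "!!x. (%k. f k x) \<longlonglongrightarrow> indicator U x"
  using open_Cb_approx[OF U] by metis
 have "measure A U = measure B U"
  using LIMSEQ_unique[OF measure_open_limit[OF A.finite_measure_axioms A(2) f U]] measure_open_limit[OF B.finite_measure_axioms B(2) f U]
  unfolding eq[OF f(1)] by blast
 then show "emeasure A U = emeasure B U" by (simp add: A.emeasure_eq_measure B.emeasure_eq_measure)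
next
 show "emeasure A UNIV ~= \<infinity>" for i :: nat
  using finite_measure.emeasure_finite[OF prob_space.finite_measure[OF A(1)]] by simp
qed (use assms in "auto simp: sets_borel_open")

lemma Cb_test_limit:
 fixes f :: "real ^ 'n::finite => real"
 assumes "f : Cb"
 obtains p :: "nat => real ^ 'n => real" and B where "!!k. EX D H. test (p k) D H" "!!k x. abs (p k x) <= B" "!!x. (%k. p k x) \<longlonglongrightarrow> f x"
proof -
 obtain B where B: "continuous_on UNIV f" "B > 0" "!!x. abs (f x) <= B" using assms by (rule CbE) blast
 have "EX p D H. test p D H & (ALL x. abs (cut (real (Suc k)) x * f x - p x) <= 1 / real (Suc k))" for k
  by (rule Cc_approx[of _ "2 * real (Suc k)"]) (auto intro!: continuous_intros C2w_cont[OF C2w_cut] B simp: cut_zero)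
 then obtain p where p: "!!k. EX D H. test (p k) D H" "!!k x. abs (cut (real (Suc k)) x * f x - p k x) <= 1 / real (Suc k)" by metis
 have "abs (p k x) <= B + 1" for k x
 proof -
  have "abs (cut (real (Suc k)) x * f x) <= 1 * B" unfolding abs_mult using cut_range[of "real (Suc k)" x] B by (intro mult_mono) auto
  moreover have "1 / real (Suc k) <= 1" by simp
  ultimately show ?thesis using p(2)[of k x] by linarith
 qed
 moreover have "(%k. p k x) \<longlonglongrightarrow> f x" for x
 proof -
  have "(%k. cut (real (Suc k)) x * f x - p k x) \<longlonglongrightarrow> 0"
   by (rule Lim_null_comparison[OF _ LIMSEQ_Suc[OF lim_1_over_n]]) (use p(2) in auto)
  moreover have "eventually (%k. cut (real (Suc k)) x * f x = f x) sequentially"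
   unfolding eventually_sequentially
  proof (intro exI[of _ "nat \<lceil>norm x\<rceil>"] allI impI)
   fix k assume "nat \<lceil>norm x\<rceil> <= k"
   then have "norm x <= real (Suc k)" by linarith
   then show "cut (real (Suc k)) x * f x = f x" using cut_one[of "real (Suc k)" x] by simp
  qed
  then have "(%k. cut (real (Suc k)) x * f x) \<longlonglongrightarrow> f x" by (rule tendsto_eventually)
  ultimately show ?thesis using tendsto_diff by fastforce
 qed
 ultimately show ?thesis using p(1) that by blast
qed

text \<open>Test functions approximate bounded continuous functions boundedly and pointwise, and
  these approximate indicators of open sets, which generate the Borel sets. Starting from test
  functions matters: the joint continuity in \<open>G_joint_cont\<close> is obtained for
  them.\<close>

lemma meas_kernel:
 fixes ka :: "'a => (real ^ 'n::finite) measure"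
 assumes k: "!!om. om : space M ==> prob_space (ka om)" "!!om. om : space M ==> sets (ka om) = sets borel"
  and t: "!!f D H. test f D H ==> (%om. lint (ka om) f) : borel_measurable M"
 shows "ka : M \<rightarrow>\<^sub>M prob_algebra borel"
proof (rule measurable_prob_algebra_generated[where G = "Collect open" and \<Omega> = UNIV])
 show "sets (borel :: (real^'n) measure) = sigma_sets UNIV (Collect open)" by (rule sets_borel_open)
 show "Int_stable (Collect open :: (real^'n) set set)" by (auto simp: Int_stable_def)
 fix U :: "(real^'n) set" assume "U : Collect open"
 then have U: "open U" by simp
 have cb: "(%om. lint (ka om) f) : borel_measurable M" if fc: "f : Cb" for f :: "real^'n => real"
 proof -
  obtain p :: "nat => real ^ 'n => real" and B where p: "!!k. EX D H. test (p k) D H" "!!k x. abs (p k x) <= B" "!!x. (%k. p k x) \<longlonglongrightarrow> f x"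
   using Cb_test_limit[OF fc] by metis
  have pm: "p k : Bmeas" for k using p(1) test_Cb Cb_measurable by blast
  show ?thesis
  proof (rule borel_measurable_LIMSEQ_real)
   show "(%om. lint (ka om) (p k)) : borel_measurable M" for k using p(1) t by blast
   fix om assume w: "om : space M"
   show "(%k. lint (ka om) (p k)) \<longlonglongrightarrow> (lint (ka om) f)"
    by (rule Cb_limit_integral[OF prob_space.finite_measure[OF k(1)[OF w]] k(2)[OF w] pm p(2,3) Cb_measurable[OF fc]])
  qed
 qed
 obtain f :: "nat => real ^ 'n => real" where f: "!!k. f k : Cb" "!!k x. 0 <= f k x & f k x <= 1" "!!x. (%k. f k x) \<longlonglongrightarrow> indicator U x"
  using open_Cb_approx[OF U] by metis
 have "(%om. measure (ka om) U) : borel_measurable M"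
 proof (rule borel_measurable_LIMSEQ_real)
  fix om assume w: "om : space M"
  show "(%k. lint (ka om) (f k)) \<longlonglongrightarrow> measure (ka om) U"
   by (rule measure_open_limit[OF prob_space.finite_measure[OF k(1)[OF w]] k(2)[OF w] f U])
 qed (rule cb[OF f(1)])
 then have "(%om. ennreal (measure (ka om) U)) : borel_measurable M" by simp
 then show "(%om. emeasure (ka om) U) : borel_measurable M"
  by (rule measurable_cong[THEN iffD1, rotated]) (use k in "auto simp: finite_measure.emeasure_eq_measure prob_space.finite_measure")
qed (use k in auto)

context kolm begin

lemma P_kernel: assumes "s : I" "s <= t" shows "P t s : borel \<rightarrow>\<^sub>M prob_algebra borel"
proof (rule meas_kernel)
 fix f :: "real^'n => real" and D H assume "test f D H"
 then have f: "f : Cb" by (rule test_Cb)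
 show "(%x. lint (P t s x) f) : Bmeas"
  using Cb_measurable[OF G_Cb[OF assms f]] P(3)[OF assms f, symmetric] by (simp cong: measurable_cong)
qed (use P assms in auto)

lemma P_kernel_sub: "s : I ==> s <= t ==> P t s : borel \<rightarrow>\<^sub>M subprob_algebra borel"
 by (rule measurable_prob_algebraD[OF P_kernel])

text \<open>Turns the invariance, stated for bounded continuous functions, into an identity of
  measures, and thereby into \<open>flow_nn\<close> for every nonnegative Borel function. The same
  identity for the flow of transition probabilities is the Chapman-Kolmogorov equation.\<close>

lemma flow_bind:
 assumes fl: "flow J m" and r: "r : J" "t : J" "r <= t"
 shows "bind (m t) (P t r) = m r"
proof (rule Cb_measure_eq)
 have rI: "r : I" using fl r by (auto simp: flow_def)
 interpret mt: prob_space "m t" using fl r by (auto simp: flow_def)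
 interpret mr: prob_space "m r" using fl r by (auto simp: flow_def)
 have st: "sets (m t) = sets borel" "sets (m r) = sets borel" using fl r by (auto simp: flow_def)
 have sp: "space (m t) = UNIV" using sets_eq_imp_space_eq[OF st(1)] by simp
 have Km: "P t r : m t \<rightarrow>\<^sub>M prob_algebra borel" using P_kernel[OF rI r(3)] measurable_cong_sets[OF st(1) refl] by blast
 have Ks: "P t r : m t \<rightarrow>\<^sub>M subprob_algebra borel" by (rule measurable_prob_algebraD[OF Km])
 show bp: "prob_space (bind (m t) (P t r))" using Km prob_space_bind'[OF _ Km] mt.prob_space_axioms by (auto simp: space_prob_algebra sets_eq_imp_space_eq)
 show bs: "sets (bind (m t) (P t r)) = sets borel" by (rule sets_bind) (use P rI r sp in auto)
 show "prob_space (m r)" "sets (m r) = sets borel" by (rule mr.prob_space_axioms, rule st)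
 fix f :: "real^'n => real" assume f: "f : Cb"
 \<comment> \<open>Nonnegative functions come first, because composition of kernels is available for
   nonnegative integrals; the general case adds the constant B.\<close>
 have main: "lint (bind (m t) (P t r)) f = lint (m r) f" if f: "f : Cb" "!!x. f x >= 0" for f :: "real^'n => real"
 proof -
  have Gp: "G t r f x >= 0" for x unfolding P(3)[OF rI r(3) f(1)] using f(2) by simp
  have "ennreal (lint (bind (m t) (P t r)) f) = nint (bind (m t) (P t r)) (%x. ennreal (f x))"
   using Cb_integrable[OF f(1) prob_space.finite_measure[OF bp] bs] f(2) by (simp add: nn_integral_eq_integral)
  also have "... = nint (m t) (%x. nint (P t r x) (%y. ennreal (f y)))"
   by (rule nn_integral_bind[OF _ Ks]) (use Cb_measurable[OF f(1)] in auto)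
  also have "... = nint (m t) (%x. ennreal (G t r f x))"
  proof (rule nn_integral_cong)
   fix x
   show "nint (P t r x) (%y. ennreal (f y)) = ennreal (G t r f x)"
    unfolding P(3)[OF rI r(3) f(1)] using Cb_integrable[OF f(1) prob_space.finite_measure[OF P(1)] P(2)] rI r f(2)
    by (simp add: nn_integral_eq_integral)
  qed
  also have "... = ennreal (lint (m t) (G t r f))"
   using flow_int(1)[OF fl r(2) G_Cb[OF rI r(3) f(1)]] Gp by (simp add: nn_integral_eq_integral)
  also have "... = ennreal (lint (m r) f)" using flow_eq[OF fl r f(1)] by simp
  finally show ?thesis using f(2) by (simp add: Bochner_Integration.integral_nonneg)
 qed
 obtain B where B: "continuous_on UNIV f" "!!x. abs (f x) <= B" using f by (rule CbE) blast
 have fB: "(%x. f x + B) : Cb"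
 proof (rule CbI[of _ "2 * B"])
  show "abs (f x + B) <= 2 * B" for x using B(2)[of x] by linarith
 qed (intro continuous_intros B)
 have "f x + B >= 0" for x using B(2)[of x] by linarith
 interpret bnd: prob_space "bind (m t) (P t r)" by (rule bp)
 from main[OF fB \<open>!!x. f x + B >= 0\<close>] show "lint (bind (m t) (P t r)) f = lint (m r) f"
  using Cb_integrable[OF f prob_space.finite_measure[OF bp] bs] flow_int(1)[OF fl r(1) f]
   by (simp add: bnd.prob_space mr.prob_space)
qed

lemma flow_nn:
 assumes fl: "flow J m" and r: "r : J" "t : J" "r <= t" and g: "g : Bmeas"
 shows "nint (m t) (%x. nint (P t r x) (%y. g y)) = nint (m r) (%x. g x)"
proof -
 have rI: "r : I" using fl r by (auto simp: flow_def)
 have st: "sets (m t) = sets borel" using fl r by (auto simp: flow_def)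
 have Ks: "P t r : m t \<rightarrow>\<^sub>M subprob_algebra borel" using P_kernel_sub[OF rI r(3)] measurable_cong_sets[OF st refl] by blast
 show ?thesis unfolding flow_bind[OF fl r, symmetric] by (rule nn_integral_bind[OF g Ks, symmetric])
qed

lemma P_nn:
 assumes "s : I" "s <= r" "r <= t" and g: "g : Bmeas"
 shows "nint (P t r x) (%y. nint (P r s y) (%z. g z)) = nint (P t s x) (%z. g z)"
 using flow_nn[OF flow_P[of t x], of s r g] assms I_up[of s r] by auto

lemma P_nn_meas: "s : I ==> s <= t ==> g : Bmeas ==> (%x. nint (P t s x) (%y. g y)) : Bmeas"
 by (rule measurable_compose[OF P_kernel_sub nn_integral_measurable_subprob_algebra])

text \<open>Continuity in the initial time: G(t,r) f - G(t,r') f is G(t,r') applied to G(r',r) f -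
  f, and for a test function the latter is of order r' - r uniformly in space. Continuity in space
  at r0 then gives joint continuity.\<close>

lemma G_joint_cont:
 assumes f: "test f D H"
 shows "continuous_on ((I \<inter> {..t}) \<times> UNIV) (%p. G t (fst p) f (snd p))"
 unfolding continuous_on_iff
proof (intro ballI allI impI)
 fix p0 :: "real \<times> (real^'n)" and e :: real assume p0: "p0 : (I \<inter> {..t}) \<times> UNIV" and e: "e > 0"
 obtain r0 x0 where p0e: "p0 = (r0, x0)" by force
 have r0: "r0 : I" "r0 <= t" using p0 p0e by auto
 have fCb: "f : Cb" by (rule test_Cb[OF f])
 have tI: "t : I" using I_up r0 by blast
 have C2: "C2w f D H" and Hc: "continuous_on UNIV H" using f by (auto simp: test_def)
 obtain p D' H' de M where pp: "de > 0" "cball r0 de \<subseteq> I" by (meson I_open open_contains_cball r0(1))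
 obtain R where R: "!!x. norm x >= R ==> f x = 0" using f by (auto simp: test_def)
 have c: "continuous_on (cball r0 de \<times> UNIV) (%p. AA (fst p) D H (snd p))"
  by (rule AA_cont) (use pp C2 Hc in "auto intro!: continuous_on_snd_UNIV C2w_contD")
 have z: "AA r D H x = 0" if "norm x >= R + 1" for r x
  using C2w_zero_out[OF C2 R, of R x] that by (simp add: AA_def)
 obtain M where M: "M > 0" "!!r x. r : cball r0 de ==> abs (AA r D H x) <= M" using cl12_compact_bound[OF compact_cball c z] by metis
 have est: "abs (G t r f x - G t r' f x) <= M * (r' - r)" if "r : cball r0 de" "r' : cball r0 de" "r <= r'" "r' <= t" for r r' x
 proof -
  have rI: "r : I" "r' : I" using that pp by auto
  have st: "abs (f y - G r' r f y) <= M * (r' - r)" for y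
  proof (rule test_step[OF f rI(1) that(3)])
   fix ro y assume "r <= ro" "ro <= r'"
   then have "ro : cball r0 de" using that by (auto simp: dist_real_def)
   then show "abs (AA ro D H y) <= M" by (rule M)
  qed
  have gc: "G r' r f : Cb" by (rule G_Cb[OF rI(1) that(3) fCb])
  have dC: "(%y. f y - G r' r f y) : Cb" by (rule CbI[OF _ st]) (use fCb gc in "auto simp: Cb_def intro!: continuous_intros")
  have "G t r' (%y. f y - G r' r f y) x = G t r' f x - G t r f x"
  proof -
   have "G t r' (%y. f y - G r' r f y) x = G t r' f x - G t r' (G r' r f) x"
    unfolding P(3)[OF rI(2) that(4) dC] P(3)[OF rI(2) that(4) fCb] P(3)[OF rI(2) that(4) gc]
    using Cb_integrable[OF fCb prob_space.finite_measure[OF P(1)[OF rI(2) that(4)]] P(2)[OF rI(2) that(4)]]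
     Cb_integrable[OF gc prob_space.finite_measure[OF P(1)[OF rI(2) that(4)]] P(2)[OF rI(2) that(4)]] by simp
   then show ?thesis using evolution_law[OF rI(1) that(3,4) fCb] by simp
  qed
  moreover have "- (M * (r' - r)) <= f y - G r' r f y & f y - G r' r f y <= M * (r' - r)" for y using st[of y] by (simp add: abs_le_iff)
  from G_bound[OF rI(2) that(4) dC this, of x] have "abs (G t r' (%y. f y - G r' r f y) x) <= M * (r' - r)" by (simp add: abs_le_iff)
  ultimately show ?thesis by linarith
 qed
 have "continuous_on UNIV (G t r0 f)" by (rule G_cont1[OF r0 fCb])
 then obtain d where d: "d > 0" "!!x. dist x x0 < d ==> dist (G t r0 f x) (G t r0 f x0) < e / 2"
  unfolding continuous_on_iff using e by (metis UNIV_I half_gt_zero)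
 show "EX d>0. ALL x':(I \<inter> {..t}) \<times> UNIV. dist x' p0 < d --> dist (G t (fst x') f (snd x')) (G t (fst p0) f (snd p0)) < e"
 proof (intro exI[of _ "min d (min de (e / (2 * M)))"] conjI ballI impI)
  show "0 < min d (min de (e / (2 * M)))" using d pp M e by simp
  fix p' assume p': "p' : (I \<inter> {..t}) \<times> (UNIV :: (real^'n) set)" "dist p' p0 < min d (min de (e / (2 * M)))"
  obtain r x where pe: "p' = (r, x)" by force
  have r: "r : I" "r <= t" using p' pe by auto
  have ds: "dist r r0 <= dist p' p0" "dist x x0 <= dist p' p0"
   unfolding pe p0e using dist_fst_le[of "(r,x)" "(r0,x0)"] dist_snd_le[of "(r,x)" "(r0,x0)"] by auto
  have rc: "r : cball r0 de" "r0 : cball r0 de" using ds p' pp by (auto simp: dist_commute)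
  have "abs (r - r0) < e / (2 * M)" using ds(1) p'(2) by (simp add: dist_real_def)
  then have s: "M * abs (r - r0) < e / 2" using M by (simp add: field_simps)
  have "abs (G t r f x - G t r0 f x) <= M * abs (r - r0)"
  proof (cases "r <= r0")
   case True then show ?thesis using est[OF rc True r0(2), of x] by simp
  next
   case False
   then have "r0 <= r" by simp
   from est[OF rc(2,1) this r(2), of x] False show ?thesis by simp
  qed
  moreover have "abs (G t r0 f x - G t r0 f x0) < e / 2" using d(2)[of x] ds p'(2) by (simp add: dist_real_def)
  ultimately show "dist (G t (fst p') f (snd p')) (G t (fst p0) f (snd p0)) < e"
   using s unfolding pe p0e dist_real_def fst_conv snd_conv by linarith
 qed
qed

text \<open>A total version of \<open>P\<close>, with Dirac measures for inadmissible times, so that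
  joint measurability can be stated on the whole product space.\<close>

definition PK :: "real => real => real ^ 'n => (real ^ 'n) measure" where
 "PK t r x = (if r : I & r <= t then P t r x else return borel x)"

lemma PK_eq: "r : I ==> r <= t ==> PK t r x = P t r x" by (simp add: PK_def)

lemma PK_prob: "prob_space (PK t r x)" "sets (PK t r x) = sets borel"
 using P by (auto simp: PK_def prob_space_return)

lemma meas_piecewise:
 fixes f g :: "real \<times> (real^'n) => real"
 assumes "S : sets borel" "continuous_on S f" "continuous_on UNIV g"
 shows "(%p. if p : S then f p else g p) : Bmeas"
proof -
 have "(%p. indicator S p *\<^sub>R f p) : Bmeas" by (rule borel_measurable_continuous_on_indicator[OF assms(1,2)])
 moreover have "g : Bmeas" by (rule borel_measurable_continuous_onI[OF assms(3)])
 ultimately have "(%p. indicator S p *\<^sub>R f p + indicator (- S) p * g p) : Bmeas" using assms(1) by measurable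
 moreover have "(%p. indicator S p *\<^sub>R f p + indicator (- S) p * g p) = (%p. if p : S then f p else g p)"
  by (auto simp: indicator_def fun_eq_iff)
 ultimately show ?thesis by simp
qed

lemma PK_meas_r: "(%p. PK t (fst p) (snd p)) : borel \<rightarrow>\<^sub>M prob_algebra borel"
proof (rule meas_kernel)
 fix f :: "real^'n => real" and D H assume tst: "test f D H"
 then have f: "f : Cb" by (rule test_Cb)
 have "I \<inter> {..t} : sets borel" using I_open by simp
 then have S: "(I \<inter> {..t}) \<times> (UNIV :: (real^'n) set) : sets borel" by (simp add: borel_prod[symmetric])
 have "(%p. if p : (I \<inter> {..t}) \<times> UNIV then G t (fst p) f (snd p) else f (snd p)) : Bmeas"
  by (rule meas_piecewise[OF S G_joint_cont[OF tst]]) (use f in "auto simp: Cb_def intro!: continuous_on_snd_UNIV")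
 moreover have "(%p. if p : (I \<inter> {..t}) \<times> UNIV then G t (fst p) f (snd p) else f (snd p)) = (%p. lint (PK t (fst p) (snd p)) f)"
  using Cb_measurable[OF f] by (auto simp: fun_eq_iff PK_def P(3)[OF _ _ f] integral_return)
 ultimately show "(%p. lint (PK t (fst p) (snd p)) f) : Bmeas" by simp
qed (use PK_prob in auto)

lemma PK_meas_t: assumes "s : I" shows "(%p. PK (fst p) s (snd p)) : borel \<rightarrow>\<^sub>M prob_algebra borel"
proof (rule meas_kernel)
 fix f :: "real^'n => real" and D H assume tst: "test f D H"
 then have f: "f : Cb" by (rule test_Cb)
 have S: "{s..} \<times> (UNIV :: (real^'n) set) : sets borel" by (simp add: borel_prod[symmetric])
 have "(%p. if p : {s..} \<times> UNIV then G (fst p) s f (snd p) else f (snd p)) : Bmeas"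
  by (rule meas_piecewise[OF S G_cont[OF assms f]]) (use f in "auto simp: Cb_def intro!: continuous_on_snd_UNIV")
 moreover have "(%p. if p : {s..} \<times> UNIV then G (fst p) s f (snd p) else f (snd p)) = (%p. lint (PK (fst p) s (snd p)) f)"
  using Cb_measurable[OF f] assms by (auto simp: fun_eq_iff PK_def P(3)[OF _ _ f] integral_return)
 ultimately show "(%p. lint (PK (fst p) s (snd p)) f) : Bmeas" by simp
qed (use PK_prob in auto)

lemma flow_meas:
 assumes fl: "flow I m"
 shows "(%t. if t : I then m t else return borel 0) : borel \<rightarrow>\<^sub>M prob_algebra borel"
proof (rule meas_kernel)
 fix f :: "real^'n => real" and D H assume tst: "test f D H"
 then have f: "f : Cb" by (rule test_Cb)
 obtain R where R: "!!x. norm x >= R ==> f x = 0" using tst by (auto simp: test_def)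
 have Iint: "is_interval I"
  unfolding is_interval_1 using I_up by blast
 have "continuous_on I (%r. lint (m r) f)"
  by (rule flow_cont[OF fl Iint I_open order_refl order_refl, of "%r. f" R]) (use f R in "auto simp: Cb_def intro!: continuous_on_snd_UNIV")
 from borel_measurable_continuous_on_indicator[OF _ this] have 1: "(%r. indicator I r *\<^sub>R lint (m r) f) : Bmeas"
  using I_open by simp
 have "(%r. indicator I r *\<^sub>R lint (m r) f + indicator (- I) r * f 0) : Bmeas" using 1 I_open by measurable
 moreover have "(%r. indicator I r *\<^sub>R lint (m r) f + indicator (- I) r * f 0) = (%t. lint ((if t : I then m t else return borel 0)) f)"
  using Cb_measurable[OF f] by (auto simp: fun_eq_iff integral_return)
 ultimately show "(%t. lint ((if t : I then m t else return borel 0)) f) : Bmeas" by simp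
qed (use fl in "auto simp: flow_def prob_space_return")

end

section \<open>Hypercontractivity beyond bounded continuous functions\<close>

lemma indicator_Cb_approx:
 fixes m :: "(real ^ 'n::finite) measure"
 assumes m: "finite_measure m" "sets m = sets borel" and A: "A : sets borel" and e: "e > 0"
 shows "EX f:Cb. lint m (%x. abs (indicator A x - f x)) < e"
proof -
 interpret finite_measure m by fact
 have sp: "space m = UNIV" using sets_eq_imp_space_eq[OF m(2)] by simp
 have "emeasure m A = (INF U\<in>{U. A \<subseteq> U & open U}. emeasure m U)"
  by (rule outer_regular[OF m(2) _ A]) simp
 moreover have "emeasure m A < emeasure m A + ennreal (e / 2)"
  using e by (simp add: emeasure_eq_measure ennreal_plus[symmetric] ennreal_less_iff del: ennreal_plus)
 ultimately have "(INF U\<in>{U. A \<subseteq> U & open U}. emeasure m U) < emeasure m A + ennreal (e / 2)" by simp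
 then obtain U where U: "A \<subseteq> U" "open U" "emeasure m U < emeasure m A + ennreal (e / 2)"
  unfolding INF_less_iff by auto
 have mU: "measure m U < measure m A + e / 2"
  using U(3) e by (simp add: emeasure_eq_measure ennreal_plus[symmetric] ennreal_less_iff del: ennreal_plus)
 obtain f :: "nat => real ^ 'n => real" where f: "!!k. f k : Cb" "!!k x. 0 <= f k x & f k x <= 1" "!!x. (%k. f k x) \<longlonglongrightarrow> indicator U x"
  using open_Cb_approx[OF U(2)] by metis
 have "(%k. lint m (%x. abs (indicator U x - f k x))) \<longlonglongrightarrow> (lint m (%x. 0))"
 proof (rule Cb_limit_integral[OF m])
  show "(%x. abs (indicator U x - f k x)) : Bmeas" for k
  proof -
   have [measurable]: "U : sets borel" "f k : Bmeas" using U(2) Cb_measurable[OF f(1)] by auto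
   show ?thesis by measurable
  qed
  show "\<bar>\<bar>indicator U x - f k x\<bar>\<bar> <= 1" for k x using f(2)[of k x] by (auto simp: indicator_def)
  show "(%k. abs (indicator U x - f k x)) \<longlonglongrightarrow> 0" for x
   using tendsto_rabs[OF tendsto_diff[OF tendsto_const[of "indicator U x"] f(3)[of x]]] by simp
 qed auto
 from LIMSEQ_D[OF this, of "e / 2"] e obtain k where "norm (lint m (%x. abs (indicator U x - f k x)) - lint m (%x. 0)) < e / 2"
  by auto
 then have k: "lint m (%x. abs (indicator U x - f k x)) < e / 2" by simp
 have fi: "integrable m (f k)" by (rule Cb_integrable[OF f(1) m])
 have AU: "A : sets m" "U : sets m" using A U m by auto
 have "lint m (%x. abs (indicator A x - f k x)) <= lint m (%x. (indicator U x - indicator A x) + abs (indicator U x - f k x))"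
 proof (rule integral_mono)
  show "integrable m (%x. abs (indicator A x - f k x))" using AU fi by (auto simp: emeasure_eq_measure)
  show "integrable m (%x. (indicator U x - indicator A x) + abs (indicator U x - f k x))" using AU fi by (auto simp: emeasure_eq_measure)
  show "abs (indicator A x - f k x) <= (indicator U x - indicator A x) + abs (indicator U x - f k x)" for x
   using U(1) f(2)[of k x] by (auto simp: indicator_def)
 qed
 also have "... = measure m U - measure m A + lint m (%x. abs (indicator U x - f k x))"
  using AU fi by (simp add: emeasure_eq_measure sp)
 also have "... < e" using mU k by simp
 finally show ?thesis using f(1) by blast
qed

lemma Cb_add: "f : Cb ==> g : Cb ==> (%x. f x + g x) : Cb"
proof -
 assume a: "f : Cb" "g : Cb"
 obtain B where B: "continuous_on UNIV f" "!!x. abs (f x) <= B" using a(1) by (rule CbE) blast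
 obtain B' where B': "continuous_on UNIV g" "!!x. abs (g x) <= B'" using a(2) by (rule CbE) blast
 show ?thesis
 proof (rule CbI[of _ "B + B'"])
  show "abs (f x + g x) <= B + B'" for x using B(2)[of x] B'(2)[of x] by linarith
 qed (intro continuous_intros B B')
qed

lemma Cb_cmult: "f : Cb ==> (%x. c * f x) : Cb"
proof -
 assume a: "f : Cb"
 obtain B where B: "continuous_on UNIV f" "!!x. abs (f x) <= B" using a by (rule CbE) blast
 show ?thesis
  by (rule CbI[of _ "abs c * B"]) (auto simp: abs_mult intro!: mult_left_mono continuous_intros B)
qed

lemma L1_Cb_dense:
 fixes m :: "(real ^ 'n::finite) measure" and F :: "real ^ 'n => real"
 assumes m: "finite_measure m" "sets m = sets borel" and F: "integrable m F" and e: "e > 0"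
 shows "EX f:Cb. lint m (%x. abs (F x - f x)) < e"
proof -
 interpret finite_measure m by fact
 have sp: "space m = UNIV" using sets_eq_imp_space_eq[OF m(2)] by simp
 note ic = Cb_integrable[OF _ m]
 have "ALL e>0. EX f:Cb. lint m (%x. abs (F x - f x)) < e"
  using F
 proof (induct rule: integrable_induct)
  case (base A c)
  show ?case
  proof (intro allI impI)
   fix e :: real assume e: "e > 0"
   have "e / (abs c + 1) > 0" using e by simp
   then obtain f where f: "f : Cb" "lint m (%x. abs (indicator A x - f x)) < e / (abs c + 1)"
    using indicator_Cb_approx[OF m, of A "e / (abs c + 1)"] base m by auto
   have "lint m (%x. abs (indicator A x *\<^sub>R c - c * f x)) = lint m (%x. abs c * abs (indicator A x - f x))"
    by (intro Bochner_Integration.integral_cong refl) (simp add: abs_mult[symmetric] right_diff_distrib mult.commute)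
   also have "... = abs c * lint m (%x. abs (indicator A x - f x))" by simp
   also have "... <= abs c * (e / (abs c + 1))" using f by (intro mult_left_mono) auto
   also have "... < e" using e by (simp add: field_simps)
   finally show "EX f:Cb. lint m (%x. abs (indicator A x *\<^sub>R c - f x)) < e"
    by (intro bexI[OF _ Cb_cmult[OF f(1), of c]])
  qed
 next
  case (add g h)
  show ?case
  proof (intro allI impI)
   fix e :: real assume e: "e > 0"
   then have e2: "e / 2 > 0" by simp
   obtain f where f: "f : Cb" "lint m (%x. abs (g x - f x)) < e / 2" using add(2) e2 by blast
   obtain f' where f': "f' : Cb" "lint m (%x. abs (h x - f' x)) < e / 2" using add(4) e2 by blast
   note i = add(1,3) ic[OF f(1)] ic[OF f'(1)]
   have "lint m (%x. abs (g x + h x - (f x + f' x))) <= lint m (%x. abs (g x - f x) + abs (h x - f' x))"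
    by (rule integral_mono) (use i in auto)
   also have "... = lint m (%x. abs (g x - f x)) + lint m (%x. abs (h x - f' x))" using i by simp
   also have "... < e" using f f' by simp
   finally show "EX f:Cb. lint m (%x. abs (g x + h x - f x)) < e"
    by (intro bexI[OF _ Cb_add[OF f(1) f'(1)]])
  qed
 next
  case (lim g s)
  show ?case
  proof (intro allI impI)
   fix e :: real assume e: "e > 0"
   then have e2: "e / 2 > 0" by simp
   have "(%i. lint m (%x. abs (g x - s i x))) \<longlonglongrightarrow> (lint m (%x. 0))"
   proof (rule integral_dominated_convergence[where w = "%x. 3 * abs (g x)"])
    show "(%x. abs (g x - s i x)) : borel_measurable m" for i using lim(1)[of i] lim(5) by auto
    show "integrable m (%x. 3 * abs (g x))" using lim(5) by simp
    show "AE x in m. (%i. abs (g x - s i x)) \<longlonglongrightarrow> 0"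
    proof (rule AE_I2)
     fix x assume "x : space m"
     from tendsto_rabs[OF tendsto_diff[OF tendsto_const[of "g x"] lim(3)[OF this]]]
     show "(%i. abs (g x - s i x)) \<longlonglongrightarrow> 0" by simp
    qed
    show "AE x in m. norm \<bar>g x - s i x\<bar> <= 3 * abs (g x)" for i
    proof (rule AE_I2)
     fix x assume "x : space m"
     then show "norm \<bar>g x - s i x\<bar> <= 3 * abs (g x)" using lim(4)[of x i] by simp
    qed
   qed simp
   from LIMSEQ_D[OF this e2] obtain i where "norm (lint m (%x. abs (g x - s i x)) - lint m (%x. 0)) < e / 2"
    by auto
   then have i: "lint m (%x. abs (g x - s i x)) < e / 2" by simp
   obtain f where f: "f : Cb" "lint m (%x. abs (s i x - f x)) < e / 2" using lim(2) e2 by blast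
   note ii = lim(1)[of i] lim(5) ic[OF f(1)]
   have "lint m (%x. abs (g x - f x)) <= lint m (%x. abs (g x - s i x) + abs (s i x - f x))"
    by (rule integral_mono) (use ii in auto)
   also have "... = lint m (%x. abs (g x - s i x)) + lint m (%x. abs (s i x - f x))" using ii by simp
   also have "... < e" using i f by simp
   finally show "EX f:Cb. lint m (%x. abs (g x - f x)) < e" using f(1) by blast
  qed
 qed
 then show ?thesis using e by blast
qed

text \<open>Clamping an approximant to [lo,hi] only brings it closer to F, whose values lie
  there.\<close>

lemma L1_Cb_dense_clamp:
 fixes m :: "(real ^ 'n::finite) measure" and F :: "real ^ 'n => real"
 assumes m: "finite_measure m" "sets m = sets borel" and F: "F : Bmeas" "!!x. lo <= F x & F x <= hi" and e: "e > 0"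
 shows "EX f:Cb. (ALL x. lo <= f x & f x <= hi) & (lint m (%x. abs (F x - f x))) < e"
proof -
 interpret finite_measure m by fact
 have c: "(borel_measurable m :: (real^'n => real) set) = Bmeas" by (rule measurable_cong_sets[OF m(2) refl])
 have Fb: "abs (F x) <= abs lo + abs hi" for x using F(2)[of x] by linarith
 have Fi: "integrable m F" by (rule integrable_const_bound[of _ "abs lo + abs hi"]) (use F Fb c in auto)
 obtain f where f: "f : Cb" "lint m (%x. abs (F x - f x)) < e" using L1_Cb_dense[OF m Fi e] by blast
 have lh: "lo <= hi" using F(2)[of 0] by linarith
 define g where "g x = max lo (min hi (f x))" for x
 have gr: "lo <= g x & g x <= hi" for x using lh by (auto simp: g_def)
 have gC: "g : Cb"
 proof (rule CbI[of _ "abs lo + abs hi"])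
  have "continuous_on UNIV f" using f by (simp add: Cb_def)
  then show "continuous_on UNIV g" unfolding g_def by (intro continuous_intros)
  show "abs (g x) <= abs lo + abs hi" for x using gr[of x] by linarith
 qed
 have "lint m (%x. abs (F x - g x)) <= lint m (%x. abs (F x - f x))"
 proof (rule integral_mono)
  show "abs (F x - g x) <= abs (F x - f x)" for x using F(2)[of x] by (auto simp: g_def max_def min_def)
 qed (use Fi Cb_integrable[OF f(1) m] Cb_integrable[OF gC m] in auto)
 then show ?thesis using gC gr f by (intro bexI[of _ g]) auto
qed

lemma powr_lipschitz:
 fixes a b M q :: real
 assumes "0 <= a" "a <= M" "0 <= b" "b <= M" "1 <= q"
 shows "abs (a powr q - b powr q) <= q * M powr (q - 1) * abs (a - b)"
proof -
 have main: "b powr q - a powr q <= q * M powr (q - 1) * (b - a)" if ab: "0 <= a" "a < b" "b <= M" for a b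
 proof (cases "a = 0")
  case True
  have "b powr q = b powr (q - 1) * b" using ab True by (simp add: powr_diff)
  also have "... <= M powr (q - 1) * b" using ab assms True by (intro mult_right_mono powr_mono2) auto
  also have "... <= q * (M powr (q - 1) * b)" using assms ab True mult_right_mono[of 1 q "M powr (q - 1) * b"] by simp
  finally show ?thesis using True by (simp add: mult_ac)
 next
  case False
  have "EX z. a < z & z < b & b powr q - a powr q = (b - a) * (q * z powr (q - 1))"
   by (rule MVT2[OF ab(2)]) (use ab False in "auto intro!: derivative_eq_intros")
  then obtain z where z: "a < z" "z < b" "b powr q - a powr q = (b - a) * (q * z powr (q - 1))" by blast
  have "(b - a) * (q * z powr (q - 1)) <= (b - a) * (q * M powr (q - 1))"
   using z ab assms by (intro mult_left_mono powr_mono2) auto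
  then show ?thesis using z by (simp add: mult_ac)
 qed
 consider "a < b" | "a = b" | "b < a" by linarith
 then show ?thesis
 proof cases
  case 1
  then have "a powr q <= b powr q" using assms by (intro powr_mono2) auto
  then show ?thesis using main[of a b] 1 assms by simp
 next
  case 3
  then have "b powr q <= a powr q" using assms by (intro powr_mono2) auto
  then show ?thesis using main[of b a] 3 assms by simp
 qed simp
qed

lemma powr_cont_0: "q > 0 ==> continuous_on {0..} (%z::real. z powr q)"
 by (intro continuous_on_powr') (auto intro!: continuous_intros)

context kolm_mu begin

text \<open>The kernels are probability measures, so adding a constant commutes with
  \<open>G\<close>. \<open>hyp_Cb\<close> is applied to f + d with d > 0, and d tends to 0.\<close>

lemma hyp_Cb0:
 fixes q :: real
 assumes s: "s : I" and sT: "s < T" and p: "p > 1" and f: "f : Cb" and fb: "!!x. 0 <= f x & f x <= M"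
  and q_def: "q = exp (\<eta>\<^sub>0 * inverse K * (T - s)) * (p - 1) + 1"
 shows "lint (\<mu> T) (%x. (G T s f x) powr q) powr (1 / q) <= lint (\<mu> s) (%x. f x powr p) powr (1 / p)"
proof -
 have q1: "q > 1" unfolding q_def using p by simp
 have TI: "T : I" using I_up[OF s] sT by simp
 have M0: "M >= 0" using fb[of 0] by linarith
 define d where "d k = inverse (real (Suc k))" for k
 have d: "d k > 0" "d k <= 1" for k by (auto simp: d_def inverse_le_1_iff)
 have dl: "d \<longlonglongrightarrow> 0" unfolding d_def by (rule LIMSEQ_inverse_real_of_nat)
 interpret Ps: prob_space "\<mu> s" by (rule mu_prob[OF s])
 interpret Pt: prob_space "\<mu> T" by (rule mu_prob[OF TI])
 have fd: "(%x. f x + d k) : Cb" for k by (rule Cb_add[OF f]) (auto intro: CbI[of _ "abs (d k)"])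
 have Gd: "G T s (%x. f x + d k) x = G T s f x + d k" for k x
 proof -
  interpret Px: prob_space "P T s x" by (rule P(1)[OF s]) (use sT in simp)
  have sT': "s <= T" using sT by simp
  show ?thesis unfolding P(3)[OF s sT' fd] P(3)[OF s sT' f]
   using Cb_integrable[OF f Px.finite_measure_axioms P(2)[OF s sT']] by (simp add: Px.prob_space)
 qed
 have Gb: "0 <= G T s f x & G T s f x <= M" for x by (rule G_bound[OF s _ f fb]) (use sT in simp)
 have GC: "G T s f : Cb" by (rule G_Cb[OF s _ f]) (use sT in simp)
 have ineq: "lint (\<mu> T) (%x. (G T s f x + d k) powr q) powr (1 / q) <= lint (\<mu> s) (%x. (f x + d k) powr p) powr (1 / p)" for k
 proof -
  have "d k <= f x + d k & f x + d k <= M + 1" for x using fb[of x] d[of k] by auto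
  from hyp_Cb[OF s sT p fd d(1) this refl] show ?thesis unfolding Gd q_def .
 qed
 have lim: "(%k. lint (\<mu> t) (%x. (g x + d k) powr r)) \<longlonglongrightarrow> (lint (\<mu> t) (%x. g x powr r))"
  if g: "g : Cb" "!!x. 0 <= g x & g x <= M" and r: "r > 1" and t: "t : I" for g r t
 proof (rule Cb_limit_integral[OF prob_space.finite_measure[OF mu_prob[OF t]] mu_sets[OF t]])
  have gm: "g : Bmeas" by (rule Cb_measurable[OF g(1)])
  show "(%x. (g x + d k) powr r) : Bmeas" for k using gm by measurable
  show "(%x. g x powr r) : Bmeas" using gm by measurable
  show "abs ((g x + d k) powr r) <= (M + 1) powr r" for k x
   using g(2)[of x] d[of k] r by (auto intro!: powr_mono2)
  show "(%k. (g x + d k) powr r) \<longlonglongrightarrow> g x powr r" for x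
  proof -
   have "(%k. g x + d k) \<longlonglongrightarrow> g x" using tendsto_add[OF tendsto_const dl, of "g x"] by simp
   moreover have "ALL k. g x + d k : {0..}"
   proof
    fix k show "g x + d k : {0..}" using g(2)[of x] d(1)[of k] by simp
   qed
   ultimately show ?thesis using powr_cont_0[of r] r g(2)[of x] unfolding continuous_on_sequentially comp_def by auto
  qed
 qed
 have lim2: "(%k. X k powr r) \<longlonglongrightarrow> x powr r" if "X \<longlonglongrightarrow> x" "r > 0" "!!k. X k >= 0" for X :: "nat => real" and x r
 proof -
  have "x >= 0" using LIMSEQ_le_const[OF that(1), of 0] that(3) by auto
  then show ?thesis using powr_cont_0[OF that(2)] that(1,3) unfolding continuous_on_sequentially comp_def by auto
 qed
 show ?thesis
 proof (rule LIMSEQ_le)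
  show "(%k. lint (\<mu> T) (%x. (G T s f x + d k) powr q) powr (1 / q)) \<longlonglongrightarrow> (lint (\<mu> T) (%x. (G T s f x) powr q)) powr (1 / q)"
   by (rule lim2[OF lim[OF GC Gb q1 TI]]) (use q1 in auto)
  show "(%k. lint (\<mu> s) (%x. (f x + d k) powr p) powr (1 / p)) \<longlonglongrightarrow> (lint (\<mu> s) (%x. f x powr p)) powr (1 / p)"
   by (rule lim2[OF lim[OF f fb p s]]) (use p in auto)
 qed (use ineq in auto)
qed

text \<open>A bounded Borel function is approximated in L^1 of the initial measure by continuous
  functions within the same bounds. The kernel does not increase the L^1 distance, and on [0,M] the
  powers are Lipschitz, so both sides of the inequality converge.\<close>

lemma hyp_bdd:
 fixes q :: real
 assumes s: "s : I" and sT: "s < T" and p: "p > 1" and F: "F : Bmeas" "!!x. 0 <= F x & F x <= M"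
  and q_def: "q = exp (\<eta>\<^sub>0 * inverse K * (T - s)) * (p - 1) + 1"
 shows "lint (\<mu> T) (%x. lint (P T s x) F powr q) powr (1 / q) <= lint (\<mu> s) (%x. F x powr p) powr (1 / p)"
proof -
 have q1: "q > 1" unfolding q_def using p by simp
 have TI: "T : I" using I_up[OF s] sT by simp
 have sT': "s <= T" using sT by simp
 have M0: "M >= 0" using F(2)[of 0] by linarith
 have fin: "finite_measure (\<mu> s)" by (rule prob_space.finite_measure[OF mu_prob[OF s]])
 have cs: "(borel_measurable (\<mu> t) :: (real^'n => real) set) = Bmeas" if "t : I" for t
  by (rule measurable_cong_sets[OF mu_sets[OF that] refl])
 have cP: "(borel_measurable (P T s x) :: (real^'n => real) set) = Bmeas" for x
  by (rule measurable_cong_sets[OF P(2)[OF s sT'] refl])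
 have bi: "integrable m g" if "finite_measure m" "sets m = sets borel" "g : Bmeas" "!!x. 0 <= g x & g x <= B"
  for m :: "(real^'n) measure" and g :: "real^'n => real" and B
 proof -
  have "abs (g x) <= B" for x using that(4)[of x] by simp
  moreover have "(borel_measurable m :: (real^'n => real) set) = Bmeas"
   by (rule measurable_cong_sets[OF that(2) refl])
  ultimately show ?thesis using that(3) by (intro finite_measure.integrable_const_bound[OF that(1), of _ B]) auto
 qed
 have fP: "finite_measure (P T s x)" for x by (rule prob_space.finite_measure[OF P(1)[OF s sT']])
 have fT: "finite_measure (\<mu> T)" by (rule prob_space.finite_measure[OF mu_prob[OF TI]])
 define V where "V g x = lint (P T s x) (%y. g y)" for g :: "real^'n => real" and x
 have Vm: "V g : Bmeas" if "g : Bmeas" for g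
  unfolding V_def by (rule measurable_compose[OF P_kernel_sub[OF s sT'] integral_measurable_subprob_algebra[OF that]])
 have Vb: "0 <= V g x & V g x <= B" if "g : Bmeas" "!!x. 0 <= g x & g x <= B" for g x B
 proof -
  interpret prob_space "P T s x" by (rule P(1)[OF s sT'])
  note i = bi[OF fP P(2)[OF s sT'] that]
  show ?thesis unfolding V_def using integral_ge_const[OF i, of 0] integral_le_const[OF i, of B] that(2) by auto
 qed
 have Vint: "lint (\<mu> T) (V g) = lint (\<mu> s) (%x. g x)" if g: "g : Bmeas" "!!x. 0 <= g x & g x <= B" for g B
 proof -
  have "ennreal (lint (\<mu> T) (V g)) = nint (\<mu> T) (%x. ennreal (V g x))"
   using bi[OF fT mu_sets[OF TI] Vm[OF g(1)] Vb[OF g]] Vb[OF g] by (simp add: nn_integral_eq_integral)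
  also have "... = nint (\<mu> T) (%x. nint (P T s x) (%y. ennreal (g y)))"
   unfolding V_def using bi[OF fP P(2)[OF s sT'] g] g(2) by (simp add: nn_integral_eq_integral)
  also have "... = nint (\<mu> s) (%x. ennreal (g x))" by (rule flow_nn[OF mu s TI sT']) (use g in auto)
  also have "... = ennreal (lint (\<mu> s) (%x. g x))" using bi[OF fin mu_sets[OF s] g] g(2) by (simp add: nn_integral_eq_integral)
  finally show ?thesis using Vb[OF g] g(2) by (simp add: Bochner_Integration.integral_nonneg)
 qed
 obtain f where f: "!!k. f k : Cb" "!!k x. 0 <= f k x & f k x <= M" "!!k. lint (\<mu> s) (%x. abs (F x - f k x)) < inverse (real (Suc k))"
 proof -
  have "EX f:Cb. (ALL x. 0 <= f x & f x <= M) & (lint (\<mu> s) (%x. abs (F x - f x))) < inverse (real (Suc k))" for k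
   by (rule L1_Cb_dense_clamp[OF fin mu_sets[OF s] F]) simp
  then show ?thesis using that by metis
 qed
 have fm: "f k : Bmeas" for k by (rule Cb_measurable[OF f(1)])
 have dm: "(%x. abs (F x - f k x)) : Bmeas" for k using F(1) fm[of k] by measurable
 have db: "0 <= abs (F x - f k x) & abs (F x - f k x) <= M" for k x using F(2)[of x] f(2)[of k x] by auto
 have conv: "(%k. lint (\<mu> t) (%x. g k x powr r)) \<longlonglongrightarrow> (lint (\<mu> t) (%x. g0 x powr r))"
  if t: "t : I" and r: "r > 1" and g: "!!k. g k : Bmeas" "!!k x. 0 <= g k x & g k x <= M"
   and g0: "g0 : Bmeas" "!!x. 0 <= g0 x & g0 x <= M"
   and c: "!!k. lint (\<mu> t) (%x. abs (g0 x - g k x)) <= inverse (real (Suc k))" for t r g g0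
 proof -
  have fin: "finite_measure (\<mu> t)" by (rule prob_space.finite_measure[OF mu_prob[OF t]])
  have pb: "0 <= z powr r & z powr r <= M powr r" if "0 <= z & z <= M" for z using that r by (auto intro!: powr_mono2)
  have ik: "integrable (\<mu> t) (%x. g k x powr r)" for k
   by (rule bi[OF fin mu_sets[OF t], of _ "M powr r"]) (use g pb in auto)
  have i0: "integrable (\<mu> t) (%x. g0 x powr r)"
   by (rule bi[OF fin mu_sets[OF t], of _ "M powr r"]) (use g0 pb in auto)
  have id: "integrable (\<mu> t) (%x. abs (g0 x - g k x))" for k
  proof (rule bi[OF fin mu_sets[OF t], of _ M])
   show "(%x. abs (g0 x - g k x)) : Bmeas" using g(1)[of k] g0(1) by measurable
   show "0 <= abs (g0 x - g k x) & abs (g0 x - g k x) <= M" for x using g(2)[of k x] g0(2)[of x] by auto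
  qed
  have le: "norm (lint (\<mu> t) (%x. g k x powr r) - lint (\<mu> t) (%x. g0 x powr r)) <= r * M powr (r - 1) * inverse (real (Suc k))" for k
  proof -
   have "lint (\<mu> t) (%x. g k x powr r) - lint (\<mu> t) (%x. g0 x powr r) = lint (\<mu> t) (%x. g k x powr r - g0 x powr r)" using ik i0 by simp
   also have "abs (...) <= lint (\<mu> t) (%x. abs (g k x powr r - g0 x powr r))" by (rule integral_abs_bound)
   also have "... <= lint (\<mu> t) (%x. r * M powr (r - 1) * abs (g0 x - g k x))"
   proof (rule integral_mono)
    show "integrable (\<mu> t) (%x. abs (g k x powr r - g0 x powr r))" using ik i0 by simp
    show "integrable (\<mu> t) (%x. r * M powr (r - 1) * abs (g0 x - g k x))" using id by simp
    show "abs (g k x powr r - g0 x powr r) <= r * M powr (r - 1) * abs (g0 x - g k x)" for x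
     using powr_lipschitz[of "g k x" M "g0 x" r] g(2)[of k x] g0(2)[of x] r by (simp add: abs_minus_commute)
   qed
   also have "... = r * M powr (r - 1) * lint (\<mu> t) (%x. abs (g0 x - g k x))" by simp
   also have "... <= r * M powr (r - 1) * inverse (real (Suc k))" using c r by (intro mult_left_mono) auto
   finally show ?thesis by simp
  qed
  have "(%k. r * M powr (r - 1) * inverse (real (Suc k))) \<longlonglongrightarrow> 0"
   using tendsto_mult[OF tendsto_const LIMSEQ_inverse_real_of_nat] by simp
  from this have "(%k. lint (\<mu> t) (%x. g k x powr r) - lint (\<mu> t) (%x. g0 x powr r)) \<longlonglongrightarrow> 0"
   by (rule Lim_null_comparison[rotated]) (intro always_eventually allI le)
  then show ?thesis by (rule LIM_zero_cancel)
 qed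
 have c1: "(%k. lint (\<mu> s) (%x. f k x powr p)) \<longlonglongrightarrow> (lint (\<mu> s) (%x. F x powr p))"
  by (rule conv[OF s p fm f(2) F less_imp_le[OF f(3)]])
 have c2: "(%k. lint (\<mu> T) (%x. V (f k) x powr q)) \<longlonglongrightarrow> (lint (\<mu> T) (%x. V F x powr q))"
 proof (rule conv[OF TI q1 Vm[OF fm] Vb[OF fm f(2)] Vm[OF F(1)] Vb[OF F]])
  fix k
  have pw: "abs (V F x - V (f k) x) <= V (%x. abs (F x - f k x)) x" for x
  proof -
   have "V F x - V (f k) x = lint (P T s x) (%y. F y - f k y)" unfolding V_def
    using bi[OF fP P(2)[OF s sT'] F] bi[OF fP P(2)[OF s sT'] fm f(2)] by simp
   then show ?thesis unfolding V_def using integral_abs_bound[of "P T s x" "%y. F y - f k y"] by simp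
  qed
  have "lint (\<mu> T) (%x. abs (V F x - V (f k) x)) <= lint (\<mu> T) (%x. V (%x. abs (F x - f k x)) x)"
  proof (rule integral_mono)
   show "integrable (\<mu> T) (V (%x. abs (F x - f k x)))" by (rule bi[OF fT mu_sets[OF TI] Vm[OF dm] Vb[OF dm db]])
   show "integrable (\<mu> T) (%x. abs (V F x - V (f k) x))"
    using bi[OF fT mu_sets[OF TI] Vm[OF F(1)] Vb[OF F]] bi[OF fT mu_sets[OF TI] Vm[OF fm] Vb[OF fm f(2)]] by simp
  qed (rule pw)
  also have "... = lint (\<mu> s) (%x. abs (F x - f k x))" by (rule Vint[OF dm db])
  also have "... <= inverse (real (Suc k))" using f(3)[of k] by simp
  finally show "lint (\<mu> T) (%x. abs (V F x - V (f k) x)) <= inverse (real (Suc k))" .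
 qed
 have lim2: "(%k. X k powr r) \<longlonglongrightarrow> x powr r" if "X \<longlonglongrightarrow> x" "r > 0" "!!k. X k >= 0" for X :: "nat => real" and x r
 proof -
  have "x >= 0" using LIMSEQ_le_const[OF that(1), of 0] that(3) by auto
  then show ?thesis using powr_cont_0[OF that(2)] that(1,3) unfolding continuous_on_sequentially comp_def by auto
 qed
 have "lint (\<mu> T) (%x. V F x powr q) powr (1 / q) <= lint (\<mu> s) (%x. F x powr p) powr (1 / p)"
 proof (rule LIMSEQ_le[OF lim2[OF c2] lim2[OF c1]])
  have "lint (\<mu> T) (%x. V (f k) x powr q) powr (1 / q) <= lint (\<mu> s) (%x. f k x powr p) powr (1 / p)" for k
   using hyp_Cb0[OF s sT p f(1) f(2) q_def, of k] unfolding P(3)[OF s sT' f(1)] V_def .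
  then show "EX N. ALL k>=N. lint (\<mu> T) (%x. V (f k) x powr q) powr (1 / q) <= lint (\<mu> s) (%x. f k x powr p) powr (1 / p)" by blast
 qed (use p q1 in auto)
 then show ?thesis unfolding V_def .
qed

text \<open>Truncation from above, monotone convergence under each kernel and Fatou's lemma.
  \<open>enn2real\<close> has the default value 0 at infinity; \<open>fin\<close> says that almost
  everywhere it is the true integral.\<close>

lemma hyp_nn:
 fixes q :: real
 assumes s: "s : I" and sT: "s < T" and p: "p > 1" and F: "F : Bmeas" "!!x. 0 <= F x"
  and Fp: "integrable (\<mu> s) (%x. F x powr p)"
  and q_def: "q = exp (\<eta>\<^sub>0 * inverse K * (T - s)) * (p - 1) + 1"
  and fin: "AE x in \<mu> T. nint (P T s x) (%y. ennreal (F y)) < \<infinity>"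
 shows "nint (\<mu> T) (%x. ennreal (enn2real (nint (P T s x) (%y. ennreal (F y))) powr q))
  <= ennreal (lint (\<mu> s) (%x. F x powr p) powr (q / p))"
proof -
 have q1: "q > 1" unfolding q_def using p by simp
 have TI: "T : I" using I_up[OF s] sT by simp
 have sT': "s <= T" using sT by simp
 define N where "N = lint (\<mu> s) (%x. F x powr p)"
 have N0: "N >= 0" by (simp add: N_def)
 have cP: "(borel_measurable (P T s x) :: (real^'n => real) set) = Bmeas" for x
  by (rule measurable_cong_sets[OF P(2)[OF s sT'] refl])
 have cP': "(borel_measurable (P T s x) :: (real^'n => ennreal) set) = Bmeas" for x
  by (rule measurable_cong_sets[OF P(2)[OF s sT'] refl])
 have cT': "(borel_measurable (\<mu> T) :: (real^'n => ennreal) set) = Bmeas"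
  by (rule measurable_cong_sets[OF mu_sets[OF TI] refl])
 define Fn where "Fn n x = min (F x) (real n)" for n x
 have Fnm: "Fn n : Bmeas" for n unfolding Fn_def using F(1) by measurable
 have Fnb: "0 <= Fn n x & Fn n x <= real n" for n x using F(2)[of x] by (simp add: Fn_def)
 define V where "V n x = lint (P T s x) (Fn n)" for n x
 have Fni: "integrable (P T s x) (Fn n)" for n x
 proof -
  have "abs (Fn n y) <= real n" for y using Fnb[of n y] by simp
  then show ?thesis using Fnm cP
   by (intro finite_measure.integrable_const_bound[OF prob_space.finite_measure[OF P(1)[OF s sT']], of _ "real n"]) auto
 qed
 have V0: "V n x >= 0" for n x unfolding V_def using Fnb by simp
 have Vnn: "ennreal (V n x) = nint (P T s x) (%y. ennreal (Fn n y))" for n x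
  unfolding V_def using Fni Fnb by (simp add: nn_integral_eq_integral)
 have Vm: "V n : Bmeas" for n
  unfolding V_def by (rule measurable_compose[OF P_kernel_sub[OF s sT'] integral_measurable_subprob_algebra[OF Fnm]])
 have Vn: "V n x <= real n" for n x
 proof -
  interpret prob_space "P T s x" by (rule P(1)[OF s sT'])
  show ?thesis unfolding V_def using Fnb by (intro integral_le_const[OF Fni]) auto
 qed
 have bound: "nint (\<mu> T) (%x. ennreal (V n x powr q)) <= ennreal (N powr (q / p))" for n
 proof -
  have cT: "(borel_measurable (\<mu> T) :: (real^'n => real) set) = Bmeas"
   by (rule measurable_cong_sets[OF mu_sets[OF TI] refl])
  have "abs (V n x powr q) <= real n powr q" for x using V0 Vn q1 by (auto intro!: powr_mono2)
  then have Vi: "integrable (\<mu> T) (%x. V n x powr q)"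
   using Vm[of n] cT by (intro finite_measure.integrable_const_bound[OF prob_space.finite_measure[OF mu_prob[OF TI]], of _ "real n powr q"]) auto
  define X where "X = lint (\<mu> T) (%x. V n x powr q)"
  have X0: "X >= 0" by (simp add: X_def)
  have "X powr (1 / q) <= lint (\<mu> s) (%x. Fn n x powr p) powr (1 / p)"
   using hyp_bdd[OF s sT p Fnm Fnb q_def] unfolding X_def V_def .
  also have "... <= N powr (1 / p)"
  proof (rule powr_mono2)
   show "lint (\<mu> s) (%x. Fn n x powr p) <= N" unfolding N_def
   proof (rule integral_mono[OF _ Fp])
    have cs: "(borel_measurable (\<mu> s) :: (real^'n => real) set) = Bmeas"
     by (rule measurable_cong_sets[OF mu_sets[OF s] refl])
    have "abs (Fn n x powr p) <= real n powr p" for x using Fnb[of n x] p by (auto intro!: powr_mono2)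
    then show "integrable (\<mu> s) (%x. Fn n x powr p)"
     using Fnm[of n] cs by (intro finite_measure.integrable_const_bound[OF prob_space.finite_measure[OF mu_prob[OF s]], of _ "real n powr p"]) auto
    show "Fn n x powr p <= F x powr p" for x using Fnb[of n x] p by (intro powr_mono2) (auto simp: Fn_def)
   qed
  qed (use p in auto)
  finally have "(X powr (1 / q)) powr q <= (N powr (1 / p)) powr q" using q1 by (intro powr_mono2) auto
  then have "X <= N powr (q / p)" using X0 q1 by (simp add: powr_powr)
  moreover have "nint (\<mu> T) (%x. ennreal (V n x powr q)) = ennreal X"
   unfolding X_def using Vi by (simp add: nn_integral_eq_integral)
  ultimately show ?thesis by (simp add: ennreal_leI)
 qed
 have lim: "AE x in \<mu> T. ennreal (enn2real (nint (P T s x) (%y. ennreal (F y))) powr q) <= liminf (%n. ennreal (V n x powr q))"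
  using fin
 proof eventually_elim
  fix x assume x: "nint (P T s x) (%y. ennreal (F y)) < \<infinity>"
  have "(%n. nint (P T s x) (%y. ennreal (Fn n y))) \<longlonglongrightarrow> (nint (P T s x) (%y. ennreal (F y)))"
  proof (rule nn_integral_LIMSEQ)
   show "incseq (%n y. ennreal (Fn n y))" by (auto simp: incseq_def le_fun_def Fn_def intro!: ennreal_leI)
   show "(%y. ennreal (Fn n y)) : borel_measurable (P T s x)" for n
    unfolding cP' using Fnm[of n] by measurable
   fix y
   obtain n0 where "F y <= real n0" using real_arch_simple by blast
   then have "eventually (%n. ennreal (Fn n y) = ennreal (F y)) sequentially"
    unfolding eventually_sequentially by (intro exI[of _ n0]) (auto simp: Fn_def)
   then show "(%n. ennreal (Fn n y)) \<longlonglongrightarrow> ennreal (F y)" by (rule tendsto_eventually)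
  qed
  then have "(%n. ennreal (V n x)) \<longlonglongrightarrow> (nint (P T s x) (%y. ennreal (F y)))" unfolding Vnn .
  then have "(%n. enn2real (ennreal (V n x))) \<longlonglongrightarrow> enn2real (nint (P T s x) (%y. ennreal (F y)))"
   using x by (intro tendsto_enn2real) auto
  then have "(%n. V n x) \<longlonglongrightarrow> enn2real (nint (P T s x) (%y. ennreal (F y)))" using V0 by simp
  then have "(%n. V n x powr q) \<longlonglongrightarrow> enn2real (nint (P T s x) (%y. ennreal (F y))) powr q"
   using powr_cont_0[of q] q1 V0 unfolding continuous_on_sequentially comp_def by auto
  then have tl: "(%n. ennreal (V n x powr q)) \<longlonglongrightarrow> ennreal (enn2real (nint (P T s x) (%y. ennreal (F y))) powr q)"
   by (rule tendsto_ennrealI)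
  show "ennreal (enn2real (nint (P T s x) (%y. ennreal (F y))) powr q) <= liminf (%n. ennreal (V n x powr q))"
   unfolding lim_imp_Liminf[OF sequentially_bot tl] by (rule order_refl)
 qed
 have "nint (\<mu> T) (%x. ennreal (enn2real (nint (P T s x) (%y. ennreal (F y))) powr q)) <= nint (\<mu> T) (%x. liminf (%n. ennreal (V n x powr q)))"
  by (rule nn_integral_mono_AE[OF lim])
 also have "... <= liminf (%n. nint (\<mu> T) (%x. ennreal (V n x powr q)))"
 proof (rule nn_integral_liminf)
  show "(%x. ennreal (V n x powr q)) : borel_measurable (\<mu> T)" for n
   unfolding cT' using Vm[of n] by measurable
 qed
 also have "... <= ennreal (N powr (q / p))"
 proof -
  have "liminf (%n. nint (\<mu> T) (%x. ennreal (V n x powr q))) <= liminf (%n::nat. ennreal (N powr (q / p)))"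
   by (intro Liminf_mono always_eventually allI bound)
  then show ?thesis by (simp add: Liminf_const)
 qed
 finally show ?thesis unfolding N_def .
qed

end

section \<open>Absolute continuity and the strong Feller property\<close>

lemma matrix_vec_norm: "norm ((A :: real ^ 'n ^ 'm::finite) *v (v :: real ^ 'n::finite)) <= norm A * norm v"
proof -
 have c: "abs ((A *v v) $ i) <= norm (A $ i) * norm v" for i
 proof -
  have "(A *v v) $ i = A $ i \<bullet> v" by (simp add: matrix_vector_mult_def inner_vec_def)
  then show ?thesis using Cauchy_Schwarz_ineq2[of "A $ i" v] by simp
 qed
 have "norm (A *v v) <= L2_set (%i. norm v * norm (A $ i)) UNIV"
  unfolding norm_vec_def[of "A *v v"] by (rule L2_set_mono) (use c in "auto simp: mult.commute")
 also have "... = norm v * norm A" by (simp add: L2_set_right_distrib[symmetric] norm_vec_def[of A])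
 finally show ?thesis by (simp add: mult.commute)
qed

lemma norm_matrix_le_sum: "norm (A :: real ^ 'n::finite ^ 'm::finite) <= (\<Sum>i\<in>UNIV. \<Sum>j\<in>UNIV. abs (A $ i $ j))"
proof -
 have "norm A <= (\<Sum>i\<in>UNIV. norm (A $ i))" unfolding norm_vec_def[of A] by (rule L2_set_le_sum) simp
 also have "... <= (\<Sum>i\<in>UNIV. \<Sum>j\<in>UNIV. abs (A $ i $ j))" by (intro sum_mono norm_le_l1_cart)
 finally show ?thesis .
qed

lemma C2w_quad_form:
 assumes S: "transpose S = (S :: real ^ 'n::finite ^ 'n)"
 shows "C2w (%x. (x - z) \<bullet> (S *v (x - z))) (%x. 2 *\<^sub>R (S *v (x - z))) (%x. 2 *\<^sub>R S)"
proof (rule C2wI)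
 have Sij: "S $ i $ j = S $ j $ i" for i j using arg_cong[OF S, of "%M. M $ j $ i"] by (simp add: transpose_def)
 have bl: "bounded_linear ((*v) S)" by (rule matrix_vector_mul_bounded_linear)
 fix x :: "real^'n"
 have d: "((%x. S *v (x - z)) has_derivative (%v. S *v v)) (at x)"
  by (rule has_derivative_eq_rhs[OF bounded_linear.has_derivative[OF bl has_derivative_diff[OF has_derivative_ident has_derivative_const]]]) simp
 show "((%x. (x - z) \<bullet> (S *v (x - z))) has_derivative (%v. (2 *\<^sub>R (S *v (x - z))) \<bullet> v)) (at x)"
  by (rule has_derivative_eq_rhs[OF has_derivative_inner[OF has_derivative_diff[OF has_derivative_ident has_derivative_const] d]])
   (auto simp: fun_eq_iff sym_inner[OF S, of "x - z"] inner_commute[of "S *v (x - z)"])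
 fix j
 have "((%x. (2 *\<^sub>R (S *v (x - z))) $ j) has_derivative (%v. 2 * (S *v v) $ j)) (at x)"
  unfolding vector_scaleR_component real_scaleR_def
  by (intro has_derivative_mult_right bounded_linear.has_derivative[OF bounded_linear_vec_nth d])
 then show "((%x. (2 *\<^sub>R (S *v (x - z))) $ j) has_derivative (%v. \<Sum>i\<in>UNIV. (2 *\<^sub>R S) $ i $ j * v $ i)) (at x)"
  by (rule has_derivative_eq_rhs) (auto simp: fun_eq_iff matrix_vector_mult_def sum_distrib_left Sij mult_ac intro!: sum.cong)
qed

text \<open>The inverse of a diffusion matrix frozen at one point. All bounds depend on the matrix
  only through its ellipticity constant e and a norm bound La, hence are uniform over compact sets
  of poles.\<close>

lemma pd_inverse:
 fixes A :: "real ^ 'n::finite ^ 'n"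
 assumes A: "transpose A = A" and e: "e > 0" "!!xi. e * (norm xi)^2 <= xi \<bullet> (A *v xi)" and L: "norm A <= La"
 obtains S where "transpose S = S" "!!y. A *v (S *v y) = y" "!!y. norm (S *v y) <= norm y / e"
  "!!y. y \<bullet> (S *v y) >= e / La^2 * (norm y)^2" "A \<bullet> S = real CARD('n)" "!!B. abs (B \<bullet> S) <= real CARD('n) * norm B / e" "La > 0"
proof -
 have "x = 0" if "A *v x = 0" for x
 proof -
  have "e * (norm x)^2 <= 0" using e(2)[of x] that by simp
  then show "x = 0" using e(1) by (simp add: mult_le_0_iff)
 qed
 then obtain S where S: "S ** A = mat 1" using matrix_left_invertible_ker[of A] by auto
 then have AS: "A ** S = mat 1" using matrix_left_right_inverse by blast
 have "transpose S ** A = mat 1" using arg_cong[OF AS, of transpose] A by (simp add: matrix_transpose_mul)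
 then have Ssym: "transpose S = S" using AS S by (metis matrix_mul_assoc matrix_mul_lid matrix_mul_rid)
 have 1: "A *v (S *v y) = y" for y by (simp add: matrix_vector_mul_assoc AS)
 have 2: "norm (S *v y) <= norm y / e" for y
 proof (cases "S *v y = 0")
  case False
  have "e * (norm (S *v y))^2 <= (S *v y) \<bullet> (A *v (S *v y))" by (rule e(2))
  also have "... <= norm (S *v y) * norm y" unfolding 1 by (rule norm_cauchy_schwarz)
  finally have "e * norm (S *v y) <= norm y" using False by (simp add: power2_eq_square)
  then show ?thesis using e(1) by (simp add: field_simps)
 qed (use e(1) in simp)
 have Lp: "La > 0"
 proof -
  have "A ~= 0" using e(2)[of "axis undefined 1"] e(1) by (auto simp: norm_axis_1)
  then show ?thesis using L by (meson less_le_trans zero_less_norm_iff)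
 qed
 have 3: "y \<bullet> (S *v y) >= e / La^2 * (norm y)^2" for y
 proof -
  have "norm y <= norm A * norm (S *v y)" using matrix_vec_norm[of A "S *v y"] by (simp add: 1)
  also have "... <= La * norm (S *v y)" using L by (intro mult_right_mono) auto
  finally have "(norm y)^2 <= (La * norm (S *v y))^2" by (intro power_mono) auto
  then have "(norm y)^2 / La^2 <= (norm (S *v y))^2" using Lp by (simp add: power_mult_distrib field_simps)
  then have "e * ((norm y)^2 / La^2) <= e * (norm (S *v y))^2" using e(1) by (intro mult_left_mono) auto
  also have "... <= (S *v y) \<bullet> (A *v (S *v y))" by (rule e(2))
  finally show ?thesis by (simp add: 1 inner_commute)
 qed
 have Sij: "S $ i $ j = S $ j $ i" for i j using arg_cong[OF Ssym, of "%M. M $ j $ i"] by (simp add: transpose_def)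
 have 4: "A \<bullet> S = real CARD('n)"
 proof -
  have "A \<bullet> S = trace (A ** S)" unfolding inner_matrix trace_def matrix_matrix_mult_def by (simp add: Sij)
  then show ?thesis by (simp add: AS trace_def mat_def)
 qed
 have 5: "abs (B \<bullet> S) <= real CARD('n) * norm B / e" for B
 proof -
  have Si: "norm (S $ i) <= 1 / e" for i
  proof -
   have "S $ i = S *v axis i 1" by (simp add: vec_eq_iff matrix_vector_mult_def sum_mult_axis Sij[of i])
   then show ?thesis using 2[of "axis i 1"] by (simp add: norm_axis_1)
  qed
  have "abs (B \<bullet> S) <= (\<Sum>i\<in>UNIV. abs (B $ i \<bullet> S $ i))" unfolding inner_vec_def[of B] by (rule sum_abs)
  also have "... <= (\<Sum>i\<in>(UNIV::'n set). norm B * (1 / e))"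
  proof (rule sum_mono)
   fix i :: 'n
   have "abs (B $ i \<bullet> S $ i) <= norm (B $ i) * norm (S $ i)" by (rule Cauchy_Schwarz_ineq2)
   also have "... <= norm B * (1 / e)" using Finite_Cartesian_Product.norm_nth_le[of B i] Si[of i] by (intro mult_mono) auto
   finally show "abs (B $ i \<bullet> S $ i) <= norm B * (1 / e)" .
  qed
  finally show ?thesis by simp
 qed
 show ?thesis by (rule that[OF Ssym 1 2 3 4 5 Lp])
qed

text \<open>The cubic factor left by \<open>gauss_bracket\<close> is absorbed by a Gaussian, by
  means of (1+y)^2 <= 2 exp y.\<close>

lemma poly_gauss:
 assumes "c > (0::real)"
 obtains C where "C > 0" "!!xi. xi >= 0 ==> (1 + xi) ^ 3 <= C * exp (c * xi^2)"
proof
 define k where "k = max 1 (1 / c)"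
 have k: "k >= 1" "k * c >= 1" using assms by (auto simp: k_def max_def field_simps)
 show "8 * k^2 > 0" using k by simp
 fix xi :: real assume x: "xi >= 0"
 define y where "y = c * xi^2"
 have y0: "y >= 0" using assms by (simp add: y_def)
 have "1 * xi^2 <= k * c * xi^2" using k by (intro mult_right_mono) auto
 then have a: "1 + xi^2 <= k * (1 + y)" using k by (simp add: y_def algebra_simps)
 have "(1 + xi)^2 <= 2 * (1 + xi^2)" using zero_le_power2[of "1 - xi"] by (simp add: power2_eq_square algebra_simps)
 also have "... <= 2 * (k * (1 + y))" using a by (rule mult_left_mono) simp
 finally have b: "(1 + xi)^2 <= 2 * (k * (1 + y))" .
 have "(1 + xi) ^ 3 <= (1 + xi) ^ 4" using x by (intro power_increasing) auto
 also have "... = ((1 + xi)^2)^2" by simp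
 also have "... <= (2 * (k * (1 + y)))^2" using b by (intro power_mono) auto
 also have "... = 4 * k^2 * (1 + y)^2" by (simp add: power_mult_distrib)
 also have "... <= 4 * k^2 * (2 * exp y)"
 proof (intro mult_left_mono)
  show "(1 + y)^2 <= 2 * exp y" using exp_lower_Taylor_quadratic[OF y0] by (simp add: power2_eq_square algebra_simps)
 qed auto
 finally show "(1 + xi) ^ 3 <= 8 * k^2 * exp (c * xi^2)" by (simp add: y_def)
qed

context kolm begin

text \<open>A cut-off Gaussian around z in the elapsed time r - t + sg. With N half the dimension
  and S the inverse of \<open>Q\<close> at (t,z), the uncut function is, up to a constant factor,
  the heat kernel of the operator with second-order coefficients frozen at (t,z), started at time t
  - sg. The long expression is its image under d/dr - A(r).\<close>

lemma gauss_Lsol: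
 fixes S :: "real ^ 'n ^ 'n" and N :: real
 assumes S: "transpose S = S" and U: "U = {t - sg<..} \<inter> I"
 shows "EX D. Lsol U (%r x. cut ro x * exp (- N * ln (r - t + sg) + (- 1 / (4 * (r - t + sg))) * ((x - z) \<bullet> (S *v (x - z)))))
  (%r x. exp (- N * ln (r - t + sg) + (- 1 / (4 * (r - t + sg))) * ((x - z) \<bullet> (S *v (x - z)))) *
   (cut ro x * (- N / (r - t + sg) + (Q r x \<bullet> S) / (2 * (r - t + sg)) + (b r x \<bullet> (S *v (x - z))) / (2 * (r - t + sg))
     + ((x - z) \<bullet> (S *v (x - z))) / (4 * (r - t + sg)^2) - ((S *v (x - z)) \<bullet> (Q r x *v (S *v (x - z)))) / (4 * (r - t + sg)^2))
   - AA r (Dcut ro) (Hcut ro) x + (Dcut ro x \<bullet> (Q r x *v (S *v (x - z)))) / (r - t + sg))) D"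
proof -
 have sub: "U \<subseteq> I" and op: "open U" using I_open by (auto simp: U)
 have tp: "r - t + sg > 0" if "r : U" for r using that by (auto simp: U)
 have a: "Lsol U (%r x. - N * ln (r - t + sg)) (%r x. - N * (1 / (r - t + sg))) (%r x. 0)"
 proof (rule Lsol_time[OF sub])
  show "((%r. - N * ln (r - t + sg)) has_real_derivative - N * (1 / (r - t + sg))) (at r)" if "r : U" for r
   using tp[OF that] by (auto intro!: derivative_eq_intros simp: field_simps)
  show "continuous_on U (%r. - N * (1 / (r - t + sg)))" using tp by (intro continuous_intros) force
 qed
 have c: "Lsol U (%r x. - 1 / (4 * (r - t + sg))) (%r x. 1 / (4 * (r - t + sg)^2)) (%r x. 0)"
 proof (rule Lsol_time[OF sub])
  show "((%r. - 1 / (4 * (r - t + sg))) has_real_derivative 1 / (4 * (r - t + sg)^2)) (at r)" if "r : U" for r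
  proof -
   have "((%ta. - 1 / (4 * ta)) has_real_derivative 1 / (4 * ta^2)) (at ta)" if "ta > 0" for ta :: real
    using that by (auto intro!: derivative_eq_intros simp: field_simps power2_eq_square)
   moreover have "((%r. r - t + sg) has_real_derivative 1) (at r)" by (auto intro!: derivative_eq_intros)
   ultimately show ?thesis using DERIV_chain2[of "%ta. - 1 / (4 * ta)" _ "%r. r - t + sg" r 1 UNIV] tp[OF that] by force
  qed
  show "continuous_on U (%r. 1 / (4 * (r - t + sg)^2))" using tp by (intro continuous_intros) force
 qed
 have qd: "Lsol U (%r x. (x - z) \<bullet> (S *v (x - z))) (%r x. - AA r (%x. 2 *\<^sub>R (S *v (x - z))) (%x. 2 *\<^sub>R S) x) (%r x. 2 *\<^sub>R (S *v (x - z)))"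
  by (rule Lsol_space[OF sub C2w_quad_form[OF S]]) simp
 have ch: "Lsol U (%r. cut ro) (%r x. - AA r (Dcut ro) (Hcut ro) x) (%r. Dcut ro)"
  by (rule Lsol_space[OF sub C2w_cut continuous_Hcut])
 have add: "Lsol U (%r x. f r x + g r x) (%r x. Lf r x + Lg r x) (%r x. Df r x + Dg r x)"
  if fg: "Lsol U f Lf Df" "Lsol U g Lg Dg" for f g Lf Lg Df Dg
 proof -
  obtain Tf Hf Tg Hg where f: "cl12 U f Tf Df Hf" "!!t x. t : U ==> Tf t x - AA t (Df t) (Hf t) x = Lf t x"
   and g: "cl12 U g Tg Dg Hg" "!!t x. t : U ==> Tg t x - AA t (Dg t) (Hg t) x = Lg t x"
   using fg unfolding Lsol_def by metis
  have "Tf t x + Tg t x - AA t (%x. Df t x + Dg t x) (%x. Hf t x + Hg t x) x = Lf t x + Lg t x" if "t : U" for t x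
   unfolding f(2)[OF that, symmetric] g(2)[OF that, symmetric] AA_add by simp
  then show ?thesis unfolding Lsol_def using cl12_add[OF f(1) g(1)] sub by blast
 qed
 note e = Lsol_compose[OF add[OF a Lsol_mult[OF c qd]] UNIV_I DERIV_exp DERIV_exp continuous_on_exp[OF continuous_on_id]]
 note r = Lsol_mult[OF ch e]
 show ?thesis
 proof (rule exI, rule Lsol_cong[OF r op refl _ refl])
  fix r x assume rU: "r : U"
  define ta where "ta = r - t + sg"
  have t0: "ta > 0" using tp[OF rU] by (simp add: ta_def)
  define y where "y = S *v (x - z)"
  define E where "E = exp (- N * ln ta + - 1 / (4 * ta) * ((x - z) \<bullet> y))"
  define X where "X = (x - z) \<bullet> y"
  have D0: "0 + ((- 1 / (4 * ta)) *\<^sub>R 2 *\<^sub>R y + X *\<^sub>R (0::real^'n)) = (- 1 / (2 * ta)) *\<^sub>R y" by simp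
  have A2: "AA r (%x. 2 *\<^sub>R (S *v (x - z))) (%x. 2 *\<^sub>R S) x = 2 * (Q r x \<bullet> S) + 2 * (b r x \<bullet> y)" by (simp add: AA_def y_def)
  have "cut ro x * (E * (- N * (1 / ta) + (- 1 / (4 * ta) * - (2 * (Q r x \<bullet> S) + 2 * (b r x \<bullet> y)) + X * (1 / (4 * ta^2)) - 2 * (0 \<bullet> (Q r x *v 2 *\<^sub>R y))))
    - E * (((- 1 / (2 * ta)) *\<^sub>R y) \<bullet> (Q r x *v ((- 1 / (2 * ta)) *\<^sub>R y))))
    + E * - AA r (Dcut ro) (Hcut ro) x - 2 * (Dcut ro x \<bullet> (Q r x *v E *\<^sub>R ((- 1 / (2 * ta)) *\<^sub>R y)))
   = E * (cut ro x * (- N / ta + (Q r x \<bullet> S) / (2 * ta) + (b r x \<bullet> y) / (2 * ta) + X / (4 * ta^2) - (y \<bullet> (Q r x *v y)) / (4 * ta^2))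
    - AA r (Dcut ro) (Hcut ro) x + (Dcut ro x \<bullet> (Q r x *v y)) / ta)"
   using t0
   by (simp only: matrix_vector_mult_scaleR inner_scaleR_left inner_scaleR_right scaleR_scaleR inner_zero_left mult_zero_right diff_zero)
    (simp add: field_simps power2_eq_square)
  then show "cut ro x * (exp (- N * ln (r - t + sg) + - 1 / (4 * (r - t + sg)) * ((x - z) \<bullet> (S *v (x - z)))) *
     (- N * (1 / (r - t + sg)) +
      (- 1 / (4 * (r - t + sg)) * - AA r (%x. 2 *\<^sub>R (S *v (x - z))) (%x. 2 *\<^sub>R S) x + (x - z) \<bullet> (S *v (x - z)) * (1 / (4 * (r - t + sg)^2)) -
      2 * (0 \<bullet> (Q r x *v 2 *\<^sub>R (S *v (x - z)))))) -
     exp (- N * ln (r - t + sg) + - 1 / (4 * (r - t + sg)) * ((x - z) \<bullet> (S *v (x - z)))) *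
     ((0 + ((- 1 / (4 * (r - t + sg))) *\<^sub>R 2 *\<^sub>R (S *v (x - z)) + ((x - z) \<bullet> (S *v (x - z))) *\<^sub>R 0)) \<bullet>
      (Q r x *v (0 + ((- 1 / (4 * (r - t + sg))) *\<^sub>R 2 *\<^sub>R (S *v (x - z)) + ((x - z) \<bullet> (S *v (x - z))) *\<^sub>R 0))))) +
     exp (- N * ln (r - t + sg) + - 1 / (4 * (r - t + sg)) * ((x - z) \<bullet> (S *v (x - z)))) * - AA r (Dcut ro) (Hcut ro) x -
     2 * (Dcut ro x \<bullet>
       (Q r x *v exp (- N * ln (r - t + sg) + - 1 / (4 * (r - t + sg)) * ((x - z) \<bullet> (S *v (x - z)))) *\<^sub>R
        (0 + ((- 1 / (4 * (r - t + sg))) *\<^sub>R 2 *\<^sub>R (S *v (x - z)) + ((x - z) \<bullet> (S *v (x - z))) *\<^sub>R 0))))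
   = exp (- N * ln (r - t + sg) + (- 1 / (4 * (r - t + sg))) * ((x - z) \<bullet> (S *v (x - z)))) *
   (cut ro x * (- N / (r - t + sg) + (Q r x \<bullet> S) / (2 * (r - t + sg)) + (b r x \<bullet> (S *v (x - z))) / (2 * (r - t + sg))
     + ((x - z) \<bullet> (S *v (x - z))) / (4 * (r - t + sg)^2) - ((S *v (x - z)) \<bullet> (Q r x *v (S *v (x - z)))) / (4 * (r - t + sg)^2))
   - AA r (Dcut ro) (Hcut ro) x + (Dcut ro x \<bullet> (Q r x *v (S *v (x - z)))) / (r - t + sg))"
   unfolding ta_def[symmetric] y_def[symmetric] A2 X_def[symmetric] E_def[symmetric] D0
   by (simp add: E_def X_def)
 qed
qed

end

lemma powr_le_max1: "0 < ta ==> ta <= tam ==> 0 <= s ==> s <= 1 ==> ta powr s <= max 1 (tam::real)"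
proof -
 assume a: "0 < ta" "ta <= tam" "0 <= s" "s <= 1"
 have "ta powr s <= (max 1 tam) powr s" using a by (intro powr_mono2) auto
 also have "... <= (max 1 tam) powr 1" using a by (intro powr_mono) auto
 finally show ?thesis by simp
qed

lemma powr_shift:
 assumes "0 < ta" "ta <= tam" "0 <= b - a" "b - a <= 1"
 shows "ta powr b <= max 1 tam * ta powr (a::real)"
proof -
 have "ta powr b = ta powr (b - a) * ta powr a" by (simp add: powr_add[symmetric])
 also have "... <= max 1 tam * ta powr a" using powr_le_max1[OF assms] by (intro mult_right_mono) auto
 finally show ?thesis .
qed

text \<open>In the self-similar variable xi = y / sqrt ta every summand is at most a constant times
  ta^(ga-1) (1+xi)^3. The freezing error \<Delta> gains ta^(\<alpha>/2) over the order 1/ta of the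
  second-order terms, and the lower order terms gain sqrt ta; as ga > 0, the singularity is
  integrable in time.\<close>

lemma gauss_bracket:
 fixes M' d e La xi ta tam \<alpha> ga \<Delta> y :: real
 assumes t: "0 < ta" "ta <= tam" and g: "0 < ga" "ga <= \<alpha> / 2" "\<alpha> < 1" and e: "e > 0" and nn: "M' >= 0" "d >= 0" "La >= 0"
  and y: "y >= 0" and D: "0 <= \<Delta>" "\<Delta> <= M' * (ta powr (\<alpha> / 2) + y powr \<alpha>)"
 shows "\<Delta> * d / (2 * e * ta) + \<Delta> * y^2 / (4 * e^2 * ta^2) + La * y / (2 * e * ta) + La + La * La * y / (e * ta)
  <= max 1 tam * (2 * M' * (d / (2 * e) + 1 / (4 * e^2)) + La / (2 * e) + La + La * La / e) * ta powr (ga - 1) * (1 + y / sqrt ta) ^ 3"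
proof -
 define xi where "xi = y / sqrt ta"
 \<comment> \<open>The price for lowering an exponent of ta by at most 1 when ta may exceed
   1.\<close>
 define k where "k = max 1 tam"
 have k: "k >= 1" by (simp add: k_def)
 have x0: "xi >= 0" using y t by (simp add: xi_def)
 have ys: "y = xi * ta powr (1/2)" using t by (simp add: xi_def powr_half_sqrt)
 have ysq: "y^2 = xi^2 * ta" using t by (simp add: xi_def power_divide)
 have x1: "xi powr \<alpha> <= 1 + xi"
 proof -
  have "xi powr \<alpha> <= (1 + xi) powr \<alpha>" using x0 g by (intro powr_mono2) auto
  also have "... <= (1 + xi) powr 1" using x0 g by (intro powr_mono) auto
  finally show ?thesis using x0 by simp
 qed
 have ya: "y powr \<alpha> = xi powr \<alpha> * ta powr (\<alpha> / 2)" unfolding ys using x0 t by (simp add: powr_mult powr_powr)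
 have D2: "\<Delta> <= 2 * M' * (1 + xi) * ta powr (\<alpha> / 2)"
 proof -
  have "ta powr (\<alpha> / 2) + y powr \<alpha> = (1 + xi powr \<alpha>) * ta powr (\<alpha> / 2)" unfolding ya by (simp add: algebra_simps)
  also have "... <= (2 * (1 + xi)) * ta powr (\<alpha> / 2)" using x1 x0 by (intro mult_right_mono) auto
  finally have "M' * (ta powr (\<alpha> / 2) + y powr \<alpha>) <= M' * ((2 * (1 + xi)) * ta powr (\<alpha> / 2))" using nn by (intro mult_left_mono) auto
  then show ?thesis using D by (simp add: mult_ac)
 qed
 define p where "p = ta powr (ga - 1)"
 have p0: "p > 0" using t by (simp add: p_def)
 have p1: "ta powr (\<alpha> / 2) / ta <= k * p"
 proof -
  have "ta powr (\<alpha> / 2) / ta = ta powr (\<alpha> / 2 - 1)" using t by (simp add: powr_diff)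
  also have "... <= k * p" unfolding k_def p_def using g by (intro powr_shift t) auto
  finally show ?thesis .
 qed
 have p2: "ta powr (1/2) / ta <= k * p"
 proof -
  have "ta powr (1/2) / ta = ta powr (1/2 - 1)" using t by (simp only: powr_diff powr_one)
  also have "... <= k * p" unfolding k_def p_def using g by (intro powr_shift t) auto
  finally show ?thesis .
 qed
 have p3: "1 <= k * p"
 proof -
  have "1 = ta powr 0" using t by simp
  also have "... <= k * p" unfolding k_def p_def using g by (intro powr_shift t) auto
  finally show ?thesis .
 qed
 define c where "c = (1 + xi) ^ 3"
 have c1: "1 <= c" "xi <= c" "(1 + xi) <= c" "(1 + xi) * xi^2 <= c"
 proof -
  show "1 <= c" using x0 by (simp add: c_def one_le_power)
  show a: "(1 + xi) <= c" unfolding c_def using self_le_power[of "1 + xi" 3] x0 by simp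
  then show "xi <= c" by simp
  have "xi^2 <= (1 + xi)^2" using x0 by (intro power_mono) auto
  then have "(1 + xi) * xi^2 <= (1 + xi) * (1 + xi)^2" using x0 by (intro mult_left_mono) auto
  then show "(1 + xi) * xi^2 <= c" by (simp add: c_def power3_eq_cube power2_eq_square)
 qed
 have kp: "k * p > 0" using k p0 by simp
 have a1: "\<Delta> * d / (2 * e * ta) <= (k * p) * c * (2 * M' * (d / (2 * e)))"
 proof -
  have "\<Delta> * d / (2 * e * ta) <= (2 * M' * (1 + xi) * ta powr (\<alpha> / 2)) * d / (2 * e * ta)"
   using D2 nn t e by (intro divide_right_mono mult_right_mono) auto
  also have "... = (2 * M' * (d / (2 * e))) * ((1 + xi) * (ta powr (\<alpha> / 2) / ta))" by simp
  also have "... <= (2 * M' * (d / (2 * e))) * (c * (k * p))" using nn e p1 c1 x0 kp t by (intro mult_left_mono mult_mono) auto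
  finally show ?thesis by (simp add: mult_ac)
 qed
 have a2: "\<Delta> * y^2 / (4 * e^2 * ta^2) <= (k * p) * c * (2 * M' * (1 / (4 * e^2)))"
 proof -
  have "\<Delta> * y^2 / (4 * e^2 * ta^2) <= (2 * M' * (1 + xi) * ta powr (\<alpha> / 2)) * y^2 / (4 * e^2 * ta^2)"
   using D2 t e by (intro divide_right_mono mult_right_mono) auto
  also have "... = (2 * M' * (1 / (4 * e^2))) * (((1 + xi) * xi^2) * (ta powr (\<alpha> / 2) / ta))"
   unfolding ysq using t e by (simp add: power2_eq_square field_simps)
  also have "... <= (2 * M' * (1 / (4 * e^2))) * (c * (k * p))" using nn e p1 c1 x0 kp t by (intro mult_left_mono mult_mono) auto
  finally show ?thesis by (simp add: mult_ac)
 qed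
 have yt: "y / ta <= c * (k * p)"
 proof -
  have "y / ta = xi * (ta powr (1/2) / ta)" by (simp add: ys)
  also have "... <= c * (k * p)" using p2 c1 x0 kp t by (intro mult_mono) auto
  finally show ?thesis .
 qed
 have a3: "La * y / (2 * e * ta) <= (k * p) * c * (La / (2 * e))"
 proof -
  have "La * y / (2 * e * ta) = (La / (2 * e)) * (y / ta)" by simp
  also have "... <= (La / (2 * e)) * (c * (k * p))" using yt nn e by (intro mult_left_mono) auto
  finally show ?thesis by (simp add: mult_ac)
 qed
 have a5: "La * La * y / (e * ta) <= (k * p) * c * (La * La / e)"
 proof -
  have "La * La * y / (e * ta) = (La * La / e) * (y / ta)" by simp
  also have "... <= (La * La / e) * (c * (k * p))" using yt nn e by (intro mult_left_mono) auto
  finally show ?thesis by (simp add: mult_ac)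
 qed
 have a4: "La <= (k * p) * c * La"
 proof -
  have "1 * 1 <= (k * p) * c" using p3 c1 kp by (intro mult_mono) auto
  then show ?thesis using nn mult_right_mono[of 1 "(k * p) * c" La] by simp
 qed
 have "k * (2 * M' * (d / (2 * e) + 1 / (4 * e^2)) + La / (2 * e) + La + La * La / e) * p * c
  = (k * p) * c * (2 * M' * (d / (2 * e))) + (k * p) * c * (2 * M' * (1 / (4 * e^2))) + (k * p) * c * (La / (2 * e)) + (k * p) * c * La + (k * p) * c * (La * La / e)"
  by (simp add: algebra_simps)
 then show ?thesis using a1 a2 a3 a4 a5 unfolding k_def p_def c_def xi_def by linarith
qed

locale kolm_h = kolm I Q b \<phi> D\<phi> H\<phi> a G P
 for I :: "real set" and Q :: "real => real ^ 'n::finite => real ^ 'n ^ 'n" and b \<phi> D\<phi> H\<phi> a G P +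
 fixes \<alpha> e0 NN :: real
 assumes NN: "NN = real CARD('n) / 2" and al: "0 < \<alpha>" "\<alpha> < 1" and e0: "e0 > 0" "!!t x xi. t : I ==> e0 * (norm xi)^2 <= xi \<bullet> (Q t x *v xi)"
  and Hol: "!!C. compact C ==> C \<subseteq> I \<times> UNIV ==> EX M. ALL p:C. ALL p':C. ALL i j.
   abs (Q (fst p) (snd p) $ i $ j - Q (fst p') (snd p') $ i $ j) <= M * (abs (fst p - fst p') powr (\<alpha> / 2) + norm (snd p - snd p') powr \<alpha>)"
begin

text \<open>The point is the uniformity: C and c do not depend on the pole (t,z) nor on sg. Beyond
  radius 2(R+1) the cutoff vanishes, and on the remaining compact set the coefficients are bounded
  and Hoelder continuous. Half of the exponent of the Gaussian, c'/8 out of c'/4, pays for the cubic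
  factor. The last clause recovers a plain Gaussian below \<open>h\<close> at time t.\<close>

lemma param_bound:
 assumes t0: "t0 : I" "t0 <= t2" and R: "R > 0" and g: "0 < ga" "ga <= \<alpha> / 2"
 shows "EX C>0. EX c>0. ALL t:{t0..t2}. ALL z:cball 0 R. ALL sg:{0<..1}. EX h L D. Lsol ({t - sg<..} \<inter> I) h L D &
  (ALL r x. 2 * (R + 1) <= norm x --> h r x = 0) &
  (ALL r:{t..t2}. ALL x. abs (L r x) <= C * (r - t + sg) powr (ga - 1 - NN) * exp (- c * (norm (x - z))^2 / (r - t + sg))) &
  (ALL r:{t..t2}. ALL x. 0 <= h r x & h r x <= (r - t + sg) powr (- NN)) &
  (ALL x. norm x <= R + 1 --> sg powr (- NN) * exp (- (norm (x - z))\<^sup>2 / (4 * e0 * sg)) <= h t x)"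
proof -
 define ro where "ro = R + 1"
 have rho: "ro > 0" using R by (simp add: ro_def)
 define K0 where "K0 = {t0..t2} \<times> cball (0::real^'n) (2 * ro)"
 have K0: "compact K0" unfolding K0_def by (intro compact_Times) auto
 have K0I: "K0 \<subseteq> I \<times> UNIV" using I_up[OF t0(1)] by (auto simp: K0_def)
 have cQ: "continuous_on K0 (%p. norm (Q (fst p) (snd p)))" by (intro continuous_intros continuous_on_subset[OF Qc K0I])
 have cb: "continuous_on K0 (%p. norm (b (fst p) (snd p)))" by (intro continuous_intros continuous_on_subset[OF bc K0I])
 have cA: "continuous_on K0 (%p. AA (fst p) (Dcut ro) (Hcut ro) (snd p))"
  by (rule continuous_on_subset[OF AA_cont[OF order_refl]])
   (use K0I in "auto intro!: continuous_on_snd_UNIV C2w_contD[OF C2w_cut] continuous_Hcut")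
 have cD: "continuous_on K0 (%p. norm (Dcut ro (snd p)))"
  by (intro continuous_intros continuous_on_snd_UNIV C2w_contD[OF C2w_cut])
 obtain L1 where L1: "L1 > 0" "!!p. p : K0 ==> abs (norm (Q (fst p) (snd p))) <= L1" using compact_bound[OF K0 cQ] by metis
 obtain L2 where L2: "L2 > 0" "!!p. p : K0 ==> abs (norm (b (fst p) (snd p))) <= L2" using compact_bound[OF K0 cb] by metis
 obtain L3 where L3: "L3 > 0" "!!p. p : K0 ==> abs (AA (fst p) (Dcut ro) (Hcut ro) (snd p)) <= L3" using compact_bound[OF K0 cA] by metis
 obtain L4 where L4: "L4 > 0" "!!p. p : K0 ==> abs (norm (Dcut ro (snd p))) <= L4" using compact_bound[OF K0 cD] by metis
 define La where "La = L1 + L2 + L3 + L4"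
 have Lp: "La > 0" using L1 L2 L3 L4 by (simp add: La_def)
 have La: "norm (Q r x) <= La" "norm (b r x) <= La" "abs (AA r (Dcut ro) (Hcut ro) x) <= La" "norm (Dcut ro x) <= La"
  if "r : {t0..t2}" "norm x <= 2 * ro" for r x
 proof -
  have "(r, x) : K0" using that by (simp add: K0_def)
  then show "norm (Q r x) <= La" "norm (b r x) <= La" "abs (AA r (Dcut ro) (Hcut ro) x) <= La" "norm (Dcut ro x) <= La"
   using L1(1) L2(1) L3(1) L4(1) L1(2)[of "(r, x)"] L2(2)[of "(r, x)"] L3(2)[of "(r, x)"] L4(2)[of "(r, x)"]
   unfolding La_def by auto
 qed
 obtain M0 where M0: "ALL p:K0. ALL p':K0. ALL i j.
   abs (Q (fst p) (snd p) $ i $ j - Q (fst p') (snd p') $ i $ j) <= M0 * (abs (fst p - fst p') powr (\<alpha> / 2) + norm (snd p - snd p') powr \<alpha>)"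
  using Hol[OF K0 K0I] by blast
 define d where "d = real CARD('n)"
 define M' where "M' = d * d * abs M0"
 have d0: "d > 0" by (simp add: d_def)
 have M': "M' >= 0" by (simp add: M'_def d_def)
 have DQ: "norm (Q r x - Q t z) <= M' * (abs (r - t) powr (\<alpha> / 2) + norm (x - z) powr \<alpha>)"
  if "r : {t0..t2}" "norm x <= 2 * ro" "t : {t0..t2}" "norm z <= 2 * ro" for r x t z
 proof -
  have in0: "(r, x) : K0" "(t, z) : K0" using that by (auto simp: K0_def)
  define w where "w = abs (r - t) powr (\<alpha> / 2) + norm (x - z) powr \<alpha>"
  have w0: "w >= 0" by (simp add: w_def)
  have "abs (Q r x $ i $ j - Q t z $ i $ j) <= abs M0 * w" for i j
  proof -
   have "abs (Q r x $ i $ j - Q t z $ i $ j) <= M0 * w" using M0[rule_format, OF in0, of i j] by (simp add: w_def)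
   also have "... <= abs M0 * w" using w0 by (intro mult_right_mono) auto
   finally show ?thesis .
  qed
  then have "(\<Sum>i\<in>UNIV. \<Sum>j\<in>UNIV. abs ((Q r x - Q t z) $ i $ j)) <= (\<Sum>i\<in>(UNIV::'n set). \<Sum>j\<in>(UNIV::'n set). abs M0 * w)"
   by (intro sum_mono) simp
  also have "... = M' * w" by (simp add: M'_def d_def)
  finally show ?thesis using norm_matrix_le_sum[of "Q r x - Q t z"] by (simp add: w_def)
 qed
 define tam where "tam = t2 - t0 + 1"
 define c' where "c' = e0 / La^2"
 have c'0: "c' > 0" using e0 Lp by (simp add: c'_def)
 define C1 where "C1 = 2 * M' * (d / (2 * e0) + 1 / (4 * e0^2)) + La / (2 * e0) + La + La * La / e0"
 have C1: "C1 > 0" unfolding C1_def using M' d0 e0 Lp by (intro add_nonneg_pos add_nonneg_nonneg) (auto intro!: add_nonneg_pos)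
 obtain C4 where C4: "C4 > 0" "!!xi. xi >= 0 ==> (1 + xi) ^ 3 <= C4 * exp (c' / 8 * xi^2)"
  using poly_gauss[of "c' / 8"] c'0 by auto
 define C where "C = max 1 tam * C1 * C4"
 have C: "C > 0" using C1 C4 by (simp add: C_def)
 show ?thesis
 proof (rule exI[of _ C], rule conjI[OF C], rule exI[of _ "c' / 8"], intro conjI ballI)
  show "c' / 8 > 0" using c'0 by simp
  fix t z sg assume t: "t : {t0..t2}" and z: "z : cball (0::real^'n) R" and s: "sg : {0<..(1::real)}"
  have tI: "t : I" using I_up[OF t0(1)] t by auto
  have z2: "norm z <= 2 * ro" using z R by (simp add: ro_def)
  have Qsym: "transpose (Q t z) = Q t z" using Qpsd[OF tI] by (simp add: psd_def)
  obtain S where S: "transpose S = S" "!!y. Q t z *v (S *v y) = y" "!!y. norm (S *v y) <= norm y / e0"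
   "!!y. y \<bullet> (S *v y) >= c' * (norm y)^2" "Q t z \<bullet> S = d" "!!B. abs (B \<bullet> S) <= d * norm B / e0"
   using pd_inverse[OF Qsym e0(1) e0(2)[OF tI] La(1)[OF t z2]] unfolding c'_def d_def by metis
  let ?h = "%r x. cut ro x * exp (- NN * ln (r - t + sg) + (- 1 / (4 * (r - t + sg))) * ((x - z) \<bullet> (S *v (x - z))))"
  let ?L = "%r x. exp (- NN * ln (r - t + sg) + (- 1 / (4 * (r - t + sg))) * ((x - z) \<bullet> (S *v (x - z)))) *
   (cut ro x * (- NN / (r - t + sg) + (Q r x \<bullet> S) / (2 * (r - t + sg)) + (b r x \<bullet> (S *v (x - z))) / (2 * (r - t + sg))
     + ((x - z) \<bullet> (S *v (x - z))) / (4 * (r - t + sg)^2) - ((S *v (x - z)) \<bullet> (Q r x *v (S *v (x - z)))) / (4 * (r - t + sg)^2))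
   - AA r (Dcut ro) (Hcut ro) x + (Dcut ro x \<bullet> (Q r x *v (S *v (x - z)))) / (r - t + sg))"
  obtain D where D: "Lsol ({t - sg<..} \<inter> I) ?h ?L D" using gauss_Lsol[OF S(1) refl, of t sg ro NN z] by blast
  have E: "exp (- NN * ln ta + (- 1 / (4 * ta)) * X) = ta powr (- NN) * exp (- X / (4 * ta))" if "ta > 0" for ta X
   using that by (simp add: powr_def exp_add[symmetric])
  have Xge: "(x - z) \<bullet> (S *v (x - z)) >= c' * (norm (x - z))^2" for x by (rule S(4))
  have X0: "(x - z) \<bullet> (S *v (x - z)) >= 0" for x
  proof -
   have "0 <= c' * (norm (x - z))^2" using c'0 by simp
   then show ?thesis using Xge[of x] by linarith
  qed
  have Lbound: "abs (?L r x) <= C * (r - t + sg) powr (ga - 1 - NN) * exp (- (c' / 8) * (norm (x - z))^2 / (r - t + sg))"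
   if r: "r : {t..t2}" for r x
  proof -
   define ta where "ta = r - t + sg"
   have tau: "0 < ta" "ta <= tam" "r - t <= ta" using r s t by (auto simp: ta_def tam_def)
   have rr: "r : {t0..t2}" using r t by auto
   define y where "y = norm (x - z)"
   define X where "X = (x - z) \<bullet> (S *v (x - z))"
   define v where "v = S *v (x - z)"
   define B where "B = cut ro x * (- NN / ta + (Q r x \<bullet> S) / (2 * ta) + (b r x \<bullet> v) / (2 * ta)
     + X / (4 * ta^2) - (v \<bullet> (Q r x *v v)) / (4 * ta^2)) - AA r (Dcut ro) (Hcut ro) x + (Dcut ro x \<bullet> (Q r x *v v)) / ta"
   have Bb: "abs B <= max 1 tam * C1 * ta powr (ga - 1) * (1 + y / sqrt ta) ^ 3"
   proof (cases "norm x <= 2 * ro")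
    case False
    then have "norm x > 2 * ro" by simp
    then have "Dcut ro x = 0" "Hcut ro x = 0" using C2w_zero_out[OF C2w_cut[of ro], of "2 * ro" x] cut_zero[OF rho] by auto
    moreover have "cut ro x = 0" using cut_zero[OF rho, of x] False by simp
    ultimately have "B = 0" by (simp add: B_def AA_def)
    then show ?thesis using C1 tau by (simp add: y_def)
   next
    case True
    note La' = La[OF rr True]
    define \<Delta> where "\<Delta> = norm (Q r x - Q t z)"
    have D1: "\<Delta> <= M' * (ta powr (\<alpha> / 2) + y powr \<alpha>)"
    proof -
     have "abs (r - t) powr (\<alpha> / 2) <= ta powr (\<alpha> / 2)" using r tau al by (intro powr_mono2) auto
     then have "M' * (abs (r - t) powr (\<alpha> / 2) + y powr \<alpha>) <= M' * (ta powr (\<alpha> / 2) + y powr \<alpha>)" using M' by (intro mult_left_mono) auto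
     then show ?thesis using DQ[OF rr True t z2] by (simp add: \<Delta>_def y_def)
    qed
    have vn: "norm v <= y / e0" using S(3) by (simp add: v_def y_def)
    have b1: "abs (- NN / ta + (Q r x \<bullet> S) / (2 * ta)) <= \<Delta> * d / (2 * e0 * ta)"
    proof -
     have "- NN / ta + (Q r x \<bullet> S) / (2 * ta) = ((Q r x - Q t z) \<bullet> S) / (2 * ta)"
      unfolding inner_diff_left S(5) d_def NN using tau by (simp add: field_simps)
     also have "abs (...) = abs ((Q r x - Q t z) \<bullet> S) / (2 * ta)" using tau by simp
     also have "... <= (d * \<Delta> / e0) / (2 * ta)" using S(6)[of "Q r x - Q t z"] tau by (intro divide_right_mono) (auto simp: \<Delta>_def)
     finally show ?thesis by (simp add: mult_ac)
    qed
    have b2: "abs (X / (4 * ta^2) - (v \<bullet> (Q r x *v v)) / (4 * ta^2)) <= \<Delta> * y^2 / (4 * e0^2 * ta^2)"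
    proof -
     have "X = v \<bullet> (Q t z *v v)" unfolding X_def v_def S(2) by (simp add: inner_commute)
     then have "X / (4 * ta^2) - (v \<bullet> (Q r x *v v)) / (4 * ta^2) = - ((v \<bullet> ((Q r x - Q t z) *v v)) / (4 * ta^2))"
      by (simp add: matrix_vector_mult_diff_rdistrib inner_diff_right diff_divide_distrib)
     also have "abs (...) = abs (v \<bullet> ((Q r x - Q t z) *v v)) / (4 * ta^2)" by simp
     also have "... <= ((y / e0) * (\<Delta> * (y / e0))) / (4 * ta^2)"
     proof (intro divide_right_mono)
      have "abs (v \<bullet> ((Q r x - Q t z) *v v)) <= norm v * norm ((Q r x - Q t z) *v v)" by (rule Cauchy_Schwarz_ineq2)
      also have "... <= norm v * (\<Delta> * norm v)" unfolding \<Delta>_def by (intro mult_left_mono matrix_vec_norm) auto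
      also have "... <= (y / e0) * (\<Delta> * (y / e0))" using vn e0(1) by (intro mult_mono) (auto simp: \<Delta>_def y_def)
      finally show "abs (v \<bullet> ((Q r x - Q t z) *v v)) <= (y / e0) * (\<Delta> * (y / e0))" .
     qed auto
     also have "... = \<Delta> * y^2 / (4 * e0^2 * ta^2)" by (simp add: power2_eq_square mult_ac)
     finally show ?thesis .
    qed
    have b3: "abs ((b r x \<bullet> v) / (2 * ta)) <= La * y / (2 * e0 * ta)"
    proof -
     have "abs (b r x \<bullet> v) <= norm (b r x) * norm v" by (rule Cauchy_Schwarz_ineq2)
     also have "... <= La * (y / e0)" using La'(2) vn Lp by (intro mult_mono) auto
     finally have "abs (b r x \<bullet> v) / (2 * ta) <= (La * (y / e0)) / (2 * ta)" using tau by (intro divide_right_mono) auto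
     then show ?thesis using tau by (simp add: mult_ac)
    qed
    have b4: "abs ((Dcut ro x \<bullet> (Q r x *v v)) / ta) <= La * La * y / (e0 * ta)"
    proof -
     have "abs (Dcut ro x \<bullet> (Q r x *v v)) <= norm (Dcut ro x) * norm (Q r x *v v)" by (rule Cauchy_Schwarz_ineq2)
     also have "... <= norm (Dcut ro x) * (norm (Q r x) * norm v)" by (intro mult_left_mono matrix_vec_norm) auto
     also have "... <= La * (La * (y / e0))" using La' vn Lp by (intro mult_mono) auto
     finally have "abs (Dcut ro x \<bullet> (Q r x *v v)) / ta <= (La * (La * (y / e0))) / ta" using tau by (intro divide_right_mono) auto
     then show ?thesis using tau by (simp add: mult_ac)
    qed
    define Y where "Y = - NN / ta + (Q r x \<bullet> S) / (2 * ta) + (b r x \<bullet> v) / (2 * ta) + X / (4 * ta^2) - (v \<bullet> (Q r x *v v)) / (4 * ta^2)"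
    have Yb: "abs Y <= \<Delta> * d / (2 * e0 * ta) + La * y / (2 * e0 * ta) + \<Delta> * y^2 / (4 * e0^2 * ta^2)"
     using b1 b2 b3 unfolding Y_def by linarith
    have "abs (cut ro x * Y) <= 1 * abs Y" unfolding abs_mult using cut_range[of ro x] by (intro mult_right_mono) auto
    then have "abs B <= \<Delta> * d / (2 * e0 * ta) + \<Delta> * y^2 / (4 * e0^2 * ta^2) + La * y / (2 * e0 * ta) + La + La * La * y / (e0 * ta)"
     unfolding B_def Y_def[symmetric] using Yb b4 La'(3) by linarith
    also have "... <= max 1 tam * C1 * ta powr (ga - 1) * (1 + y / sqrt ta) ^ 3"
     unfolding C1_def by (rule gauss_bracket[OF tau(1,2) g al(2) e0(1) M' _ _ _ _ D1]) (use d0 Lp in "auto simp: \<Delta>_def y_def")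
    finally show ?thesis .
   qed
   define xi where "xi = y / sqrt ta"
   have xs: "xi^2 = y^2 / ta" using tau by (simp add: xi_def power_divide)
   have x0: "xi >= 0" using tau by (simp add: xi_def y_def)
   have "abs (?L r x) = ta powr (- NN) * exp (- X / (4 * ta)) * abs B"
   proof -
    have Xv: "(x - z) \<bullet> v = X" by (simp add: X_def v_def)
    show ?thesis unfolding ta_def[symmetric] v_def[symmetric] Xv E[OF tau(1)] B_def[symmetric] by (simp add: abs_mult)
   qed
   also have "... <= ta powr (- NN) * exp (- c' / 4 * xi^2) * (max 1 tam * C1 * ta powr (ga - 1) * (C4 * exp (c' / 8 * xi^2)))"
   proof (intro mult_mono mult_left_mono)
    have "X / (4 * ta) >= c' * y^2 / (4 * ta)" using Xge[of x] tau by (intro divide_right_mono) (auto simp: X_def y_def)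
    then show "exp (- X / (4 * ta)) <= exp (- c' / 4 * xi^2)" unfolding xs using tau by simp
    have "max 1 tam * C1 * ta powr (ga - 1) * (1 + y / sqrt ta) ^ 3 <= max 1 tam * C1 * ta powr (ga - 1) * (C4 * exp (c' / 8 * xi^2))"
     using C4(2)[OF x0] C1 by (intro mult_left_mono) (auto simp: xi_def)
    then show "abs B <= max 1 tam * C1 * ta powr (ga - 1) * (C4 * exp (c' / 8 * xi^2))" using Bb by linarith
   qed auto
   also have "... = C * (ta powr (- NN) * ta powr (ga - 1)) * (exp (- c' / 4 * xi^2) * exp (c' / 8 * xi^2))"
    by (simp add: C_def mult_ac)
   also have "ta powr (- NN) * ta powr (ga - 1) = ta powr (ga - 1 - NN)" by (simp add: powr_add[symmetric] algebra_simps)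
   also have "exp (- c' / 4 * xi^2) * exp (c' / 8 * xi^2) = exp (- (c' / 8) * y^2 / ta)" unfolding xs exp_add[symmetric] by simp
   finally show ?thesis by (simp only: ta_def y_def)
  qed
  show "EX h L D. Lsol ({t - sg<..} \<inter> I) h L D &
   (ALL r x. 2 * (R + 1) <= norm x --> h r x = 0) &
   (ALL r:{t..t2}. ALL x. abs (L r x) <= C * (r - t + sg) powr (ga - 1 - NN) * exp (- (c' / 8) * (norm (x - z))^2 / (r - t + sg))) &
   (ALL r:{t..t2}. ALL x. 0 <= h r x & h r x <= (r - t + sg) powr (- NN)) &
   (ALL x. norm x <= R + 1 --> sg powr (- NN) * exp (- (norm (x - z))\<^sup>2 / (4 * e0 * sg)) <= h t x)"
  proof (rule exI[of _ ?h], rule exI[of _ ?L], rule exI[of _ D], intro conjI D allI impI ballI)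
   show "?h r x = 0" if "2 * (R + 1) <= norm x" for r x using cut_zero[OF rho, of x] that by (simp add: ro_def)
   show "abs (?L r x) <= C * (r - t + sg) powr (ga - 1 - NN) * exp (- (c' / 8) * (norm (x - z))^2 / (r - t + sg))" if "r : {t..t2}" for r x
    by (rule Lbound[OF that])
   fix r x assume r: "r : {t..t2}"
   show "0 <= ?h r x" using cut_range(1)[of ro x] by (intro mult_nonneg_nonneg) auto
   have tp: "r - t + sg > 0" using r s by auto
   have "?h r x <= 1 * ((r - t + sg) powr (- NN) * 1)"
    unfolding E[OF tp] using cut_range[of ro x] X0[of x] tp by (intro mult_mono) auto
   then show "?h r x <= (r - t + sg) powr (- NN)" by simp
  next
   fix x :: "real^'n" assume x: "norm x <= R + 1"
   have sp: "sg > 0" using s by simp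
   have st: "t - t + sg = sg" by simp
   have "cut ro x = 1" by (rule cut_one[OF rho]) (use x in "simp add: ro_def")
   moreover have "(x - z) \<bullet> (S *v (x - z)) <= (norm (x - z))^2 / e0"
   proof -
    have "(x - z) \<bullet> (S *v (x - z)) <= norm (x - z) * norm (S *v (x - z))" by (rule norm_cauchy_schwarz)
    also have "... <= norm (x - z) * (norm (x - z) / e0)" by (intro mult_left_mono S(3)) auto
    finally show ?thesis by (simp add: power2_eq_square)
   qed
   then have "((x - z) \<bullet> (S *v (x - z))) / (4 * sg) <= ((norm (x - z))^2 / e0) / (4 * sg)" using sp by (intro divide_right_mono) auto
   then have "- (norm (x - z))\<^sup>2 / (4 * e0 * sg) <= - ((x - z) \<bullet> (S *v (x - z))) / (4 * sg)" by (simp add: mult_ac)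
   ultimately show "sg powr (- NN) * exp (- (norm (x - z))\<^sup>2 / (4 * e0 * sg)) <= ?h t x"
    unfolding st E[OF sp] using sp by simp
  qed
 qed
qed

text \<open>
 Gaussian bumps of variance \<open>sg\<close> have mass at most a multiple of \<open>sg powr \<beta>\<close> under every flow of
 measures. The parametrix raises the exponent in small steps up to half the dimension, where the
 bound compares the measure of a ball with its volume.
\<close>
definition SB :: "real => bool" where
 "SB \<beta> \<longleftrightarrow> (ALL t0 t1 T R. t0 : I & t0 <= t1 & t1 < T & R > 0 -->
  (EX C>0. ALL m. flow {t0..T} m --> (ALL t:{t0..t1}. ALL z:cball 0 R. ALL sg>0. lint (m t) (%x. exp (- (norm (x - z))\<^sup>2 / sg)) <= C * sg powr \<beta>)))"

lemma gauss_Cb: "sg > 0 ==> (%x::real^'n. exp (- (norm (x - z))\<^sup>2 / sg)) : Cb"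
 by (rule CbI[of _ 1]) (auto intro!: continuous_intros)

lemma SB_0: "SB 0"
 unfolding SB_def
proof (intro allI impI exI[of _ 1] conjI ballI)
 fix t0 t1 T R m t z and sg :: real
 assume a: "t0 : I & t0 <= t1 & t1 < T & 0 < R" "flow {t0..T} m" "t : {t0..t1}" "z : cball (0::real^'n) R" "sg > 0"
 have "abs (lint (m t) (%x. exp (- (norm (x - z))\<^sup>2 / sg))) <= 1"
  by (rule flow_bound[OF a(2) _ gauss_Cb[OF a(5)]]) (use a in auto)
 then show "lint (m t) (%x. exp (- (norm (x - z))\<^sup>2 / sg)) <= 1 * sg powr 0" using a(5) by simp
qed simp

text \<open>Controls the Gaussian at distance at least 1 from its centre. From exp y >= (1 + y/n)^n
  with n the dimension it is of order sg^n, better than the required sg^(n/2).\<close>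

lemma exp_neg_inv:
 assumes s: "0 < sg" "sg <= 1" and e: "e > 0"
 shows "exp (- 1 / (4 * e * sg)) <= (4 * e * real CARD('n)) ^ CARD('n) * sg powr NN"
proof -
 define n where "n = CARD('n)"
 have n: "n > 0" by (simp add: n_def)
 define y where "y = 1 / (4 * e * sg)"
 have y: "y > 0" using s e by (simp add: y_def)
 have "(y / real n) ^ n <= (1 + y / real n) ^ n" using y n by (intro power_mono) auto
 also have "... <= exp y" by (rule exp_ge_one_plus_x_over_n_power_n) (use y n in auto)
 finally have "exp (- y) <= 1 / (y / real n) ^ n" using y n by (simp add: exp_minus field_simps)
 also have "... = (4 * e * real n * sg) ^ n" using s e n by (simp add: y_def power_divide power_mult_distrib field_simps)
 also have "... = (4 * e * real n) ^ n * sg powr real n" using s by (simp add: power_mult_distrib powr_realpow)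
 also have "... <= (4 * e * real n) ^ n * sg powr (real n / 2)" using s e by (intro mult_left_mono powr_mono') auto
 finally show ?thesis by (simp add: y_def n_def NN)
qed

text \<open>Let \<Psi>(r) be the integral of the parametrix under m r. Its derivative is at least a
  negative multiple of ta^(ga-1-NN) times a Gaussian integral, and the hypothesis turns this into
  ta^(e-1) with e = ga + \<beta> - NN. Integration from t up to a later time, where the Gaussian is
  already wide and \<Psi> bounded, gives \<Psi>(t) of order sg^(min e 0); multiplication by sg^NN
  yields the new exponent. The case e = 0 would bring in a logarithm and is excluded.\<close>

lemma SB_step:
 assumes SB: "SB \<beta>" and g: "0 < ga" "ga <= \<alpha> / 2" and b0: "\<beta> >= 0" and ne: "ga + \<beta> ~= NN"
 shows "SB (min (ga + \<beta>) NN)"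
 unfolding SB_def
proof (intro allI impI)
 fix t0 t1 T R :: real
 assume a: "t0 : I & t0 <= t1 & t1 < T & 0 < R"
 \<comment> \<open>The midpoint leaves time after every t <= t1 for the Gaussian to spread, and
   stays below T as the induction hypothesis demands.\<close>
 define t2 where "t2 = (t1 + T) / 2"
 have t2: "t1 < t2" "t2 < T" "t0 <= t2" using a by (auto simp: t2_def)
 define e where "e = ga + \<beta> - NN"
 have e: "e ~= 0" using ne by (simp add: e_def)
 define \<beta>' where "\<beta>' = min (ga + \<beta>) NN"
 have be: "\<beta>' = NN + min e 0" by (auto simp: \<beta>'_def e_def min_def)
 have N0: "NN >= 0" by (simp add: NN)
 have be0: "\<beta>' >= 0" using g b0 N0 by (auto simp: \<beta>'_def)
 obtain C c where C: "C > 0" "c > 0" and pb: "ALL t:{t0..t2}. ALL z:cball 0 R. ALL sg:{0<..1}. EX h L D. Lsol ({t - sg<..} \<inter> I) h L D &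
  (ALL r x. 2 * (R + 1) <= norm x --> h r x = 0) &
  (ALL r:{t..t2}. ALL x. abs (L r x) <= C * (r - t + sg) powr (ga - 1 - NN) * exp (- c * (norm (x - z))^2 / (r - t + sg))) &
  (ALL r:{t..t2}. ALL x. 0 <= h r x & h r x <= (r - t + sg) powr (- NN)) &
  (ALL x. norm x <= R + 1 --> sg powr (- NN) * exp (- (norm (x - z))\<^sup>2 / (4 * e0 * sg)) <= h t x)"
  using param_bound[of t0 t2 R ga] a t2 g by blast
 have "t0 : I & t0 <= t2 & t2 < T & 0 < R" using a t2 by simp
 then obtain Cb' where Cb': "Cb' > 0" "!!m t z sg. flow {t0..T} m ==> t : {t0..t2} ==> z : cball 0 R ==> sg > 0 ==>
   (lint (m t) (%x. exp (- (norm (x - z))\<^sup>2 / sg))) <= Cb' * sg powr \<beta>"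
  using SB unfolding SB_def by meson
 define C6 where "C6 = C * Cb' * (1 / c) powr \<beta>"
 have C6: "C6 > 0" using C Cb' by (simp add: C6_def)
 define tam where "tam = t2 - t0 + 1"
 have tm: "tam > 0" using t2 by (simp add: tam_def)
 define de where "de = t2 - t1"
 have de: "de > 0" using t2 by (simp add: de_def)
 define C8 where "C8 = de powr (- NN) + C6 / abs e * (1 + tam powr abs e)"
 define C9 where "C9 = (4 * e0 * real CARD('n)) ^ CARD('n)"
 have C8: "C8 > 0" unfolding C8_def using de C6 e by (intro add_pos_nonneg) auto
 have C9: "C9 > 0" using e0 by (simp add: C9_def)
 have small: "lint (m t) (%x. exp (- (norm (x - z))\<^sup>2 / (4 * e0 * sg))) <= (C8 + C9) * sg powr \<beta>'"
  if fl: "flow {t0..T} m" and t: "t : {t0..t1}" and z: "z : cball 0 R" and s: "0 < sg" "sg <= 1" for m t z sg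
 proof -
  have tt: "t : {t0..t2}" "t : {t0..T}" using t t2 a by auto
  have s': "sg : {0<..1}" using s by simp
  obtain h L D where L: "Lsol ({t - sg<..} \<inter> I) h L D" and hz: "!!r x. 2 * (R + 1) <= norm x ==> h r x = 0"
   and Lb: "!!r x. r : {t..t2} ==> abs (L r x) <= C * (r - t + sg) powr (ga - 1 - NN) * exp (- c * (norm (x - z))^2 / (r - t + sg))"
   and hb: "!!r x. r : {t..t2} ==> 0 <= h r x & h r x <= (r - t + sg) powr (- NN)"
   and hl: "!!x. norm x <= R + 1 ==> sg powr (- NN) * exp (- (norm (x - z))\<^sup>2 / (4 * e0 * sg)) <= h t x"
   using pb[rule_format, OF tt(1) z s'] by metis
  have Jsub: "{t..t2} \<subseteq> {t0..T}" using t t2 by auto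
  have flJ: "flow {t..t2} m" by (rule flow_subset[OF fl Jsub])
  have JU: "{t..t2} \<subseteq> {t - sg<..} \<inter> I" using s I_up[of t0] a t by auto
  have opU: "open ({t - sg<..} \<inter> I)" using I_open by auto
  define \<Psi> where "\<Psi> r = lint (m r) (h r)" for r
  have der: "(\<Psi> has_real_derivative (lint (m r) (L r))) (at r within {t..t2})" and LCb: "L r : Cb" if r: "r : {t..t2}" for r
  proof -
   note d = Lsol_flow_deriv[OF L flJ is_interval_cc opU JU _ r, of "2 * (R + 1)"]
   show "(\<Psi> has_real_derivative (lint (m r) (L r))) (at r within {t..t2})" unfolding \<Psi>_def by (rule d(1)) (rule hz)
   show "L r : Cb" by (rule d(2)) (rule hz)
  qed
  have dlow: "lint (m r) (L r) >= - C6 * (r - t + sg) powr (e - 1)" if r: "r : {t..t2}" for r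
  proof -
   define ta where "ta = r - t + sg"
   have tp: "ta > 0" using r s by (auto simp: ta_def)
   have rT: "r : {t0..T}" "r : {t0..t2}" using r Jsub t by auto
   have gc: "ta / c > 0" using tp C by simp
   have "lint (m r) (%x. - L r x) <= lint (m r) (%x. C * ta powr (ga - 1 - NN) * exp (- (norm (x - z))\<^sup>2 / (ta / c)))"
   proof (rule integral_mono)
    show "integrable (m r) (%x. - L r x)" using flow_int(1)[OF fl rT(1) LCb[OF r]] by simp
    show "integrable (m r) (%x. C * ta powr (ga - 1 - NN) * exp (- (norm (x - z))\<^sup>2 / (ta / c)))"
     using flow_int(1)[OF fl rT(1) gauss_Cb[OF gc]] by simp
    show "- L r x <= C * ta powr (ga - 1 - NN) * exp (- (norm (x - z))\<^sup>2 / (ta / c))" for x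
    proof -
     have "- c * (norm (x - z))^2 / ta = - (norm (x - z))\<^sup>2 / (ta / c)" using C by simp
     then show ?thesis using Lb[OF r, of x] unfolding ta_def[symmetric] by (simp add: mult.commute)
    qed
   qed
   also have "... = C * ta powr (ga - 1 - NN) * lint (m r) (%x. exp (- (norm (x - z))\<^sup>2 / (ta / c)))" by simp
   also have "... <= C * ta powr (ga - 1 - NN) * (Cb' * (ta / c) powr \<beta>)"
    using Cb'(2)[OF fl rT(2) z gc] C by (intro mult_left_mono) auto
   also have "... = C6 * (ta powr (ga - 1 - NN) * ta powr \<beta>)"
    using tp C by (simp add: C6_def powr_divide powr_mult mult_ac)
   also have "ta powr (ga - 1 - NN) * ta powr \<beta> = ta powr (e - 1)" by (simp add: powr_add[symmetric] e_def algebra_simps)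
   finally show ?thesis by (simp add: ta_def)
  qed
  \<comment> \<open>The lower bound on the derivative of \<Psi> says that \<Psi> plus a primitive of
    C6 ta^(e-1) is nondecreasing.\<close>
  have mono: "\<Psi> t + C6 / e * (t - t + sg) powr e <= \<Psi> t2 + C6 / e * (t2 - t + sg) powr e"
  proof (rule DERIV_nonneg_imp_increasing_open[where f = "%r. \<Psi> r + C6 / e * (r - t + sg) powr e"])
   show "t <= t2" using t t2 by simp
   have "continuous_on {t..t2} \<Psi>" using der by (rule DERIV_continuous_on)
   then show "continuous_on {t..t2} (%r. \<Psi> r + C6 / e * (r - t + sg) powr e)"
    using s by (intro continuous_intros) auto
   fix r assume r: "t < r" "r < t2"
   then have rr: "r : {t..t2}" by simp
   have d1: "(\<Psi> has_real_derivative (lint (m r) (L r))) (at r)"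
    using der[OF rr] r at_within_interior[of r "{t..t2}"] by (simp add: interior_atLeastAtMost_real)
   have d2: "((%r. C6 / e * (r - t + sg) powr e) has_real_derivative C6 * (r - t + sg) powr (e - 1)) (at r)"
    using r s e by (auto intro!: derivative_eq_intros)
   have "((%r. \<Psi> r + C6 / e * (r - t + sg) powr e) has_real_derivative (lint (m r) (L r)) + C6 * (r - t + sg) powr (e - 1)) (at r)"
    by (rule DERIV_add[OF d1 d2])
   moreover have "lint (m r) (L r) + C6 * (r - t + sg) powr (e - 1) >= 0" using dlow[OF rr] by simp
   ultimately show "EX y. ((%r. \<Psi> r + C6 / e * (r - t + sg) powr e) has_real_derivative y) (at r) & 0 <= y" by blast
  qed
  define ta2 where "ta2 = t2 - t + sg"
  have ta: "de <= ta2" "ta2 <= tam" "ta2 > 0" using t s t2 by (auto simp: de_def ta2_def tam_def)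
  have tt2: "t2 : {t..t2}" "t2 : {t0..T}" using t t2 by auto
  have hCb2: "h r : Cb" if "r : {t..t2}" for r
  proof (rule Cc_Cb[of _ "2 * (R + 1)"])
   show "continuous_on UNIV (h r)" using L JU that unfolding Lsol_def cl12_def by (meson C2w_cont subsetD)
  qed (rule hz)
  have P2: "\<Psi> t2 <= de powr (- NN)"
  proof -
   have hp: "abs (h t2 x) <= ta2 powr (- NN)" for x using hb[OF tt2(1), of x] by (simp add: ta2_def)
   have "abs (\<Psi> t2) <= ta2 powr (- NN)" unfolding \<Psi>_def by (rule flow_bound[OF fl tt2(2) hCb2[OF tt2(1)] hp])
   also have "... <= de powr (- NN)" using ta de N0 by (intro powr_mono2') auto
   finally show ?thesis by simp
  qed
  have sm: "sg powr (min e 0) >= 1"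
  proof -
   have "sg powr 0 <= sg powr (min e 0)" using s by (intro powr_mono') auto
   then show ?thesis using s by simp
  qed
  have dif: "C6 / e * ta2 powr e - C6 / e * sg powr e <= C6 / abs e * (1 + tam powr abs e) * sg powr (min e 0)"
  proof (cases "e > 0")
   case True
   have "C6 / e * ta2 powr e - C6 / e * sg powr e <= C6 / e * ta2 powr e" using C6 True by simp
   also have "... <= C6 / e * tam powr e" using ta C6 True by (intro mult_left_mono powr_mono2) auto
   also have "... <= C6 / e * (1 + tam powr e)" using C6 True by (intro mult_left_mono) auto
   finally show ?thesis using True s by (simp add: min_def)
  next
   case False
   then have en: "e < 0" using e by simp
   have "C6 / e * ta2 powr e - C6 / e * sg powr e = C6 / abs e * sg powr e - C6 / abs e * ta2 powr e" using en by (simp add: field_simps)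
   also have "... <= C6 / abs e * sg powr e" using C6 by simp
   also have "... = C6 / abs e * 1 * sg powr e" by simp
   also have "... <= C6 / abs e * (1 + tam powr abs e) * sg powr e" using C6 by (intro mult_right_mono mult_left_mono) auto
   finally show ?thesis using en by (simp add: min_def)
  qed
  have Psi: "\<Psi> t <= C8 * sg powr (min e 0)"
  proof -
   have "\<Psi> t <= \<Psi> t2 + (C6 / e * ta2 powr e - C6 / e * sg powr e)" using mono by (simp add: ta2_def)
   also have "... <= de powr (- NN) * 1 + C6 / abs e * (1 + tam powr abs e) * sg powr (min e 0)" using P2 dif by simp
   also have "... <= de powr (- NN) * sg powr (min e 0) + C6 / abs e * (1 + tam powr abs e) * sg powr (min e 0)"
    using sm by (intro add_right_mono mult_left_mono) auto
   finally show ?thesis unfolding C8_def by (simp add: distrib_right)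
  qed
  have t1: "t : {t..t2}" using t t2 by simp
  interpret pm: prob_space "m t" using fl tt(2) by (auto simp: flow_def)
  have es: "4 * e0 * sg > 0" using e0 s by simp
  \<comment> \<open>Within radius R + 1 the parametrix at time t dominates the Gaussian. Outside,
    the distance to z is at least 1 and the Gaussian is below the constant.\<close>
  have "lint (m t) (%x. exp (- (norm (x - z))\<^sup>2 / (4 * e0 * sg))) <= lint (m t) (%x. sg powr NN * h t x + exp (- 1 / (4 * e0 * sg)))"
  proof (rule integral_mono)
   show "integrable (m t) (%x. exp (- (norm (x - z))\<^sup>2 / (4 * e0 * sg)))" by (rule flow_int(1)[OF fl tt(2) gauss_Cb[OF es]])
   show "integrable (m t) (%x. sg powr NN * h t x + exp (- 1 / (4 * e0 * sg)))" using flow_int(1)[OF fl tt(2) hCb2[OF t1]] by simp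
   fix x
   show "exp (- (norm (x - z))\<^sup>2 / (4 * e0 * sg)) <= sg powr NN * h t x + exp (- 1 / (4 * e0 * sg))"
   proof (cases "norm x <= R + 1")
    case True
    have "sg powr NN * (sg powr (- NN) * exp (- (norm (x - z))\<^sup>2 / (4 * e0 * sg))) <= sg powr NN * h t x"
     using hl[OF True] by (intro mult_left_mono) auto
    moreover have "sg powr NN * sg powr (- NN) = 1" using s by (simp add: powr_add[symmetric])
    ultimately have "exp (- (norm (x - z))\<^sup>2 / (4 * e0 * sg)) <= sg powr NN * h t x" by (simp add: mult.assoc[symmetric])
    then show ?thesis by (smt (verit) exp_ge_zero)
   next
    case False
    have "norm x <= norm (x - z) + norm z" using norm_triangle_ineq[of "x - z" z] by simp
    then have "1 <= norm (x - z)" using False z by simp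
    then have "1 <= (norm (x - z))^2" by (simp add: one_le_power)
    then have "- (norm (x - z))\<^sup>2 / (4 * e0 * sg) <= - 1 / (4 * e0 * sg)" using es by (intro divide_right_mono) auto
    then have "exp (- (norm (x - z))\<^sup>2 / (4 * e0 * sg)) <= exp (- 1 / (4 * e0 * sg))" by simp
    moreover have "sg powr NN * h t x >= 0" using hb[OF t1, of x] by simp
    ultimately show ?thesis by linarith
   qed
  qed
  also have "... = sg powr NN * \<Psi> t + exp (- 1 / (4 * e0 * sg))"
   using flow_int(1)[OF fl tt(2) hCb2[OF t1]] by (simp add: \<Psi>_def pm.prob_space)
  also have "... <= sg powr NN * (C8 * sg powr (min e 0)) + C9 * sg powr NN"
   using Psi exp_neg_inv[OF s e0(1)] unfolding C9_def by (intro add_mono mult_left_mono) auto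
  also have "... <= sg powr NN * (C8 * sg powr (min e 0)) + C9 * sg powr \<beta>'"
  proof -
   have "sg powr NN <= sg powr \<beta>'" using s be by (intro powr_mono') auto
   then show ?thesis using C9 by (intro add_left_mono mult_left_mono) auto
  qed
  also have "... = (C8 + C9) * sg powr \<beta>'" unfolding be using s by (simp add: powr_add algebra_simps)
  finally show ?thesis .
 qed
 define Cf where "Cf = (C8 + C9 + 1) * (1 / (4 * e0)) powr \<beta>'"
 show "EX C>0. ALL m. flow {t0..T} m --> (ALL t:{t0..t1}. ALL z:cball 0 R. ALL sg>0. lint (m t) (%x. exp (- (norm (x - z))\<^sup>2 / sg)) <= C * sg powr min (ga + \<beta>) NN)"
 proof (intro exI[of _ Cf] conjI allI impI ballI)
  show "Cf > 0" using C8 C9 e0 by (simp add: Cf_def)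
  fix m t z sg assume fl: "flow {t0..T} m" and t: "t : {t0..t1}" and z: "z : cball (0::real^'n) R" and s: "(0::real) < sg"
  \<comment> \<open>The parametrix compares with Gaussians of width 4 e0 sg', for sg' at most 1. For
    larger sg' the total mass 1 is a sufficient bound.\<close>
  define sg' where "sg' = sg / (4 * e0)"
  have s': "sg' > 0" "sg = 4 * e0 * sg'" using s e0 by (auto simp: sg'_def)
  have sp: "sg' powr \<beta>' = (1 / (4 * e0)) powr \<beta>' * sg powr \<beta>'" unfolding sg'_def using s e0 by (simp add: powr_divide)
  have "lint (m t) (%x. exp (- (norm (x - z))\<^sup>2 / sg)) <= (C8 + C9 + 1) * sg' powr \<beta>'"
  proof (cases "sg' <= 1")
   case True
   have "lint (m t) (%x. exp (- (norm (x - z))\<^sup>2 / sg)) <= (C8 + C9) * sg' powr \<beta>'"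
    unfolding s'(2) by (rule small[OF fl t z s'(1) True])
   also have "... <= (C8 + C9 + 1) * sg' powr \<beta>'" by (intro mult_right_mono) auto
   finally show ?thesis .
  next
   case False
   have "abs (lint (m t) (%x. exp (- (norm (x - z))\<^sup>2 / sg))) <= 1"
    by (rule flow_bound[OF fl _ gauss_Cb[OF s]]) (use t a s in auto)
   moreover have "1 * 1 <= (C8 + C9 + 1) * sg' powr \<beta>'"
    using C8 C9 False be0 by (intro mult_mono ge_one_powr_ge_zero) auto
   ultimately show ?thesis by simp
  qed
  then show "lint (m t) (%x. exp (- (norm (x - z))\<^sup>2 / sg)) <= Cf * sg powr min (ga + \<beta>) NN"
   unfolding sp by (simp add: Cf_def \<beta>'_def mult.assoc)
 qed
qed

lemma SB_full: "SB NN"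
proof -
 have N: "NN > 0" by (simp add: NN)
 obtain n0 :: nat where n0: "real n0 > 2 * NN / \<alpha>" using reals_Archimedean2 by blast
 \<comment> \<open>The offset 1/2 ensures that no multiple of the step equals NN, the case excluded
   in \<open>SB_step\<close>; the multiple n0 + 1 is the first beyond NN.\<close>
 define ga where "ga = NN / (real n0 + 1 / 2)"
 have g0: "ga > 0" using N by (simp add: ga_def add_nonneg_pos)
 have gn: "ga * (real n0 + 1 / 2) = NN"
 proof -
  have "real n0 + 1 / 2 > 0" by (simp add: add_nonneg_pos)
  then show ?thesis by (simp add: ga_def)
 qed
 have ga: "ga <= \<alpha> / 2"
 proof -
  have "2 * NN < real n0 * \<alpha>" using n0 al by (simp add: field_simps)
  also have "... <= (real n0 + 1 / 2) * \<alpha>" using al by (intro mult_right_mono) auto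
  finally have "NN < (real n0 + 1 / 2) * (\<alpha> / 2)" by simp
  then have "ga * (real n0 + 1 / 2) < \<alpha> / 2 * (real n0 + 1 / 2)" unfolding gn by (simp add: mult.commute)
  moreover have "real n0 + 1 / 2 > 0" by (simp add: add_nonneg_pos)
  ultimately show ?thesis by (simp add: mult_less_cancel_right)
 qed
 have ne: "ga + real k * ga ~= NN" for k
 proof
  assume "ga + real k * ga = NN"
  then have "ga * (real k + 1) = ga * (real n0 + 1 / 2)" unfolding gn by (simp add: algebra_simps)
  then have "real k + 1 = real n0 + 1 / 2" using g0 by simp
  then have "2 * real k + 2 = 2 * real n0 + 1" by simp
  then have "2 * k + 2 = 2 * n0 + 1" by linarith
  then show False by presburger
 qed
 have "k <= n0 ==> SB (real k * ga)" for k
 proof (induction k)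
  case 0 then show ?case using SB_0 by simp
 next
  case (Suc k)
  have "SB (min (ga + real k * ga) NN)" using Suc g0 by (intro SB_step ga g0 ne) auto
  moreover have "ga + real k * ga <= NN"
  proof -
   have "ga + real k * ga = ga * (real (Suc k))" by (simp add: algebra_simps)
   also have "... <= ga * (real n0 + 1 / 2)" using Suc g0 by (intro mult_left_mono) auto
   finally show ?thesis by (simp add: gn)
  qed
  ultimately show ?case by (simp add: min_def algebra_simps)
 qed
 from this[of n0] have "SB (min (ga + real n0 * ga) NN)" using g0 by (intro SB_step ga g0 ne) auto
 moreover have "NN <= ga + real n0 * ga"
 proof -
  have "ga * (real n0 + 1 / 2) <= ga * (real n0 + 1)" using g0 by (intro mult_left_mono) auto
  then show ?thesis unfolding gn by (simp add: algebra_simps)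
 qed
 ultimately show ?thesis by (simp add: min_def split: if_splits)
qed

end

section \<open>From Gaussian bounds to densities\<close>

lemma nn_integral_dominated_measure:
 assumes s: "sets M = sets N" and le: "!!A. A : sets M ==> A \<subseteq> S ==> emeasure M A <= C * emeasure N A" and S: "S : sets M"
  and g: "g : borel_measurable M"
 shows "nint M (%x. g x * indicator S x) <= C * nint N (%x. g x * indicator S x)"
proof -
 have SN: "S : sets N" and gN: "g : borel_measurable N" using S g s measurable_cong_sets[OF s refl] by auto
 have "nint (density M (indicator S)) (%x. g x) <= nint (density N (%x. C * indicator S x)) (%x. g x)"
 proof (rule nn_integral_mono_measure)
  show "sets (density M (indicator S)) = sets (density N (%x. C * indicator S x))" using s by simp
  show "density M (indicator S) <= density N (%x. C * indicator S x)"
   unfolding le_measure[OF \<open>sets (density M (indicator S)) = sets (density N (%x. C * indicator S x))\<close>]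
  proof (intro ballI)
   fix A assume A: "A : sets (density M (indicator S))"
   show "emeasure (density M (indicator S)) A <= emeasure (density N (%x. C * indicator S x)) A"
   proof (cases "A : sets M")
    case True
    then have AN: "A : sets N" using s by simp
    have "emeasure (density M (indicator S)) A = emeasure M (A \<inter> S)"
     using True S by (simp add: emeasure_density indicator_inter_arith[symmetric] Int_commute)
    also have "... <= C * emeasure N (A \<inter> S)" by (rule le) (use True S in auto)
    also have "... = emeasure (density N (%x. C * indicator S x)) A"
     using AN SN by (simp add: emeasure_density mult.assoc indicator_inter_arith[symmetric] Int_commute nn_integral_cmult)
    finally show ?thesis .
   next
    case False
    then show ?thesis using s by (simp add: emeasure_notin_sets)
   qed
  qed
 qed
 moreover have "nint (density M (indicator S)) (%x. g x) = nint M (%x. g x * indicator S x)"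
  using S g by (simp add: nn_integral_density mult.commute)
 moreover have "nint (density N (%x. C * indicator S x)) (%x. g x) = C * nint N (%x. g x * indicator S x)"
  using SN gN by (simp add: nn_integral_density mult_ac flip: nn_integral_cmult)
 ultimately show ?thesis by simp
qed

context kolm_h begin

text \<open>The indicator of a ball of radius r lies below exp 1 times the Gaussian with sg = r^2,
  and (r^2)^NN is r to the dimension.\<close>

lemma ball_bound:
 assumes "t0 : I" "t0 <= t1" "t1 < T" "R > 0"
 shows "EX C>0. ALL m. flow {t0..T} m --> (ALL t:{t0..t1}. ALL z:cball 0 R. ALL r>0. measure (m t) (ball z r) <= C * r ^ CARD('n))"
proof -
 obtain C where C: "C > 0" "!!m t z sg. flow {t0..T} m ==> t : {t0..t1} ==> z : cball 0 R ==> sg > 0 ==>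
  (lint (m t) (%x. exp (- (norm (x - z))\<^sup>2 / sg))) <= C * sg powr NN"
  using SB_full assms unfolding SB_def by meson
 show ?thesis
 proof (intro exI[of _ "exp 1 * C"] conjI allI impI ballI)
  show "exp 1 * C > 0" using C by simp
  fix m t z and r :: real assume fl: "flow {t0..T} m" and t: "t : {t0..t1}" and z: "z : cball (0::real^'n) R" and r: "0 < r"
  have tt: "t : {t0..T}" using t assms by simp
  interpret prob_space "m t" using fl tt by (auto simp: flow_def)
  have st: "sets (m t) = sets borel" using fl tt by (auto simp: flow_def)
  have sp: "space (m t) = UNIV" using sets_eq_imp_space_eq[OF st] by simp
  have r2: "r^2 > 0" using r by simp
  have bs: "ball z r : sets (m t)" by (simp add: st)
  have "measure (m t) (ball z r) = lint (m t) (%x. indicator (ball z r) x)" using sp by simp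
  also have "... <= lint (m t) (%x. exp 1 * exp (- (norm (x - z))\<^sup>2 / r^2))"
  proof (rule integral_mono)
   show "integrable (m t) (indicat_real (ball z r))" using bs by (simp add: emeasure_eq_measure)
   show "integrable (m t) (%x. exp 1 * exp (- (norm (x - z))\<^sup>2 / r^2))"
    using flow_int(1)[OF fl tt gauss_Cb[OF r2]] by simp
   show "indicat_real (ball z r) x <= exp 1 * exp (- (norm (x - z))\<^sup>2 / r^2)" for x
   proof (cases "x : ball z r")
    case True
    then have "norm (x - z) <= r" by (simp add: dist_norm norm_minus_commute)
    then have "(norm (x - z))^2 <= r^2" by (intro power_mono) auto
    then have "(norm (x - z))^2 / r^2 <= 1" using r by simp
    then show ?thesis using True by (simp add: exp_add[symmetric])
   qed simp
  qed
  also have "... = exp 1 * lint (m t) (%x. exp (- (norm (x - z))\<^sup>2 / r^2))" by simp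
  also have "... <= exp 1 * (C * (r^2) powr NN)" using C(2)[OF fl t z r2] by (intro mult_left_mono) auto
  also have "(r^2) powr NN = r ^ CARD('n)"
  proof -
   have "(r^2) powr NN = (r powr 2) powr NN" using r by (simp add: powr_numeral)
   also have "... = r powr real CARD('n)" by (simp add: powr_powr NN)
   finally show ?thesis using r by (simp add: powr_realpow)
  qed
  finally show "measure (m t) (ball z r) <= exp 1 * C * r ^ CARD('n)" by (simp add: mult.assoc)
 qed
qed

text \<open>Averaging takes the place of a covering theorem. For open U let \<open>g k x\<close> be
  the fraction of the ball of radius \<open>ro k\<close> around x that lies in U; it is eventually 1
  for x in U. By Tonelli its integral under m t is an average of measures of small balls centred in
  U, at most C times the volume of U; Fatou's lemma gives the claim for U, outer regularity of
  Lebesgue measure for Borel sets.\<close>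

lemma flow_density:
 assumes "t0 : I" "t0 <= t1" "t1 < T" "R > 0"
 shows "EX C>0. ALL m. flow {t0..T} m --> (ALL t:{t0..t1}. ALL A:sets borel. A \<subseteq> ball 0 R --> emeasure (m t) A <= ennreal C * emeasure lborel A)"
proof -
 obtain C0 where C0: "C0 > 0" "!!m t z r. flow {t0..T} m ==> t : {t0..t1} ==> z : cball 0 R ==> r > 0 ==> measure (m t) (ball z r) <= C0 * r ^ CARD('n)"
  using ball_bound[OF assms] by metis
 define om where "om = unit_ball_vol (real DIM(real^'n))"
 have om: "om > 0" by (simp add: om_def)
 define C where "C = C0 / om"
 have C: "C > 0" using C0 om by (simp add: C_def)
 have op: "emeasure (m t) U <= ennreal C * emeasure lborel U"
  if fl: "flow {t0..T} m" and t: "t : {t0..t1}" and U: "open U" "U \<subseteq> ball 0 R" for m t U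
 proof -
  have tt: "t : {t0..T}" using t assms by simp
  interpret prob_space "m t" using fl tt by (auto simp: flow_def)
  have st: "sets (m t) = sets borel" using fl tt by (auto simp: flow_def)
  have sp: "space (m t) = UNIV" using sets_eq_imp_space_eq[OF st] by simp
  have Us: "U : sets (m t)" using U by (simp add: st)
  define ro where "ro k = 1 / real (Suc k)" for k
  have rho: "ro k > 0" for k by (simp add: ro_def)
  define v where "v k = om * ro k ^ CARD('n)" for k
  have v: "v k > 0" for k using om rho by (simp add: v_def)
  have eb: "emeasure lborel (ball x (ro k)) = ennreal (v k)" for x :: "real^'n" and k
   using emeasure_ball[of "ro k" x] rho[of k] by (simp add: v_def om_def less_imp_le)
  define F where "F k x z = (indicator U z * indicator {z. dist x z < ro k} z :: ennreal)" for k and x z :: "real^'n"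
  define g where "g k x = ennreal (1 / v k) * nint lborel (F k x)" for k x
  have Fm: "(%p. F k (fst p) (snd p)) : borel_measurable (borel \<Otimes>\<^sub>M borel)" for k
  proof -
   have "(%p::(real^'n) \<times> (real^'n). F k (fst p) (snd p)) = (%p. indicator ((UNIV \<times> U) \<inter> {p. dist (fst p) (snd p) < ro k}) p)"
    by (auto simp: F_def indicator_def fun_eq_iff)
   moreover have "open ((UNIV \<times> U) \<inter> {p::(real^'n) \<times> (real^'n). dist (fst p) (snd p) < ro k})"
    by (intro open_Int open_Times U open_Collect_less continuous_intros) auto
   then have "(UNIV \<times> U) \<inter> {p::(real^'n) \<times> (real^'n). dist (fst p) (snd p) < ro k} : sets (borel \<Otimes>\<^sub>M borel)"
    unfolding borel_prod by simp
   ultimately show ?thesis by simp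
  qed
  have lim: "indicator U x <= liminf (%k. g k x)" for x
  proof (cases "x : U")
   case True
   then obtain e where e: "e > 0" "ball x e \<subseteq> U" using U(1) open_contains_ball by blast
   obtain n where n: "inverse (real (Suc n)) < e" using reals_Archimedean[OF e(1)] by blast
   have "g k x = 1" if "k >= n" for k
   proof -
    have "ro k <= ro n" using that by (simp add: ro_def frac_le)
    then have "ro k < e" using n by (simp add: ro_def inverse_eq_divide)
    then have "ball x (ro k) \<subseteq> U" using e(2) subset_ball[of "ro k" e x] by auto
    then have "F k x = indicator (ball x (ro k))" by (auto simp: F_def fun_eq_iff indicator_def ball_def)
    then have "g k x = ennreal (1 / v k) * ennreal (v k)" by (simp add: g_def eb)
    also have "... = 1" using v[of k] by (simp add: ennreal_mult[symmetric])
    finally show ?thesis .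
   qed
   then have "eventually (%k. g k x = 1) sequentially" unfolding eventually_sequentially by blast
   then have "(%k. g k x) \<longlonglongrightarrow> 1" by (rule tendsto_eventually)
   from lim_imp_Liminf[OF sequentially_bot this] show ?thesis using True by simp
  qed simp
  have gint: "nint (m t) (g k) <= ennreal C * emeasure lborel U" for k
  proof -
   interpret L: pair_sigma_finite lborel "m t"
    by (intro pair_sigma_finite.intro) (auto intro: sigma_finite_measure_axioms lborel.sigma_finite_measure_axioms)
   have ms: "sets (lborel \<Otimes>\<^sub>M m t) = sets ((borel :: (real^'n) measure) \<Otimes>\<^sub>M borel)" by (intro sets_pair_measure_cong) (auto simp: st)
   have sw: "(%p. F k (snd p) (fst p)) : borel_measurable (lborel \<Otimes>\<^sub>M m t)"
    unfolding measurable_cong_sets[OF ms refl]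
    using measurable_compose[OF measurable_Pair[OF measurable_snd measurable_fst] Fm[of k]] by simp
   have ms2: "sets (m t \<Otimes>\<^sub>M lborel) = sets ((borel :: (real^'n) measure) \<Otimes>\<^sub>M borel)" by (intro sets_pair_measure_cong) (auto simp: st)
   have "(%x. nint lborel (F k x)) : borel_measurable (m t)"
    using lborel.borel_measurable_nn_integral[of "%x z. F k x z" "m t"] Fm[of k]
    unfolding measurable_cong_sets[OF ms2 refl] by (simp add: case_prod_beta')
   then have "nint (m t) (g k) = ennreal (1 / v k) * nint (m t) (%x. nint lborel (F k x))"
    unfolding g_def by (rule nn_integral_cmult)
   also have "nint (m t) (%x. nint lborel (F k x)) = nint lborel (%z. nint (m t) (%x. F k x z))"
    by (rule L.Fubini') (use sw in "simp add: case_prod_beta'")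
   also have "... <= nint lborel (%z. ennreal (C0 * ro k ^ CARD('n)) * indicator U z)"
   proof (rule nn_integral_mono)
    fix z :: "real^'n"
    have "nint (m t) (%x. F k x z) = indicator U z * emeasure (m t) (ball z (ro k))"
    proof -
     have "nint (m t) (%x. F k x z) = nint (m t) (%x. indicator U z * indicator (ball z (ro k)) x)"
      by (intro nn_integral_cong) (auto simp: F_def indicator_def dist_commute)
     also have "... = nint (m t) (%x. indicator (ball z (ro k)) x * indicator U z)" by (simp add: mult.commute)
     also have "... = emeasure (m t) (ball z (ro k)) * indicator U z"
      by (subst nn_integral_multc) (auto intro!: borel_measurable_indicator simp: st)
     finally show ?thesis by (simp add: mult.commute)
    qed
    also have "... <= ennreal (C0 * ro k ^ CARD('n)) * indicator U z"
    proof (cases "z : U")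
     case True
     then have "z : cball 0 R" using U(2) by auto
     then show ?thesis using True C0(2)[OF fl t _ rho] by (simp add: emeasure_eq_measure ennreal_leI)
    qed simp
    finally show "nint (m t) (%x. F k x z) <= ennreal (C0 * ro k ^ CARD('n)) * indicator U z" .
   qed
   also have "... = ennreal (C0 * ro k ^ CARD('n)) * emeasure lborel U" using U(1) by (simp add: nn_integral_cmult)
   finally have "nint (m t) (g k) <= ennreal (1 / v k) * (ennreal (C0 * ro k ^ CARD('n)) * emeasure lborel U)"
    by (simp add: mult_left_mono)
   also have "... = ennreal (1 / v k * (C0 * ro k ^ CARD('n))) * emeasure lborel U"
    using v[of k] C0 rho[of k] by (subst ennreal_mult) (auto simp: mult.assoc)
   also have "1 / v k * (C0 * ro k ^ CARD('n)) = C" using om rho[of k] by (simp add: v_def C_def)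
   finally show ?thesis .
  qed
  have gm: "g k : borel_measurable (m t)" for k
  proof -
   have ms2: "sets (m t \<Otimes>\<^sub>M lborel) = sets ((borel :: (real^'n) measure) \<Otimes>\<^sub>M borel)" by (intro sets_pair_measure_cong) (auto simp: st)
   have "(%x. nint lborel (F k x)) : borel_measurable (m t)"
    using lborel.borel_measurable_nn_integral[of "%x z. F k x z" "m t"] Fm[of k]
    unfolding measurable_cong_sets[OF ms2 refl] by (simp add: case_prod_beta')
   then show ?thesis unfolding g_def by measurable
  qed
  have "emeasure (m t) U = nint (m t) (indicator U)" using Us by simp
  also have "... <= nint (m t) (%x. liminf (%k. g k x))" by (intro nn_integral_mono lim)
  also have "... <= liminf (%k. nint (m t) (g k))" by (rule nn_integral_liminf[OF gm])
  also have "... <= liminf (%k::nat. ennreal C * emeasure lborel U)"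
   by (intro Liminf_mono always_eventually allI gint)
  finally show ?thesis by (simp add: Liminf_const)
 qed
 show ?thesis
 proof (intro exI[of _ C] conjI allI impI ballI)
  show "C > 0" by (rule C)
  fix m t A assume fl: "flow {t0..T} m" and t: "t : {t0..t1}" and A: "A : sets (borel :: (real^'n) measure)" "A \<subseteq> ball 0 R"
  have tt: "t : {t0..T}" using t assms by simp
  have st: "sets (m t) = sets borel" using fl tt by (auto simp: flow_def)
  show "emeasure (m t) A <= ennreal C * emeasure lborel A"
  proof (rule ennreal_le_epsilon)
   fix e :: real assume e: "0 < e"
   then have "e / C > 0" using C by simp
   from outer_regular_lborel[OF A(1) this] obtain V where V: "open V" "A \<subseteq> V" "emeasure lborel (V - A) < ennreal (e / C)" by metis
   define U where "U = V \<inter> ball 0 R"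
   have U: "open U" "U \<subseteq> ball 0 R" "A \<subseteq> U" using V A by (auto simp: U_def)
   have "emeasure (m t) A <= emeasure (m t) U" using U by (intro emeasure_mono) (auto simp: st)
   also have "... <= ennreal C * emeasure lborel U" by (rule op[OF fl t U(1,2)])
   also have "emeasure lborel U <= emeasure lborel A + emeasure lborel (V - A)"
   proof -
    have "emeasure lborel U <= emeasure lborel (A \<union> (V - A))" using V A U by (intro emeasure_mono) (auto simp: U_def)
    also have "... <= emeasure lborel A + emeasure lborel (V - A)" using V A by (intro emeasure_subadditive) auto
    finally show ?thesis .
   qed
   also have "... <= emeasure lborel A + ennreal (e / C)" using V(3) by (intro add_left_mono less_imp_le)
   finally have "emeasure (m t) A <= ennreal C * (emeasure lborel A + ennreal (e / C))"
    by (meson mult_left_mono order_trans zero_le)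
   also have "... = ennreal C * emeasure lborel A + ennreal e"
    using C e by (simp add: distrib_left ennreal_mult[symmetric])
   finally show "emeasure (m t) A <= ennreal C * emeasure lborel A + ennreal e" .
  qed
 qed
qed

text \<open>C does not depend on x, because \<open>flow_density\<close> is uniform over flows and
  the transition probabilities form a flow for every x.\<close>

lemma P_density:
 assumes "r : I" "r < t" "R > 0"
 shows "EX C>0. ALL x. ALL A:sets borel. A \<subseteq> ball 0 R --> emeasure (P t r x) A <= ennreal C * emeasure lborel A"
proof -
 have "flow {r..t} (%ro. P t ro x)" for x
  by (rule flow_subset[OF flow_P]) (use I_up[OF assms(1)] in auto)
 moreover have "r : {r..r}" by simp
 ultimately show ?thesis using flow_density[OF assms(1) order_refl assms(2,3)] by blast
qed

text \<open>Allows the mild equation, which holds Lebesgue-almost everywhere, to be used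
  \<mu>-almost everywhere. The density bounds are local, hence the exhaustion by balls.\<close>

lemma flow_AC:
 assumes fl: "flow I m" and t: "t : I" and N: "N : null_sets lborel"
 shows "N : null_sets (m t)"
proof -
 have st: "sets (m t) = sets borel" using fl t by (auto simp: flow_def)
 have Ns: "N : sets borel" using N by auto
 have fl': "flow {t..t + 1} m" by (rule flow_subset[OF fl]) (use I_up[OF t] in auto)
 have "emeasure (m t) (N \<inter> ball 0 (real (Suc k))) = 0" for k
 proof -
  obtain C where "C > 0" "ALL m. flow {t..t + 1} m --> (ALL s:{t..t}. ALL A:sets borel. A \<subseteq> ball 0 (real (Suc k)) --> emeasure (m s) A <= ennreal C * emeasure lborel A)"
   using flow_density[OF t order_refl, of "t + 1" "real (Suc k)"] by auto
  then have "emeasure (m t) (N \<inter> ball 0 (real (Suc k))) <= ennreal C * emeasure lborel (N \<inter> ball 0 (real (Suc k)))"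
   using fl' Ns by auto
  also have "emeasure lborel (N \<inter> ball 0 (real (Suc k))) = 0"
   using N by (metis Int_lower1 emeasure_mono le_zero_eq null_setsD1 null_setsD2)
  finally show ?thesis by simp
 qed
 then have "emeasure (m t) (\<Union>k. N \<inter> ball 0 (real (Suc k))) = 0"
  by (intro emeasure_UN_eq_0) (auto simp: st Ns)
 moreover have "(\<Union>k. N \<inter> ball 0 (real (Suc k))) = N"
 proof -
  have "EX k. norm x < real (Suc k)" for x :: "real^'n"
   using reals_Archimedean2[of "norm x"] by (metis less_trans of_nat_less_iff lessI)
  then show ?thesis by (auto simp: mem_ball_0)
 qed
 ultimately show ?thesis using Ns st by auto
qed

text \<open>Near x0 the kernels have uniformly small mass outside a ball, because their integrals of
  a cutoff are continuous in x. On the ball they have a common density bound C, so replacing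
  \<open>g\<close> by a continuous function close in L^1 of Lebesgue measure costs little uniformly
  in x; the continuous function is handled by \<open>G\<close>.\<close>

lemma strong_feller:
 fixes g :: "real ^ 'n => real"
 assumes r: "r : I" "r < t" and g: "g : Bmeas" "!!x. abs (g x) <= B"
 shows "continuous_on UNIV (%x. lint (P t r x) (%y. g y))"
 unfolding continuous_on_iff
proof (intro ballI allI impI)
 fix x0 :: "real^'n" and ep :: real assume e: "ep > 0"
 have rt: "r <= t" using r by simp
 have B0: "B >= 0" using g(2)[of 0] by linarith
 have Pp: "prob_space (P t r x)" and Ps: "sets (P t r x) = sets borel" for x using P[OF r(1) rt] by auto
 have sp: "space (P t r x) = UNIV" for x using sets_eq_imp_space_eq[OF Ps] by simp
 \<comment> \<open>The mass outside the ball meets a difference of at most 2B and so contributes at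
   most ep/6; B + 1 avoids division by 0.\<close>
 define de where "de = ep / (12 * (B + 1))"
 have de: "de > 0" using e B0 by (simp add: de_def)
 have cutCb: "(cut n :: real^'n => real) : Cb" for n
  by (rule CbI[OF C2w_cont[OF C2w_cut], of _ 1]) (simp add: abs_of_nonneg[OF cut_range(1)] cut_range(2))
 have "(%k. lint (P t r x0) (%y. cut (real (Suc k)) y)) \<longlonglongrightarrow> (lint (P t r x0) (%y. 1))"
 proof (rule Cb_limit_integral[OF prob_space.finite_measure[OF Pp] Ps, of _ 1])
  show "abs (cut (real (Suc k)) x) <= 1" for k and x :: "real^'n" using cut_range[of "real (Suc k)" x] by simp
  fix x :: "real^'n"
  have "eventually (%k. cut (real (Suc k)) x = 1) sequentially"
   unfolding eventually_sequentially
  proof (intro exI[of _ "nat \<lceil>norm x\<rceil>"] allI impI)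
   fix k assume "nat \<lceil>norm x\<rceil> <= k"
   then have "norm x <= real (Suc k)" by linarith
   then show "cut (real (Suc k)) x = 1" using cut_one[of "real (Suc k)" x] by simp
  qed
  then show "(%k. cut (real (Suc k)) x) \<longlonglongrightarrow> 1" by (rule tendsto_eventually)
 qed (use Cb_measurable[OF cutCb] in auto)
 then have "(%k. lint (P t r x0) (%y. cut (real (Suc k)) y)) \<longlonglongrightarrow> 1" using prob_space.prob_space[OF Pp] by (simp add: sp)
 from LIMSEQ_D[OF this de] obtain k where k: "abs (lint (P t r x0) (%y. cut (real (Suc k)) y) - 1) < de" by auto
 define n where "n = real (Suc k)"
 have n: "n > 0" by (simp add: n_def)
 define R where "R = 2 * n + 1"
 have Gc: "continuous_on UNIV (%x. lint (P t r x) (cut n))"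
  using G_cont1[OF r(1) rt cutCb[of n]] unfolding P(3)[OF r(1) rt cutCb] by simp
 obtain d1 where d1: "d1 > 0" "!!x. dist x x0 < d1 ==> (lint (P t r x) (cut n)) > 1 - de"
 proof -
  have "lint (P t r x0) (cut n) > 1 - de" using k by (simp add: n_def abs_less_iff)
  then have "lint (P t r x0) (cut n) - (1 - de) > 0" by simp
  then obtain d where "d > 0" "!!x. dist x x0 < d ==> dist (lint (P t r x) (cut n)) (lint (P t r x0) (cut n)) < (lint (P t r x0) (cut n)) - (1 - de)"
   using Gc unfolding continuous_on_iff by (metis UNIV_I)
  then have "lint (P t r x) (cut n) > 1 - de" if "dist x x0 < d" for x using that by (fastforce simp: dist_real_def abs_less_iff)
  then show ?thesis using \<open>d > 0\<close> that by blast
 qed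
 have tailb: "measure (P t r x) (- ball 0 R) <= de" if "dist x x0 < d1" for x
 proof -
  interpret prob_space "P t r x" by (rule Pp)
  note ci = Cb_integrable[OF cutCb[of n] finite_measure_axioms Ps]
  have "measure (P t r x) (- ball 0 R) = lint (P t r x) (%y. indicator (- ball 0 R) y)" by (simp add: sp)
  also have "... <= lint (P t r x) (%y. 1 - cut n y)"
  proof (rule integral_mono)
   show "integrable (P t r x) (indicat_real (- ball 0 R))" by (simp add: Ps emeasure_eq_measure)
   show "integrable (P t r x) (%y. 1 - cut n y)" using ci by simp
   show "indicat_real (- ball 0 R) y <= 1 - cut n y" for y
    using cut_range[of n y] cut_zero[OF n, of y] by (auto simp: indicator_def R_def)
  qed
  also have "... = 1 - lint (P t r x) (cut n)" using ci by (simp add: prob_space)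
  also have "... <= de" using d1(2)[OF that] by simp
  finally show ?thesis .
 qed
 have R0: "R > 0" using n by (simp add: R_def)
 obtain C where C: "C > 0" "!!x A. A : sets borel ==> A \<subseteq> ball 0 R ==> emeasure (P t r x) A <= ennreal C * emeasure lborel A"
  using P_density[OF r R0] by blast
 define m where "m = density lborel (indicator (ball (0::real^'n) R))"
 have ms: "sets m = sets borel" by (simp add: m_def)
 have mf: "finite_measure m"
 proof
  have "emeasure m (space m) = emeasure lborel (ball (0::real^'n) R)" by (simp add: m_def emeasure_restricted)
  also have "... < \<infinity>" using emeasure_bounded_finite[OF bounded_ball] by simp
  finally show "emeasure m (space m) ~= \<infinity>" by simp
 qed
 have gb: "- B <= g x & g x <= B" for x using g(2)[of x] by (simp add: abs_le_iff)
 have "ep / (6 * C) > 0" using e C by simp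
 from L1_Cb_dense_clamp[OF mf ms g(1) gb this] obtain f where f: "f : Cb" "!!x. - B <= f x & f x <= B" "lint m (%x. abs (g x - f x)) < ep / (6 * C)"
  by blast
 have fm: "f : Bmeas" by (rule Cb_measurable[OF f(1)])
 define w where "w x = abs (g x - f x)" for x
 have wm: "w : Bmeas" unfolding w_def using g(1) fm by measurable
 have wb: "0 <= w x" "w x <= 2 * B" for x using gb[of x] f(2)[of x] by (auto simp: w_def)
 have wi: "integrable M w" if "finite_measure M" "sets M = sets borel" for M
 proof -
  interpret finite_measure M by fact
  show ?thesis by (rule integrable_const_bound[of _ "2 * B"]) (use wb wm in "auto simp: measurable_cong_sets[OF that(2) refl]")
 qed
 have diff: "lint (P t r x) (%y. w y) <= ep / 3" if x: "dist x x0 < d1" for x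
 proof -
  interpret prob_space "P t r x" by (rule Pp)
  have bs: "ball 0 R : sets (P t r x)" "- ball 0 R : sets (P t r x)" by (auto simp: Ps)
  have wP: "w : borel_measurable (P t r x)" using wm by (simp add: measurable_cong_sets[OF Ps refl])
  have i1: "integrable (P t r x) (%y. w y * indicator (ball 0 R) y)"
   using wi[OF finite_measure_axioms Ps] bs by (intro integrable_real_mult_indicator) auto
  have "lint (P t r x) (%y. w y) <= lint (P t r x) (%y. w y * indicator (ball 0 R) y + 2 * B * indicator (- ball 0 R) y)"
  proof (rule integral_mono[OF wi[OF finite_measure_axioms Ps]])
   show "integrable (P t r x) (%y. w y * indicator (ball 0 R) y + 2 * B * indicator (- ball 0 R) y)"
    using i1 bs by (intro Bochner_Integration.integrable_add integrable_mult_right) (auto simp: emeasure_eq_measure)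
   show "w y <= w y * indicator (ball 0 R) y + 2 * B * indicator (- ball 0 R) y" for y
    using wb[of y] by (auto simp: indicator_def)
  qed
  also have "... = lint (P t r x) (%y. w y * indicator (ball 0 R) y) + 2 * B * measure (P t r x) (- ball 0 R)"
   using i1 bs by (simp add: emeasure_eq_measure sp)
  also have "2 * B * measure (P t r x) (- ball 0 R) <= 2 * B * de" using tailb[OF x] B0 by (intro mult_left_mono) auto
  also have "2 * B * de <= ep / 6"
  proof -
   have "2 * B * de = (ep / 6) * (B / (B + 1))" using B0 by (simp add: de_def field_simps)
   also have "... <= (ep / 6) * 1" using B0 e by (intro mult_left_mono) auto
   finally show ?thesis by simp
  qed
  also have "lint (P t r x) (%y. w y * indicator (ball 0 R) y) <= ep / 6"
  proof -
   have "ennreal (lint (P t r x) (%y. w y * indicator (ball 0 R) y)) = nint (P t r x) (%y. ennreal (w y * indicator (ball 0 R) y))"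
    using i1 wb by (subst nn_integral_eq_integral) auto
   also have "... = nint (P t r x) (%y. ennreal (w y) * indicator (ball 0 R) y)"
    by (intro nn_integral_cong) (auto simp: indicator_def)
   also have "... <= ennreal C * nint lborel (%y. ennreal (w y) * indicator (ball 0 R) y)"
    by (rule nn_integral_dominated_measure) (use C bs wP Ps in auto)
   also have "nint lborel (%y. ennreal (w y) * indicator (ball 0 R) y) = nint m (%y. ennreal (w y))"
    unfolding m_def using wm by (subst nn_integral_density) (auto intro!: borel_measurable_indicator simp: mult.commute)
   also have "... = ennreal (lint m (%y. w y))" using wi[OF mf ms] wb by (simp add: nn_integral_eq_integral)
   also have "ennreal C * ennreal (lint m (%y. w y)) = ennreal (C * lint m (%y. w y))" using C by (subst ennreal_mult') auto
   also have "... <= ennreal (ep / 6)"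
   proof (rule ennreal_leI)
    have "C * lint m (%y. w y) <= C * (ep / (6 * C))" using f(3) C by (intro mult_left_mono) (auto simp: w_def)
    then show "C * lint m (%y. w y) <= ep / 6" using C by simp
   qed
   finally show ?thesis using e by simp
  qed
  finally show ?thesis by simp
 qed
 have gf: "abs (lint (P t r x) (%y. g y) - lint (P t r x) f) <= ep / 3" if x: "dist x x0 < d1" for x
 proof -
  interpret prob_space "P t r x" by (rule Pp)
  have gi: "integrable (P t r x) g"
   by (rule integrable_const_bound[of _ B]) (use g in "auto simp: measurable_cong_sets[OF Ps refl]")
  have "lint (P t r x) (%y. g y) - lint (P t r x) f = lint (P t r x) (%y. g y - f y)"
   using gi Cb_integrable[OF f(1) finite_measure_axioms Ps] by simp
  also have "abs (...) <= lint (P t r x) (%y. w y)" unfolding w_def by (rule integral_abs_bound)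
  finally show ?thesis using diff[OF x] by simp
 qed
 have fc: "continuous_on UNIV (%x. lint (P t r x) f)"
  using G_cont1[OF r(1) rt f(1)] unfolding P(3)[OF r(1) rt f(1)] by simp
 have "ep / 3 > 0" using e by simp
 then obtain d2 where d2: "d2 > 0" "!!x. dist x x0 < d2 ==> dist (lint (P t r x) f) (lint (P t r x0) f) < ep / 3"
  using fc unfolding continuous_on_iff by (metis UNIV_I)
 show "EX d>0. ALL x':UNIV. dist x' x0 < d --> dist (lint (P t r x') (%y. g y)) (lint (P t r x0) (%y. g y)) < ep"
 proof (intro exI[of _ "min d1 d2"] conjI ballI impI)
  show "0 < min d1 d2" using d1 d2 by simp
  fix x assume "dist x x0 < min d1 d2"
  then have "dist x x0 < d1" "dist x x0 < d2" by auto
  then show "dist (lint (P t r x) (%y. g y)) (lint (P t r x0) (%y. g y)) < ep"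
   using gf[of x] gf[of x0, simplified dist_self, OF d1(1)] d2(2)[of x] unfolding dist_real_def by linarith
 qed
qed

end

section \<open>Gronwall inequalities for transition kernels\<close>

text \<open>Continuity in x is required only along sequences in X whose images under \<Theta>
  converge, that is, for a topology that may be finer than the given one. The image of X is still
  separable: \<open>g\<close> is the limit of its values at countably many points, chosen measurably
  in x. For these points the exceptional times fit into one null set N, off which \<open>g\<close>
  is replaced by Borel functions of time.\<close>

lemma caratheodory_measurable:
 fixes g :: "real => 'a::topological_space => real" and \<Theta> :: "'a => 'b::{metric_space, second_countable_topology}"
 assumes Th: "\<Theta> : Bmeas" and X: "X : sets borel"
  and cont: "!!sg x y. x : X ==> (!!k. y k : X) ==> (%k::nat. \<Theta> (y k)) \<longlonglongrightarrow> \<Theta> x ==> (%k. g sg (y k)) \<longlonglongrightarrow> g sg x"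
  and meas: "!!x. x : X ==> EX g':Bmeas. AE sg in lborel. g sg x = g' sg"
 shows "EX N:null_sets lborel. (%p. if fst p \<notin> N & snd p : X then g (fst p) (snd p) else 0) : borel_measurable (borel \<Otimes>\<^sub>M borel)"
proof (cases "X = {}")
 case True
 then show ?thesis by (intro bexI[of _ "{}"]) auto
next
 case False
 obtain T where T: "countable T" "T \<subseteq> \<Theta> ` X" "\<Theta> ` X \<subseteq> closure T" by (rule separable)
 have "T ~= {}" using T False by auto
 define e where "e = from_nat_into T"
 have e: "range e = T" unfolding e_def by (rule range_from_nat_into[OF \<open>T ~= {}\<close> T(1)])
 have "EX x:X. \<Theta> x = e k" for k :: nat
 proof -
  have "e k : range e" by (rule rangeI)
  then have "e k : \<Theta> ` X" using e T(2) by auto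
  then obtain x where "e k = \<Theta> x" "x : X" by (rule imageE)
  then show ?thesis by (intro bexI[of _ x]) simp_all
 qed
 then obtain d where d: "!!k::nat. d k : X" "!!k. \<Theta> (d k) = e k" by metis
 have dense: "EX k. dist (e k) (\<Theta> x) < ep" if x: "x : X" and "ep > 0" for x ep
 proof -
  have "\<Theta> x : closure T" using T(3) x by blast
  then obtain y where "y : T" "dist y (\<Theta> x) < ep" using \<open>ep > 0\<close> closure_approachable by blast
  then show ?thesis using e by blast
 qed
 have "ALL k. EX g'. g' : Bmeas & (AE sg in lborel. g sg (d k) = g' sg)" using meas[OF d(1)] by blast
 then obtain g' where g': "!!k. g' k : Bmeas" "!!k. AE sg in lborel. g sg (d k) = g' k sg" by metis
 have "AE sg in lborel. ALL k. g sg (d k) = g' k sg" using g'(2) by (simp add: AE_all_countable)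
 then obtain N where N: "N : null_sets lborel" "{sg. \<not> (ALL k. g sg (d k) = g' k sg)} \<subseteq> N"
  by (auto simp: eventually_ae_filter)
 have gN: "g sg (d k) = g' k sg" if "sg \<notin> N" for sg k using N(2) that by blast
 \<comment> \<open>The least index of a point of the countable family that is 1/(n+1)-close; the
   second disjunct makes it 0 off X.\<close>
 define J where "J n x = (LEAST k. dist (e k) (\<Theta> x) < 1 / real (Suc n) \<or> x \<notin> X)" for n x
 have Jd: "dist (e (J n x)) (\<Theta> x) < 1 / real (Suc n)" if x: "x : X" for n x
 proof -
  have "EX k. dist (e k) (\<Theta> x) < 1 / real (Suc n) \<or> x \<notin> X" using dense[OF x, of "1 / real (Suc n)"] by auto
  from LeastI_ex[OF this] show ?thesis using x by (simp add: J_def)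
 qed
 have Jm: "J n : borel \<rightarrow>\<^sub>M count_space UNIV" for n
 proof -
  have "{x. dist (e k) (\<Theta> x) < 1 / real (Suc n) \<or> x \<notin> X} : sets borel" for k
  proof -
   have "{x : space borel. \<Theta> x : ball (e k) (1 / real (Suc n))} : sets borel" by (rule measurable_sets_Collect[OF Th]) simp
   then have "{x. dist (e k) (\<Theta> x) < 1 / real (Suc n)} : sets borel" by (simp add: ball_def)
   moreover have "{x. dist (e k) (\<Theta> x) < 1 / real (Suc n) \<or> x \<notin> X} = {x. dist (e k) (\<Theta> x) < 1 / real (Suc n)} \<union> - X" by auto
   ultimately show ?thesis using X by (simp add: sets.Un)
  qed
  then have "(%x. LEAST k. dist (e k) (\<Theta> x) < 1 / real (Suc n) \<or> x \<notin> X) : borel \<rightarrow>\<^sub>M count_space UNIV"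
   by (intro measurable_Least) (simp add: pred_def)
  then show ?thesis by (simp add: J_def[abs_def])
 qed
 define G where "G n p = (if fst p \<notin> N & snd p : X then g' (J n (snd p)) (fst p) else 0)" for n and p :: "real \<times> 'a"
 have Nb: "N : sets borel" using N(1) by auto
 have Sm: "{p : space (borel \<Otimes>\<^sub>M borel). fst p \<notin> N & snd p : X} : sets ((borel :: real measure) \<Otimes>\<^sub>M (borel :: 'a measure))"
 proof -
  have "{p : space ((borel :: real measure) \<Otimes>\<^sub>M (borel :: 'a measure)). fst p \<notin> N & snd p : X} = (- N) \<times> X"
   by (auto simp: space_pair_measure)
  moreover have "(- N) \<times> X : sets ((borel :: real measure) \<Otimes>\<^sub>M (borel :: 'a measure))"
   by (rule pair_measureI) (use Nb X in auto)
  ultimately show ?thesis by simp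
 qed
 have Gm: "G n : borel_measurable (borel \<Otimes>\<^sub>M borel)" for n
 proof -
  have "(%p::real \<times> 'a. g' k (fst p)) : borel_measurable (borel \<Otimes>\<^sub>M borel)" for k
   by (rule measurable_compose[OF measurable_fst g'(1)])
  moreover have "(%p::real \<times> 'a. J n (snd p)) : (borel \<Otimes>\<^sub>M borel) \<rightarrow>\<^sub>M count_space UNIV"
   by (rule measurable_compose[OF measurable_snd Jm])
  ultimately have "(%p::real \<times> 'a. g' (J n (snd p)) (fst p)) : borel_measurable (borel \<Otimes>\<^sub>M borel)"
   by (rule measurable_compose_countable)
  then show ?thesis unfolding G_def[abs_def] by (rule measurable_If[OF _ _ Sm]) simp
 qed
 have "(%p. if fst p \<notin> N & snd p : X then g (fst p) (snd p) else 0) : borel_measurable (borel \<Otimes>\<^sub>M borel)"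
 proof (rule borel_measurable_LIMSEQ_real[OF _ Gm])
  fix p :: "real \<times> 'a"
  show "(%n. G n p) \<longlonglongrightarrow> (if fst p \<notin> N & snd p : X then g (fst p) (snd p) else 0)"
  proof (cases "fst p \<notin> N & snd p : X")
   case True
   have "(%n. \<Theta> (d (J n (snd p)))) \<longlonglongrightarrow> \<Theta> (snd p)"
    unfolding d(2)
   proof (rule metric_LIMSEQ_I)
    fix ep :: real assume "ep > 0"
    then obtain n0 where n0: "inverse (real (Suc n0)) < ep" using reals_Archimedean by blast
    have "dist (e (J n (snd p))) (\<Theta> (snd p)) < ep" if "n >= n0" for n
    proof -
     have "1 / real (Suc n) <= inverse (real (Suc n0))" using that by (simp add: field_simps)
     then show ?thesis using Jd[of "snd p" n] True n0 by linarith
    qed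
    then show "EX n0. ALL n>=n0. dist (e (J n (snd p))) (\<Theta> (snd p)) < ep" by blast
   qed
   from cont[OF _ d(1) this] True have "(%n. g (fst p) (d (J n (snd p)))) \<longlonglongrightarrow> g (fst p) (snd p)" by blast
   then show ?thesis using True by (simp add: G_def gN)
  qed (auto simp: G_def)
 qed
 then show ?thesis using N(1) by blast
qed

text \<open>Integrability alone starts the iteration: inserting the finite integral Y gives the
  pointwise bound ka Y, and every further insertion gains a factor of the exponential series, whose
  terms tend to 0.\<close>

lemma scalar_gronwall:
 fixes ze :: "real => ennreal"
 assumes k: "ka >= 0" and Z: "ze : Bmeas"
  and ineq: "!!t. s < t ==> t <= ta ==> ze t <= ennreal ka * nint lborel (%r. indicator {s<..<t} r * ze r)"
  and fin: "nint lborel (%r. indicator {s<..ta} r * ze r) < \<infinity>"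
  and t: "s < t" "t <= ta"
 shows "ze t = 0"
proof -
 define Y where "Y = enn2real (nint lborel (%r. indicator {s<..ta} r * ze r))"
 have Y: "nint lborel (%r. indicator {s<..ta} r * ze r) = ennreal Y" "Y >= 0" using fin by (simp_all add: Y_def)
 have step: "ALL t. s < t & t <= ta --> ze t <= ennreal (ka * Y * ((ka * (t - s)) ^ n / fact n))" for n
 proof (induction n)
  case 0
  show ?case
  proof (intro allI impI)
   fix t assume t: "s < t & t <= ta"
   have "ze t <= ennreal ka * nint lborel (%r. indicator {s<..<t} r * ze r)" using ineq t by blast
   also have "... <= ennreal ka * nint lborel (%r. indicator {s<..ta} r * ze r)"
    by (intro mult_left_mono nn_integral_mono mult_right_mono) (use t in "auto simp: indicator_def")
   finally show "ze t <= ennreal (ka * Y * ((ka * (t - s)) ^ 0 / fact 0))" using k Y by (simp add: ennreal_mult)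
  qed
 next
  case (Suc n)
  show ?case
  proof (intro allI impI)
   fix t assume t: "s < t & t <= ta"
   define f where "f r = Y * ka * ((ka * (r - s)) ^ n / fact n)" for r
   define F where "F r = Y * ((ka * (r - s)) ^ Suc n / fact (Suc n))" for r
   have fF: "DERIV F r :> f r" for r
   proof -
    have "DERIV F r :> Y * (real (Suc n) * ((ka * (r - s)) ^ n * ka) / fact (Suc n))"
     unfolding F_def by (auto intro!: derivative_eq_intros simp del: fact_Suc power_Suc)
    moreover have "real (Suc n) * ((ka * (r - s)) ^ n * ka) / fact (Suc n) = ka * ((ka * (r - s)) ^ n / fact n)"
     by (simp add: divide_simps)
    ultimately show ?thesis by (simp add: f_def mult_ac)
   qed
   have f0: "0 <= f r" if "s <= r" for r using that k Y by (simp add: f_def)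
   have "ze t <= ennreal ka * nint lborel (%r. indicator {s<..<t} r * ze r)" using ineq t by blast
   also have "... <= ennreal ka * nint lborel (%r. ennreal (f r) * indicator {s..t} r)"
   proof (intro mult_left_mono nn_integral_mono)
    fix r
    show "indicator {s<..<t} r * ze r <= ennreal (f r) * indicator {s..t} r"
    proof (cases "r : {s<..<t}")
     case True
     then have "ze r <= ennreal (ka * Y * ((ka * (r - s)) ^ n / fact n))" using Suc t by auto
     then show ?thesis using True by (simp add: f_def mult_ac)
    qed simp
   qed simp
   also have "nint lborel (%r. ennreal (f r) * indicator {s..t} r) = ennreal (F t - F s)"
   proof (rule nn_integral_FTC_Icc)
    show "f : Bmeas" unfolding f_def by measurable
   qed (use t fF f0 in auto)
   also have "F t - F s = Y * ((ka * (t - s)) ^ Suc n / fact (Suc n))" by (simp add: F_def)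
   finally show "ze t <= ennreal (ka * Y * ((ka * (t - s)) ^ Suc n / fact (Suc n)))"
    using k Y t by (simp add: ennreal_mult[symmetric] mult.assoc del: fact_Suc power_Suc)
  qed
 qed
 have "(%n. ka * Y * ((ka * (t - s)) ^ n / fact n)) \<longlonglongrightarrow> ka * Y * 0"
  using summable_exp[of "ka * (t - s)"] by (intro tendsto_intros summable_LIMSEQ_zero) (simp add: divide_inverse mult.commute)
 then have "(%n. ennreal (ka * Y * ((ka * (t - s)) ^ n / fact n))) \<longlonglongrightarrow> ennreal 0" by (intro tendsto_ennrealI) simp
 then have "ze t <= ennreal 0" by (rule LIMSEQ_le_const) (use step t in auto)
 then show ?thesis by simp
qed

lemma (in pair_sigma_finite) integrable_tensor:
 fixes f :: "'a => real" and g :: "'b => real"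
 assumes f: "integrable M1 f" and g: "integrable M2 g"
 shows "integrable (M1 \<Otimes>\<^sub>M M2) (%(x, y). f x * g y)"
proof (rule Fubini_integrable)
 show "(%(x, y). f x * g y) : borel_measurable (M1 \<Otimes>\<^sub>M M2)"
  using f g by measurable
 show "integrable M1 (%x. lint M2 (%y. norm (case (x, y) of (x, y) => f x * g y)))"
  using f by (simp add: abs_mult)
qed (use g in simp)

text \<open>The formula for the derivative of exp(l(t-s)) times a primitive of \<open>ga\<close>, in
  integrated form. As \<open>ga\<close> is merely integrable, it comes from Fubini's theorem on the
  triangle sg < r < t. This is the algebra of the shift by l: \<open>A\<close> plus the integral up
  to r will be the transported solution at time r.\<close>

lemma integrating_factor:
 fixes ga :: "real => real"
 assumes g: "integrable lborel ga" and z: "!!r. r \<notin> {s<..<t} ==> ga r = 0" and st: "s <= t"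
 shows "exp (l * (t - s)) * (A + (lint lborel ga)) =
  A + lint lborel (%r. indicator {s<..<t} r * (exp (l * (r - s)) * (ga r + l * (A + lint lborel (%sg. indicator {..<r} sg * ga sg)))))"
  "integrable lborel (%r. indicator {s<..<t} r * (exp (l * (r - s)) * (ga r + l * (A + lint lborel (%sg. indicator {..<r} sg * ga sg)))))"
proof -
 define E where "E r = exp (l * (r - s))" for r
 have Ec: "continuous_on UNIV E" unfolding E_def by (intro continuous_intros)
 have Em: "E : Bmeas" by (rule borel_measurable_continuous_onI[OF Ec])
 define M where "M = exp (abs l * (t - s))"
 have EM: "E r <= M" "0 < E r" if "r : {s..t}" for r
 proof -
  have "l * (r - s) <= abs l * (r - s)" using that by (intro mult_right_mono) auto
  also have "... <= abs l * (t - s)" using that by (intro mult_left_mono) auto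
  finally show "E r <= M" by (simp add: E_def M_def)
 qed (simp add: E_def)
 have gm: "ga : Bmeas" using borel_measurable_integrable[OF g] by simp
 have iE: "integrable lborel (%r. E r * ga r)"
 proof (rule Bochner_Integration.integrable_bound)
  show "integrable lborel (%r. M * ga r)" using g by simp
  show "AE r in lborel. norm (E r * ga r) <= norm (M * ga r)"
  proof (intro always_eventually allI)
   fix r
   show "norm (E r * ga r) <= norm (M * ga r)"
   proof (cases "r : {s<..<t}")
    case True
    then show ?thesis using EM[of r] by (auto simp: abs_mult intro!: mult_right_mono)
   qed (simp add: z)
  qed
 qed (use Em gm in measurable)
 define k where "k r sg = indicator {s<..<t} r * (l * E r) * (indicator {..<r} sg * ga sg)" for r sg
 have lE: "has_bochner_integral lborel (%r. indicator {a..t} r *\<^sub>R (l * E r)) (E t - E a)" if "s <= a" "a <= t" for a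
 proof (rule has_bochner_integral_FTC_Icc)
  show "continuous_on {a..t} (%r. l * E r)" by (intro continuous_intros continuous_on_subset[OF Ec]) auto
  show "(E has_vector_derivative l * E r) (at r within {a..t})" for r
   unfolding E_def has_real_derivative_iff_has_vector_derivative[symmetric] by (auto intro!: derivative_eq_intros)
 qed (use that in auto)
 have op: "lint lborel (%r. indicator {a<..<t} r * (l * E r)) = E t - E a" "integrable lborel (%r. indicator {a<..<t} r * (l * E r))" if "s <= a" "a <= t" for a
 proof -
  have ae: "AE r in lborel. indicator {a..t} r *\<^sub>R (l * E r) = indicator {a<..<t} r * (l * E r)"
   using AE_lborel_singleton[of a] AE_lborel_singleton[of t] by eventually_elim (auto simp: indicator_def)
  have m1: "(%r. indicator {a<..<t} r * (l * E r)) : borel_measurable lborel" using Em by measurable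
  show "lint lborel (%r. indicator {a<..<t} r * (l * E r)) = E t - E a"
   using integral_cong_AE[OF borel_measurable_integrable[OF integrable.intros[OF lE[OF that]]] m1 ae] has_bochner_integral_integral_eq[OF lE[OF that]] by simp
  show "integrable lborel (%r. indicator {a<..<t} r * (l * E r))"
   by (rule integrable_cong_AE_imp[OF integrable.intros[OF lE[OF that]] m1 ae])
 qed
 have km: "(%p. k (fst p) (snd p)) : borel_measurable (borel \<Otimes>\<^sub>M borel)"
 proof -
  have "(%p::real \<times> real. indicator {..<fst p} (snd p) :: real) : borel_measurable (borel \<Otimes>\<^sub>M borel)"
  proof -
   have "(%p::real \<times> real. indicator {..<fst p} (snd p) :: real) = indicator {p. snd p < fst p}" by (auto simp: indicator_def fun_eq_iff)
   moreover have "open {p::real \<times> real. snd p < fst p}" by (intro open_Collect_less continuous_intros)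
   ultimately show ?thesis unfolding borel_prod by (simp add: borel_measurable_indicator)
  qed
  then show ?thesis unfolding k_def
   by (intro borel_measurable_times measurable_compose[OF measurable_fst Em] measurable_compose[OF measurable_snd gm]
     measurable_compose[OF measurable_fst borel_measurable_indicator]) auto
 qed
 have kb: "norm (k r sg) <= (abs l * M * indicator {s..t} r) * abs (ga sg)" for r sg
  using EM[of r] by (auto simp: k_def indicator_def abs_mult intro!: mult_mono)
 have ki: "integrable (lborel \<Otimes>\<^sub>M lborel) (%(r, sg). k r sg)"
 proof (rule Bochner_Integration.integrable_bound)
  show "integrable (lborel \<Otimes>\<^sub>M lborel) (%(r, sg). (abs l * M * indicator {s..t} r) * abs (ga sg))"
   by (rule lborel_pair.integrable_tensor) (use g in "auto intro!: integrable_mult_right integrable_real_indicator simp: emeasure_lborel_Icc_eq")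
  show "AE p in lborel \<Otimes>\<^sub>M lborel. norm (case p of (r, sg) => k r sg) <= norm (case p of (r, sg) => (abs l * M * indicator {s..t} r) * abs (ga sg))"
  proof (rule AE_I2)
   fix p :: "real \<times> real"
   show "norm (case p of (r, sg) => k r sg) <= norm (case p of (r, sg) => (abs l * M * indicator {s..t} r) * abs (ga sg))"
    using kb[of "fst p" "snd p"] by (simp add: case_prod_beta')
  qed
 qed (use km in "auto simp: case_prod_beta' measurable_cong_sets[OF sets_pair_measure_cong[OF sets_lborel sets_lborel] refl]")
 have I1: "lint lborel (%sg. k r sg) = indicator {s<..<t} r * (l * E r) * lint lborel (%sg. indicator {..<r} sg * ga sg)" for r
  by (simp add: k_def)
 have I2: "lint lborel (%r. k r sg) = E t * ga sg - E sg * ga sg" for sg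
 proof (cases "sg : {s<..<t}")
  case True
  have "lint lborel (%r. k r sg) = lint lborel (%r. (indicator {sg<..<t} r * (l * E r)) * ga sg)"
   by (intro Bochner_Integration.integral_cong) (use True in "auto simp: k_def indicator_def")
  also have "... = lint lborel (%r. indicator {sg<..<t} r * (l * E r)) * ga sg" by simp
  also have "... = (E t - E sg) * ga sg" using op(1)[of sg] True by simp
  finally show ?thesis by (simp add: algebra_simps)
 qed (simp add: k_def z)
 have F: "lint lborel (%r. lint lborel (%sg. k r sg)) = lint lborel (%sg. E t * ga sg - E sg * ga sg)"
  using lborel_pair.Fubini_integral[OF ki] by (simp add: I2)
 have iK: "integrable lborel (%r. lint lborel (%sg. k r sg))" using lborel_pair.integrable_fst[OF ki] .
 have dec: "indicator {s<..<t} r * (exp (l * (r - s)) * (ga r + l * (A + lint lborel (%sg. indicator {..<r} sg * ga sg)))) =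
  E r * ga r + A * (indicator {s<..<t} r * (l * E r)) + lint lborel (%sg. k r sg)" for r
  unfolding I1 by (cases "r : {s<..<t}") (auto simp: E_def z algebra_simps)
 note ii = iE op(2)[OF order_refl st] iK
 show "integrable lborel (%r. indicator {s<..<t} r * (exp (l * (r - s)) * (ga r + l * (A + lint lborel (%sg. indicator {..<r} sg * ga sg)))))"
  unfolding dec by (intro Bochner_Integration.integrable_add integrable_mult_right ii)
 have "lint lborel (%r. indicator {s<..<t} r * (exp (l * (r - s)) * (ga r + l * (A + lint lborel (%sg. indicator {..<r} sg * ga sg))))) =
  lint lborel (%r. E r * ga r) + A * (E t - E s) + (E t * (lint lborel ga) - lint lborel (%sg. E sg * ga sg))"
  unfolding dec using ii g iE op(1)[OF order_refl st] F by simp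
 then show "exp (l * (t - s)) * (A + (lint lborel ga)) =
  A + lint lborel (%r. indicator {s<..<t} r * (exp (l * (r - s)) * (ga r + l * (A + lint lborel (%sg. indicator {..<r} sg * ga sg)))))"
  by (simp add: E_def algebra_simps)
qed

text \<open>
 Unlike the Bochner integral, this is built from nonnegative integrals only, so that it depends
 measurably on the parameter of a kernel without any integrability hypothesis.
\<close>
definition sint :: "'a measure => ('a => real) => real" where
 "sint M g = enn2real (nint M (%x. ennreal (g x))) - enn2real (nint M (%x. ennreal (- g x)))"

lemma sint_eq: "g : borel_measurable M ==> (nint M (%x. ennreal \<bar>g x\<bar>)) < \<infinity> ==> sint M g = lint M (%x. g x)"
 unfolding sint_def by (rule real_lebesgue_integral_def[symmetric]) (auto simp: integrable_iff_bounded)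

lemma pn_le_abs:
 "nint M (%x. ennreal (g x)) <= nint M (%x. ennreal \<bar>g x\<bar>)" "nint M (%x. ennreal (- g x)) <= nint M (%x. ennreal \<bar>g x\<bar>)"
 by (intro nn_integral_mono ennreal_leI; simp)+

context kolm begin

section \<open>Integrals against transition kernels\<close>

lemma nn_real_fin: "nint M (%x. ennreal (abs (g x))) < \<infinity> ==> (nint M (%x. ennreal (g x))) < \<infinity> & (nint M (%x. ennreal (- g x))) < \<infinity>"
 using pn_le_abs[of M g] by (auto intro: le_less_trans)

lemma P_meas: "s : I ==> s <= t ==> g : Bmeas ==> g : borel_measurable (P t s x)"
 using measurable_cong_sets[OF P(2) refl] by blast

text \<open>Chapman-Kolmogorov applied to positive and negative parts. Each inner integral may be
  infinite on a null set of y, where \<open>sint\<close> takes a default value that the outer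
  integral does not see.\<close>

lemma P_integral_CK:
 fixes g :: "real ^ 'n => real"
 assumes s: "s : I" "s <= r" "r <= t" and g: "g : Bmeas" and fin: "nint (P t s x) (%y. ennreal \<bar>g y\<bar>) < \<infinity>"
 shows "lint (P t r x) (%y. sint (P r s y) g) = sint (P t s x) g"
proof -
 have rI: "r : I" using I_up s by blast
 note m = P_meas[OF rI s(3)] P_nn_meas[OF s(1,2)]
 have gm: "(%y. ennreal (g y)) : Bmeas" "(%y. ennreal (- g y)) : Bmeas"
  using g by measurable
 have ck: "nint (P t r x) (%y. nint (P r s y) h) = nint (P t s x) h" if "h : Bmeas" for h
  by (rule P_nn[OF s that])
 define a b where "a y = nint (P r s y) (%z. ennreal (g z))" and "b y = nint (P r s y) (%z. ennreal (- g z))" for y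
 have am: "a : borel_measurable (P t r x)" "b : borel_measurable (P t r x)"
  unfolding a_def b_def by (rule m(1)[OF m(2)[OF gm(1)]], rule m(1)[OF m(2)[OF gm(2)]])
 have fa: "nint (P t r x) a < \<infinity>" "nint (P t r x) b < \<infinity>"
  unfolding a_def b_def ck[OF gm(1)] ck[OF gm(2)] using nn_real_fin[OF fin] by auto
 have aea: "AE y in P t r x. a y = ennreal (enn2real (a y))" "AE y in P t r x. b y = ennreal (enn2real (b y))"
  using nn_integral_PInf_AE[OF am(1)] nn_integral_PInf_AE[OF am(2)] fa by (auto simp: less_top)
 have ia: "integrable (P t r x) (%y. enn2real (a y))" "integrable (P t r x) (%y. enn2real (b y))"
  using am fa nn_integral_cong_AE[OF aea(1)] nn_integral_cong_AE[OF aea(2)] by (auto simp: integrable_iff_bounded)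
 have "lint (P t r x) (%y. sint (P r s y) g) = lint (P t r x) (%y. enn2real (a y)) - lint (P t r x) (%y. enn2real (b y))"
  using ia by (simp add: sint_def a_def b_def)
 also have "lint (P t r x) (%y. enn2real (a y)) = enn2real (nint (P t r x) a)"
  by (rule enn2real_nn_integral_eq_integral[symmetric, OF aea(1)]) (use am in auto)
 also have "lint (P t r x) (%y. enn2real (b y)) = enn2real (nint (P t r x) b)"
  by (rule enn2real_nn_integral_eq_integral[symmetric, OF aea(2)]) (use am in auto)
 finally show ?thesis
  unfolding a_def b_def ck[OF gm(1)] ck[OF gm(2)] sint_def .
qed

lemma P_integral_meas:
 fixes g :: "real ^ 'n => real"
 assumes s: "s : I" "s <= r" and g: "g : Bmeas"
 shows "(%y. sint (P r s y) g) : Bmeas"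
 unfolding sint_def using P_nn_meas[OF s, of "%y. ennreal (g y)"] P_nn_meas[OF s, of "%y. ennreal (- g y)"] g by measurable

text \<open>The m t-average of the kernel mass of an m r-null set is its m r-mass, which is
  0.\<close>

lemma flow_AE:
 assumes fl: "flow J m" and r: "r : J" "t : J" "r <= t" and ae: "AE y in m r. Q' y"
 shows "AE x in m t. AE y in P t r x. Q' y"
proof -
 have rI: "r : I" using fl r by (auto simp: flow_def)
 have st: "sets (m t) = sets borel" "sets (m r) = sets borel" using fl r by (auto simp: flow_def)
 have sp: "space (m r) = UNIV" using sets_eq_imp_space_eq[OF st(2)] by simp
 obtain N where N: "N : null_sets (m r)" "{y. \<not> Q' y} \<subseteq> N" using ae by (auto simp: eventually_ae_filter sp)
 have Nb: "N : sets borel" using N(1) st by auto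
 then have im: "(indicator N :: _ => ennreal) : Bmeas" by simp
 have "nint (m t) (%x. nint (P t r x) (indicator N)) = 0"
  using flow_nn[OF fl r im] N(1) Nb st by auto
 moreover have "(%x. nint (P t r x) (indicator N)) : borel_measurable (m t)"
  using P_nn_meas[OF rI r(3) im] measurable_cong_sets[OF st(1) refl] by blast
 ultimately have "AE x in m t. nint (P t r x) (indicator N) = 0" by (simp add: nn_integral_0_iff_AE)
 then show ?thesis
 proof eventually_elim
  case (elim x)
  have "N : sets (P t r x)" using Nb P(2)[OF rI r(3)] by simp
  then have "N : null_sets (P t r x)" using elim by auto
  then have "AE y in P t r x. y \<notin> N" by (rule AE_not_in)
  then show ?case by eventually_elim (use N(2) in blast)
 qed
qed

lemma PK_nn_meas:
 assumes w: "(%p. w (fst p) (snd p)) : borel_measurable bst"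
 shows "(%p. nint (PK t (fst p) (snd p)) (%y. w (fst p) y)) : borel_measurable bst"
proof (rule nn_integral_measurable_subprob_algebra2[of "%p y. w (fst p) y" borel borel "%p. PK t (fst p) (snd p)"])
 have "(%q::(real \<times> (real^'n)) \<times> (real^'n). (fst (fst q), snd q)) : borel \<Otimes>\<^sub>M borel \<rightarrow>\<^sub>M borel \<Otimes>\<^sub>M borel"
  unfolding borel_prod by (intro borel_measurable_continuous_onI continuous_intros)
 from measurable_compose[OF this, of "%p. w (fst p) (snd p)" borel] w
 show "(%(p, y). w (fst p) y) : borel_measurable (bst \<Otimes>\<^sub>M borel)"
  by (simp add: case_prod_beta' borel_prod)
qed (rule measurable_prob_algebraD[OF PK_meas_r])

lemma PK_nn_meas_t:
 assumes s: "s : I" and w: "w : Bmeas"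
 shows "(%p. nint (PK (fst p) s (snd p)) (%y. w y)) : borel_measurable bst"
 by (rule measurable_compose[OF measurable_prob_algebraD[OF PK_meas_t[OF s]] nn_integral_measurable_subprob_algebra[OF w]])

lemma section_meas:
 assumes "(%p. w (fst p) (snd p)) : borel_measurable (borel :: ('b::second_countable_topology \<times> 'c::second_countable_topology) measure)"
 shows "w r : Bmeas" "(%r. w r x) : Bmeas"
proof -
 have "Pair r : borel \<rightarrow>\<^sub>M borel" for r :: 'b by (intro borel_measurable_continuous_onI continuous_intros)
 from measurable_compose[OF this assms] show "w r : Bmeas" by simp
 have "(%r. (r, x)) : borel \<rightarrow>\<^sub>M borel" for x :: 'c by (intro borel_measurable_continuous_onI continuous_intros)
 from measurable_compose[OF this assms] show "(%r. w r x) : Bmeas" by simp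
qed

lemma flow_nn_meas:
 assumes fl: "flow I m" and w: "(%p. w (fst p) (snd p)) : borel_measurable bst"
 shows "(%r. nint ((if r : I then m r else return borel 0)) (w r)) : Bmeas"
 by (rule nn_integral_measurable_subprob_algebra2[OF _ measurable_prob_algebraD[OF flow_meas[OF fl]]])
  (use w in "simp add: case_prod_beta' borel_prod")

text \<open>Tonelli followed by the flow identity at each time. It converts a potential seen from
  time t into a plain space-time integral, so that finiteness or vanishing of the latter gives the
  same for the former almost everywhere.\<close>

lemma flow_space_time:
 assumes fl: "flow I m" and st: "s : I" "s < t" and w: "(%p. w (fst p) (snd p)) : borel_measurable bst"
 shows "nint (m t) (%x. nint lborel (%r. indicator {s<..<t} r * nint (PK t r x) (w r))) = nint lborel (%r. indicator {s<..<t} r * nint (m r) (w r))"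
proof -
 have tI: "t : I" using I_up st less_imp_le by blast
 interpret mt: prob_space "m t" using fl tI by (auto simp: flow_def)
 have smt: "sets (m t) = sets borel" using fl tI by (auto simp: flow_def)
 interpret L: pair_sigma_finite lborel "m t"
  by (intro pair_sigma_finite.intro) (auto intro: mt.sigma_finite_measure_axioms lborel.sigma_finite_measure_axioms)
 have km: "(%p. indicator {s<..<t} (fst p) * nint (PK t (fst p) (snd p)) (%y. w (fst p) y)) : borel_measurable (lborel \<Otimes>\<^sub>M m t)"
 proof -
  have "(%p::real \<times> (real^'n). indicator {s<..<t} (fst p) :: ennreal) : Bmeas"
   unfolding borel_prod[symmetric] by (rule measurable_compose[OF measurable_fst borel_measurable_indicator]) simp
  then have "(%p. indicator {s<..<t} (fst p) * nint (PK t (fst p) (snd p)) (%y. w (fst p) y)) : borel_measurable bst"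
   by (rule borel_measurable_times_ennreal[OF _ PK_nn_meas[OF w]])
  moreover have "sets (lborel \<Otimes>\<^sub>M m t) = sets bst"
   unfolding borel_prod[symmetric] by (rule sets_pair_measure_cong) (auto simp: smt)
  ultimately show ?thesis using measurable_cong_sets by blast
 qed
 have "nint (m t) (%x. nint lborel (%r. indicator {s<..<t} r * nint (PK t r x) (w r))) = nint lborel (%r. nint (m t) (%x. indicator {s<..<t} r * nint (PK t r x) (w r)))"
  by (rule L.Fubini') (use km in "simp add: case_prod_beta'")
 also have "... = nint lborel (%r. indicator {s<..<t} r * nint (m r) (w r))"
 proof (intro nn_integral_cong)
  fix r
  show "nint (m t) (%x. indicator {s<..<t} r * nint (PK t r x) (w r)) = indicator {s<..<t} r * nint (m r) (w r)"
  proof (cases "r : {s<..<t}")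
   case True
   then have rI: "r : I" using I_up[OF st(1), of r] by auto
   have "nint (m t) (%x. nint (PK t r x) (w r)) = nint (m t) (%x. nint (P t r x) (w r))" using True rI by (simp add: PK_eq)
   also have "... = nint (m r) (w r)" by (rule flow_nn[OF fl rI tI]) (use True section_meas(1)[OF w] in auto)
   finally show ?thesis using True by simp
  qed simp
 qed
 finally show ?thesis .
qed

lemma space_time_inner_meas:
 assumes w: "(%p. w (fst p) (snd p)) : borel_measurable bst"
 shows "(%x. nint lborel (%r. indicator {s<..<t} r * nint (PK t r x) (w r))) : Bmeas"
proof (rule lborel.borel_measurable_nn_integral)
 have "(%p. (snd p, fst p)) : (borel :: (real^'n) measure) \<Otimes>\<^sub>M (lborel :: real measure) \<rightarrow>\<^sub>M borel \<Otimes>\<^sub>M borel" by measurable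
 from measurable_compose[OF this, of "%p. nint (PK t (fst p) (snd p)) (%y. w (fst p) y)" borel] PK_nn_meas[OF w, of t]
 have "(%p. nint (PK t (snd p) (fst p)) (%y. w (snd p) y)) : borel_measurable ((borel :: (real^'n) measure) \<Otimes>\<^sub>M lborel)"
  by (simp add: borel_prod)
 then show "(%(x, r). indicator {s<..<t} r * nint (PK t r x) (w r)) : borel_measurable ((borel :: (real^'n) measure) \<Otimes>\<^sub>M lborel)"
  unfolding case_prod_beta' by measurable
qed

text \<open>The evolved datum V is transported exactly by the kernels, so subtracting exp(ka(r-s)) V
  absorbs it and leaves a homogeneous inequality for the excess. Integrated against m t, this is
  scalar, and \<open>scalar_gronwall\<close> makes the excess vanish.\<close>

lemma kernel_gronwall:
 assumes fl: "flow I m" and s: "s : I" and k: "ka >= 0"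
  and F: "F : Bmeas" "nint (m s) F < \<infinity>"
  and W: "(%p. W (fst p) (snd p)) : borel_measurable bst"
  and ineq: "!!t. s < t ==> t <= ta ==> AE x in m t. W t x <= nint (PK t s x) F + ennreal ka * nint lborel (%r. indicator {s<..<t} r * nint (PK t r x) (W r))"
  and fin: "nint lborel (%r. indicator {s<..ta} r * nint (m r) (W r)) < \<infinity>"
  and t: "s < t" "t <= ta"
 shows "AE x in m t. W t x <= ennreal (exp (ka * (t - s))) * nint (PK t s x) F"
proof -
 define V where "V r x = nint (PK r s x) F" for r x
 define E where "E r = ennreal (exp (ka * (r - s)))" for r
 \<comment> \<open>Truncated subtraction in the extended nonnegative reals: Z is the excess of W
   over the claimed bound, and W <= E V + Z always holds. Finiteness of V almost everywhere is used
   when the inequality is solved for Z.\<close>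
 define Z where "Z r x = W r x - E r * V r x" for r x
 have Vm: "(%p. V (fst p) (snd p)) : borel_measurable bst"
  unfolding V_def by (rule PK_nn_meas_t[OF s F(1)])
 have Em: "(%p. E (fst p)) : borel_measurable bst"
 proof -
  have "E : Bmeas" unfolding E_def by measurable
  then show ?thesis unfolding borel_prod[symmetric] by (rule measurable_compose[OF measurable_fst])
 qed
 have Zm: "(%p. Z (fst p) (snd p)) : borel_measurable bst"
  unfolding Z_def using W Vm Em by measurable
 define ze where "ze r = nint ((if r : I then m r else return borel 0)) (Z r)" for r
 have zm: "ze : Bmeas" unfolding ze_def by (rule flow_nn_meas[OF fl Zm])
 have ineqZ: "AE x in m t. Z t x <= ennreal ka * nint lborel (%r. indicator {s<..<t} r * nint (PK t r x) (Z r))" if t: "s < t" "t <= ta" for t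
 proof -
  have tI: "t : I" using I_up[OF s, of t] t by simp
  have smt: "sets (m t) = sets borel" using fl tI by (auto simp: flow_def)
  have "nint (m t) (V t) = nint (m s) F"
   unfolding V_def using flow_nn[OF fl s tI less_imp_le[OF t(1)] F(1)] t s by (simp add: PK_eq)
  then have "nint (m t) (V t) ~= \<infinity>" using F(2) by simp
  moreover have "V t : borel_measurable (m t)" using section_meas(1)[OF Vm] measurable_cong_sets[OF smt refl] by blast
  ultimately have "AE x in m t. V t x ~= \<infinity>" by (intro nn_integral_noteq_infinite)
  with ineq[OF t] show ?thesis
  proof eventually_elim
   case (elim x)
   have kt: "nint (PK t r x) (W r) <= E r * V t x + nint (PK t r x) (Z r)" if r: "r : {s<..<t}" for r
   proof -
    have rI: "r : I" "r <= t" "s <= r" using I_up[OF s, of r] r by auto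
    have pm: "g : borel_measurable (PK t r x)" if "g : Bmeas" for g :: "real^'n => ennreal"
     using that measurable_cong_sets[OF PK_prob(2) refl] by blast
    have "nint (PK t r x) (W r) <= nint (PK t r x) (%y. E r * V r y + Z r y)"
     by (intro nn_integral_mono) (use ennreal_minus_le_iff[THEN iffD1, OF order_refl, THEN conjunct1] in "simp add: Z_def")
    also have "... = E r * nint (PK t r x) (V r) + nint (PK t r x) (Z r)"
     using pm[OF section_meas(1)[OF Vm]] pm[OF section_meas(1)[OF Zm]] by (simp add: nn_integral_add nn_integral_cmult)
    also have "nint (PK t r x) (V r) = V t x"
     unfolding V_def using P_nn[OF s rI(3,2) F(1), of x] rI s t by (simp add: PK_eq)
    finally show ?thesis .
   qed
   have Im: "(%r. nint (PK t r x) (Z r)) : Bmeas"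
    using section_meas(2)[of "%r x. nint (PK t r x) (Z r)"] PK_nn_meas[OF Zm, of t] by blast
   have E1: "E : Bmeas" unfolding E_def by measurable
   have "ennreal ka * nint lborel (%r. indicator {s<..<t} r * nint (PK t r x) (W r))
    <= ennreal ka * nint lborel (%r. indicator {s<..<t} r * E r * V t x + indicator {s<..<t} r * nint (PK t r x) (Z r))"
    by (intro mult_left_mono nn_integral_mono) (use kt in "auto simp: indicator_def")
   also have "... = ennreal ka * nint lborel (%r. indicator {s<..<t} r * E r) * V t x + ennreal ka * nint lborel (%r. indicator {s<..<t} r * nint (PK t r x) (Z r))"
   proof -
    have "nint lborel (%r. indicator {s<..<t} r * E r * V t x + indicator {s<..<t} r * nint (PK t r x) (Z r))
     = nint lborel (%r. indicator {s<..<t} r * E r * V t x) + nint lborel (%r. indicator {s<..<t} r * nint (PK t r x) (Z r))"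
     by (rule nn_integral_add) (use Im E1 in measurable)
    also have "nint lborel (%r. indicator {s<..<t} r * E r * V t x) = nint lborel (%r. indicator {s<..<t} r * E r) * V t x"
     by (rule nn_integral_multc) (use E1 in measurable)
    finally show ?thesis by (simp add: distrib_left mult.assoc)
   qed
   also have "ennreal ka * nint lborel (%r. indicator {s<..<t} r * E r) <= ennreal (exp (ka * (t - s)) - 1)"
   proof -
    have "ennreal ka * nint lborel (%r. indicator {s<..<t} r * E r) = nint lborel (%r. ennreal ka * (indicator {s<..<t} r * E r))"
     using E1 by (simp add: nn_integral_cmult)
    also have "... <= nint lborel (%r. ennreal (ka * exp (ka * (r - s))) * indicator {s..t} r)"
     by (intro nn_integral_mono) (use k in "auto simp: indicator_def E_def ennreal_mult")
    also have "... = ennreal (exp (ka * (t - s)) - exp (ka * (s - s)))"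
     by (rule nn_integral_FTC_Icc) (use t k in "auto intro!: derivative_eq_intros")
    finally show ?thesis by simp
   qed
   finally have "W t x <= V t x + (ennreal (exp (ka * (t - s)) - 1) * V t x + ennreal ka * nint lborel (%r. indicator {s<..<t} r * nint (PK t r x) (Z r)))"
    using elim(1) unfolding V_def[symmetric] by (meson add_left_mono mult_right_mono order_trans add_right_mono zero_le)
   also have "... = (1 + ennreal (exp (ka * (t - s)) - 1)) * V t x + ennreal ka * nint lborel (%r. indicator {s<..<t} r * nint (PK t r x) (Z r))"
    by (simp add: distrib_right add.assoc)
   also have "1 + ennreal (exp (ka * (t - s)) - 1) = E t"
    using k t by (simp add: E_def ennreal_plus[symmetric] ennreal_1[symmetric] del: ennreal_1)
   finally show ?case
    using elim(2) unfolding Z_def by (subst ennreal_minus_le_iff) (auto simp: E_def ennreal_mult_eq_top_iff)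
  qed
 qed
 have z0: "ze t = 0"
 proof (rule scalar_gronwall[OF k zm _ _ t])
  fix t assume t: "s < t" "t <= ta"
  have tI: "t : I" using I_up[OF s, of t] t by simp
  have smt: "sets (m t) = sets borel" using fl tI by (auto simp: flow_def)
  have "ze t <= nint (m t) (%x. ennreal ka * nint lborel (%r. indicator {s<..<t} r * nint (PK t r x) (Z r)))"
   unfolding ze_def using tI ineqZ[OF t] by (simp add: nn_integral_mono_AE)
  also have "... = ennreal ka * nint (m t) (%x. nint lborel (%r. indicator {s<..<t} r * nint (PK t r x) (Z r)))"
  proof (rule nn_integral_cmult)
   show "(%x. nint lborel (%r. indicator {s<..<t} r * nint (PK t r x) (Z r))) : borel_measurable (m t)"
    using space_time_inner_meas[OF Zm] measurable_cong_sets[OF smt refl] by blast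
  qed
  also have "... = ennreal ka * nint lborel (%r. indicator {s<..<t} r * nint (m r) (Z r))"
   unfolding flow_space_time[OF fl s t(1) Zm] ..
  also have "nint lborel (%r. indicator {s<..<t} r * nint (m r) (Z r)) = nint lborel (%r. indicator {s<..<t} r * ze r)"
   by (intro nn_integral_cong) (use I_up[OF s] in "auto simp: ze_def indicator_def")
  finally show "ze t <= ennreal ka * nint lborel (%r. indicator {s<..<t} r * ze r)" .
 next
  have "nint lborel (%r. indicator {s<..ta} r * ze r) <= nint lborel (%r. indicator {s<..ta} r * nint (m r) (W r))"
   by (intro nn_integral_mono) (use I_up[OF s] in "auto simp: ze_def indicator_def Z_def diff_le_self_ennreal intro!: nn_integral_mono")
  then show "nint lborel (%r. indicator {s<..ta} r * ze r) < \<infinity>" using fin by simp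
 qed
 have tI: "t : I" using I_up[OF s, of t] t by simp
 have smt: "sets (m t) = sets borel" using fl tI by (auto simp: flow_def)
 have "Z t : borel_measurable (m t)" using section_meas(1)[OF Zm, of t] measurable_cong_sets[OF smt refl] by blast
 moreover have "nint (m t) (Z t) = 0" using z0 tI by (simp add: ze_def)
 ultimately have "AE x in m t. Z t x = 0" by (simp add: nn_integral_0_iff_AE)
 then show ?thesis
 proof eventually_elim
  case (elim x)
  have "W t x <= E t * V t x + Z t x"
   using ennreal_minus_le_iff[THEN iffD1, OF order_refl, THEN conjunct1] by (simp add: Z_def)
  then show ?case using elim by (simp add: E_def V_def)
 qed
qed

end

context kolm_h begin

text \<open>Unbounded integrands by truncation at level n: the error is at most the integral of v -
  min v n. At x0 it is small for large n by dominated convergence. The truncated v converges along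
  the sequence by \<open>strong_feller\<close> and v by hypothesis, so the error is small along the
  sequence as well.\<close>

lemma strong_feller_dominated:
 fixes h v :: "real ^ 'n => real"
 assumes r: "r : I" "r < t" and h: "h : Bmeas" and v: "v : Bmeas" and hv: "!!y. abs (h y) <= v y"
  and int: "!!k. integrable (P t r (x k)) v" "integrable (P t r x0) v"
  and lim: "x \<longlonglongrightarrow> x0" "(%k::nat. lint (P t r (x k)) v) \<longlonglongrightarrow> (lint (P t r x0) v)"
 shows "(%k. lint (P t r (x k)) h) \<longlonglongrightarrow> (lint (P t r x0) h)"
proof -
 have rt: "r <= t" using r by simp
 note m = P_meas[OF r(1) rt]
 define c where "c n y = max (- real n) (min (real n) (h y))" for n y
 define w where "w n y = min (v y) (real n)" for n y
 have v0: "0 <= v y" for y using hv[of y] by linarith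
 have cm: "c n : Bmeas" and wm: "w n : Bmeas" for n
  unfolding c_def w_def using h v by measurable
 have cb: "abs (c n y) <= real n" and wb: "abs (w n y) <= real n" for n y using v0[of y] by (auto simp: c_def w_def abs_le_iff)
 have cw: "abs (h y - c n y) <= v y - w n y" for n y using hv[of y] by (auto simp: c_def w_def abs_le_iff min_def max_def)
 have bi: "integrable (P t r z) g" if "g : Bmeas" "!!y. abs (g y) <= B" for g :: "real^'n => real" and B z
 proof -
  interpret prob_space "P t r z" using P(1)[OF r(1) rt] .
  show ?thesis by (rule integrable_const_bound[of _ B]) (use that m in auto)
 qed
 have app: "abs (lint (P t r z) h - lint (P t r z) (c n)) <= lint (P t r z) v - lint (P t r z) (w n)" if "integrable (P t r z) v" for z n
 proof -
  have hi: "integrable (P t r z) h" by (rule Bochner_Integration.integrable_bound[OF that m[OF h]]) (use hv v0 in auto)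
  have "abs (lint (P t r z) h - lint (P t r z) (c n)) = abs (lint (P t r z) (%y. h y - c n y))" using hi bi[OF cm cb] by simp
  also have "... <= lint (P t r z) (%y. v y - w n y)"
   by (rule integral_abs_bound_integral) (use hi that bi[OF cm cb] bi[OF wm wb] cw in auto)
  also have "... = lint (P t r z) v - lint (P t r z) (w n)" using that bi[OF wm wb] by simp
  finally show ?thesis .
 qed
 have wlim: "(%n. lint (P t r x0) (w n)) \<longlonglongrightarrow> (lint (P t r x0) v)"
 proof (rule integral_dominated_convergence[where w = v])
  show "AE y in P t r x0. (%n. w n y) \<longlonglongrightarrow> v y"
  proof (rule AE_I2, rule tendsto_eventually)
   fix y
   show "\<forall>\<^sub>F n in sequentially. w n y = v y"
    using eventually_ge_at_top[of "nat \<lceil>v y\<rceil>"] by eventually_elim (auto simp: w_def min_def)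
  qed
 qed (use int m[OF v] m[OF wm] v0 in "auto simp: w_def")
 have sc: "(%k. lint (P t r (x k)) (%y. g y)) \<longlonglongrightarrow> (lint (P t r x0) (%y. g y))" if "g : Bmeas" "!!y. abs (g y) <= B" for g :: "real^'n => real" and B
  by (rule continuous_on_tendsto_compose[OF strong_feller[OF r that] lim(1)]) auto
 show ?thesis
 proof (rule LIMSEQ_I)
  fix e :: real assume "e > 0"
  then have e: "e / 4 > 0" by simp
  from LIMSEQ_D[OF wlim e] obtain n where n: "abs (lint (P t r x0) (w n) - lint (P t r x0) v) < e / 4" by auto
  have "(%k. lint (P t r (x k)) v - lint (P t r (x k)) (w n)) \<longlonglongrightarrow> (lint (P t r x0) v) - lint (P t r x0) (w n)"
   by (intro tendsto_intros lim sc[OF wm wb])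
  moreover have "lint (P t r x0) v - lint (P t r x0) (w n) < e / 4" using n by linarith
  ultimately have "\<forall>\<^sub>F k in sequentially. lint (P t r (x k)) v - lint (P t r (x k)) (w n) < e / 4" by (rule order_tendstoD)
  moreover have "\<forall>\<^sub>F k in sequentially. dist (lint (P t r (x k)) (c n)) (lint (P t r x0) (c n)) < e / 4"
   by (rule tendstoD[OF sc[OF cm cb] e])
  ultimately have "\<forall>\<^sub>F k in sequentially. norm (lint (P t r (x k)) h - lint (P t r x0) h) < e"
  proof eventually_elim
   case (elim k)
   then show ?case using app[OF int(1), of k n] app[OF int(2), of n] n \<open>e > 0\<close> unfolding dist_real_def real_norm_def by linarith
  qed
  then show "EX no. ALL k>=no. norm (lint (P t r (x k)) h - lint (P t r x0) h) < e" by (simp add: eventually_sequentially)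
 qed
qed

end

text \<open>True without integrability, since the Bochner integral is then 0.\<close>

lemma abs_integral_nn: "ennreal \<bar>lint M (%x. g x)\<bar> <= nint M (%x. ennreal \<bar>g x\<bar>)" for g :: "'a => real"
proof (cases "integrable M g")
 case True
 from integral_norm_bound_ennreal[OF this] show ?thesis by simp
qed (simp add: not_integrable_integral_eq)

lemma abs_sint_nn:
 assumes "g : borel_measurable M"
 shows "ennreal \<bar>sint M g\<bar> <= nint M (%x. ennreal \<bar>g x\<bar>)"
proof (cases "nint M (%x. ennreal \<bar>g x\<bar>) < \<infinity>")
 case True
 then show ?thesis using sint_eq[OF assms] abs_integral_nn[of M g] by simp
next
 case False
 then show ?thesis by (simp add: less_top[symmetric])
qed

lemma integrable_Ioo: "integrable lborel (indicat_real {a<..<b})" for a b :: real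
 by (cases "a <= b") (auto intro!: integrable_real_indicator)

section \<open>Domination of mild solutions\<close>

text \<open>\<open>h r\<close> stands for \<open>%y. \<psi> r (u r y)\<close>, replaced by 0 at a null set of times \<open>r\<close>.\<close>
locale mild = kolm_h I Q b \<phi> D\<phi> H\<phi> a G P \<alpha> e0 NN
 for I :: "real set" and Q :: "real => real ^ 'n::finite => real ^ 'n ^ 'n" and b \<phi> D\<phi> H\<phi> a G P \<alpha> e0 NN +
 fixes m :: "real => (real ^ 'n) measure" and s ta L l ka :: real and f :: "real ^ 'n => real" and h u :: "real => real ^ 'n => real"
 assumes fl: "flow I m" and s: "s : I"
  and fm: "f : Bmeas" "nint (m s) (%x. ennreal \<bar>f x\<bar>) < \<infinity>"
  and um: "(%p. u (fst p) (snd p)) : borel_measurable bst"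
  and ufin: "nint lborel (%r. indicator {s<..ta} r * nint (m r) (%y. ennreal \<bar>u r y\<bar>)) < \<infinity>"
  and hm: "!!r. r : {s<..<ta} ==> h r : Bmeas"
  and L: "L >= 0" "!!r y. r : {s<..<ta} ==> abs (h r y) <= L * abs (u r y)"
  and kl: "ka >= 0" "l >= 0" "AE r in lborel. r : {s<..<ta} --> (ALL y. abs (h r y + l * u r y) <= ka * abs (u r y))"
  and mint: "!!t. t : {s<..ta} ==> AE x in lborel. set_integrable lebesgue {s<..<t} (%r. lint (PK t r x) (h r))"
  and meq: "!!t. t : {s<..ta} ==> AE x in lborel.
    u t x = lint (PK t s x) f + set_lebesgue_integral lebesgue {s<..<t} (%r. lint (PK t r x) (h r))"
begin

lemma upI: "r > s ==> r : I" using I_up[OF s, of r] by simp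

lemma m_sets: "r > s ==> sets (m r) = sets borel" using fl upI by (auto simp: flow_def)

lemma m_meas[simp]: "r > s ==> borel_measurable (m r) = Bmeas" by (rule measurable_cong_sets[OF m_sets refl])

lemma PK_meas[simp]: "borel_measurable (PK t r x) = Bmeas" by (rule measurable_cong_sets[OF PK_prob(2) refl])

lemma AE_lborel_flow: "AE x in lborel. Q' x ==> t > s ==> AE x in m t. Q' x"
proof -
 assume ae: "AE x in lborel. Q' x" and t: "t > s"
 from ae obtain N where N: "N : null_sets lborel" "{x. \<not> Q' x} \<subseteq> N" by (auto simp: eventually_ae_filter)
 have "N : null_sets (m t)" by (rule flow_AC[OF fl upI[OF t] N(1)])
 then have "AE x in m t. x \<notin> N" by (rule AE_not_in)
 then show ?thesis by eventually_elim (use N(2) in blast)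
qed

definition V :: "real => real ^ 'n => ennreal" where
 "V t x = nint (PK t s x) (%y. ennreal \<bar>f y\<bar>)"

lemma fa: "(%y. ennreal \<bar>f y\<bar>) : Bmeas" using fm(1) by measurable

lemma V_meas: "(%p. V (fst p) (snd p)) : borel_measurable bst"
 unfolding V_def by (rule PK_nn_meas_t[OF s fa])

lemma V_fin: assumes t: "t > s" shows "AE x in m t. V t x < \<infinity>"
proof -
 have "nint (m t) (V t) = nint (m s) (%x. ennreal \<bar>f x\<bar>)"
  unfolding V_def using flow_nn[OF fl s upI[OF t] less_imp_le[OF t] fa] t s by (simp add: PK_eq)
 then have "AE x in m t. V t x ~= \<infinity>"
  using fm(2) section_meas(1)[OF V_meas] t by (intro nn_integral_noteq_infinite) auto
 then show ?thesis by eventually_elim (simp add: less_top)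
qed

lemma V_CK: "s < r ==> r <= t ==> (nint (PK t r x) (V r)) = V t x"
 unfolding V_def using P_nn[OF s _ _ fa, of r t x] upI s by (simp add: PK_eq)

lemma ua_meas: "(%p. ennreal \<bar>u (fst p) (snd p)\<bar>) : borel_measurable bst"
 using um by measurable

lemma u_sec: "u r : Bmeas" by (rule section_meas(1)[OF um])

lemma first_bound:
 assumes t: "t : {s<..ta}"
 shows "AE x in m t. ennreal \<bar>u t x\<bar> <= V t x + ennreal L * nint lborel (%r. indicator {s<..<t} r * nint (PK t r x) (%y. ennreal \<bar>u r y\<bar>))"
proof -
 have "t > s" using t by simp
 from AE_lborel_flow[OF meq[OF t] this] show ?thesis
 proof eventually_elim
  case (elim x)
  define g where "g r = indicator {s<..<t} r * lint (PK t r x) (h r)" for r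
  have gb: "ennreal \<bar>g r\<bar> <= ennreal L * (indicator {s<..<t} r * nint (PK t r x) (%y. ennreal \<bar>u r y\<bar>))" for r
  proof (cases "r : {s<..<t}")
   case True
   then have r: "r : {s<..<ta}" using t by auto
   have "ennreal \<bar>g r\<bar> <= nint (PK t r x) (%y. ennreal \<bar>h r y\<bar>)" using True by (simp add: g_def abs_integral_nn)
   also have "... <= nint (PK t r x) (%y. ennreal L * ennreal \<bar>u r y\<bar>)"
    using L(2)[OF r] L(1) by (intro nn_integral_mono) (simp add: ennreal_mult[symmetric] ennreal_leI)
   also have "... = ennreal L * nint (PK t r x) (%y. ennreal \<bar>u r y\<bar>)"
    by (rule nn_integral_cmult) (use u_sec PK_meas in auto)
   finally show ?thesis using True by simp
  qed (simp add: g_def)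
  have "ennreal \<bar>u t x\<bar> <= ennreal (abs (lint (PK t s x) f) + abs (lint lebesgue (%r. g r)))"
   using elim by (intro ennreal_leI) (simp add: set_lebesgue_integral_def g_def)
  also have "... = ennreal \<bar>lint (PK t s x) f\<bar> + ennreal \<bar>lint lebesgue (%r. g r)\<bar>" by simp
  also have "... <= V t x + nint lebesgue (%r. ennreal \<bar>g r\<bar>)" unfolding V_def by (intro add_mono abs_integral_nn)
  also have "nint lebesgue (%r. ennreal \<bar>g r\<bar>) = nint lborel (%r. ennreal \<bar>g r\<bar>)" by (rule nn_integral_completion)
  also have "... <= nint lborel (%r. ennreal L * (indicator {s<..<t} r * nint (PK t r x) (%y. ennreal \<bar>u r y\<bar>)))"
   by (intro nn_integral_mono gb)
  also have "... = ennreal L * nint lborel (%r. indicator {s<..<t} r * nint (PK t r x) (%y. ennreal \<bar>u r y\<bar>))"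
   using section_meas(2)[OF PK_nn_meas[of "%r y. ennreal \<bar>u r y\<bar>", OF ua_meas]] by (intro nn_integral_cmult) measurable
  finally show ?case by (simp add: add_left_mono)
 qed
qed

text \<open>The rate L is crude, but it secures integrability: the solution is dominated by V, which
  is finite almost everywhere and is transported exactly by the kernels.\<close>

lemma a_priori:
 assumes t: "t : {s<..ta}"
 shows "AE x in m t. ennreal \<bar>u t x\<bar> <= ennreal (exp (L * (ta - s))) * V t x"
proof -
 have "AE x in m t. ennreal \<bar>u t x\<bar> <= ennreal (exp (L * (t - s))) * V t x"
  unfolding V_def
  by (rule kernel_gronwall[OF fl s L(1) fa fm(2) ua_meas, of ta])
   (use first_bound ufin t in "auto simp: V_def")
 then show ?thesis
 proof eventually_elim
  case (elim x)
  have "ennreal (exp (L * (t - s))) <= ennreal (exp (L * (ta - s)))" using t L(1) by (intro ennreal_leI) (simp add: mult_left_mono)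
  then show ?case using elim by (meson mult_right_mono order_trans zero_le)
 qed
qed

definition C :: real where "C = exp (L * (ta - s))"

definition v :: "real => real ^ 'n => real" where "v r y = enn2real (V r y)"

definition good :: "real => real ^ 'n => bool" where
 "good r y \<longleftrightarrow> V r y < \<infinity> & ennreal \<bar>u r y\<bar> <= ennreal C * V r y"

text \<open>Setting \<open>h\<close> to 0 off the good points turns the almost-everywhere bound into
  |ht| <= L C v at every point, as needed for kernels started at arbitrary x. By
  \<open>good_kernel\<close> integrals are affected only in exceptional cases.\<close>

definition ht :: "real => real ^ 'n => real" where
 "ht r y = (if good r y & r : {s<..<ta} then h r y else 0)"

lemma good_AE: "t : {s<..ta} ==> AE y in m t. good t y"
 using V_fin[of t] a_priori[of t] by (auto simp: good_def C_def elim: eventually_elim2)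

lemma good_meas: "{p. good (fst p) (snd p)} : sets bst"
proof -
 have "{p : space borel. V (fst p) (snd p) < \<infinity> & ennreal \<bar>u (fst p) (snd p)\<bar> <= ennreal C * V (fst p) (snd p)} : sets bst"
  using V_meas ua_meas by measurable
 then show ?thesis by (simp add: good_def)
qed

lemma good_sec: "{y. good r y} : sets borel"
proof -
 have "Pair r : borel \<rightarrow>\<^sub>M bst" by (intro borel_measurable_continuous_onI continuous_intros)
 from measurable_sets[OF this good_meas] show ?thesis by (simp add: vimage_def)
qed

lemma ht_meas: "ht r : Bmeas"
proof (cases "r : {s<..<ta}")
 case True
 have "(%y. if y : {y. good r y} then h r y else 0) : Bmeas"
  by (rule measurable_If_set[OF hm[OF True]]) (use good_sec in auto)
 then show ?thesis using True by (simp add: ht_def[abs_def])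
next
 case False
 then have "ht r = (%y. 0)" by (auto simp: ht_def fun_eq_iff)
 then show ?thesis by simp
qed

lemma v_meas: "v r : Bmeas"
 unfolding v_def[abs_def] using section_meas(1)[OF V_meas, of r] by measurable

lemma C_pos: "C > 0" by (simp add: C_def)

lemma v_nonneg: "0 <= v r y" by (simp add: v_def)

lemma ht_bound: "abs (ht r y) <= L * C * v r y"
proof (cases "good r y & r : {s<..<ta}")
 case True
 then have "ennreal \<bar>u r y\<bar> <= ennreal C * ennreal (v r y)" by (auto simp: good_def v_def)
 then have "abs (u r y) <= C * v r y" using C_pos v_nonneg by (simp add: ennreal_mult[symmetric] ennreal_le_iff)
 then have "L * abs (u r y) <= L * (C * v r y)" using L(1) by (rule mult_left_mono)
 then show ?thesis using True L(2)[of r y] by (simp add: ht_def mult.assoc)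
qed (use L(1) C_pos v_nonneg[of r y] in "auto simp: ht_def")

lemma v_int:
 assumes r: "s < r" "r <= t" and x: "V t x < \<infinity>"
 shows "integrable (PK t r x) (v r)" "lint (PK t r x) (v r) = v t x"
proof -
 have Vm: "V r : borel_measurable (PK t r x)" using section_meas(1)[OF V_meas] by simp
 have "AE y in PK t r x. V r y ~= \<infinity>"
  using V_CK[OF r, of x] x by (intro nn_integral_noteq_infinite Vm) auto
 then have ae: "AE y in PK t r x. V r y = ennreal (v r y)" by eventually_elim (simp add: v_def less_top)
 show "integrable (PK t r x) (v r)"
  using nn_integral_cong_AE[OF ae] V_CK[OF r, of x] x v_meas PK_meas by (auto simp: integrable_iff_bounded v_nonneg)
 show "lint (PK t r x) (v r) = v t x"
 proof -
  have "enn2real (nint (PK t r x) (V r)) = lint (PK t r x) (v r)"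
   by (rule enn2real_nn_integral_eq_integral[OF ae]) (use v_meas in "auto simp: v_nonneg")
  then show ?thesis unfolding V_CK[OF r] by (simp add: v_def[of t x])
 qed
qed

lemma ht_fin: "s < r ==> r <= t ==> V t x < \<infinity> ==> (nint (PK t r x) (%y. ennreal \<bar>ht r y\<bar>)) < \<infinity>"
proof -
 assume a: "s < r" "r <= t" "V t x < \<infinity>"
 have "integrable (PK t r x) (ht r)"
  by (rule Bochner_Integration.integrable_bound[of _ "%y. L * C * v r y"])
   (use v_int(1)[OF a] ht_meas PK_meas ht_bound L(1) C_pos v_nonneg in auto)
 then show ?thesis by (simp add: integrable_iff_bounded)
qed

text \<open>At each time the bad points form a null set of the flow, so their space-time potential
  vanishes by \<open>flow_space_time\<close>.\<close>

lemma good_kernel: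
 assumes t: "t : {s<..ta}"
 shows "AE x in m t. AE r in lborel. r : {s<..<t} --> (AE y in PK t r x. good r y)"
proof -
 have ts: "s < t" using t by simp
 define w where "w r y = (indicator (- {p. good (fst p) (snd p)}) (r, y) :: ennreal)" for r y
 have wm: "(%p. w (fst p) (snd p)) : borel_measurable bst"
  unfolding w_def using good_meas by (simp add: borel_measurable_indicator)
 have w0: "nint M (w r) = 0 \<longleftrightarrow> (AE y in M. good r y)" if "borel_measurable M = (Bmeas :: (real^'n => ennreal) set)" for r M
 proof -
  have "w r : borel_measurable M" using section_meas(1)[OF wm, of r] that by simp
  then have "nint M (w r) = 0 \<longleftrightarrow> (AE y in M. w r y = 0)" by (rule nn_integral_0_iff_AE)
  moreover have "w r y = 0 \<longleftrightarrow> good r y" for y by (simp add: w_def indicator_def)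
  ultimately show ?thesis by simp
 qed
 have "nint lborel (%r. indicator {s<..<t} r * nint (m r) (w r)) = nint ((lborel :: real measure)) (%r. 0)"
  by (intro nn_integral_cong) (use w0 m_meas good_AE t in "auto simp: indicator_def")
 then have "nint (m t) (%x. nint lborel (%r. indicator {s<..<t} r * nint (PK t r x) (w r))) = 0"
  unfolding flow_space_time[OF fl s ts wm] by simp
 then have "AE x in m t. nint lborel (%r. indicator {s<..<t} r * nint (PK t r x) (w r)) = 0"
  using space_time_inner_meas[OF wm, of s t] ts by (subst (asm) nn_integral_0_iff_AE) auto
 then show ?thesis
 proof eventually_elim
  case (elim x)
  have "(%r. indicator {s<..<t} r * nint (PK t r x) (w r)) : borel_measurable lborel"
   using section_meas(2)[of "%r x. nint (PK t r x) (w r)"] PK_nn_meas[OF wm, of t] by measurable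
  then have "AE r in lborel. indicator {s<..<t} r * nint (PK t r x) (w r) = 0" using elim by (simp add: nn_integral_0_iff_AE)
  then show ?case by eventually_elim (use w0 PK_meas in "auto simp: indicator_def")
 qed
qed

lemma ht_integral:
 assumes "r : {s<..<ta}" "AE y in PK t r x. good r y"
 shows "lint (PK t r x) (ht r) = lint (PK t r x) (h r)"
proof (rule integral_cong_AE)
 show "ht r : borel_measurable (PK t r x)" "h r : borel_measurable (PK t r x)" using ht_meas hm[OF assms(1)] by simp_all
 show "AE y in PK t r x. ht r y = h r y" using assms(2) by eventually_elim (use assms(1) in "simp add: ht_def")
qed

text \<open>\<open>g\<close> is a jointly Borel version of (r,x) -> integral of \<open>ht r\<close>
  under the kernel from (t,x) to time r. It is 0 on the null set \<open>N\<close> of times and off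
  the set \<open>X\<close> of full measure; at the points of X the mild equation at time t holds
  with \<open>g\<close> as its integrand.\<close>

definition drift :: "real => real set => (real ^ 'n) set => (real => real ^ 'n => real) => bool" where
 "drift t N X g \<longleftrightarrow> N : null_sets lborel & X : sets borel & (AE x in m t. x : X) &
  (%p. g (fst p) (snd p)) : borel_measurable bst &
  (ALL r x. g r x = (if r : {s<..<t} & r \<notin> N & x : X then lint (PK t r x) (ht r) else 0)) &
  (ALL x:X. V t x < \<infinity> & u t x = sint (PK t s x) f + lint lborel (%r. g r x) &
    (AE r in lborel. r : {s<..<t} --> (AE y in PK t r x. good r y)))"

lemma
 assumes "drift t N X g"
 shows drift_N: "N : null_sets lborel" and drift_X: "AE x in m t. x : X"
  and drift_gm: "(%p. g (fst p) (snd p)) : borel_measurable bst"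
  and drift_eq: "g r x = (if r : {s<..<t} & r \<notin> N & x : X then lint (PK t r x) (ht r) else 0)"
  and drift_V: "x : X ==> V t x < \<infinity>" and drift_u: "x : X ==> u t x = sint (PK t s x) f + lint lborel (%r. g r x)"
  and drift_good: "x : X ==> AE r in lborel. r : {s<..<t} --> (AE y in PK t r x. good r y)"
 using assms unfolding drift_def by blast+

text \<open>The points where integrability in time, the mild equation, finiteness of V or
  \<open>good_kernel\<close> fails are put into one Borel null set, whose complement is X. There,
  \<open>h\<close> and \<open>ht\<close> have the same kernel integrals for almost every r, so
  measurability in time passes from one to the other.\<close>

lemma drift_exists:
 assumes t: "t : {s<..ta}"
 obtains N X g where "drift t N X g"
proof -
 have ts: "s < t" using t by simp
 define R where "R x \<longleftrightarrow> set_integrable lebesgue {s<..<t} (%r. lint (PK t r x) (h r)) &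
  u t x = lint (PK t s x) f + set_lebesgue_integral lebesgue {s<..<t} (%r. lint (PK t r x) (h r)) &
  V t x < \<infinity> & (AE r in lborel. r : {s<..<t} --> (AE y in PK t r x. good r y))" for x
 have "AE x in m t. R x"
  using AE_lborel_flow[OF mint[OF t] ts] AE_lborel_flow[OF meq[OF t] ts] V_fin[OF ts] good_kernel[OF t]
  by eventually_elim (simp add: R_def)
 then obtain N0 where N0: "N0 : null_sets (m t)" and n0: "{x. \<not> R x} \<subseteq> N0"
  using sets_eq_imp_space_eq[OF m_sets[OF ts]] by (auto simp: eventually_ae_filter)
 have n: "set_integrable lebesgue {s<..<t} (%r. lint (PK t r x) (h r)) &
  u t x = lint (PK t s x) f + set_lebesgue_integral lebesgue {s<..<t} (%r. lint (PK t r x) (h r)) &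
  V t x < \<infinity> & (AE r in lborel. r : {s<..<t} --> (AE y in PK t r x. good r y))" if "x \<notin> N0" for x
  using n0 that unfolding R_def by blast
 define X where "X = - N0"
 have "N0 : sets borel" using null_setsD2[OF N0] unfolding m_sets[OF ts] .
 then have X: "X : sets borel" unfolding X_def by (rule borel_comp)
 note nX = n[unfolded Compl_iff[symmetric] X_def[symmetric]]
 have XAE: "AE x in m t. x : X" using AE_not_in[OF N0] by (simp add: X_def)
 define g0 where "g0 r x = (if r : {s<..<t} then lint (PK t r x) (ht r) else 0)" for r x
 \<comment> \<open>The second component makes the dominating functions converge along the sequences considered.\<close>
  define \<Theta> where "\<Theta> x = (x, v t x)" for x
 have "EX N:null_sets lborel. (%p. if fst p \<notin> N & snd p : X then g0 (fst p) (snd p) else 0) : borel_measurable (borel \<Otimes>\<^sub>M borel)"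
 proof (rule caratheodory_measurable[OF _ X])
  show "\<Theta> : Bmeas" unfolding \<Theta>_def by (intro borel_measurable_Pair v_meas) simp
  fix r x and y :: "nat => real^'n"
  assume x: "x : X" and y: "!!k. y k : X" and lim: "(%k. \<Theta> (y k)) \<longlonglongrightarrow> \<Theta> x"
  show "(%k. g0 r (y k)) \<longlonglongrightarrow> g0 r x"
  proof (cases "r : {s<..<t}")
   case True
   then have r: "s < r" "r < t" "r <= t" "r : I" using upI by auto
   have Vf: "V t x < \<infinity>" "V t (y k) < \<infinity>" for k using nX x y by blast+
   have pk: "P t r z = PK t r z" for z using r by (simp add: PK_eq)
   have "(%k. lint (P t r (y k)) (ht r)) \<longlonglongrightarrow> (lint (P t r x) (ht r))"
   proof (rule strong_feller_dominated[OF r(4,2) ht_meas _ ht_bound])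
    show "(%y. L * C * v r y) : Bmeas" using v_meas by measurable
    show "y \<longlonglongrightarrow> x" using tendsto_fst[OF lim] by (simp add: \<Theta>_def)
    have "(%k. L * C * v t (y k)) \<longlonglongrightarrow> L * C * v t x" using tendsto_snd[OF lim] by (intro tendsto_intros) (simp add: \<Theta>_def)
    then show "(%k. lint (P t r (y k)) (%z. L * C * v r z)) \<longlonglongrightarrow> (lint (P t r x) (%z. L * C * v r z))"
     using v_int(2)[OF r(1,3) Vf(1)] v_int(2)[OF r(1,3) Vf(2)] by (simp add: pk)
   qed (use v_int(1)[OF r(1,3) Vf(1)] v_int(1)[OF r(1,3) Vf(2)] pk in auto)
   then show ?thesis using True by (simp add: g0_def pk)
  next
   case False
   then have "g0 r = (%x. 0)" by (auto simp: g0_def fun_eq_iff)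
   then show ?thesis by simp
  qed
 next
  fix x assume x: "x : X"
  have "(%r. indicator {s<..<t} r *\<^sub>R lint (PK t r x) (h r)) : borel_measurable lebesgue"
   using nX[OF x] unfolding set_integrable_def by (intro borel_measurable_integrable) blast
  then obtain g' where g': "g' : borel_measurable lborel" "AE r in lborel. indicator {s<..<t} r *\<^sub>R lint (PK t r x) (h r) = g' r"
   using completion_ex_borel_measurable_real by blast
  have "AE r in lborel. r : {s<..<t} --> (AE y in PK t r x. good r y)" using nX[OF x] by blast
  with g'(2) have "AE r in lborel. g0 r x = g' r"
   by eventually_elim (use t ht_integral in "auto simp: g0_def indicator_def")
  then show "EX g':Bmeas. AE r in lborel. g0 r x = g' r" using g'(1) by auto
 qed
 then obtain N where N: "N : null_sets lborel" and gm: "(%p. if fst p \<notin> N & snd p : X then g0 (fst p) (snd p) else 0) : borel_measurable (borel \<Otimes>\<^sub>M borel)"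
  by blast
 define g where "g r x = (if r \<notin> N & x : X then g0 r x else 0)" for r x
 have gm': "(%p. g (fst p) (snd p)) : borel_measurable bst" using gm by (simp add: g_def borel_prod)
 have "u t x = sint (PK t s x) f + lint lborel (%r. g r x)" if x: "x : X" for x
 proof -
  have gx: "(%r. g r x) : borel_measurable lborel" using section_meas(2)[OF gm', of x] by simp
  have "AE r in lborel. r : {s<..<t} --> (AE y in PK t r x. good r y)" using nX[OF x] by blast
  with AE_not_in[OF N] have "AE r in lborel. indicator {s<..<t} r *\<^sub>R lint (PK t r x) (h r) = g r x"
   by eventually_elim (use t x ht_integral in "auto simp: g_def g0_def indicator_def")
  then have ae: "AE r in lebesgue. indicator {s<..<t} r *\<^sub>R lint (PK t r x) (h r) = g r x" by (rule AE_completion)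
  have "lint lebesgue (%r. indicator {s<..<t} r *\<^sub>R lint (PK t r x) (h r)) = lint lebesgue (%r. g r x)"
   using nX[OF x] unfolding set_integrable_def
   by (intro integral_cong_AE[OF _ measurable_completion[OF gx] ae] borel_measurable_integrable) blast
  also have "... = lint lborel (%r. g r x)" by (rule integral_completion[OF gx])
  finally show ?thesis
   using nX[OF x] sint_eq[of f "PK t s x"] fm(1) PK_meas by (simp add: set_lebesgue_integral_def V_def)
 qed
 then have "drift t N X g"
  unfolding drift_def using N X XAE gm' nX by (auto simp: g_def g0_def)
 then show ?thesis by (rule that)
qed

lemma drift_bound:
 assumes d: "drift t N X g"
 shows "abs (g r x) <= indicator {s<..<t} r * (L * C * v t x)" "integrable lborel (%r. g r x)"
proof -
 have gr: "g r x = (if r : {s<..<t} & r \<notin> N & x : X then lint (PK t r x) (ht r) else 0)" for r x by (rule drift_eq[OF d])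
 have B: "abs (g r x) <= indicator {s<..<t} r * (L * C * v t x)" for r x
 proof (cases "r : {s<..<t} & r \<notin> N & x : X")
  case True
  then have r: "s < r" "r <= t" and Vx: "V t x < \<infinity>" using drift_V[OF d] by auto
  have "abs (lint (PK t r x) (ht r)) <= lint (PK t r x) (%y. L * C * v r y)"
   by (rule integral_abs_bound_integral)
    (use v_int(1)[OF r Vx] ht_fin[OF r Vx] ht_meas PK_meas ht_bound in "auto simp: integrable_iff_bounded")
  then show ?thesis using True v_int(2)[OF r Vx] gr[of r x] by simp
 next
  case False
  then show ?thesis using gr[of r x] L(1) C_pos v_nonneg by auto
 qed
 then show "abs (g r x) <= indicator {s<..<t} r * (L * C * v t x)" .
 show "integrable lborel (%r. g r x)"
 proof (rule Bochner_Integration.integrable_bound)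
  show "integrable lborel (%r. indicator {s<..<t} r * (L * C * v t x))"
   by (intro integrable_mult_left integrable_Ioo)
  show "(%r. g r x) : borel_measurable lborel" using section_meas(2)[OF drift_gm[OF d]] by simp
 qed (use B in "auto intro!: always_eventually order_trans[OF B]")
qed

lemma drift_joint: "drift t N X g ==> (%p. g (snd p) (fst p)) : borel_measurable ((borel :: (real^'n) measure) \<Otimes>\<^sub>M lborel)"
proof -
 assume d: "drift t N X g"
 have "(%p. (snd p, fst p)) : (borel :: (real^'n) measure) \<Otimes>\<^sub>M lborel \<rightarrow>\<^sub>M borel \<Otimes>\<^sub>M borel" by measurable
 from measurable_compose[OF this, of "%p. g (fst p) (snd p)" borel] drift_gm[OF d] show ?thesis by (simp add: borel_prod)
qed

text \<open>The mild equation at time r, averaged over the kernel from (t,x), becomes the equation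
  at time t with its integral stopped at r: Chapman-Kolmogorov transports the datum and, after
  Fubini's theorem, each value of the drift. The a priori bound supplies the integrability for
  both.\<close>

lemma propagate:
 assumes t: "t : {s<..ta}" and r: "r : {s<..<t}" and d: "drift t N X g"
 shows "AE x in m t. nint (PK t r x) (%y. ennreal \<bar>u r y\<bar>) < \<infinity> &
  sint (PK t r x) (u r) = sint (PK t s x) f + lint lborel (%sg. indicator {..<r} sg * g sg x)"
proof -
 have r': "r : {s<..ta}" "s < r" "r <= t" "r : I" "s < t" "t : I" "s <= r" using r t upI by auto
 obtain N' X' g' where d': "drift r N' X' g'" using drift_exists[OF r'(1)] .
 have "AE y in m r. y : X' & good r y" using drift_X[OF d'] good_AE[OF r'(1)] by eventually_elim blast
 from flow_AE[OF fl r'(4,6,3) this] have ae: "AE x in m t. AE y in PK t r x. y : X' & good r y" unfolding PK_eq[OF r'(4,3)] .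
 with drift_X[OF d] show ?thesis
 proof eventually_elim
  case e: (elim x)
  note elim = e(2,1)
  have Vx: "V t x < \<infinity>" by (rule drift_V[OF d e(1)])
  interpret K: prob_space "PK t r x" by (rule PK_prob)
  interpret D: pair_sigma_finite lborel "PK t r x"
   by (intro pair_sigma_finite.intro) (auto intro: K.sigma_finite_measure_axioms lborel.sigma_finite_measure_axioms)
  have "nint (PK t r x) (%y. ennreal \<bar>u r y\<bar>) <= nint (PK t r x) (%y. ennreal C * V r y)"
   by (rule nn_integral_mono_AE) (use elim(1) in eventually_elim, simp add: good_def)
  also have "... = ennreal C * V t x"
   using V_CK[OF r'(2,3), of x] section_meas(1)[OF V_meas, of r] PK_meas by (simp add: nn_integral_cmult)
  also have "... < \<infinity>" using Vx by (simp add: ennreal_mult_less_top)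
  finally have uf: "nint (PK t r x) (%y. ennreal \<bar>u r y\<bar>) < \<infinity>" .
  have ui: "integrable (PK t r x) (u r)" using uf u_sec PK_meas by (auto simp: integrable_iff_bounded)
  define A where "A y = sint (PK r s y) f" for y
  define B where "B y = lint lborel (%sg. g' sg y)" for y
  have Am: "A : Bmeas"
   using P_integral_meas[OF s r'(7) fm(1)] r' s by (simp add: A_def[abs_def] PK_eq)
  have Bm: "B : Bmeas"
   unfolding B_def by (intro lborel.borel_measurable_lebesgue_integral) (use drift_joint[OF d'] in "simp add: case_prod_beta'")
  have gi: "integrable (lborel \<Otimes>\<^sub>M PK t r x) (%(sg, y). g' sg y)"
  proof (rule Bochner_Integration.integrable_bound)
   show "integrable (lborel \<Otimes>\<^sub>M PK t r x) (%(sg, y). indicator {s<..<r} sg * (L * C * v r y))"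
    by (rule D.integrable_tensor) (use v_int(1)[OF r'(2,3) Vx] in "auto intro: integrable_Ioo")
   have sq: "sets (lborel \<Otimes>\<^sub>M PK t r x) = sets bst"
    unfolding borel_prod[symmetric] by (rule sets_pair_measure_cong) (auto simp: PK_prob)
   show "(%(sg, y). g' sg y) : borel_measurable (lborel \<Otimes>\<^sub>M PK t r x)"
    unfolding measurable_cong_sets[OF sq refl] using drift_gm[OF d'] by (simp add: case_prod_beta')
   show "AE p in lborel \<Otimes>\<^sub>M PK t r x. norm (case p of (sg, y) => g' sg y) <= norm (case p of (sg, y) => indicator {s<..<r} sg * (L * C * v r y))"
   proof (intro always_eventually allI)
    fix p :: "real \<times> (real^'n)"
    show "norm (case p of (sg, y) => g' sg y) <= norm (case p of (sg, y) => indicator {s<..<r} sg * (L * C * v r y))"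
     using drift_bound(1)[OF d', of "fst p" "snd p"] L(1) C_pos v_nonneg[of r "snd p"] by (simp add: case_prod_beta' abs_mult)
   qed
  qed
  have Bi: "integrable (PK t r x) B" unfolding B_def using D.integrable_snd[OF gi] .
  have "lint (PK t r x) (u r) - lint (PK t r x) B = lint (PK t r x) (%y. u r y - B y)" using ui Bi by simp
  also have "... = lint (PK t r x) A"
  proof (rule integral_cong_AE)
   show "AE y in PK t r x. u r y - B y = A y"
    using elim(1) by eventually_elim (simp add: drift_u[OF d'] A_def B_def)
  qed (use Am Bm u_sec PK_meas in auto)
  also have "... = sint (PK t s x) f"
  proof -
   have "nint (P t s x) (%y. ennreal \<bar>f y\<bar>) < \<infinity>" using Vx s r' by (simp add: V_def PK_eq)
   from P_integral_CK[OF s r'(7,3) fm(1) this] show ?thesis using s r' by (simp add: A_def[abs_def] PK_eq)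
  qed
  finally have e1: "lint (PK t r x) (u r) = sint (PK t s x) f + lint (PK t r x) B" by simp
  have "lint (PK t r x) B = lint lborel (%sg. lint (PK t r x) (g' sg))"
   unfolding B_def by (rule D.Fubini_integral[OF gi])
  also have "... = lint lborel (%sg. indicator {..<r} sg * g sg x)"
  proof (rule integral_cong_AE)
   show "(%sg. lint (PK t r x) (g' sg)) : borel_measurable lborel" using D.integrable_fst[OF gi] by simp
   show "(%sg. indicator {..<r} sg * g sg x) : borel_measurable lborel"
    using section_meas(2)[OF drift_gm[OF d]] by simp
   have nn: "N : null_sets lborel" "N' : null_sets lborel" using drift_N[OF d] drift_N[OF d'] by auto
   from AE_not_in[OF nn(1)] AE_not_in[OF nn(2)]
   show "AE sg in lborel. lint (PK t r x) (g' sg) = indicator {..<r} sg * g sg x"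
   proof eventually_elim
    case n: (elim sg)
    have g': "g' sg y = (if sg : {s<..<r} & sg \<notin> N' & y : X' then lint (PK r sg y) (ht sg) else 0)" for y by (rule drift_eq[OF d'])
    have g: "g sg x = (if sg : {s<..<t} & sg \<notin> N & x : X then lint (PK t sg x) (ht sg) else 0)" by (rule drift_eq[OF d])
    show ?case
    proof (cases "sg : {s<..<r}")
     case True
     then have q: "s < sg" "sg <= r" "sg <= t" "sg : I" "sg < r" "sg < t" using r' upI by auto
     have gs: "g' sg : Bmeas" using section_meas(1)[OF drift_gm[OF d']] by simp
     have ss: "(%y. sint (PK r sg y) (ht sg)) : Bmeas"
      using P_integral_meas[OF q(4,2) ht_meas] q by (simp add: PK_eq)
     have "lint (PK t r x) (g' sg) = lint (PK t r x) (%y. sint (PK r sg y) (ht sg))"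
     proof (rule integral_cong_AE)
      show "AE y in PK t r x. g' sg y = sint (PK r sg y) (ht sg)"
       using elim(1)
      proof eventually_elim
       case (elim y)
       then have "V r y < \<infinity>" by (simp add: good_def)
       from sint_eq[OF _ ht_fin[OF q(1,2) this]] show ?case using elim n True ht_meas PK_meas by (simp add: g')
      qed
     qed (use gs ss PK_meas in auto)
     also have "... = sint (PK t sg x) (ht sg)"
      using P_integral_CK[OF q(4,2) r'(3) ht_meas, of x] ht_fin[OF q(1,3) Vx] q r' by (simp add: PK_eq)
     also have "... = lint (PK t sg x) (ht sg)" by (rule sint_eq[OF _ ht_fin[OF q(1,3) Vx]]) (use ht_meas PK_meas in auto)
     finally show ?thesis using True n elim q by (simp add: g)
    next
     case False
     then have "g' sg = (%y. 0)" "indicator {..<r} sg * g sg x = 0" by (auto simp: g' g indicator_def fun_eq_iff)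
     then show ?thesis by simp
    qed
   qed
  qed
  finally show ?case using uf e1 sint_eq[OF _ uf] u_sec PK_meas by simp
 qed
qed

text \<open>\<open>propagate\<close> holds for each r at almost every x, whereas the time integral
  for fixed x needs almost every r. Exchanging the two requires a jointly measurable set, and
  \<open>sint\<close> makes the kernel integral of \<open>u\<close> measurable at all
  points.\<close>

lemma propagate_AE:
 assumes t: "t : {s<..ta}" and d: "drift t N X g"
 shows "AE x in m t. AE r in lborel. r : {s<..<t} --> (nint (PK t r x) (%y. ennreal \<bar>u r y\<bar>)) < \<infinity> &
  sint (PK t r x) (u r) = sint (PK t s x) f + lint lborel (%sg. indicator {..<r} sg * g sg x)"
proof -
 have ts: "s < t" "s <= t" using t by auto
 interpret mt: prob_space "m t" using fl upI[OF ts(1)] by (auto simp: flow_def)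
 interpret D: pair_sigma_finite lborel "m t"
  by (intro pair_sigma_finite.intro) (auto intro: mt.sigma_finite_measure_axioms lborel.sigma_finite_measure_axioms)
 let ?b = "borel :: (real \<times> (real^'n)) measure"
 have sp: "sets (lborel \<Otimes>\<^sub>M m t) = sets ?b"
  unfolding borel_prod[symmetric] by (rule sets_pair_measure_cong) (auto simp: m_sets[OF ts(1)])
 have m1: "(%p. nint (PK t (fst p) (snd p)) (%y. ennreal \<bar>u (fst p) y\<bar>)) : borel_measurable ?b"
  by (rule PK_nn_meas[of "%r y. ennreal \<bar>u r y\<bar>", OF ua_meas])
 have m2: "(%p. sint (PK t (fst p) (snd p)) (u (fst p))) : borel_measurable ?b"
  unfolding sint_def using PK_nn_meas[of "%r y. ennreal (u r y)" t] PK_nn_meas[of "%r y. ennreal (- u r y)" t] um by measurable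
 have m3: "(%p::real \<times> (real^'n). sint (PK t s (snd p)) f) : borel_measurable ?b"
 proof -
  have "(%x. sint (PK t s x) f) : Bmeas" using P_integral_meas[OF s ts(2) fm(1)] s ts by (simp add: PK_eq)
  then show ?thesis unfolding borel_prod[symmetric] by (rule measurable_compose[OF measurable_snd])
 qed
 have m4: "(%p. lint lborel (%sg. indicator {..<fst p} sg * g sg (snd p))) : borel_measurable ?b"
 proof (rule lborel.borel_measurable_lebesgue_integral)
  have "(%q::(real \<times> (real^'n)) \<times> real. (snd q, snd (fst q))) : ?b \<Otimes>\<^sub>M borel \<rightarrow>\<^sub>M ?b"
   unfolding borel_prod by (intro borel_measurable_continuous_onI continuous_intros)
  from measurable_compose[OF this, of "%p. g (fst p) (snd p)" borel] drift_gm[OF d]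
  have "(%q::(real \<times> (real^'n)) \<times> real. g (snd q) (snd (fst q))) : borel_measurable (?b \<Otimes>\<^sub>M borel)" by simp
  moreover have "(%q::(real \<times> (real^'n)) \<times> real. indicator {..<fst (fst q)} (snd q) :: real) : borel_measurable (?b \<Otimes>\<^sub>M borel)"
  proof -
   have "(%q::(real \<times> (real^'n)) \<times> real. indicator {..<fst (fst q)} (snd q) :: real) = indicator {q. snd q < fst (fst q)}" by (auto simp: indicator_def fun_eq_iff)
   moreover have "open {q::(real \<times> (real^'n)) \<times> real. snd q < fst (fst q)}" by (intro open_Collect_less continuous_intros)
   ultimately show ?thesis unfolding borel_prod by (simp add: borel_measurable_indicator)
  qed
  ultimately have "(%q::(real \<times> (real^'n)) \<times> real. indicator {..<fst (fst q)} (snd q) * g (snd q) (snd (fst q))) : borel_measurable (?b \<Otimes>\<^sub>M borel)"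
   by measurable
  then show "(%(p, sg). indicator {..<fst p} sg * g sg (snd p)) : borel_measurable (?b \<Otimes>\<^sub>M lborel)"
   by (simp add: case_prod_beta' measurable_cong_sets[OF sets_pair_measure_cong[OF refl sets_lborel] refl])
 qed
 define R where "R r x \<longleftrightarrow> r : {s<..<t} --> (nint (PK t r x) (%y. ennreal \<bar>u r y\<bar>)) < \<infinity> &
  sint (PK t r x) (u r) = sint (PK t s x) f + lint lborel (%sg. indicator {..<r} sg * g sg x)" for r x
 have "{p : space ?b. fst p : {s<..<t} --> (nint (PK t (fst p) (snd p)) (%y. ennreal \<bar>u (fst p) y\<bar>)) < \<infinity> &
  sint (PK t (fst p) (snd p)) (u (fst p)) = sint (PK t s (snd p)) f + lint lborel (%sg. indicator {..<fst p} sg * g sg (snd p))} : sets ?b"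
 proof -
  have mf: "(fst :: real \<times> (real^'n) => real) : borel_measurable ?b" by (intro borel_measurable_continuous_onI continuous_intros)
  show ?thesis using m1 m2 m3 m4 mf by measurable
 qed
 then have "{p:space (lborel \<Otimes>\<^sub>M m t). R (fst p) (snd p)} : sets (lborel \<Otimes>\<^sub>M m t)"
  using sp sets_eq_imp_space_eq[OF sp] by (simp add: R_def)
 from D.AE_commute[OF this] have "(AE r in lborel. AE x in m t. R r x) \<longleftrightarrow> (AE x in m t. AE r in lborel. R r x)" .
 moreover have "AE r in lborel. AE x in m t. R r x"
 proof (rule AE_I2)
  fix r
  show "AE x in m t. R r x"
  proof (cases "r : {s<..<t}")
   case True
   from propagate[OF t this d] show ?thesis by eventually_elim (simp add: R_def)
  qed (auto simp: R_def)
 qed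
 ultimately show ?thesis by (simp add: R_def)
qed

section \<open>The equation shifted by l\<close>

definition w :: "real => real ^ 'n => ennreal" where
 "w r y = ennreal (exp (l * (r - s)) * abs (u r y))"

lemma w_meas: "(%p. w (fst p) (snd p)) : borel_measurable bst"
proof -
 have "(fst :: real \<times> (real^'n) => real) : Bmeas" by (intro borel_measurable_continuous_onI continuous_intros)
 then show ?thesis unfolding w_def using um by measurable
qed

text \<open>With \<open>propagate_AE\<close> the stopped integral is the kernel average of u, so
  \<open>integrating_factor\<close> writes exp(l(t-s)) u as datum plus time integral of exp(l(r-s))
  times the kernel averages of h + l u. The absolute value of h + l u is at most ka |u|, which
  closes the inequality for \<open>w\<close>.\<close>

lemma shifted_bound:
 assumes t: "t : {s<..ta}"
 shows "AE x in m t. w t x <= V t x + ennreal ka * nint lborel (%r. indicator {s<..<t} r * nint (PK t r x) (w r))"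
proof -
 have ts: "s < t" "s <= t" using t by auto
 obtain N X g where d: "drift t N X g" using drift_exists[OF t] .
 have N: "N : null_sets lborel" by (rule drift_N[OF d])
 from propagate_AE[OF t d] drift_X[OF d] show ?thesis
 proof eventually_elim
  case (elim x)
  have x: "x : X" by fact
  have Vx: "V t x < \<infinity>" and ux: "u t x = sint (PK t s x) f + lint lborel (%r. g r x)"
   and gd: "AE r in lborel. r : {s<..<t} --> (AE y in PK t r x. good r y)"
   using drift_V[OF d x] drift_u[OF d x] drift_good[OF d x] by auto
  define A where "A = sint (PK t s x) f"
  define k where "k r = exp (l * (r - s)) * (g r x + l * (A + lint lborel (%sg. indicator {..<r} sg * g sg x)))" for r
  have z: "g r x = 0" if "r \<notin> {s<..<t}" for r using drift_eq[OF d, of r x] that by auto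
  note F = integrating_factor[of "%r. g r x" s t l A, OF drift_bound(2)[OF d] z ts(2), folded k_def]
  have kb: "AE r in lborel. ennreal \<bar>indicator {s<..<t} r * k r\<bar> <= ennreal ka * (indicator {s<..<t} r * nint (PK t r x) (w r))"
   using elim(1) gd AE_not_in[OF N] kl(3)
  proof eventually_elim
   case e: (elim r)
   show ?case
   proof (cases "r : {s<..<t}")
    case True
    then have r: "r : {s<..<ta}" using t by auto
    have uf: "nint (PK t r x) (%y. ennreal \<bar>u r y\<bar>) < \<infinity>" and us: "sint (PK t r x) (u r) = A + lint lborel (%sg. indicator {..<r} sg * g sg x)"
     using e True by (auto simp: A_def)
    have ui: "integrable (PK t r x) (u r)" using uf u_sec PK_meas by (auto simp: integrable_iff_bounded)
    have hi: "integrable (PK t r x) (h r)"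
     by (rule Bochner_Integration.integrable_bound[of _ "%y. L * u r y"]) (use ui hm[OF r] PK_meas L r in "auto simp: abs_mult")
    have "g r x = lint (PK t r x) (h r)"
     using drift_eq[OF d, of r x] e True x ht_integral[OF r] by simp
    moreover have "A + lint lborel (%sg. indicator {..<r} sg * g sg x) = lint (PK t r x) (u r)"
     unfolding us[symmetric] by (rule sint_eq[OF _ uf]) (use u_sec PK_meas in auto)
    ultimately have kr: "k r = exp (l * (r - s)) * lint (PK t r x) (%y. h r y + l * u r y)"
     using ui hi by (simp add: k_def)
    have "ennreal \<bar>k r\<bar> = ennreal (exp (l * (r - s))) * ennreal \<bar>lint (PK t r x) (%y. h r y + l * u r y)\<bar>"
     by (simp add: kr abs_mult ennreal_mult)
    also have "... <= ennreal (exp (l * (r - s))) * nint (PK t r x) (%y. ennreal \<bar>h r y + l * u r y\<bar>)"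
     by (intro mult_left_mono abs_integral_nn) simp
    also have "... <= ennreal (exp (l * (r - s))) * nint (PK t r x) (%y. ennreal ka * ennreal \<bar>u r y\<bar>)"
     using e r kl(1) by (intro mult_left_mono nn_integral_mono) (auto simp: ennreal_mult[symmetric] ennreal_leI)
    also have "... = ennreal ka * (ennreal (exp (l * (r - s))) * nint (PK t r x) (%y. ennreal \<bar>u r y\<bar>))"
     using u_sec PK_meas by (simp add: nn_integral_cmult mult_ac)
    also have "ennreal (exp (l * (r - s))) * nint (PK t r x) (%y. ennreal \<bar>u r y\<bar>) = nint (PK t r x) (w r)"
     using u_sec PK_meas by (simp add: w_def[abs_def] ennreal_mult nn_integral_cmult)
    finally show ?thesis using True by simp
   qed simp
  qed
  have "exp (l * (t - s)) * u t x = A + lint lborel (%r. indicator {s<..<t} r * k r)"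
   unfolding ux A_def[symmetric] using F(1) .
  then have "exp (l * (t - s)) * abs (u t x) <= abs A + abs (lint lborel (%r. indicator {s<..<t} r * k r))"
   using abs_mult[of "exp (l * (t - s))" "u t x"] by simp
  then have "w t x <= ennreal (abs A + abs (lint lborel (%r. indicator {s<..<t} r * k r)))" unfolding w_def by (rule ennreal_leI)
  also have "... = ennreal \<bar>A\<bar> + ennreal \<bar>lint lborel (%r. indicator {s<..<t} r * k r)\<bar>" by simp
  also have "... <= V t x + nint lborel (%r. ennreal \<bar>indicator {s<..<t} r * k r\<bar>)"
   unfolding V_def A_def by (intro add_mono abs_integral_nn abs_sint_nn) (use fm(1) PK_meas in auto)
  also have "... <= V t x + nint lborel (%r. ennreal ka * (indicator {s<..<t} r * nint (PK t r x) (w r)))"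
   by (intro add_left_mono nn_integral_mono_AE kb)
  also have "nint lborel (%r. ennreal ka * (indicator {s<..<t} r * nint (PK t r x) (w r))) =
   ennreal ka * nint lborel (%r. indicator {s<..<t} r * nint (PK t r x) (w r))"
   using section_meas(2)[OF PK_nn_meas[OF w_meas]] by (intro nn_integral_cmult) measurable
  finally show ?case .
 qed
qed

text \<open>\<open>kernel_gronwall\<close> gives the rate ka for the weighted function; removing the
  weight exp(l(t-s)) lowers it to ka - l.\<close>

theorem sharp_bound:
 assumes t: "t : {s<..ta}"
 shows "AE x in m t. ennreal \<bar>u t x\<bar> <= ennreal (exp ((ka - l) * (t - s))) * nint (PK t s x) (%y. ennreal \<bar>f y\<bar>)"
proof -
 have "nint lborel (%r. indicator {s<..ta} r * nint (m r) (w r)) <=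
  nint lborel (%r. ennreal (exp (l * (ta - s))) * (indicator {s<..ta} r * nint (m r) (%y. ennreal \<bar>u r y\<bar>)))"
 proof (rule nn_integral_mono)
  fix r
  show "indicator {s<..ta} r * nint (m r) (w r) <= ennreal (exp (l * (ta - s))) * (indicator {s<..ta} r * nint (m r) (%y. ennreal \<bar>u r y\<bar>))"
  proof (cases "r : {s<..ta}")
   case True
   then have "nint (m r) (w r) = ennreal (exp (l * (r - s))) * nint (m r) (%y. ennreal \<bar>u r y\<bar>)"
    using u_sec m_meas[of r] by (simp add: w_def[abs_def] ennreal_mult nn_integral_cmult)
   also have "... <= ennreal (exp (l * (ta - s))) * nint (m r) (%y. ennreal \<bar>u r y\<bar>)"
    using True kl(2) by (intro mult_right_mono ennreal_leI) (auto intro!: mult_left_mono)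
   finally show ?thesis using True by simp
  qed simp
 qed
 also have "... = ennreal (exp (l * (ta - s))) * nint lborel (%r. indicator {s<..ta} r * nint (m r) (%y. ennreal \<bar>u r y\<bar>))"
 proof (rule nn_integral_cmult)
  have "(%r. indicator {s<..ta} r * nint ((if r : I then m r else return borel 0)) (%y. ennreal \<bar>u r y\<bar>)) : Bmeas"
   using flow_nn_meas[OF fl, of "%r y. ennreal \<bar>u r y\<bar>", OF ua_meas] by measurable
  moreover have "(%r. indicator {s<..ta} r * nint ((if r : I then m r else return borel 0)) (%y. ennreal \<bar>u r y\<bar>)) = (%r. indicator {s<..ta} r * nint (m r) (%y. ennreal \<bar>u r y\<bar>))"
   using upI by (auto simp: indicator_def fun_eq_iff)
  ultimately show "(%r. indicator {s<..ta} r * nint (m r) (%y. ennreal \<bar>u r y\<bar>)) : borel_measurable lborel" by simp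
 qed
 also have "... < \<infinity>" using ufin by (simp add: ennreal_mult_less_top)
 finally have wf: "nint lborel (%r. indicator {s<..ta} r * nint (m r) (w r)) < \<infinity>" .
 have "AE x in m t. w t x <= ennreal (exp (ka * (t - s))) * nint (PK t s x) (%y. ennreal \<bar>f y\<bar>)"
  by (rule kernel_gronwall[OF fl s kl(1) fa fm(2) w_meas _ wf]) (use shifted_bound t in "auto simp: V_def")
 then show ?thesis
 proof eventually_elim
  case (elim x)
  have "ennreal \<bar>u t x\<bar> = ennreal (exp (- (l * (t - s)))) * w t x"
   by (simp add: w_def ennreal_mult[symmetric] mult.assoc[symmetric] exp_add[symmetric])
  also have "... <= ennreal (exp (- (l * (t - s)))) * (ennreal (exp (ka * (t - s))) * nint (PK t s x) (%y. ennreal \<bar>f y\<bar>))"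
   using elim by (rule mult_left_mono) simp
  also have "... = ennreal (exp ((ka - l) * (t - s))) * nint (PK t s x) (%y. ennreal \<bar>f y\<bar>)"
   by (simp add: mult.assoc[symmetric] ennreal_mult[symmetric] exp_add[symmetric] algebra_simps)
  finally show ?case .
 qed
qed

end

context kolm begin

text \<open>\<open>\<nu>\<close> is prescribed only on rectangles. Its restriction to the strip and
  the measure composed from time and the \<mu> r agree on rectangles and have finite mass at most ta
  - s, hence coincide.\<close>

lemma space_time_disintegration:
 assumes fl: "flow I \<mu>" and s: "s : I" "s <= ta" and nu: "space_time_measure I \<mu> \<nu>"
  and g: "g : borel_measurable bst"
 shows "(nint \<nu> (%p. g p * indicator ({s..ta} \<times> UNIV) p)) = nint lborel (%r. indicator {s..ta} r * nint (\<mu> r) (%y. g (r, y)))"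
proof -
 let ?b = "borel :: (real \<times> (real^'n)) measure"
 define S where "S = {s..ta} \<times> (UNIV :: (real^'n) set)"
 define M where "M r = (if r : I then \<mu> r else return borel 0)" for r
 have JI: "{s..ta} \<subseteq> I" using I_up[OF s(1)] by auto
 have I_b: "I : sets borel" using I_open by simp
 have nus: "sets \<nu> = sets (restrict_space ?b (I \<times> UNIV))" using nu by (simp add: space_time_measure_def)
 have nusp: "space \<nu> = I \<times> UNIV" using sets_eq_imp_space_eq[OF nus] by (simp add: space_restrict_space)
 have Sb: "S : sets ?b" by (simp add: S_def borel_Times)
 have An: "A \<inter> S : sets \<nu>" if "A : sets ?b" for A
 proof -
  have "A \<inter> S = (I \<times> UNIV) \<inter> (A \<inter> S)" using JI by (auto simp: S_def)
  then show ?thesis unfolding nus sets_restrict_space using that Sb by blast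
 qed
 have Sn: "S : sets \<nu>" using An[of UNIV] by simp
 have idm: "(%p. p) : \<nu> \<rightarrow>\<^sub>M ?b"
  unfolding measurable_cong_sets[OF nus refl] by (rule measurable_restrict_space1) simp
 have idm': "(%p. p) : density \<nu> (indicator S) \<rightarrow>\<^sub>M ?b" using idm by simp
 define \<nu>1 where "\<nu>1 = distr (density \<nu> (indicator S)) ?b (%p. p)"
 define \<nu>2 where "\<nu>2 = density lborel (indicator {s..ta}) \<bind> (%r. distr (M r) ?b (%y. (r, y)))"
 have Mm: "M : borel \<rightarrow>\<^sub>M subprob_algebra borel"
  unfolding M_def by (rule measurable_prob_algebraD[OF flow_meas[OF fl]])
 have Mp: "prob_space (M r)" "sets (M r) = sets borel" for r
  using fl by (auto simp: M_def flow_def prob_space_return)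
 have pm: "Pair r : M r \<rightarrow>\<^sub>M ?b" for r
  unfolding measurable_cong_sets[OF Mp(2) refl] by (intro borel_measurable_continuous_onI continuous_intros)
 have km: "(%r. distr (M r) ?b (Pair r)) : density lborel (indicator {s..ta}) \<rightarrow>\<^sub>M subprob_algebra ?b"
 proof -
  have "(%r. distr (M r) ?b (Pair r)) : borel \<rightarrow>\<^sub>M subprob_algebra ?b"
   by (rule measurable_distr2[OF _ Mm]) (simp add: borel_prod)
  then show ?thesis by simp
 qed
 have i2: "nint (\<nu>2) k = nint lborel (%r. indicator {s..ta} r * nint (\<mu> r) (%y. k (r, y)))" if k: "k : borel_measurable ?b" for k
 proof -
  have "nint (\<nu>2) k = nint (density lborel (indicator {s..ta})) (%r. nint (distr (M r) ?b (Pair r)) k)"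
   unfolding \<nu>2_def by (rule nn_integral_bind[OF k km])
  also have "... = nint (density lborel (indicator {s..ta})) (%r. nint (M r) (%y. k (r, y)))"
   by (intro nn_integral_cong nn_integral_distr pm) (simp add: k)
  also have "... = nint lborel (%r. indicator {s..ta} r * nint (M r) (%y. k (r, y)))"
   by (rule nn_integral_density) (use flow_nn_meas[OF fl, of "%r y. k (r, y)"] k in "simp_all add: M_def")
  also have "... = nint lborel (%r. indicator {s..ta} r * nint (\<mu> r) (%y. k (r, y)))"
   by (intro nn_integral_cong) (use JI in "auto simp: M_def indicator_def")
  finally show ?thesis .
 qed
 have i1: "nint (\<nu>1) k = (nint \<nu> (%p. k p * indicator S p))" if k: "k : borel_measurable ?b" for k
 proof -
  have kn: "k : borel_measurable \<nu>" using measurable_compose[OF idm k] .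
  have "nint (\<nu>1) k = nint (density \<nu> (indicator S)) k" unfolding \<nu>1_def by (rule nn_integral_distr[OF idm']) (simp add: k)
  also have "... = (nint \<nu> (%p. k p * indicator S p))" using kn Sn by (simp add: nn_integral_density mult.commute)
  finally show ?thesis .
 qed
 have s1: "sets \<nu>1 = sets ?b" by (simp add: \<nu>1_def)
 have s2: "sets \<nu>2 = sets ?b" unfolding \<nu>2_def
  by (rule sets_bind[OF sets_kernel[OF km]]) simp_all
 have rect: "emeasure \<nu>1 (a \<times> c) = emeasure \<nu>2 (a \<times> c)" "emeasure \<nu>1 (a \<times> c) <= ennreal (ta - s)" if ac: "a : sets borel" "c : sets (borel :: (real^'n) measure)" for a c
 proof -
  have acb: "a \<times> c : sets ?b" using ac by (rule borel_Times)
  have "emeasure \<nu>1 (a \<times> c) = nint (\<nu>1) (%p. indicator (a \<times> c) p)" using acb s1 by simp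
  also have "... = (nint \<nu> (%p. indicator (a \<times> c) p * indicator S p))" by (rule i1) (use acb in simp)
  also have "... = (nint \<nu> (%p. indicator ((a \<inter> {s..ta}) \<times> c) p))"
   by (intro nn_integral_cong) (auto simp: S_def indicator_def)
  also have "... = emeasure \<nu> ((a \<inter> {s..ta}) \<times> c)"
  proof -
   have "(a \<inter> {s..ta}) \<times> c = (a \<times> c) \<inter> S" by (auto simp: S_def)
   then show ?thesis using An[OF acb] by simp
  qed
  also have "... = (\<integral>\<^sup>+r\<in>(a \<inter> {s..ta}). emeasure (\<mu> r) c \<partial>lborel)"
  proof -
   have "ALL J:sets borel. ALL S:sets borel. J \<subseteq> I --> emeasure \<nu> (J \<times> S) = (\<integral>\<^sup>+t\<in>J. emeasure (\<mu> t) S \<partial>lborel)"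
    using nu by (simp add: space_time_measure_def)
   moreover have "a \<inter> {s..ta} : sets borel" using ac by simp
   ultimately show ?thesis using ac JI by blast
  qed
  finally have e1: "emeasure \<nu>1 (a \<times> c) = (\<integral>\<^sup>+r\<in>(a \<inter> {s..ta}). emeasure (\<mu> r) c \<partial>lborel)" .
  have "emeasure \<nu>2 (a \<times> c) = nint (\<nu>2) (%p. indicator (a \<times> c) p)" using acb s2 by simp
  also have "... = nint lborel (%r. indicator {s..ta} r * nint (\<mu> r) (%y. indicator (a \<times> c) (r, y)))" by (rule i2) (use acb in simp)
  also have "... = (\<integral>\<^sup>+r\<in>(a \<inter> {s..ta}). emeasure (\<mu> r) c \<partial>lborel)"
  proof (intro nn_integral_cong)
   fix r
   show "indicator {s..ta} r * nint (\<mu> r) (%y. indicator (a \<times> c) (r, y)) = emeasure (\<mu> r) c * indicator (a \<inter> {s..ta}) r"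
   proof (cases "r : {s..ta}")
    case True
    then have "sets (\<mu> r) = sets borel" using fl JI by (auto simp: flow_def)
    then have "nint (\<mu> r) (indicator c) = emeasure (\<mu> r) c" using ac by simp
    moreover have "nint (\<mu> r) (%y. indicator (a \<times> c) (r, y)) = (if r : a then nint (\<mu> r) (indicator c) else 0)"
     by (auto simp: indicator_def intro!: nn_integral_cong)
    ultimately show ?thesis using True by (auto simp: indicator_def)
   qed simp
  qed
  finally show "emeasure \<nu>1 (a \<times> c) = emeasure \<nu>2 (a \<times> c)" using e1 by simp
  have "(\<integral>\<^sup>+r\<in>(a \<inter> {s..ta}). emeasure (\<mu> r) c \<partial>lborel) <= nint lborel (%r. indicator {s..ta} r)"
  proof (intro nn_integral_mono)
   fix r
   show "emeasure (\<mu> r) c * indicator (a \<inter> {s..ta}) r <= indicator {s..ta} r"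
   proof (cases "r : {s..ta}")
    case True
    then have "prob_space (\<mu> r)" using fl JI by (auto simp: flow_def)
    then have "emeasure (\<mu> r) c <= 1" by (rule prob_space.emeasure_le_1)
    then show ?thesis using True by (auto simp: indicator_def)
   qed simp
  qed
  then show "emeasure \<nu>1 (a \<times> c) <= ennreal (ta - s)" using e1 s by simp
 qed
 have "\<nu>1 = \<nu>2"
 proof (rule measure_eqI_generator_eq[where E = "{a \<times> c |a c. a : sets borel & c : sets borel}" and \<Omega> = UNIV and A = "%i. UNIV"])
  show "Int_stable {a \<times> c |a c. a : sets borel & c : sets borel}"
   by (rule Int_stable_pair_measure_generator)
  have sb: "sets ?b = sigma_sets UNIV {a \<times> c |a c. a : sets (borel :: real measure) & c : sets (borel :: (real^'n) measure)}"
   unfolding borel_prod[symmetric] sets_pair_measure by simp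
  show "sets \<nu>1 = sigma_sets UNIV {a \<times> c |a c. a : sets borel & c : sets borel}"
   "sets \<nu>2 = sigma_sets UNIV {a \<times> c |a c. a : sets borel & c : sets borel}" using s1 s2 sb by auto
  show "range (%i::nat. UNIV) \<subseteq> {a \<times> c |a c. a : sets (borel :: real measure) & c : sets (borel :: (real^'n) measure)}"
   by (auto intro!: exI[of _ UNIV])
  show "emeasure \<nu>1 UNIV ~= \<infinity>" using rect(2)[of UNIV UNIV] by (auto simp: top_unique)
  show "emeasure \<nu>1 X = emeasure \<nu>2 X" if "X : {a \<times> c |a c. a : sets borel & c : sets borel}" for X
   using that rect(1) by auto
 qed auto
 then show ?thesis using i1[OF g] i2[OF g] by (simp add: S_def)
qed

end

section \<open>Hypercontractivity of mild solutions\<close>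

text \<open>Dividing the dissipativity bound by xi on either side of 0 and letting xi tend to 0
  forces the value 0 at 0. For l >= L the shifted function xi -> \<psi> xi + l xi has the sign of
  xi, so the one-sided bound on \<psi> bounds its absolute value.\<close>

lemma dissipative_Lipschitz_bound:
 fixes \<psi> :: "real => real"
 assumes d: "!!xi. xi * \<psi> xi <= c * xi^2" and L: "!!xi ze. abs (\<psi> xi - \<psi> ze) <= L * abs (xi - ze)"
 shows "\<psi> 0 = 0" "abs (\<psi> xi) <= L * abs xi" "l >= L ==> abs (\<psi> xi + l * xi) <= (c + l) * abs xi"
proof -
 have up: "\<psi> xi <= c * xi" if "xi > 0" for xi
  using d[of xi] that by (simp add: power2_eq_square)
 have lo: "c * xi <= \<psi> xi" if "xi < 0" for xi
 proof -
  have "xi * \<psi> xi <= xi * (c * xi)" using d[of xi] by (simp add: power2_eq_square mult_ac)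
  then show ?thesis using that by (simp add: mult_le_cancel_left)
 qed
 have le: "\<psi> 0 <= 0"
 proof (rule field_le_epsilon)
  fix e :: real assume e: "e > 0"
  define xi where "xi = e / (abs c + abs L + 1)"
  have x: "xi > 0" using e by (simp add: xi_def add_nonneg_pos)
  have "\<psi> 0 <= c * xi + L * xi" using L[of 0 xi] up[OF x] x by simp
  also have "... <= (abs c + abs L + 1) * xi" using x by (simp add: distrib_right[symmetric])
  also have "... = e" by (simp add: xi_def add_nonneg_pos)
  finally show "\<psi> 0 <= 0 + e" by simp
 qed
 have ge: "0 <= \<psi> 0"
 proof (rule field_le_epsilon)
  fix e :: real assume e: "e > 0"
  define xi where "xi = e / (abs c + abs L + 1)"
  have x: "xi > 0" using e by (simp add: xi_def add_nonneg_pos)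
  have "\<psi> (- xi) - \<psi> 0 <= L * xi" using L[of "- xi" 0] x by simp
  then have "- \<psi> 0 <= c * xi + L * xi" using lo[of "- xi"] x by simp
  also have "... <= (abs c + abs L + 1) * xi" using x by (simp add: distrib_right[symmetric])
  also have "... = e" by (simp add: xi_def add_nonneg_pos)
  finally show "0 <= \<psi> 0 + e" by simp
 qed
 show p0: "\<psi> 0 = 0" using le ge by simp
 show pb: "abs (\<psi> xi) <= L * abs xi" for xi using L[of xi 0] p0 by simp
 assume l: "l >= L"
 show "abs (\<psi> xi + l * xi) <= (c + l) * abs xi"
 proof (cases xi "0::real" rule: linorder_cases)
  case less
  have "L * (- xi) <= l * (- xi)" using l less by (intro mult_right_mono) auto
  moreover have "\<psi> xi <= L * (- xi)" using pb[of xi] less by (simp add: abs_le_iff)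
  ultimately have "\<psi> xi + l * xi <= 0" by simp
  then show ?thesis using lo[OF less] less by (simp add: abs_of_nonpos algebra_simps)
 next
  case greater
  have "L * xi <= l * xi" using l greater by (intro mult_right_mono) auto
  moreover have "- \<psi> xi <= L * xi" using pb[of xi] greater by (simp add: abs_le_iff)
  ultimately have "0 <= \<psi> xi + l * xi" by simp
  then show ?thesis using up[OF greater] greater by (simp add: distrib_right)
 qed (simp add: p0)
qed

lemma parabolic_Hoelder_loc_continuous:
 assumes I: "open I" and al: "0 < \<alpha>" and h: "parabolic_Hoelder_loc \<alpha> I g"
 shows "continuous_on (I \<times> UNIV) (%p. g (fst p) (snd (p :: real \<times> (real ^ 'n::finite))))"
proof (rule continuous_at_imp_continuous_on, rule ballI)
 fix p :: "real \<times> (real^'n)" assume p: "p : I \<times> UNIV"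
 have "open (I \<times> (UNIV :: (real^'n) set))" using I by (intro open_Times) auto
 then obtain e where e: "e > 0" "cball p e \<subseteq> I \<times> UNIV" using p open_contains_cball by blast
 obtain M where M: "!!q. q : cball p e ==> abs (g (fst q) (snd q) - g (fst p) (snd p)) <= M * (abs (fst q - fst p) powr (\<alpha> / 2) + norm (snd q - snd p) powr \<alpha>)"
 proof -
  obtain M where "ALL q:cball p e. ALL q':cball p e. abs (g (fst q) (snd q) - g (fst q') (snd q')) <= M * (abs (fst q - fst q') powr (\<alpha> / 2) + norm (snd q - snd q') powr \<alpha>)"
   by (rule exE[OF h[unfolded parabolic_Hoelder_loc_def case_prod_beta', THEN spec, THEN mp], of "cball p e"]) (use e(2) in simp)
  then show ?thesis using e(1) by (intro that[of M]) simp
 qed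
 have "((%q. M * (abs (fst q - fst p) powr (\<alpha> / 2) + norm (snd q - snd p) powr \<alpha>)) \<longlongrightarrow> M * (abs (fst p - fst p) powr (\<alpha> / 2) + norm (snd p - snd p) powr \<alpha>)) (at p)"
  using al by (intro tendsto_intros tendsto_powr2) auto
 then have l: "((%q. M * (abs (fst q - fst p) powr (\<alpha> / 2) + norm (snd q - snd p) powr \<alpha>)) \<longlongrightarrow> 0) (at p)" by simp
 have "eventually (%q. q : ball p e) (at p)" using e(1) by (intro eventually_at_in_open') auto
 then have "eventually (%q. norm (g (fst q) (snd q) - g (fst p) (snd p)) <= M * (abs (fst q - fst p) powr (\<alpha> / 2) + norm (snd q - snd p) powr \<alpha>)) (at p)"
  by eventually_elim (use M in "auto simp: less_imp_le")
 from Lim_null_comparison[OF this l] show "isCont (%p. g (fst p) (snd p)) p" by (simp add: isCont_def LIM_zero_iff)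
qed

lemma continuous_on_vecI: "(!!i. continuous_on S (%x. f x $ i)) ==> continuous_on S f"
 unfolding continuous_on_def by (auto intro!: vec_tendstoI)

lemma Lp_borel_iff: "sets M = sets borel ==> g : Lp M p \<longleftrightarrow> g : Bmeas & integrable M (%x. abs (g x) powr p)"
 using sets_eq_imp_space_eq[of M borel]
 by (simp add: Lp_on_def set_borel_measurable_def set_integrable_def measurable_cong_sets[of M borel borel borel])

lemma abs_le_one_plus_powr: "abs (z::real) <= 1 + abs z powr p" if "p >= 1"
proof (cases "abs z <= 1")
 case False
 then have "abs z powr 1 <= abs z powr p" using that by (intro powr_mono) auto
 then show ?thesis using False by simp
qed (simp add: add_increasing2)

theorem theorem5p11:
  fixes I :: "real set"
    and Q :: "real \<Rightarrow> real ^ 'n::finite \<Rightarrow> real ^ 'n ^ 'n"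
    and b :: "real \<Rightarrow> real ^ 'n \<Rightarrow> real ^ 'n"
    and \<eta> :: "real \<Rightarrow> real ^ 'n \<Rightarrow> real"
    and \<phi> :: "real ^ 'n \<Rightarrow> real"
    and k m :: "real \<Rightarrow> real"
    and \<psi> :: "real \<Rightarrow> real \<Rightarrow> real"
    and \<alpha> \<eta>\<^sub>0 \<psi>\<^sub>0 K s p :: real
    and G :: "real \<Rightarrow> real \<Rightarrow> (real ^ 'n \<Rightarrow> real) \<Rightarrow> real ^ 'n \<Rightarrow> real"
    and \<mu> :: "real \<Rightarrow> (real ^ 'n) measure"
    and \<nu> :: "(real \<times> (real ^ 'n)) measure"
    and f :: "real ^ 'n \<Rightarrow> real"
    and u :: "real \<Rightarrow> real ^ 'n \<Rightarrow> real"
  assumes I: "I = UNIV \<or> (\<exists>a. I = {a<..})"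
    \<comment> \<open>standing assumption (i)\<close>
    and alpha: "0 < \<alpha>" "\<alpha> < 1"
    and q_Hoelder: "\<And>i j. parabolic_Hoelder_loc \<alpha> I (\<lambda>t x. Q t x $ i $ j)"
    and b_Hoelder: "\<And>i. parabolic_Hoelder_loc \<alpha> I (\<lambda>t x. b t x $ i)"
    \<comment> \<open>standing assumption (ii)\<close>
    and symmetric: "\<And>t x. t \<in> I \<Longrightarrow> transpose (Q t x) = Q t x"
    and elliptic: "\<And>t x \<xi>. t \<in> I \<Longrightarrow> inner (Q t x *v \<xi>) \<xi> \<ge> \<eta> t x * (norm \<xi>)\<^sup>2"
    and eta_bdd: "bdd_below ((\<lambda>(t, x). \<eta> t x) ` (I \<times> UNIV))"
    and eta0: "\<eta>\<^sub>0 = (INF (t, x)\<in>I \<times> UNIV. \<eta> t x)" "\<eta>\<^sub>0 > 0"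
    \<comment> \<open>standing assumption (iii)\<close>
    and phi_C2: "\<phi> \<in> C2"
    and phi_nonneg: "\<And>x. \<phi> x \<ge> 0"
    and phi_infinity: "filterlim \<phi> at_top at_infinity"
    and Lyapunov: "\<exists>a>0. \<exists>c>0. \<forall>t\<in>I. \<forall>x. elliptic_op Q b t \<phi> x \<le> a - c * \<phi> x"
    \<comment> \<open>evolution operator and measures\<close>
    and G: "evolution_operator I Q b G"
    and mu: "tight_evolution_system I G \<mu>"
    and mu_phi: "(SUP t\<in>I. \<integral>\<^sup>+x. ennreal (\<phi> x) \<partial>\<mu> t) < \<infinity>"
    and G_Lp: "Lp_extended I \<mu> G"
    and nu: "space_time_measure I \<mu> \<nu>"
    \<comment> \<open>(a)\<close>
    and q_diff: "\<And>t i j. t \<in> I \<Longrightarrow> (\<lambda>x. Q t x $ i $ j) differentiable_on UNIV"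
    and b_diff: "\<And>t i. t \<in> I \<Longrightarrow> (\<lambda>x. b t x $ i) differentiable_on UNIV"
    and dq_Hoelder: "\<And>h i j. parabolic_Hoelder_loc \<alpha> I (\<lambda>t. partial h (\<lambda>x. Q t x $ i $ j))"
    and db_Hoelder: "\<And>h i. parabolic_Hoelder_loc \<alpha> I (\<lambda>t. partial h (\<lambda>x. b t x $ i))"
    and k: "continuous_on I k" "\<And>t. t \<in> I \<Longrightarrow> k t \<ge> 0"
    and dq_bound: "\<And>t x i j. t \<in> I \<Longrightarrow> norm (gradient (\<lambda>y. Q t y $ i $ j) x) \<le> k t * \<eta> t x"
    and m: "continuous_on I m"
    and db_bound: "\<And>t x \<xi>. t \<in> I \<Longrightarrow>
                     inner (jacobian_matrix (b t) x *v \<xi>) \<xi> \<le> m t * (norm \<xi>)\<^sup>2"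
    \<comment> \<open>(b)\<close>
    and psi_L1: "L1_loc I (\<lambda>t. \<psi> t 0)"
    and psi_Lipschitz: "\<And>\<sigma> \<tau>. \<sigma> \<in> I \<Longrightarrow> \<tau> > \<sigma> \<Longrightarrow>
                          \<exists>L>0. \<forall>t\<in>{\<sigma>..\<tau>}. \<forall>\<xi> \<zeta>. \<bar>\<psi> t \<xi> - \<psi> t \<zeta>\<bar> \<le> L * \<bar>\<xi> - \<zeta>\<bar>"
    \<comment> \<open>(c)\<close>
    and growth: "\<And>\<sigma> \<tau>. \<sigma> \<in> I \<Longrightarrow> \<tau> > \<sigma> \<Longrightarrow>
                   \<exists>C\<^sub>0>0. \<exists>C\<^sub>1>0. \<exists>C\<^sub>2>0. \<forall>t\<in>{\<sigma>..\<tau>}. \<forall>x.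
                     norm (Q t x *v x) \<le> C\<^sub>0 * norm x * \<phi> x \<and>
                     trace (Q t x) \<le> C\<^sub>1 * (1 + norm x) * \<phi> x \<and>
                     inner (b t x) x \<le> C\<^sub>2 * norm x * \<phi> x"
    \<comment> \<open>(d)\<close>
    and psi_dissipative: "\<And>t \<xi>. t \<in> I \<Longrightarrow> \<xi> * \<psi> t \<xi> \<le> \<psi>\<^sub>0 * \<xi>\<^sup>2"
    \<comment> \<open>(e)\<close>
    and K: "K > 0" "log_Sobolev I \<mu> K"
    and s: "s \<in> I"
    and p: "p > 1"
    and f: "f \<in> Lp (\<mu> s) p"
    and u: "global_mild_solution G \<nu> \<psi> p s f u"
  shows "\<forall>t>s. let p\<^sub>t = exp (\<eta>\<^sub>0 * inverse K * (t - s)) * (p - 1) + 1 in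
           u t \<in> Lp (\<mu> t) p\<^sub>t \<and>
           Lp_norm (\<mu> t) p\<^sub>t (u t) \<le> exp (\<psi>\<^sub>0 * (t - s)) * Lp_norm (\<mu> s) p f"
proof (intro allI impI)
 fix t assume st: "s < t"
 have I_open: "open I" using I by auto
 have I_up: "t : I" if "s : I" "s <= t" for s t using I that by auto
 have tI: "t : I" using I_up[OF s] st by simp
 have eta_ge: "\<eta>\<^sub>0 <= \<eta> t x" if "t : I" for t x
  unfolding eta0(1) using cINF_lower[OF eta_bdd, of "(t, x)"] that by simp
 have ell: "\<eta>\<^sub>0 * (norm xi)^2 <= xi \<bullet> (Q t x *v xi)" if "t : I" for t x xi
  using elliptic[OF that, of x xi] mult_right_mono[OF eta_ge[OF that, of x], of "(norm xi)^2"] by (simp add: inner_commute)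
 have psdQ: "psd (Q t x)" if "t : I" for t x
  unfolding psd_def using symmetric[OF that] ell[OF that] eta0(2) by (meson less_imp_le mult_nonneg_nonneg order_trans zero_le_power2)
 have mus: "prob_space (\<mu> r)" "sets (\<mu> r) = sets borel" if "r : I" for r
  using mu that by (auto simp: tight_evolution_system_def)
 obtain P where P': "ALL s:I. ALL t>=s. ALL x. prob_space (P t s x) & sets (P t s x) = sets borel &
    (ALL f:Lp (\<mu> s) 1. G t s f x = lint (P t s x) f)"
  by (rule exE[OF G_Lp[unfolded Lp_extended_def, THEN conjunct2]])
 have P: "prob_space (P t s x) & sets (P t s x) = sets borel & (ALL f:Lp (\<mu> s) 1. G t s f x = lint (P t s x) f)"
  if "s : I" "s <= t" for s t x by (rule P'[THEN bspec, OF that(1), THEN spec, THEN mp, OF that(2), THEN spec])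
 have Cb_Lp: "g : Lp (\<mu> r) 1" if r: "r : I" and g: "g : Cb" for r g
 proof -
  interpret prob_space "\<mu> r" by (rule mus(1)[OF r])
  obtain B where B: "!!x. abs (g x) <= B" using g by (rule CbE) blast
  have gm: "g : Bmeas" by (rule Cb_measurable[OF g])
  have "integrable (\<mu> r) (%x. abs (g x) powr 1)"
   by (rule integrable_const_bound[of _ B]) (use B gm in "auto simp: measurable_cong_sets[OF mus(2)[OF r] refl]")
  then show ?thesis using Lp_borel_iff[OF mus(2)[OF r]] gm by blast
 qed
 define D\<phi> where "D\<phi> = gradient \<phi>"
 define H\<phi> where "H\<phi> = (%x. \<chi> i j. partial i (partial j \<phi>) x)"
 have C2: "C2w \<phi> D\<phi> H\<phi>" unfolding D\<phi>_def H\<phi>_def by (rule C2_C2w[OF phi_C2])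
 obtain a c where ac: "c > 0" "!!t x. t : I ==> elliptic_op Q b t \<phi> x <= a - c * \<phi> x" using Lyapunov by blast
 have Lyap: "Q t x \<bullet> H\<phi> x + b t x \<bullet> D\<phi> x <= a" if "t : I" for t x
 proof -
  have "0 <= c * \<phi> x" using ac(1) phi_nonneg[of x] by simp
  then show ?thesis using ac(2)[OF that, of x] unfolding elliptic_op_C2w[OF C2] by linarith
 qed
 interpret K: kolm I Q b \<phi> D\<phi> H\<phi> a G P
 proof (rule kolm.intro)
  show "continuous_on (I \<times> UNIV) (%p. Q (fst p) (snd p))"
   by (intro continuous_on_vecI parabolic_Hoelder_loc_continuous[OF I_open alpha(1) q_Hoelder])
  show "continuous_on (I \<times> UNIV) (%p. b (fst p) (snd p))"
   by (intro continuous_on_vecI parabolic_Hoelder_loc_continuous[OF I_open alpha(1) b_Hoelder])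
  show "G t s f x = lint (P t s x) f" if "s : I" "s <= t" "f : Cb" for s t x f
   using P[OF that(1,2)] Cb_Lp[OF that(1,3)] by blast
  show "prob_space (P t s x)" if "s : I" "s <= t" for s t x using P[OF that] by blast
  show "sets (P t s x) = sets borel" if "s : I" "s <= t" for s t x using P[OF that] by blast
 qed (fact I_open I_up psdQ C2 phi_nonneg phi_infinity Lyap G)+
 have fl: "K.flow I \<mu>"
  using mu mus unfolding K.flow_def tight_evolution_system_def by auto
 interpret M: kolm_mu I Q b \<phi> D\<phi> H\<phi> a G P \<mu> \<eta>\<^sub>0 K "enn2real (SUP t\<in>I. nint (\<mu> t) (%x. ennreal (\<phi> x)))"
 proof
  have phim: "\<phi> : Bmeas" by (rule borel_measurable_continuous_onI[OF C2w_cont[OF C2]])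
  fix r assume r: "r : I"
  have phim': "\<phi> : borel_measurable (\<mu> r)" using phim measurable_cong_sets[OF mus(2)[OF r] refl] by blast
  have le: "nint (\<mu> r) (%x. ennreal (\<phi> x)) <= (SUP t\<in>I. nint (\<mu> t) (%x. ennreal (\<phi> x)))" using r by (rule SUP_upper)
  show "integrable (\<mu> r) \<phi>"
   using phim' le mu_phi phi_nonneg by (auto simp: integrable_iff_bounded intro: le_less_trans)
  have "(lint (\<mu> r) \<phi>) = enn2real (nint (\<mu> r) (%x. ennreal (\<phi> x)))"
   by (rule integral_eq_nn_integral) (use phim' phi_nonneg in auto)
  also have "... <= enn2real (SUP t\<in>I. nint (\<mu> t) (%x. ennreal (\<phi> x)))" by (rule enn2real_mono[OF le]) (use mu_phi in simp)
  finally show "(lint (\<mu> r) \<phi>) <= enn2real (SUP t\<in>I. nint (\<mu> t) (%x. ennreal (\<phi> x)))" .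
 next
  show "EX C. compact C & (ALL t:I. 1 - ep <= measure (\<mu> t) C)" if "ep > 0" for ep
   using mu that by (simp add: tight_evolution_system_def)
 qed (use fl eta0(2) ell K growth in auto)
 interpret H: kolm_h I Q b \<phi> D\<phi> H\<phi> a G P \<alpha> \<eta>\<^sub>0 "real CARD('n) / 2"
 proof
  fix C :: "(real \<times> (real^'n)) set" assume C: "compact C" "C \<subseteq> I \<times> UNIV"
  have "EX M. ALL p:C. ALL p':C. abs (Q (fst p) (snd p) $ i $ j - Q (fst p') (snd p') $ i $ j) <= M * (abs (fst p - fst p') powr (\<alpha> / 2) + norm (snd p - snd p') powr \<alpha>)" for i j
   by (rule q_Hoelder[of i j, unfolded parabolic_Hoelder_loc_def case_prod_beta', THEN spec, THEN mp]) (use C in simp)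
  then obtain M where M: "!!i j p p'. p : C ==> p' : C ==> abs (Q (fst p) (snd p) $ i $ j - Q (fst p') (snd p') $ i $ j) <= M i j * (abs (fst p - fst p') powr (\<alpha> / 2) + norm (snd p - snd p') powr \<alpha>)" by metis
  define M' where "M' = (\<Sum>i\<in>UNIV. \<Sum>j\<in>UNIV. abs (M i j))"
  have MM: "M i j <= M'" for i j
  proof -
   have "abs (M i j) <= (\<Sum>j\<in>UNIV. abs (M i j))" by (rule member_le_sum) auto
   also have "... <= M'" unfolding M'_def by (rule member_le_sum[of i UNIV "%i. \<Sum>j\<in>UNIV. abs (M i j)"]) (auto intro: sum_nonneg)
   finally show ?thesis by simp
  qed
  show "EX M. ALL p:C. ALL p':C. ALL i j. abs (Q (fst p) (snd p) $ i $ j - Q (fst p') (snd p') $ i $ j) <= M * (abs (fst p - fst p') powr (\<alpha> / 2) + norm (snd p - snd p') powr \<alpha>)"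
  proof (intro exI[of _ M'] ballI allI)
   fix p p' i j assume pp: "p : C" "p' : C"
   have "abs (Q (fst p) (snd p) $ i $ j - Q (fst p') (snd p') $ i $ j) <= M i j * (abs (fst p - fst p') powr (\<alpha> / 2) + norm (snd p - snd p') powr \<alpha>)"
    by (rule M[OF pp])
   also have "... <= M' * (abs (fst p - fst p') powr (\<alpha> / 2) + norm (snd p - snd p') powr \<alpha>)"
    by (intro mult_right_mono MM) auto
   finally show "abs (Q (fst p) (snd p) $ i $ j - Q (fst p') (snd p') $ i $ j) <= M' * (abs (fst p - fst p') powr (\<alpha> / 2) + norm (snd p - snd p') powr \<alpha>)" .
  qed
 qed (use alpha eta0(2) ell in auto)
 have p1: "p >= 1" using p by simp
 have fm: "f : Bmeas" and fp: "integrable (\<mu> s) (%x. abs (f x) powr p)"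
  using f Lp_borel_iff[OF mus(2)[OF s]] by auto
 have L1: "g : Lp (\<mu> r) 1 & (nint (\<mu> r) (%x. ennreal \<bar>g x\<bar>)) < \<infinity>"
  if r: "r : I" and g: "g : Bmeas" and fin: "nint (\<mu> r) (%x. ennreal (abs (w x) powr p)) < \<infinity>"
   and w: "w : Bmeas" "!!x. abs (g x) <= C * abs (w x)" "C >= 0" for r C and g w :: "real^'n => real"
 proof -
  interpret prob_space "\<mu> r" by (rule mus(1)[OF r])
  have mm: "borel_measurable (\<mu> r) = (Bmeas :: (real^'n => real) set)" by (rule measurable_cong_sets[OF mus(2)[OF r] refl])
  have "(%x. abs (w x) powr p) : Bmeas" using w(1) by measurable
  then have "integrable (\<mu> r) (%x. abs (w x) powr p)" using fin mm by (auto simp: integrable_iff_bounded)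
  then have i: "integrable (\<mu> r) (%x. C * (1 + abs (w x) powr p))" by simp
  have "integrable (\<mu> r) g"
  proof (rule Bochner_Integration.integrable_bound[OF i])
   show "AE x in \<mu> r. norm (g x) <= norm (C * (1 + abs (w x) powr p))"
   proof (rule AE_I2)
    fix x
    have "abs (g x) <= C * (1 + abs (w x) powr p)"
     using w(2)[of x] mult_left_mono[OF abs_le_one_plus_powr[OF p1, of "w x"] w(3)] by simp
    then show "norm (g x) <= norm (C * (1 + abs (w x) powr p))" using w(3) by (simp add: abs_of_nonneg)
   qed
  qed (use g mm in simp)
  then have "integrable (\<mu> r) (%x. abs (g x))" "nint (\<mu> r) (%x. ennreal \<bar>g x\<bar>) < \<infinity>" by (auto simp: integrable_iff_bounded)
  then show ?thesis using Lp_borel_iff[OF mus(2)[OF r]] g by simp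
 qed
 have fpn: "nint (\<mu> s) (%x. ennreal (abs (f x) powr p)) < \<infinity>" using fp by (simp add: integrable_iff_bounded)
 have f1: "f : Lp (\<mu> s) 1" "nint (\<mu> s) (%x. ennreal \<bar>f x\<bar>) < \<infinity>" using L1[OF s fm fpn fm, of 1] by auto
 have ms: "mild_solution G \<psi> s t f u" and uLp: "(%(t, x). u t x) : Lp_on \<nu> ({s..t} \<times> UNIV) p"
  using u st unfolding global_mild_solution_def by auto
 obtain L where L: "L > 0" "!!r xi ze. r : {s..t} ==> abs (\<psi> r xi - \<psi> r ze) <= L * abs (xi - ze)"
  using psi_Lipschitz[OF s st] by blast
 \<comment> \<open>At least L, and large enough that \<psi>0 + l is nonnegative whatever the sign of
   \<psi>0.\<close>
 define l where "l = L + abs (\<psi>\<^sub>0)"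
 have rI: "r : I" if "r : {s..t}" for r using I_up[OF s] that by simp
 have dis: "abs (\<psi> r xi) <= L * abs xi" "abs (\<psi> r xi + l * xi) <= (\<psi>\<^sub>0 + l) * abs xi" if r: "r : {s..t}" for r xi
 proof -
  note d = dissipative_Lipschitz_bound[of "\<psi> r" \<psi>\<^sub>0 L, OF psi_dissipative[OF rI[OF r]] L(2)[OF r]]
  show "abs (\<psi> r xi) <= L * abs xi" by (rule d(2))
  show "abs (\<psi> r xi + l * xi) <= (\<psi>\<^sub>0 + l) * abs xi" by (rule d(3)) (simp add: l_def)
 qed
 let ?b = "borel :: (real \<times> (real^'n)) measure"
 \<comment> \<open>Extended by 0 beyond [s,t], \<open>u\<close> becomes Borel on the whole product
   space, as the locale \<open>mild\<close> requires.\<close>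
 define u' where "u' r y = indicator {s..t} r * u r y" for r y
 have ueq: "u' r = u r" if "r : {s..t}" for r using that by (auto simp: u'_def)
 have nus: "sets \<nu> = sets (restrict_space ?b (I \<times> UNIV))" using nu by (simp add: space_time_measure_def)
 have um: "(%p. u' (fst p) (snd p)) : borel_measurable ?b"
 proof -
  have "(%p. indicator ({s..t} \<times> UNIV) p *\<^sub>R (case p of (t, x) => u t x)) : borel_measurable (restrict_space ?b (I \<times> UNIV))"
   using uLp measurable_cong_sets[OF nus refl] by (auto simp: Lp_on_def set_borel_measurable_def)
  moreover have "(I \<times> UNIV) \<inter> space ?b : sets ?b" using I_open by (simp add: borel_Times)
  ultimately have "(%p. indicator (I \<times> UNIV) p *\<^sub>R indicator ({s..t} \<times> UNIV) p *\<^sub>R (case p of (t, x) => u t x)) : borel_measurable ?b"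
   by (simp add: borel_measurable_restrict_space_iff)
  moreover have "(%p. indicator (I \<times> UNIV) p *\<^sub>R indicator ({s..t} \<times> UNIV) p *\<^sub>R (case p of (t, x) => u t x)) = (%p. u' (fst p) (snd p))"
   using rI by (auto simp: u'_def indicator_def fun_eq_iff)
  ultimately show ?thesis by simp
 qed
 note usec = K.section_meas(1)[OF um]
 have upm: "(%z. ennreal (abs (u' (fst z) (snd z)) powr p)) : borel_measurable ?b" using um by measurable
 \<comment> \<open>Finite for almost every time, because \<open>u\<close> is in L^p of the
   space-time measure; where it is finite, \<open>u r\<close> is in L^p of \<mu> r.\<close>
 define Y where "Y r = indicator {s..t} r * nint ((if r : I then \<mu> r else return borel 0)) (%y. ennreal (abs (u' r y) powr p))" for r
 have Ym: "Y : borel_measurable lborel"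
  unfolding Y_def using K.flow_nn_meas[OF fl, of "%r y. ennreal (abs (u' r y) powr p)"] upm by measurable
 have Yfin: "nint lborel Y < \<infinity>"
 proof -
  have "nint lborel Y = nint lborel (%r. indicator {s..t} r * nint (\<mu> r) (%y. ennreal (abs (u' r y) powr p)))"
   by (intro nn_integral_cong) (use rI in "auto simp: Y_def indicator_def")
  also have "... = (nint \<nu> (%q. ennreal (abs (u' (fst q) (snd q)) powr p) * indicator ({s..t} \<times> UNIV) q))"
   using K.space_time_disintegration[OF fl s less_imp_le[OF st] nu upm] by simp
  also have "... = (nint \<nu> (%q. ennreal (norm (indicator ({s..t} \<times> UNIV) q *\<^sub>R abs (case q of (t, x) => u t x) powr p))))"
   by (intro nn_integral_cong) (auto simp: u'_def indicator_def)
  also have "... < \<infinity>" using uLp by (simp add: Lp_on_def set_integrable_def integrable_iff_bounded)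
  finally show ?thesis .
 qed
 have YAE: "AE r in lborel. Y r < \<infinity>" using nn_integral_PInf_AE[OF Ym] Yfin by (auto simp: less_top)
 have Yr: "nint (\<mu> r) (%y. ennreal (abs (u r y) powr p)) < \<infinity>" if "r : {s..t}" "Y r < \<infinity>" for r
  using that rI[OF that(1)] ueq[OF that(1)] by (simp add: Y_def)
 \<comment> \<open>The kernel formula for \<open>G\<close> is available for functions in L^1 of
   \<mu> r, which \<psi>(r,u) is at times with \<open>Y r\<close> finite. The other times form a
   null set and do not change the integral in the mild equation.\<close>
 define h where "h r y = (if Y r < \<infinity> then \<psi> r (u' r y) else 0)" for r y
 have psm: "(%y. \<psi> r (u' r y)) : Bmeas" if r: "r : {s..t}" for r
 proof -
  have "continuous_on UNIV (\<psi> r)"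
  proof (rule continuous_on_iff[THEN iffD2], intro ballI allI impI)
   fix xi e :: real assume "e > 0"
   then show "EX d>0. ALL ze:UNIV. dist ze xi < d --> dist (\<psi> r ze) (\<psi> r xi) < e"
   proof (intro exI[of _ "e / L"] conjI ballI impI)
    fix ze assume d: "dist ze xi < e / L"
    have "dist (\<psi> r ze) (\<psi> r xi) <= L * dist ze xi" using L(2)[OF r, of ze xi] by (simp add: dist_real_def)
    also have "... < L * (e / L)" using d L(1) by (intro mult_strict_left_mono)
    finally show "dist (\<psi> r ze) (\<psi> r xi) < e" using L(1) by simp
   qed (use L(1) in simp)
  qed
  then have "\<psi> r : Bmeas" by (rule borel_measurable_continuous_onI)
  from measurable_compose[OF usec this] show ?thesis .
 qed
 have hG: "lint (K.PK t' r x) (h r) = indicator {r. Y r < \<infinity>} r * G t' r (%y. \<psi> r (u r y)) x"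
  if t': "t' : {s<..t}" and r: "r : {s<..<t'}" for t' r x
 proof (cases "Y r < \<infinity>")
  case True
  have r': "r : {s..t}" "r : I" "r <= t'" using r t' rI by auto
  have "(%y. \<psi> r (u r y)) : Lp (\<mu> r) 1"
   using L1[OF r'(2), of "%y. \<psi> r (u r y)" "u r" L] psm[OF r'(1)] usec[of r] Yr[OF r'(1) True] dis(1)[OF r'(1)] L(1) ueq[OF r'(1)] by auto
  then have "G t' r (%y. \<psi> r (u r y)) x = lint (P t' r x) (%y. \<psi> r (u r y))" using P[OF r'(2,3)] by blast
  then show ?thesis using True r' by (simp add: h_def[abs_def] K.PK_eq ueq)
 qed (simp add: h_def[abs_def])
 have Yset: "{r. Y r < \<infinity>} : sets lebesgue"
 proof -
  have "{r : space lborel. Y r < \<infinity>} : sets lborel" using Ym by measurable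
  then show ?thesis using sets_completionI_sets by fastforce
 qed
 have YL: "AE r in lebesgue. Y r < \<infinity>" by (rule AE_completion[OF YAE])
 \<comment> \<open>With ka = \<psi>0 + l, the rate ka - l of \<open>sharp_bound\<close> is
   \<psi>0.\<close>
 interpret N: mild I Q b \<phi> D\<phi> H\<phi> a G P \<alpha> \<eta>\<^sub>0 "real CARD('n) / 2" \<mu> s t L l "\<psi>\<^sub>0 + l" f h u'
 proof
  show "nint lborel (%r. indicator {s<..t} r * nint (\<mu> r) (%y. ennreal \<bar>u' r y\<bar>)) < \<infinity>"
  proof -
   have "nint lborel (%r. indicator {s<..t} r * nint (\<mu> r) (%y. ennreal \<bar>u' r y\<bar>)) <= nint lborel (%r. indicator {s..t} r + Y r)"
   proof (rule nn_integral_mono)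
    fix r
    show "indicator {s<..t} r * nint (\<mu> r) (%y. ennreal \<bar>u' r y\<bar>) <= indicator {s..t} r + Y r"
    proof (cases "r : {s<..t}")
     case True
     then have r: "r : {s..t}" "r : I" using rI by auto
     interpret prob_space "\<mu> r" by (rule mus(1)[OF r(2)])
     have "nint (\<mu> r) (%y. ennreal \<bar>u' r y\<bar>) <= nint (\<mu> r) (%y. 1 + ennreal (abs (u' r y) powr p))"
      by (intro nn_integral_mono) (use abs_le_one_plus_powr[OF p1] in "simp add: ennreal_leI ennreal_plus[symmetric] ennreal_1[symmetric] del: ennreal_1 ennreal_plus")
     also have "... = 1 + nint (\<mu> r) (%y. ennreal (abs (u' r y) powr p))"
     proof -
      have "(%y. ennreal (abs (u' r y) powr p)) : borel_measurable (\<mu> r)"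
       unfolding measurable_cong_sets[OF mus(2)[OF r(2)] refl] using usec[of r] by measurable
      then show ?thesis by (simp add: nn_integral_add emeasure_space_1)
     qed
     finally show ?thesis using True r by (simp add: Y_def)
    qed simp
   qed
   also have "... = nint lborel (%r. indicator {s..t} r) + nint lborel Y" using Ym by (simp add: nn_integral_add)
   also have "... < \<infinity>" using Yfin st by simp
   finally show ?thesis .
  qed
  show "h r : Bmeas" if "r : {s<..<t}" for r
   using psm[of r] that unfolding h_def[abs_def] by auto
  show "abs (h r y) <= L * abs (u' r y)" if "r : {s<..<t}" for r y
   using dis(1)[of r "u' r y"] that L(1) by (auto simp: h_def)
  show "AE r in lborel. r : {s<..<t} --> (ALL y. abs (h r y + l * u' r y) <= (\<psi>\<^sub>0 + l) * abs (u' r y))"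
   using YAE
  proof eventually_elim
   case (elim r)
   then show ?case using dis(2)[of r] by (auto simp: h_def)
  qed
  show "0 <= \<psi>\<^sub>0 + l" "0 <= l" "0 <= L" using L(1) by (auto simp: l_def)
  fix t' assume t': "t' : {s<..t}"
  have ind: "indicator {s<..<t'} r *\<^sub>R lint (K.PK t' r x) (h r) =
   indicator {r. Y r < \<infinity>} r *\<^sub>R (indicator {s<..<t'} r *\<^sub>R G t' r (%y. \<psi> r (u r y)) x)" for r x
   using hG[OF t', of r x] by (cases "r : {s<..<t'}") auto
  have mi: "AE x in lborel. ALL t:{s<..t}. set_integrable lebesgue {s<..<t} (%r. G t r (%y. \<psi> r (u r y)) x)"
   and me: "AE x in lborel. u t' x = G t' s f x + set_lebesgue_integral lebesgue {s<..<t'} (%r. G t' r (%y. \<psi> r (u r y)) x)"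
   using ms t' unfolding mild_solution_def by auto
  from mi show "AE x in lborel. set_integrable lebesgue {s<..<t'} (%r. lint (K.PK t' r x) (h r))"
  proof eventually_elim
   case (elim x)
   then have "set_integrable lebesgue {s<..<t'} (%r. G t' r (%y. \<psi> r (u r y)) x)" using t' by blast
   then show ?case unfolding set_integrable_def ind by (rule integrable_mult_indicator[OF Yset])
  qed
  from mi me show "AE x in lborel. u' t' x = lint (K.PK t' s x) f + set_lebesgue_integral lebesgue {s<..<t'} (%r. lint (K.PK t' r x) (h r))"
  proof eventually_elim
   case (elim x)
   then have i: "integrable lebesgue (%r. indicator {s<..<t'} r *\<^sub>R G t' r (%y. \<psi> r (u r y)) x)" using t' by (simp add: set_integrable_def)
   have "set_lebesgue_integral lebesgue {s<..<t'} (%r. G t' r (%y. \<psi> r (u r y)) x) = set_lebesgue_integral lebesgue {s<..<t'} (%r. lint (K.PK t' r x) (h r))"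
    unfolding set_lebesgue_integral_def ind
   proof (rule integral_cong_AE[OF borel_measurable_integrable[OF i] borel_measurable_integrable[OF integrable_mult_indicator[OF Yset i]]])
    show "AE r in lebesgue. indicator {s<..<t'} r *\<^sub>R G t' r (%y. \<psi> r (u r y)) x =
     indicator {r. Y r < \<infinity>} r *\<^sub>R (indicator {s<..<t'} r *\<^sub>R G t' r (%y. \<psi> r (u r y)) x)"
     using YL by eventually_elim simp
   qed
   moreover have "G t' s f x = lint (K.PK t' s x) f" using P[OF s, of t' x] f1(1) t' s by (simp add: K.PK_eq)
   ultimately show ?case using elim(2) t' by (simp add: ueq)
  qed
 qed (use fl s fm f1(2) um in auto)
 define q where "q = exp (\<eta>\<^sub>0 * inverse K * (t - s)) * (p - 1) + 1"
 have q: "q > 1" using p by (simp add: q_def)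
 define v where "v x = enn2real (nint (P t s x) (%y. ennreal \<bar>f y\<bar>))" for x
 have pk: "K.PK t s x = P t s x" for x using s st by (simp add: K.PK_eq)
 have Vfin: "AE x in \<mu> t. nint (P t s x) (%y. ennreal \<bar>f y\<bar>) < \<infinity>"
  using N.V_fin[OF st] by (simp add: N.V_def pk)
 have tt: "t : {s<..t}" using st by simp
 have main: "AE x in \<mu> t. abs (u t x) <= exp (\<psi>\<^sub>0 * (t - s)) * v x"
  using N.sharp_bound[OF tt] Vfin unfolding pk
 proof eventually_elim
  case (elim x)
  then have "ennreal \<bar>u t x\<bar> <= ennreal (exp (\<psi>\<^sub>0 * (t - s)) * v x)" using st by (simp add: v_def ennreal_mult ueq)
  then show ?case by (simp add: v_def ennreal_le_iff)
 qed
 have hyp: "nint (\<mu> t) (%x. ennreal (v x powr q)) <= ennreal (lint (\<mu> s) (%x. abs (f x) powr p) powr (q / p))"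
  unfolding v_def by (rule M.hyp_nn[OF s st p _ _ fp q_def Vfin]) (use fm in auto)
 define E where "E = exp (\<psi>\<^sub>0 * (t - s))"
 define A where "A = lint (\<mu> s) (%x. abs (f x) powr p)"
 have A0: "A >= 0" by (simp add: A_def)
 have utm: "u t : Bmeas" using usec[of t] st by (simp add: ueq)
 have mt: "borel_measurable (\<mu> t) = (Bmeas :: (real^'n => real) set)" by (rule measurable_cong_sets[OF mus(2)[OF tI] refl])
 have upm': "(%x. abs (u t x) powr q) : borel_measurable (\<mu> t)" unfolding mt using utm by measurable
 have vm: "v : Bmeas"
  unfolding v_def[abs_def] using K.P_nn_meas[OF s less_imp_le[OF st], of "%y. ennreal \<bar>f y\<bar>"] fm by measurable
 have vpm: "(%x. ennreal (v x powr q)) : borel_measurable (\<mu> t)"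
  unfolding measurable_cong_sets[OF mus(2)[OF tI] refl] using vm by measurable
 have ub: "nint (\<mu> t) (%x. ennreal (abs (u t x) powr q)) <= ennreal (E powr q * A powr (q / p))"
 proof -
  have "nint (\<mu> t) (%x. ennreal (abs (u t x) powr q)) <= nint (\<mu> t) (%x. ennreal (E powr q) * ennreal (v x powr q))"
  proof (rule nn_integral_mono_AE)
   show "AE x in \<mu> t. ennreal (abs (u t x) powr q) <= ennreal (E powr q) * ennreal (v x powr q)"
    using main
   proof eventually_elim
    case (elim x)
    then have "abs (u t x) powr q <= (E * v x) powr q" using q by (intro powr_mono2) (auto simp: E_def)
    also have "... = E powr q * v x powr q" by (simp add: powr_mult E_def v_def)
    finally show ?case by (simp add: ennreal_mult[symmetric] ennreal_leI)
   qed
  qed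
  also have "... = ennreal (E powr q) * nint (\<mu> t) (%x. ennreal (v x powr q))" by (rule nn_integral_cmult[OF vpm])
  also have "... <= ennreal (E powr q) * ennreal (A powr (q / p))" using hyp unfolding A_def by (rule mult_left_mono) simp
  finally show ?thesis by (simp add: ennreal_mult)
 qed
 have ui: "integrable (\<mu> t) (%x. abs (u t x) powr q)"
  using upm' ub by (auto simp: integrable_iff_bounded intro: le_less_trans)
 have "u t : Lp (\<mu> t) q" using Lp_borel_iff[OF mus(2)[OF tI]] utm ui by blast
 moreover have "Lp_norm (\<mu> t) q (u t) <= E * Lp_norm (\<mu> s) p f"
 proof -
  have "ennreal (lint (\<mu> t) (%x. abs (u t x) powr q)) <= ennreal (E powr q * A powr (q / p))"
   using ub nn_integral_eq_integral[OF ui] by simp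
  then have "lint (\<mu> t) (%x. abs (u t x) powr q) <= E powr q * A powr (q / p)" by (subst (asm) ennreal_le_iff) simp_all
  then have "lint (\<mu> t) (%x. abs (u t x) powr q) powr (1 / q) <= (E powr q * A powr (q / p)) powr (1 / q)"
   using q by (intro powr_mono2) auto
  also have "... = E * A powr (1 / p)" using q by (simp add: powr_mult powr_powr E_def)
  finally show ?thesis by (simp add: Lp_norm_def A_def)
 qed
 ultimately show "let p\<^sub>t = exp (\<eta>\<^sub>0 * inverse K * (t - s)) * (p - 1) + 1 in
     u t : Lp (\<mu> t) p\<^sub>t &
     Lp_norm (\<mu> t) p\<^sub>t (u t) <= exp (\<psi>\<^sub>0 * (t - s)) * Lp_norm (\<mu> s) p f"
  by (simp add: Let_def q_def E_def)
qed

end
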